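(* Let $\mathbb{A}=(a_{ij})_{i,j\in I}$ be a symmetrizable Borcherds–Cartan matrix with countable index set $I$, let $\mathbf{m}=(m_i\mid i\in I)$ be a charge, let $q\in k\setminus 0$ be transcendental over $\mathbb{Q}$, and let $\mathcal{B}$, $R$ and $\mathcal{O}(\mathcal{B})$ be as defined in the context. Then there is a category equivalence $$\mathcal{O}(\mathcal{B})\approx\mathrm{Vec},$$ given by the mutually quasi-inverse functors $R\otimes:\mathrm{Vec}\to\mathcal{O}(\mathcal{B})$, $X\mapsto R\otimes X$, and $(\ )_0:\mathcal{O}(\mathcal{B})\to\mathrm{Vec}$, $M\mapsto M_0$.
   Context: $k$ is a field of characteristic zero. $I$ is a countable (possibly infinite) index set; $\mathbb{A}=(a_{ij})_{i,j\in I}$ is an integer matrix with $a_{ii}=2$ or $a_{ii}\le 0$; $a_{ij}\le 0$ for $i\ne j$; $a_{ij}=0$ iff $a_{ji}=0$; and there are positive integers $s_i$ with $s_ia_{ij}=s_ja_{ji}$. The charge $\mathbf{m}=(m_i\mid i\in I)$ consists of positive integers, with $m_i=1$ whenever $a_{ii}=2$. Put $q_i=q^{s_i}$, $q_{ij}=q^{-s_ia_{ij}}\,(=q^{-s_ja_{ji}})$, and let $\left[{n\atop r}\right]_{q_i}$ be the symmetric $q_i$-binomial coefficients (built from $[n]_{q_i}=(q_i^n-q_i^{-n})/(q_i-q_i^{-1})$). The generalized $q$-boson algebra $\mathcal{B}$ associated to the quantized enveloping algebra $U_q$ of $(\mathbb{A},\mathbf{m})$ is the $k$-algebra generated by $e_{ik},f'_{ik}$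 ($i\in I$, $1\le k\le m_i$) with relations: $\sum_{r=0}^{1-a_{ij}}(-1)^r\left[{1-a_{ij}\atop r}\right]_{q_i}e_{ik}^{1-a_{ij}-r}e_{jl}e_{ik}^{r}=0$ if $a_{ii}=2$, $i\ne j$; the same relation with $f'$ in place of $e$; $e_{ik}e_{jl}=e_{jl}e_{ik}$ and $f'_{ik}f'_{jl}=f'_{jl}f'_{ik}$ if $a_{ij}=0$; and $e_{ik}f'_{jl}=q_{ij}f'_{jl}e_{ik}+\delta_{ij}\delta_{kl}$, for all $i,j\in I$, $1\le k\le m_i$, $1\le l\le m_j$. $R$ is the subalgebra of $\mathcal{B}$ generated by all $f'_{ik}$, and $S=U_q^+$ the subalgebra generated by all $e_{ik}$; multiplication gives a linear isomorphism $R\otimes S\simeq\mathcal{B}$. (In $U_q$, $f'_{ik}=-(q_i-q_i^{-1})f_{ik}K_i$.) $R$ is a left $\mathcal{B}$-module: $f'_{ik}$ acts by left multiplication and $$e_{ik}\triangleright f'_{j_1l_1}\cdots f'_{j_tl_t}=\sum_{p=1}^t\delta_{ij_p}\delta_{kl_p}q_{ij_1}\cdots q_{ij_{p-1}}f'_{j_1l_1}\cdots\widehat{f'_{j_pl_p}}\cdots f'_{j_tl_t},$$ where the hat means omission (so $e_{ik}\triangleright 1=0$). A left $\mathcal{B}$-module $M$ is integrable if for each $m\in M$ there exist an integer $n>0$ and a finite subset $F\subset I$ such that $m$ is annihilated by the product $e_{i_1k_1}\cdots e_{i_tk_t}$ of length $t>0$ whenever $t\ge n$ or $i_p\notin F$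 for some $1\le p\le t$. $\mathcal{O}(\mathcal{B})$ is the full subcategory of left $\mathcal{B}$-modules consisting of the integrable ones. $\mathrm{Vec}$ is the category of $k$-vector spaces. $M_0=\{m\in M\mid e_{ik}m=0\text{ for all }i\in I,1\le k\le m_i\}$. $\mathcal{B}$ acts on $R\otimes X$ through the factor $R$. *)

theory Defs
  imports
    "HOL-Algebra.QuotRing"
    "HOL-Algebra.Algebraic_Closure_Type"
    "HOL-Library.Poly_Mapping"
    "HOL-Library.Countable_Set"
    "HOL-Computational_Algebra.Polynomial"
begin

(* frees X for use as a variable *)
no_notation var (\<open>X\<index>\<close>)

section \<open>Categories, functors, quasi-inverse functors\<close>

text \<open>Hom-sets are indexed by their source and target and need not be disjoint, so composition
  and the action of a functor on morphisms take the objects involved as arguments: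
  \<open>Comp C X Y Z g f\<close> is the composite of \<open>f : X \<rightarrow> Y\<close> and \<open>g : Y \<rightarrow> Z\<close>.\<close>

record ('o, 'h) category =
  Obj :: "'o set"
  Hom :: "'o \<Rightarrow> 'o \<Rightarrow> 'h set"
  Ident :: "'o \<Rightarrow> 'h"
  Comp :: "'o \<Rightarrow> 'o \<Rightarrow> 'o \<Rightarrow> 'h \<Rightarrow> 'h \<Rightarrow> 'h"

record ('o, 'h, 'p, 'g) cfunctor =
  on_obj :: "'o \<Rightarrow> 'p"
  on_hom :: "'o \<Rightarrow> 'o \<Rightarrow> 'h \<Rightarrow> 'g"

definition is_category :: "('o, 'h) category \<Rightarrow> bool" where
  "is_category C \<longleftrightarrow>
     (\<forall>X\<in>Obj C. Ident C X \<in> Hom C X X) \<and>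
     (\<forall>X\<in>Obj C. \<forall>Y\<in>Obj C. \<forall>Z\<in>Obj C. \<forall>f\<in>Hom C X Y. \<forall>g\<in>Hom C Y Z.
        Comp C X Y Z g f \<in> Hom C X Z) \<and>
     (\<forall>X\<in>Obj C. \<forall>Y\<in>Obj C. \<forall>f\<in>Hom C X Y.
        Comp C X X Y f (Ident C X) = f \<and> Comp C X Y Y (Ident C Y) f = f) \<and>
     (\<forall>W\<in>Obj C. \<forall>X\<in>Obj C. \<forall>Y\<in>Obj C. \<forall>Z\<in>Obj C.
        \<forall>f\<in>Hom C W X. \<forall>g\<in>Hom C X Y. \<forall>h\<in>Hom C Y Z.
        Comp C W X Z (Comp C X Y Z h g) f = Comp C W Y Z h (Comp C W X Y g f))"

definition full_subcategory :: "('o, 'h) category \<Rightarrow> ('o \<Rightarrow> bool) \<Rightarrow> ('o, 'h) category" where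
  "full_subcategory C P = C\<lparr>Obj := {X \<in> Obj C. P X}\<rparr>"

definition is_functor ::
  "('o, 'h) category \<Rightarrow> ('p, 'g) category \<Rightarrow> ('o, 'h, 'p, 'g) cfunctor \<Rightarrow> bool" where
  "is_functor C D F \<longleftrightarrow>
     (\<forall>X\<in>Obj C. on_obj F X \<in> Obj D) \<and>
     (\<forall>X\<in>Obj C. \<forall>Y\<in>Obj C. \<forall>f\<in>Hom C X Y.
        on_hom F X Y f \<in> Hom D (on_obj F X) (on_obj F Y)) \<and>
     (\<forall>X\<in>Obj C. on_hom F X X (Ident C X) = Ident D (on_obj F X)) \<and>
     (\<forall>X\<in>Obj C. \<forall>Y\<in>Obj C. \<forall>Z\<in>Obj C. \<forall>f\<in>Hom C X Y. \<forall>g\<in>Hom C Y Z.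
        on_hom F X Z (Comp C X Y Z g f) =
        Comp D (on_obj F X) (on_obj F Y) (on_obj F Z) (on_hom F Y Z g) (on_hom F X Y f))"

definition id_functor :: "('o, 'h, 'o, 'h) cfunctor" where
  "id_functor = \<lparr>on_obj = (\<lambda>X. X), on_hom = (\<lambda>X Y f. f)\<rparr>"

definition comp_functor ::
  "('p, 'g, 'r, 'l) cfunctor \<Rightarrow> ('o, 'h, 'p, 'g) cfunctor \<Rightarrow> ('o, 'h, 'r, 'l) cfunctor" where
  "comp_functor G F =
     \<lparr>on_obj = (\<lambda>X. on_obj G (on_obj F X)),
      on_hom = (\<lambda>X Y f. on_hom G (on_obj F X) (on_obj F Y) (on_hom F X Y f))\<rparr>"

definition is_iso :: "('o, 'h) category \<Rightarrow> 'o \<Rightarrow> 'o \<Rightarrow> 'h \<Rightarrow> bool" where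
  "is_iso C X Y f \<longleftrightarrow> f \<in> Hom C X Y \<and>
     (\<exists>g\<in>Hom C Y X. Comp C X Y X g f = Ident C X \<and> Comp C Y X Y f g = Ident C Y)"

definition natural_iso ::
  "('o, 'h) category \<Rightarrow> ('p, 'g) category \<Rightarrow> ('o, 'h, 'p, 'g) cfunctor \<Rightarrow>
   ('o, 'h, 'p, 'g) cfunctor \<Rightarrow> ('o \<Rightarrow> 'g) \<Rightarrow> bool" where
  "natural_iso C D F G \<eta> \<longleftrightarrow>
     (\<forall>X\<in>Obj C. is_iso D (on_obj F X) (on_obj G X) (\<eta> X)) \<and>
     (\<forall>X\<in>Obj C. \<forall>Y\<in>Obj C. \<forall>f\<in>Hom C X Y.
        Comp D (on_obj F X) (on_obj F Y) (on_obj G Y) (\<eta> Y) (on_hom F X Y f) =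
        Comp D (on_obj F X) (on_obj G X) (on_obj G Y) (on_hom G X Y f) (\<eta> X))"

definition quasi_inverse_equivalence ::
  "('o, 'h) category \<Rightarrow> ('p, 'g) category \<Rightarrow> ('o, 'h, 'p, 'g) cfunctor \<Rightarrow>
   ('p, 'g, 'o, 'h) cfunctor \<Rightarrow> bool" where
  "quasi_inverse_equivalence C D F G \<longleftrightarrow>
     is_category C \<and> is_category D \<and> is_functor C D F \<and> is_functor D C G \<and>
     (\<exists>\<eta>. natural_iso C C id_functor (comp_functor G F) \<eta>) \<and>
     (\<exists>\<epsilon>. natural_iso D D (comp_functor F G) id_functor \<epsilon>)"

section \<open>Vector spaces, algebras and their left modules\<close>

text \<open>A vector space over the field \<open>'k\<close> is a \<^locale>\<open>module\<close> over
  \<^const>\<open>ring_of_type_algebra\<close>.  The record type \<^typ>\<open>('k, 'v) module\<close> inherits from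
  \<^typ>\<open>'v ring\<close> the fields \<^const>\<open>monoid.mult\<close> and \<^const>\<open>monoid.one\<close>.  They form part of the structure
  when the record is used for a \<open>'k\<close>-algebra, and are irrelevant when it is used for a
  mere vector space.\<close>

definition vector_space_rec :: "('k::field, 'v, 'x) module_scheme \<Rightarrow> bool" where
  "vector_space_rec V \<longleftrightarrow> module (ring_of_type_algebra :: 'k ring) V"

definition linear_maps ::
  "('k, 'v, 'x) module_scheme \<Rightarrow> ('k, 'w, 'y) module_scheme \<Rightarrow> ('v \<Rightarrow> 'w) set" where
  "linear_maps V W =
     {f \<in> carrier V \<rightarrow>\<^sub>E carrier W.
        (\<forall>x\<in>carrier V. \<forall>y\<in>carrier V. f (x \<oplus>\<^bsub>V\<^esub> y) = f x \<oplus>\<^bsub>W\<^esub> f y) \<and>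
        (\<forall>c. \<forall>x\<in>carrier V. f (c \<odot>\<^bsub>V\<^esub> x) = c \<odot>\<^bsub>W\<^esub> f x)}"

text \<open>The category of \<open>'k\<close>-vector spaces, and below that of left modules over an algebra, is
  relative to a universe: the carriers of the objects are subsets of the type \<open>'u\<close>.\<close>

definition Vec :: "(('k::field, 'u) module, 'u \<Rightarrow> 'u) category" where
  "Vec = \<lparr>Obj = {V. vector_space_rec V}, Hom = linear_maps,
          Ident = (\<lambda>V. restrict (\<lambda>x. x) (carrier V)),
          Comp = (\<lambda>V W X g f. compose (carrier V) g f)\<rparr>"

record ('k, 'b, 'v) left_module = "('k, 'v) module" +
  act :: "'b \<Rightarrow> 'v \<Rightarrow> 'v"

definition is_left_module ::
  "('k::field, 'b, 'y) module_scheme \<Rightarrow> ('k, 'b, 'v, 'x) left_module_scheme \<Rightarrow> bool" where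
  "is_left_module B M \<longleftrightarrow> vector_space_rec M \<and>
     (\<forall>b\<in>carrier B. \<forall>x\<in>carrier M. act M b x \<in> carrier M) \<and>
     (\<forall>b\<in>carrier B. \<forall>x\<in>carrier M. \<forall>y\<in>carrier M.
        act M b (x \<oplus>\<^bsub>M\<^esub> y) = act M b x \<oplus>\<^bsub>M\<^esub> act M b y) \<and>
     (\<forall>b\<in>carrier B. \<forall>d\<in>carrier B. \<forall>x\<in>carrier M.
        act M (b \<oplus>\<^bsub>B\<^esub> d) x = act M b x \<oplus>\<^bsub>M\<^esub> act M d x) \<and>
     (\<forall>b\<in>carrier B. \<forall>d\<in>carrier B. \<forall>x\<in>carrier M.
        act M (b \<otimes>\<^bsub>B\<^esub> d) x = act M b (act M d x)) \<and>
     (\<forall>x\<in>carrier M. act M \<one>\<^bsub>B\<^esub> x = x) \<and>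
     (\<forall>c. \<forall>b\<in>carrier B. \<forall>x\<in>carrier M.
        act M (c \<odot>\<^bsub>B\<^esub> b) x = c \<odot>\<^bsub>M\<^esub> act M b x \<and>
        act M b (c \<odot>\<^bsub>M\<^esub> x) = c \<odot>\<^bsub>M\<^esub> act M b x)"

definition left_module_homs ::
  "('k, 'b, 'y) module_scheme \<Rightarrow> ('k, 'b, 'v, 'x) left_module_scheme \<Rightarrow>
   ('k, 'b, 'w, 'z) left_module_scheme \<Rightarrow> ('v \<Rightarrow> 'w) set" where
  "left_module_homs B M N =
     {f \<in> linear_maps M N. \<forall>b\<in>carrier B. \<forall>x\<in>carrier M. f (act M b x) = act N b (f x)}"

definition LMod ::
  "('k::field, 'b, 'y) module_scheme \<Rightarrow> (('k, 'b, 'u) left_module, 'u \<Rightarrow> 'u) category" where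
  "LMod B = \<lparr>Obj = {M. is_left_module B M}, Hom = left_module_homs B,
             Ident = (\<lambda>M. restrict (\<lambda>x. x) (carrier M)),
             Comp = (\<lambda>M N L g f. compose (carrier M) g f)\<rparr>"

definition generated_subalgebra :: "('k, 'b, 'y) module_scheme \<Rightarrow> 'b set \<Rightarrow> 'b set" where
  "generated_subalgebra B S =
     \<Inter>{T. subring T B \<and> (\<forall>c. \<forall>x\<in>T. c \<odot>\<^bsub>B\<^esub> x \<in> T) \<and> S \<subseteq> T}"

text \<open>Quotient of a vector space by a subspace, or of an algebra by an ideal (only in the latter
  case does \<^const>\<open>FactRing\<close> provide a meaningful product).\<close>

definition quotient_space ::
  "('k, 'v, 'x) module_scheme \<Rightarrow> 'v set \<Rightarrow> ('k, 'v set) module" where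
  "quotient_space V N =
     ring.extend (V Quot N) (module.fields (\<lambda>c X. \<Union>x\<in>X. N +>\<^bsub>V\<^esub> (c \<odot>\<^bsub>V\<^esub> x)))"

section \<open>Tensor products of vector spaces\<close>

definition free_space :: "'a set \<Rightarrow> ('k::field, 'a \<Rightarrow>\<^sub>0 'k) module" where
  "free_space S =
     \<lparr>carrier = {p. Poly_Mapping.keys p \<subseteq> S}, monoid.mult = undefined, one = undefined, zero = 0,
      add = (+), module.smult = (\<lambda>c. Poly_Mapping.map ((*) c))\<rparr>"

definition bilinearity_relations ::
  "('k::field, 'v, 'x) module_scheme \<Rightarrow> ('k, 'w, 'y) module_scheme \<Rightarrow> ('v \<times> 'w \<Rightarrow>\<^sub>0 'k) set" where
  "bilinearity_relations V W =
     {Poly_Mapping.single (v \<oplus>\<^bsub>V\<^esub> v', w) 1 - Poly_Mapping.single (v, w) 1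
        - Poly_Mapping.single (v', w) 1 | v v' w.
        v \<in> carrier V \<and> v' \<in> carrier V \<and> w \<in> carrier W} \<union>
     {Poly_Mapping.single (v, w \<oplus>\<^bsub>W\<^esub> w') 1 - Poly_Mapping.single (v, w) 1
        - Poly_Mapping.single (v, w') 1 | v w w'.
        v \<in> carrier V \<and> w \<in> carrier W \<and> w' \<in> carrier W} \<union>
     {Poly_Mapping.single (c \<odot>\<^bsub>V\<^esub> v, w) 1 - Poly_Mapping.single (v, w) c | c v w.
        v \<in> carrier V \<and> w \<in> carrier W} \<union>
     {Poly_Mapping.single (v, c \<odot>\<^bsub>W\<^esub> w) 1 - Poly_Mapping.single (v, w) c | c v w.
        v \<in> carrier V \<and> w \<in> carrier W}"

definition tensor_kernel ::
  "('k::field, 'v, 'x) module_scheme \<Rightarrow> ('k, 'w, 'y) module_scheme \<Rightarrow> ('v \<times> 'w \<Rightarrow>\<^sub>0 'k) set" where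
  "tensor_kernel V W =
     \<Inter>{N. submodule N (ring_of_type_algebra :: 'k ring)
             (free_space (carrier V \<times> carrier W) :: ('k, 'v \<times> 'w \<Rightarrow>\<^sub>0 'k) module) \<and>
         bilinearity_relations V W \<subseteq> N}"

definition tensor_space ::
  "('k::field, 'v, 'x) module_scheme \<Rightarrow> ('k, 'w, 'y) module_scheme \<Rightarrow>
   ('k, ('v \<times> 'w \<Rightarrow>\<^sub>0 'k) set) module" where
  "tensor_space V W = quotient_space (free_space (carrier V \<times> carrier W)) (tensor_kernel V W)"

text \<open>\<open>tensor_map V' W' g f\<close> is the map \<open>g \<otimes> f\<close> from any \<open>V \<otimes> W\<close> to \<open>V' \<otimes> W'\<close>; the class of
  \<open>\<Sum> c\<^sub>t (v\<^sub>t, w\<^sub>t)\<close> goes to the class of \<open>\<Sum> c\<^sub>t (g v\<^sub>t, f w\<^sub>t)\<close>.\<close>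

definition tensor_map ::
  "('k::field, 'v', 'x) module_scheme \<Rightarrow> ('k, 'w', 'y) module_scheme \<Rightarrow>
   ('v \<Rightarrow> 'v') \<Rightarrow> ('w \<Rightarrow> 'w') \<Rightarrow> ('v \<times> 'w \<Rightarrow>\<^sub>0 'k) set \<Rightarrow> ('v' \<times> 'w' \<Rightarrow>\<^sub>0 'k) set" where
  "tensor_map V' W' g f t =
     (\<Union>p\<in>t. tensor_kernel V' W'
        +>\<^bsub>free_space (carrier V' \<times> carrier W') :: ('k, 'v' \<times> 'w' \<Rightarrow>\<^sub>0 'k) module\<^esub>
        (\<Sum>(v, w)\<in>Poly_Mapping.keys p.
           Poly_Mapping.single (g v, f w) (Poly_Mapping.lookup p (v, w))))"

text \<open>Transport of structure along a map that is injective on the carrier.\<close>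

definition transport ::
  "('v \<Rightarrow> 'u) \<Rightarrow> ('k, 'b, 'v) left_module \<Rightarrow> ('k, 'b, 'u) left_module" where
  "transport \<phi> M =
     (let \<psi> = inv_into (carrier M) \<phi> in
      \<lparr>carrier = \<phi> ` carrier M, monoid.mult = undefined, one = undefined, zero = \<phi> \<zero>\<^bsub>M\<^esub>,
       add = (\<lambda>x y. \<phi> (\<psi> x \<oplus>\<^bsub>M\<^esub> \<psi> y)), module.smult = (\<lambda>c x. \<phi> (c \<odot>\<^bsub>M\<^esub> \<psi> x)),
       act = (\<lambda>b x. \<phi> (act M b (\<psi> x)))\<rparr>)"

section \<open>Free associative algebras\<close>

text \<open>The free algebra on \<open>'a\<close> is the monoid algebra of the free monoid; words are
  written additively so that the type of their linear combinations carries the convolution product.\<close>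

datatype 'a word = Word (letters: "'a list")

instantiation word :: (type) monoid_add
begin
definition zero_word :: "'a word" where "zero_word = Word []"
definition plus_word :: "'a word \<Rightarrow> 'a word \<Rightarrow> 'a word" where
  "plus_word u v = Word (letters u @ letters v)"
instance
  by standard (simp_all add: zero_word_def plus_word_def)
end

definition free_algebra :: "'a set \<Rightarrow> ('k::field, 'a word \<Rightarrow>\<^sub>0 'k) module" where
  "free_algebra S =
     \<lparr>carrier = {p. \<forall>w\<in>Poly_Mapping.keys p. set (letters w) \<subseteq> S}, monoid.mult = (*), one = 1, zero = 0,
      add = (+), module.smult = (\<lambda>c. Poly_Mapping.map ((*) c))\<rparr>"

definition monomial :: "'a list \<Rightarrow> 'a word \<Rightarrow>\<^sub>0 'k::field" where
  "monomial w = Poly_Mapping.single (Word w) 1"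

section \<open>Quantum binomial coefficients\<close>

definition qint :: "'k::field \<Rightarrow> nat \<Rightarrow> 'k" where
  "qint b n = (b ^ n - inverse b ^ n) / (b - inverse b)"

definition qfact :: "'k::field \<Rightarrow> nat \<Rightarrow> 'k" where
  "qfact b n = (\<Prod>j=1..n. qint b j)"

definition qbinom :: "'k::field \<Rightarrow> nat \<Rightarrow> nat \<Rightarrow> 'k" where
  "qbinom b n r = qfact b n / (qfact b r * qfact b (n - r))"

section \<open>The generalized q-boson algebra\<close>

locale borcherds_cartan_charge =
  fixes I :: "'i set" and a :: "'i \<Rightarrow> 'i \<Rightarrow> int" and s :: "'i \<Rightarrow> nat" and m :: "'i \<Rightarrow> nat"
  assumes countable_index: "countable I"
    and diag: "i \<in> I \<Longrightarrow> a i i = 2 \<or> a i i \<le> 0"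
    and off_diag: "i \<in> I \<Longrightarrow> j \<in> I \<Longrightarrow> i \<noteq> j \<Longrightarrow> a i j \<le> 0"
    and zero_iff: "i \<in> I \<Longrightarrow> j \<in> I \<Longrightarrow> a i j = 0 \<longleftrightarrow> a j i = 0"
    and s_pos: "i \<in> I \<Longrightarrow> s i > 0"
    and symmetrizable: "i \<in> I \<Longrightarrow> j \<in> I \<Longrightarrow> int (s i) * a i j = int (s j) * a j i"
    and m_pos: "i \<in> I \<Longrightarrow> m i > 0"
    and m_real: "i \<in> I \<Longrightarrow> a i i = 2 \<Longrightarrow> m i = 1"

text \<open>\<open>E i k\<close> and \<open>F i k\<close> are the symbols for \<open>e\<^sub>i\<^sub>k\<close> and \<open>f'\<^sub>i\<^sub>k\<close>.\<close>

datatype 'i boson_gen = E 'i nat | F 'i nat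

locale q_boson_data = borcherds_cartan_charge I a s m
  for I :: "'i set" and a s m +
  fixes q :: "'k::field_char_0"
begin


definition idx :: "('i \<times> nat) set" where
  "idx = {(i, k). i \<in> I \<and> 1 \<le> k \<and> k \<le> m i}"

definition qi :: "'i \<Rightarrow> 'k" where
  "qi i = q ^ s i"

definition qq :: "'i \<Rightarrow> 'i \<Rightarrow> 'k" where
  "qq i j = q powi (- (int (s i) * a i j))"

definition free_boson :: "('k, 'i boson_gen word \<Rightarrow>\<^sub>0 'k) module" where
  "free_boson = free_algebra ((\<lambda>(i, k). E i k) ` idx \<union> (\<lambda>(i, k). F i k) ` idx)"

definition serre ::
  "('i \<Rightarrow> nat \<Rightarrow> 'i boson_gen) \<Rightarrow> 'i \<Rightarrow> nat \<Rightarrow> 'i \<Rightarrow> nat \<Rightarrow> 'i boson_gen word \<Rightarrow>\<^sub>0 'k" where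
  "serre X i k j l =
     (let n = nat (1 - a i j) in
      \<Sum>r=0..n. Poly_Mapping.map ((*) ((- 1) ^ r * qbinom (qi i) n r))
        (monomial [X i k] ^ (n - r) * monomial [X j l] * monomial [X i k] ^ r))"

definition relations :: "('i boson_gen word \<Rightarrow>\<^sub>0 'k) set" where
  "relations =
     {serre X i k j l | X i k j l.
        X \<in> {E, F} \<and> (i, k) \<in> idx \<and> (j, l) \<in> idx \<and> a i i = 2 \<and> i \<noteq> j} \<union>
     {monomial [X i k, X j l] - monomial [X j l, X i k] | X i k j l.
        X \<in> {E, F} \<and> (i, k) \<in> idx \<and> (j, l) \<in> idx \<and> a i j = 0} \<union>
     {monomial [E i k, F j l] - Poly_Mapping.map ((*) (qq i j)) (monomial [F j l, E i k])
        - (if i = j \<and> k = l then 1 else 0) | i k j l.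
        (i, k) \<in> idx \<and> (j, l) \<in> idx}"

definition relation_ideal :: "('i boson_gen word \<Rightarrow>\<^sub>0 'k) set" where
  "relation_ideal = genideal free_boson relations"

definition boson :: "('k, ('i boson_gen word \<Rightarrow>\<^sub>0 'k) set) module" where
  "boson = quotient_space free_boson relation_ideal"

definition cls :: "('i boson_gen word \<Rightarrow>\<^sub>0 'k) \<Rightarrow> ('i boson_gen word \<Rightarrow>\<^sub>0 'k) set" where
  "cls p = relation_ideal +>\<^bsub>free_boson\<^esub> p"

definition eprod :: "('i \<times> nat) list \<Rightarrow> ('i boson_gen word \<Rightarrow>\<^sub>0 'k) set" where
  "eprod w = cls (monomial (map (\<lambda>(i, k). E i k) w))"

definition fprod :: "('i \<times> nat) list \<Rightarrow> ('i boson_gen word \<Rightarrow>\<^sub>0 'k) set" where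
  "fprod w = cls (monomial (map (\<lambda>(i, k). F i k) w))"

definition R_alg :: "('k, ('i boson_gen word \<Rightarrow>\<^sub>0 'k) set) module" where
  "R_alg = boson\<lparr>carrier := generated_subalgebra boson {fprod [x] | x. x \<in> idx}\<rparr>"

text \<open>The left module structure on \<open>R\<close>; the two equations determine it, because the \<open>e\<^sub>i\<^sub>k\<close> and
  \<open>f'\<^sub>i\<^sub>k\<close> generate the algebra and the products of the \<open>f'\<^sub>i\<^sub>k\<close> span \<open>R\<close>.\<close>

definition is_R_action ::
  "(('i boson_gen word \<Rightarrow>\<^sub>0 'k) set \<Rightarrow> ('i boson_gen word \<Rightarrow>\<^sub>0 'k) set \<Rightarrow>
    ('i boson_gen word \<Rightarrow>\<^sub>0 'k) set) \<Rightarrow> bool" where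
  "is_R_action \<alpha> \<longleftrightarrow>
     is_left_module boson (module.extend R_alg (left_module.fields \<alpha>)) \<and>
     (\<forall>x\<in>idx. \<forall>r\<in>carrier R_alg. \<alpha> (fprod [x]) r = fprod [x] \<otimes>\<^bsub>boson\<^esub> r) \<and>
     (\<forall>x\<in>idx. \<forall>w\<in>lists idx.
        \<alpha> (eprod [x]) (fprod w) =
        (\<Oplus>\<^bsub>boson\<^esub>p\<in>{p. p < length w \<and> w ! p = x}.
           (\<Prod>t<p. qq (fst x) (fst (w ! t))) \<odot>\<^bsub>boson\<^esub> fprod (take p w @ drop (Suc p) w)))"

definition R_mod ::
  "('k, ('i boson_gen word \<Rightarrow>\<^sub>0 'k) set, ('i boson_gen word \<Rightarrow>\<^sub>0 'k) set) left_module" where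
  "R_mod = module.extend R_alg (left_module.fields (SOME \<alpha>. is_R_action \<alpha>))"

section \<open>Integrable modules and the two functors\<close>

definition integrable ::
  "('k, ('i boson_gen word \<Rightarrow>\<^sub>0 'k) set, 'v) left_module \<Rightarrow> bool" where
  "integrable M \<longleftrightarrow>
     (\<forall>x\<in>carrier M. \<exists>n>0. \<exists>J. finite J \<and> J \<subseteq> I \<and>
        (\<forall>w\<in>lists idx. w \<noteq> [] \<and> (length w \<ge> n \<or> (\<exists>(i, k)\<in>set w. i \<notin> J)) \<longrightarrow>
           act M (eprod w) x = \<zero>\<^bsub>M\<^esub>))"

definition OB ::
  "(('k, ('i boson_gen word \<Rightarrow>\<^sub>0 'k) set, 'u) left_module, 'u \<Rightarrow> 'u) category" where
  "OB = full_subcategory (LMod boson) integrable"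

definition R_tensor_space ::
  "('k, 'u) module \<Rightarrow>
   ('k, ('i boson_gen word \<Rightarrow>\<^sub>0 'k) set, (('i boson_gen word \<Rightarrow>\<^sub>0 'k) set \<times> 'u \<Rightarrow>\<^sub>0 'k) set) left_module"
  where
  "R_tensor_space X =
     module.extend (tensor_space R_mod X)
       (left_module.fields (\<lambda>b. tensor_map R_mod X (act R_mod b) (\<lambda>x. x)))"

text \<open>The carrier of \<open>R \<otimes> X\<close> is not a set of elements of \<open>'u\<close>, so it is transported into the
  universe \<open>'u\<close> along a chosen injection.  One exists for every \<open>X\<close> with carrier in \<open>'u\<close>:
  \<open>R \<otimes> X\<close> is a singleton if \<open>X = 0\<close>, and otherwise has the cardinality of the infinite set \<open>X\<close>,
  since \<open>R\<close> is nonzero and of countable dimension.  Different choices give isomorphic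
  functors.\<close>

definition R_embed ::
  "('k, 'u) module \<Rightarrow> (('i boson_gen word \<Rightarrow>\<^sub>0 'k) set \<times> 'u \<Rightarrow>\<^sub>0 'k) set \<Rightarrow> 'u" where
  "R_embed X = (SOME \<phi>. inj_on \<phi> (carrier (R_tensor_space X)))"

definition R_tensor ::
  "(('k, 'u) module, 'u \<Rightarrow> 'u,
    ('k, ('i boson_gen word \<Rightarrow>\<^sub>0 'k) set, 'u) left_module, 'u \<Rightarrow> 'u) cfunctor" where
  "R_tensor =
     \<lparr>on_obj = (\<lambda>X. transport (R_embed X) (R_tensor_space X)),
      on_hom = (\<lambda>X Y f.
        restrict
          (\<lambda>x. R_embed Y (tensor_map R_mod Y (\<lambda>r. r) f
                 (inv_into (carrier (R_tensor_space X)) (R_embed X) x)))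
          (R_embed X ` carrier (R_tensor_space X)))\<rparr>"

definition invariants ::
  "('k, ('i boson_gen word \<Rightarrow>\<^sub>0 'k) set, 'v) left_module \<Rightarrow> 'v set" where
  "invariants M = {x \<in> carrier M. \<forall>(i, k)\<in>idx. act M (eprod [(i, k)]) x = \<zero>\<^bsub>M\<^esub>}"

definition invariants_functor ::
  "(('k, ('i boson_gen word \<Rightarrow>\<^sub>0 'k) set, 'u) left_module, 'u \<Rightarrow> 'u,
    ('k, 'u) module, 'u \<Rightarrow> 'u) cfunctor" where
  "invariants_functor =
     \<lparr>on_obj = (\<lambda>M. (module.truncate M)\<lparr>carrier := invariants M\<rparr>),
      on_hom = (\<lambda>M N f. restrict f (invariants M))\<rparr>"

end

end

(* Let T be the free algebra on the letters f', equipped with the skew derivations d_x through which the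
   e_x act, and let S be the ideal generated by the Serre and commutation relations.

   The heart of the matter is that S contains every p with eps(d_z p) = 0 for all words z, so that R = T/S
   carries a nondegenerate form.  By induction on the degree it suffices to treat a p of degree beta with
   all d_x p in S.  Such a p is primitive modulo S, so the braided antipode sends it to -p; the antipode
   squares to q^(-((beta|beta) - sum over the letters x of p of (x|x))) times the identity, and so
   (beta|beta) = sum (x|x) or p is in S.  For a real letter x the quantum adjoint action of x on p is
   nilpotent modulo S, and an sl_2-argument gives (x|beta) <= 0 unless p is in S.  For imaginary x the
   contribution (x|beta) - (x|x) is a sum of nonpositive terms (x|y).  Hence all letters of p are pairwise
   orthogonal and commute modulo S, and the Euler operator sum f'_x d_x, which multiplies p by its length
   and sends it into S, shows that p is in S.

   Given nondegeneracy, (R tensor X)_0 = 1 tensor X.  For integrable M the map R tensor M_0 -> M is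
   injective because it is injective on invariants, and surjective because generalized inverses of
   (possibly infinite) Gram matrices of the form let one split off the part of m
   detected by the products e_w of maximal length with e_w m nonzero. *)
theory Submission
  imports Defs
begin

section \<open>Generalized inverses of matrices with finitely many rows\<close>

text \<open>No basis of T/S is at hand, so duality is expressed through the functionals
  \<open>p \<mapsto> lookup (ders z p) 0\<close>, and a matrix H with G H G = G replaces dual bases:
  once for the left factors of the reduced coproduct, which may be dependent modulo S, and once for
  the products of the e applied to a vector, which satisfy the relations of the e. The hypothesis on
  a primitive p concerns left derivations, while the sl_2-argument needs right ones. The link is
  that on a homogeneous element the antipode is reversal up to a scalar, so that \<open>rv p\<close>
  is proportional to p modulo S. The same scalar, applied twice, is the power of q in the weight
  condition. That the e act on T/S is itself a consequence of nondegeneracy: the form is symmetric,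
  so an element of S, read as a differential operator, maps the free algebra into S. Letting the
  relations of the algebra act on 1 then shows that they impose on the f' nothing beyond S.\<close>

lemma sum_delta_mult:
  fixes f :: "'t \<Rightarrow> 'k::comm_ring_1"
  assumes "finite A" "a \<in> A"
  shows "(\<Sum>p\<in>A. (if p = a then 1 else 0) * f p) = f a"
  using assms by (simp add: if_distrib[of "\<lambda>x. x * _"] cong: if_cong)

text \<open>Rows are added one at a time. With Q = G H the condition reads Q G = G; a new row either
  satisfies it already or has a nonzero residual at some column \<open>z0\<close>, and then a
  rank-one correction of \<open>H\<close> settles it. The column set \<Phi> is arbitrary, so it may
  consist of all words.\<close>

lemma generalized_inverse:
  fixes G :: "'t \<Rightarrow> 'z \<Rightarrow> 'k::field"
  assumes "finite A"
  shows "\<exists>\<Psi> H. finite \<Psi> \<and> \<Psi> \<subseteq> \<Phi> \<and>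
    (\<forall>t\<in>A. \<forall>z\<in>\<Phi>. (\<Sum>p\<in>A. (\<Sum>y\<in>\<Psi>. G t y * H y p) * G p z) = G t z)"
  using assms
proof (induction A)
  case empty
  then show ?case by (intro exI[of _ "{}"]) auto
next
  case (insert a A)
  from insert.IH obtain \<Psi> H where *: "finite \<Psi> \<and> \<Psi> \<subseteq> \<Phi> \<and>
    (\<forall>t\<in>A. \<forall>z\<in>\<Phi>. (\<Sum>p\<in>A. (\<Sum>y\<in>\<Psi>. G t y * H y p) * G p z) = G t z)"
    by (elim exE)
  then have \<Psi>: "finite \<Psi>" "\<Psi> \<subseteq> \<Phi>"
    and H: "\<And>t z. t \<in> A \<Longrightarrow> z \<in> \<Phi> \<Longrightarrow> (\<Sum>p\<in>A. (\<Sum>y\<in>\<Psi>. G t y * H y p) * G p z) = G t z"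
    by simp_all
  define Q where "Q t p = (\<Sum>y\<in>\<Psi>. G t y * H y p)" for t p
  \<comment> \<open>The part of row t not reproduced by the rows indexed by
    \<open>A\<close>.\<close>
  define r where "r t z = G t z - (\<Sum>p\<in>A. Q t p * G p z)" for t z
  have r0: "r t z = 0" if "t \<in> A" "z \<in> \<Phi>" for t z
    using H[OF that] by (simp add: r_def Q_def)
  show ?case
  proof (cases "\<forall>z\<in>\<Phi>. r a z = 0")
    case True
    let ?H = "\<lambda>y p. if p = a then 0 else H y p"
    have "(\<Sum>p\<in>insert a A. (\<Sum>y\<in>\<Psi>. G t y * ?H y p) * G p z) = G t z"
      if "t \<in> insert a A" "z \<in> \<Phi>" for t z
    proof -
      have "(\<Sum>p\<in>insert a A. (\<Sum>y\<in>\<Psi>. G t y * ?H y p) * G p z) = (\<Sum>p\<in>A. Q t p * G p z)"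
        using insert.hyps by (auto simp: Q_def intro!: sum.cong)
      also have "\<dots> = G t z - r t z" by (simp add: r_def)
      finally show ?thesis using that True r0 by auto
    qed
    then show ?thesis using \<Psi> by (intro exI[of _ \<Psi>] exI[of _ ?H]) auto
  next
    case False
    then obtain z0 where z0: "z0 \<in> \<Phi>" "r a z0 \<noteq> 0" by auto
    define \<Psi>' where "\<Psi>' = insert z0 \<Psi>"
    \<comment> \<open>Cuts \<open>H\<close> back to the old rows and columns, since its values at
      \<open>a\<close> and outside \<Psi> are arbitrary.\<close>
    define h where "h y p = (if p = a \<or> y \<notin> \<Psi> then 0 else H y p)" for y p
    \<comment> \<open>The correction is the rank-one matrix u v, where u is a column with G u = r(_,
      z0) and v a row with v G = r(a, _) / r(a, z0). It adds r(t, z0) r(a, z) / r(a, z0) to Q G,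
      which repairs row a and vanishes on the old rows.\<close>
    define u where "u y = (if y = z0 then 1 else 0) - (\<Sum>p\<in>A. h y p * G p z0)" for y
    define v where "v p = ((if p = a then 1 else 0) - (if p = a then 0 else Q a p)) / r a z0" for p
    define H' where "H' y p = h y p + u y * v p" for y p
    have fin: "finite \<Psi>'" and sub: "\<Psi>' \<subseteq> \<Phi>" using \<Psi> z0 by (auto simp: \<Psi>'_def)
    have Qh: "(\<Sum>y\<in>\<Psi>'. G t y * h y p) = (if p = a then 0 else Q t p)" for t p
    proof -
      have "(\<Sum>y\<in>\<Psi>'. G t y * h y p) = (\<Sum>y\<in>\<Psi>. G t y * h y p)"
        unfolding \<Psi>'_def by (rule sum.mono_neutral_right) (use \<Psi> in \<open>auto simp: h_def\<close>)
      also have "\<dots> = (if p = a then 0 else Q t p)"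
        by (auto simp: h_def Q_def intro!: sum.cong)
      finally show ?thesis .
    qed
    have Gu: "(\<Sum>y\<in>\<Psi>'. G t y * u y) = r t z0" for t
    proof -
      have "(\<Sum>y\<in>\<Psi>'. G t y * u y) =
          (\<Sum>y\<in>\<Psi>'. (if y = z0 then 1 else 0) * G t y) - (\<Sum>y\<in>\<Psi>'. \<Sum>p\<in>A. G t y * h y p * G p z0)"
        by (simp add: u_def right_diff_distrib sum_subtractf sum_distrib_left mult_ac)
      also have "(\<Sum>y\<in>\<Psi>'. (if y = z0 then 1 else 0) * G t y) = G t z0"
        by (rule sum_delta_mult) (use fin in \<open>auto simp: \<Psi>'_def\<close>)
      also have "(\<Sum>y\<in>\<Psi>'. \<Sum>p\<in>A. G t y * h y p * G p z0) = (\<Sum>p\<in>A. Q t p * G p z0)"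
        unfolding sum.swap[of _ A] sum_distrib_right[symmetric] Qh
        using insert.hyps by (auto intro!: sum.cong)
      finally show ?thesis by (simp add: r_def)
    qed
    have main: "(\<Sum>p\<in>insert a A. (\<Sum>y\<in>\<Psi>'. G t y * H' y p) * G p z) = G t z"
      if t: "t \<in> insert a A" and z: "z \<in> \<Phi>" for t z
    proof -
      have "(\<Sum>y\<in>\<Psi>'. G t y * H' y p) = (if p = a then 0 else Q t p) + r t z0 * v p" for p
        unfolding H'_def distrib_left sum.distrib Qh Gu[symmetric] sum_distrib_right mult.assoc ..
      then have "(\<Sum>p\<in>insert a A. (\<Sum>y\<in>\<Psi>'. G t y * H' y p) * G p z)
        = (\<Sum>p\<in>insert a A. (if p = a then 0 else Q t p) * G p z) + r t z0 * (\<Sum>p\<in>insert a A. v p * G p z)"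
        by (simp only: distrib_right sum.distrib sum_distrib_left mult.assoc)
      also have "(\<Sum>p\<in>insert a A. (if p = a then 0 else Q t p) * G p z) = (\<Sum>p\<in>A. Q t p * G p z)"
        using insert.hyps by (auto intro!: sum.cong)
      also have "(\<Sum>p\<in>insert a A. v p * G p z) = r a z / r a z0"
      proof -
        have "(\<Sum>p\<in>A. v p * G p z) = - (\<Sum>p\<in>A. Q a p * G p z) / r a z0"
          unfolding sum_divide_distrib sum_negf[symmetric]
          using insert.hyps by (auto simp: v_def intro!: sum.cong)
        then show ?thesis using insert.hyps
          by (simp add: v_def r_def diff_divide_distrib)
      qed
      finally have *: "(\<Sum>p\<in>insert a A. (\<Sum>y\<in>\<Psi>'. G t y * H' y p) * G p z)
          = G t z - r t z + r t z0 * (r a z / r a z0)"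
        by (simp add: r_def)
      show ?thesis
      proof (cases "t = a")
        case True then show ?thesis using * z0 by simp
      next
        case False then show ?thesis using * t z z0 r0 by simp
      qed
    qed
    show ?thesis
      by (intro exI[of _ \<Psi>'] exI[of _ H']) (use fin sub main in auto)
  qed
qed

abbreviation "keys \<equiv> Poly_Mapping.keys"
abbreviation "lookup \<equiv> Poly_Mapping.lookup"
abbreviation "single \<equiv> Poly_Mapping.single"

section \<open>Linear maps between spaces of formal linear combinations\<close>

abbreviation smul :: "'k::field \<Rightarrow> ('b \<Rightarrow>\<^sub>0 'k) \<Rightarrow> ('b \<Rightarrow>\<^sub>0 'k)" where
  "smul c \<equiv> Poly_Mapping.map ((*) c)"

lemma lookup_smul: "lookup (smul c p) w = c * lookup p w"
  by (transfer) (auto simp: when_def)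

interpretation free: vector_space "smul :: 'k::field \<Rightarrow> ('b \<Rightarrow>\<^sub>0 'k) \<Rightarrow> _"
  by standard (rule poly_mapping_eqI; simp add: lookup_smul lookup_add algebra_simps)+

lemma smul_mult: "smul c p * r = smul c (p * r)"
  for p :: "'a::monoid_add \<Rightarrow>\<^sub>0 'k::field"
  by (simp add: mult_map_scale_conv_mult mult.assoc)

lemma poly_mapping_decomp: "p = (\<Sum>w\<in>keys p. single w (lookup p w))"
proof (rule poly_mapping_eqI)
  fix k
  show "lookup p k = lookup (\<Sum>w\<in>keys p. single w (lookup p w)) k"
    by (auto simp: lookup_sum lookup_single when_def in_keys_iff sum.delta)
qed

lemma poly_mapping_induct [case_names zero single add]:
  assumes "P 0" "\<And>w c. P (single w c)" "\<And>p r. P p \<Longrightarrow> P r \<Longrightarrow> P (p + r)"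
  shows "P (p :: 'b \<Rightarrow>\<^sub>0 'k::comm_monoid_add)"
proof -
  have "P (\<Sum>w\<in>A. single w (lookup p w))" if "finite A" for A
    using that by induction (auto intro: assms)
  then show ?thesis by (subst poly_mapping_decomp) simp
qed

text \<open>Words do not commute, but a scalar is a multiple of the empty word and hence
  central.\<close>

lemma mult_smul: "p * smul c r = smul c (p * r)"
  for p :: "'a::monoid_add \<Rightarrow>\<^sub>0 'k::field"
proof -
  have "p * single 0 c = single 0 c * p"
    by (induction p rule: poly_mapping_induct) (simp_all add: algebra_simps mult_single)
  then show ?thesis by (simp only: mult_map_scale_conv_mult mult.assoc[symmetric])
qed

definition linmap :: "(('b \<Rightarrow>\<^sub>0 'k::field) \<Rightarrow> ('c \<Rightarrow>\<^sub>0 'k)) \<Rightarrow> bool" where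
  "linmap f \<longleftrightarrow> (\<forall>p r. f (p + r) = f p + f r) \<and> (\<forall>c p. f (smul c p) = smul c (f p))"

lemma linmapI:
  assumes "\<And>p r. f (p + r) = f p + f r" "\<And>c p. f (smul c p) = smul c (f p)"
  shows "linmap f"
  using assms by (auto simp: linmap_def)

lemma linmap_add: "linmap f \<Longrightarrow> f (p + r) = f p + f r"
  and linmap_smul: "linmap f \<Longrightarrow> f (smul c p) = smul c (f p)"
  by (auto simp: linmap_def)

lemma linmap_zero: "linmap f \<Longrightarrow> f 0 = 0"
  using linmap_smul[of f 0 0] by simp

lemma linmap_minus: "linmap f \<Longrightarrow> f (- p) = - f p"
  using linmap_smul[of f "-1" p] by (simp add: free.scale_minus_left)

lemma linmap_diff: "linmap f \<Longrightarrow> f (p - r) = f p - f r"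
  using linmap_add[of f p "- r"] by (simp add: linmap_minus)

lemma linmap_sum: "linmap f \<Longrightarrow> f (sum g A) = (\<Sum>x\<in>A. f (g x))"
  by (induction A rule: infinite_finite_induct) (auto simp: linmap_zero linmap_add)

lemma linmap_sum_list: "linmap f \<Longrightarrow> f (sum_list xs) = (\<Sum>x\<leftarrow>xs. f x)"
  by (induction xs) (auto simp: linmap_zero linmap_add)

lemmas linmapD = linmap_add linmap_smul linmap_zero linmap_minus linmap_diff

lemma linmap_id: "linmap (\<lambda>p. p)" by (simp add: linmap_def)
lemma linmap_const_zero: "linmap (\<lambda>p. 0)" by (simp add: linmap_def)
lemma linmap_comp: "linmap f \<Longrightarrow> linmap g \<Longrightarrow> linmap (\<lambda>p. f (g p))"
  by (simp add: linmap_def)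
lemma linmap_plus: "linmap f \<Longrightarrow> linmap g \<Longrightarrow> linmap (\<lambda>p. f p + g p)"
  by (simp add: linmap_def free.scale_right_distrib)
lemma linmap_subtract: "linmap f \<Longrightarrow> linmap g \<Longrightarrow> linmap (\<lambda>p. f p - g p)"
  by (simp add: linmap_def free.scale_right_diff_distrib)
lemma linmap_scale: "linmap f \<Longrightarrow> linmap (\<lambda>p. smul c (f p))"
  by (simp add: linmap_def free.scale_right_distrib mult.commute)
lemma linmap_if: "linmap f \<Longrightarrow> linmap g \<Longrightarrow> linmap (\<lambda>p. if b then f p else g p)"
  by (cases b) auto
lemma linmap_mult_left: "linmap f \<Longrightarrow> linmap (\<lambda>p. r * f p)"
  for r :: "'a::monoid_add \<Rightarrow>\<^sub>0 'k::field"
  by (simp add: linmap_def distrib_left mult_smul)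
lemma linmap_mult_right: "linmap f \<Longrightarrow> linmap (\<lambda>p. f p * r)"
  for r :: "'a::monoid_add \<Rightarrow>\<^sub>0 'k::field"
  by (simp add: linmap_def distrib_right smul_mult)
lemma linmap_funpow: "linmap f \<Longrightarrow> linmap (f ^^ n)"
  for f :: "('b \<Rightarrow>\<^sub>0 'k::field) \<Rightarrow> ('b \<Rightarrow>\<^sub>0 'k)"
  by (induction n) (simp_all add: linmap_def)

lemmas linmap_intros = linmap_id linmap_const_zero linmap_plus linmap_subtract linmap_scale
  linmap_if linmap_mult_left linmap_mult_right linmap_funpow

lemma linmap_eqI:
  assumes "linmap f" "linmap g" "\<And>w. f (single w 1) = g (single w 1)"
  shows "f p = g p"
proof (induction p rule: poly_mapping_induct)
  case (single w c)
  have "single w c = smul c (single w 1)" by (cases "c = 0") auto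
  then show ?case using assms by (metis linmap_smul)
qed (use assms in \<open>auto simp: linmap_add linmap_zero\<close>)

definition lin :: "('b \<Rightarrow> ('c \<Rightarrow>\<^sub>0 'k)) \<Rightarrow> ('b \<Rightarrow>\<^sub>0 'k::field) \<Rightarrow> ('c \<Rightarrow>\<^sub>0 'k)" where
  "lin g p = (\<Sum>w\<in>keys p. smul (lookup p w) (g w))"

lemma lin_superset: "finite A \<Longrightarrow> keys p \<subseteq> A \<Longrightarrow> lin g p = (\<Sum>w\<in>A. smul (lookup p w) (g w))"
  unfolding lin_def by (rule sum.mono_neutral_left) (auto simp: in_keys_iff)

lemma linmap_lin: "linmap (lin g)"
  for g :: "'b \<Rightarrow> ('c \<Rightarrow>\<^sub>0 'k::field)"
proof (rule linmapI)
  fix p r :: "'b \<Rightarrow>\<^sub>0 'k" and c :: 'k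
  have "lin g (p + r) = (\<Sum>w\<in>keys p \<union> keys r. smul (lookup (p + r) w) (g w))"
    by (rule lin_superset) (auto dest: subsetD[OF Poly_Mapping.keys_add])
  also have "\<dots> = lin g p + lin g r"
    by (simp add: lookup_add free.scale_left_distrib sum.distrib lin_superset[of "keys p \<union> keys r"])
  finally show "lin g (p + r) = lin g p + lin g r" .
  have "lin g (smul c p) = (\<Sum>w\<in>keys p. smul (lookup (smul c p) w) (g w))"
    by (rule lin_superset) (auto simp: in_keys_iff lookup_smul)
  then show "lin g (smul c p) = smul c (lin g p)"
    by (simp add: lookup_smul lin_def free.scale_sum_right)
qed

lemma lin_single [simp]: "lin g (single w c) = smul c (g w)"
  by (cases "c = 0") (auto simp: lin_def)

lemma linmap_lin_comp: "linmap f \<Longrightarrow> linmap (\<lambda>p. lin g (f p))"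
  by (rule linmap_comp[OF linmap_lin])

section \<open>The free algebra\<close>

abbreviation ltr :: "'a \<Rightarrow> 'a word \<Rightarrow>\<^sub>0 'k::field" where "ltr a \<equiv> monomial [a]"

lemma monomial_Nil: "monomial [] = 1"
  by (simp add: monomial_def zero_word_def[symmetric])

lemma monomial_append: "monomial (u @ v) = monomial u * monomial v"
  by (simp add: monomial_def mult_single plus_word_def)

lemma monomial_Cons: "monomial (a # w) = ltr a * monomial w"
  using monomial_append[of "[a]" w] by simp

lemma letters_zero [simp]: "letters 0 = []" by (simp add: zero_word_def)
lemma letters_plus [simp]: "letters (u + v) = letters u @ letters v" by (simp add: plus_word_def)

lemma single_word: "single w 1 = monomial (letters w)" by (simp add: monomial_def)

lemma linmap_eqI_monomial:
  assumes "linmap f" "linmap g" "\<And>w. f (monomial w) = g (monomial w)"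
  shows "f p = g p"
  by (rule linmap_eqI[OF assms(1,2)]) (unfold single_word, rule assms(3))

lemma linmap_eqI_letters:
  assumes "linmap f" "linmap g" "f 1 = g 1"
    "\<And>a w. f (monomial w) = g (monomial w) \<Longrightarrow> f (ltr a * monomial w) = g (ltr a * monomial w)"
  shows "f p = g p"
proof (rule linmap_eqI_monomial[OF assms(1,2)])
  fix w show "f (monomial w) = g (monomial w)"
  proof (induction w)
    case (Cons a w)
    then show ?case using assms(4) by (subst (1 2) monomial_Cons)
  qed (simp add: monomial_Nil assms(3))
qed

text \<open>All gradings act through such diagonal operators: the twists by powers of q, the sign
  and power of q in the antipode, the projections onto graded components.\<close>

definition scal :: "('b \<Rightarrow> 'k) \<Rightarrow> ('b \<Rightarrow>\<^sub>0 'k::field) \<Rightarrow> ('b \<Rightarrow>\<^sub>0 'k)" where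
  "scal \<chi> = lin (\<lambda>w. single w (\<chi> w))"

lemma linmap_scal: "linmap (scal \<chi>)" by (simp add: scal_def linmap_lin)

lemma scal_single [simp]: "scal \<chi> (single w c) = single w (\<chi> w * c)"
  by (simp add: scal_def mult.commute)

lemma lookup_scal: "lookup (scal \<chi> p) w = \<chi> w * lookup p w"
  by (induction p rule: poly_mapping_induct)
    (auto simp: linmapD[OF linmap_scal] lookup_add algebra_simps lookup_single when_def)

lemma scal_scal: "scal \<chi> (scal \<psi> p) = scal (\<lambda>w. \<chi> w * \<psi> w) p"
  by (rule poly_mapping_eqI) (simp add: lookup_scal mult.assoc)

lemma scal_const: "(\<And>w. w \<in> keys p \<Longrightarrow> \<chi> w = c) \<Longrightarrow> scal \<chi> p = smul c p"
  by (rule poly_mapping_eqI) (auto simp: lookup_scal lookup_smul in_keys_iff)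

lemma scal_id: "(\<And>w. w \<in> keys p \<Longrightarrow> \<chi> w = 1) \<Longrightarrow> scal \<chi> p = p"
  using scal_const[of p \<chi> 1] by simp

lemma scal_mult:
  assumes "\<And>u v. \<chi> (u + v) = \<chi> u * \<chi> v"
  shows "scal \<chi> (p * r) = scal \<chi> p * scal \<chi> r"
proof (induction p rule: poly_mapping_induct)
  case (single u c)
  show ?case
    by (induction r rule: poly_mapping_induct)
      (auto simp: linmapD[OF linmap_scal] distrib_left mult_single assms mult_ac)
qed (auto simp: linmapD[OF linmap_scal] distrib_right)

lemma keys_monomial: "keys (monomial w) = {Word w}" by (simp add: monomial_def)

section \<open>Skew derivations of the free algebra\<close>

lemma single_eq_smul: "single w c = smul c (single w 1)"
  for c :: "'k::field"
  by (cases "c = 0") auto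

definition rv :: "('a word \<Rightarrow>\<^sub>0 'k::field) \<Rightarrow> ('a word \<Rightarrow>\<^sub>0 'k)" where
  "rv = lin (\<lambda>w. monomial (rev (letters w)))"

lemma linmap_rv: "linmap rv" by (simp add: rv_def linmap_lin)

lemma rv_monomial: "rv (monomial w) = monomial (rev w)"
  by (simp add: rv_def monomial_def)

lemma rv_one: "rv 1 = 1"
  using rv_monomial[of "[]"] by (simp add: monomial_Nil)

lemma rv_mult: "rv (p * r) = rv r * rv p"
proof -
  have "rv (monomial u * r) = rv r * rv (monomial u)" for u
  proof (rule linmap_eqI_monomial[of "\<lambda>r. rv (monomial u * r)" "\<lambda>r. rv r * rv (monomial u)"])
    show "rv (monomial u * monomial v) = rv (monomial v) * rv (monomial u)" for v
      by (simp add: monomial_append[symmetric] rv_monomial)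
  qed (intro linmap_comp[OF linmap_rv] linmap_intros linmap_rv)+
  then show ?thesis
    by (rule linmap_eqI_monomial[of "\<lambda>p. rv (p * r)" "\<lambda>p. rv r * rv p", rotated -1])
      (intro linmap_comp[OF linmap_rv] linmap_intros linmap_rv)+
qed

lemma rv_rv [simp]: "rv (rv p) = p"
  by (rule linmap_eqI_monomial[of "\<lambda>p. rv (rv p)" "\<lambda>p. p"])
    (auto intro!: linmap_comp[OF linmap_rv] linmap_intros linmap_rv simp: rv_monomial)

lemma lookup_zero_ltr_mult: "lookup (ltr b * p) 0 = 0"
  by (induction p rule: poly_mapping_induct)
    (auto simp: distrib_left lookup_add monomial_def mult_single lookup_single when_def
      plus_word_def zero_word_def)

text \<open>\<open>C x y\<close> stands for the form (x|y) on letters, later s_i a_ij, and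
  \<open>q powi C x y\<close> is the bicharacter that braids the free algebra.\<close>

locale bicharacter =
  fixes C :: "'a \<Rightarrow> 'a \<Rightarrow> int" and q :: "'k::field"
  assumes C_sym: "C x y = C y x" and q_nz: "q \<noteq> 0"
begin

definition wt :: "'a \<Rightarrow> 'a list \<Rightarrow> int" where "wt a w = (\<Sum>b\<leftarrow>w. C a b)"

lemma wt_simps [simp]: "wt a [] = 0" "wt a (b # w) = C a b + wt a w" "wt a (u @ v) = wt a u + wt a v"
  "wt a (rev w) = wt a w"
  by (auto simp: wt_def rev_map[symmetric])

lemma wt_mset: "mset u = mset v \<Longrightarrow> wt a u = wt a v"
  unfolding wt_def by (metis mset_map sum_mset_sum_list)

text \<open>The analogue of conjugation by the n-th power of the torus element K_a.\<close>

definition tw :: "'a \<Rightarrow> int \<Rightarrow> ('a word \<Rightarrow>\<^sub>0 'k) \<Rightarrow> ('a word \<Rightarrow>\<^sub>0 'k)" where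
  "tw a n = scal (\<lambda>w. q powi (n * wt a (letters w)))"

lemma linmap_tw: "linmap (tw a n)" by (simp add: tw_def linmap_scal)

lemma tw_monomial: "tw a n (monomial w) = smul (q powi (n * wt a w)) (monomial w)"
  by (simp add: tw_def monomial_def)

lemma tw_one [simp]: "tw a n 1 = 1"
  using tw_monomial[of a n "[]"] by (simp add: monomial_Nil)

lemma tw_mult: "tw a n (p * r) = tw a n p * tw a n r"
  unfolding tw_def by (rule scal_mult) (simp add: distrib_left power_int_add q_nz)

lemma tw_tw: "tw a n (tw b m p) = tw b m (tw a n p)"
  by (simp add: tw_def scal_scal mult.commute)

lemma tw_add: "tw a n (tw a m p) = tw a (n + m) p"
  by (simp add: tw_def scal_scal power_int_add[symmetric] q_nz distrib_right)

lemma tw_zero [simp]: "tw a 0 p = p"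
  by (simp add: tw_def scal_id)

lemma tw_ltr_mult: "tw a n (ltr b * p) = smul (q powi (n * C a b)) (ltr b * tw a n p)"
  by (simp add: tw_mult tw_monomial smul_mult)

text \<open>The action of e_a on a word in the f', unrolled one letter at a time;
  \<open>q powi (- C a b)\<close> is the q_ij of the commutation rule.\<close>

fun dword :: "'a \<Rightarrow> 'a list \<Rightarrow> ('a word \<Rightarrow>\<^sub>0 'k)" where
  "dword a [] = 0"
| "dword a (b # w) = (if a = b then monomial w else 0) + smul (q powi (- C a b)) (ltr b * dword a w)"

definition der :: "'a \<Rightarrow> ('a word \<Rightarrow>\<^sub>0 'k) \<Rightarrow> ('a word \<Rightarrow>\<^sub>0 'k)" where
  "der a = lin (\<lambda>w. dword a (letters w))"

lemma linmap_der: "linmap (der a)" by (simp add: der_def linmap_lin)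

lemma der_monomial: "der a (monomial w) = dword a w"
  by (simp add: der_def monomial_def)

lemma der_one [simp]: "der a 1 = 0"
  using der_monomial[of a "[]"] by (simp add: monomial_Nil)

lemma der_ltr_mult:
  "der a (ltr b * p) = (if a = b then p else 0) + smul (q powi (- C a b)) (ltr b * der a p)"
proof (rule linmap_eqI_monomial[of "\<lambda>p. der a (ltr b * p)"])
  show "der a (ltr b * monomial w) =
     (if a = b then monomial w else 0) + smul (q powi - C a b) (ltr b * der a (monomial w))" for w
    unfolding monomial_Cons[symmetric] der_monomial by simp
qed (intro linmap_comp[OF linmap_der] linmap_intros linmap_der)+

lemma der_ltr: "der a (ltr b) = (if a = b then 1 else 0)"
  using der_ltr_mult[of a b 1] by simp

text \<open>The scalar records that \<open>der a\<close> lowers the weight by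
  \<open>a\<close>.\<close>

lemma der_tw: "der a (tw b n p) = smul (q powi (n * C a b)) (tw b n (der a p))"
proof (rule linmap_eqI_letters[of "\<lambda>p. der a (tw b n p)" "\<lambda>p. smul (q powi (n * C a b)) (tw b n (der a p))"])
  fix c w
  assume IH: "der a (tw b n (monomial w)) = smul (q powi (n * C a b)) (tw b n (der a (monomial w)))"
  show "der a (tw b n (ltr c * monomial w)) =
      smul (q powi (n * C a b)) (tw b n (der a (ltr c * monomial w)))"
    using IH by (cases "a = c") (simp_all add: tw_ltr_mult linmapD[OF linmap_der] linmapD[OF linmap_tw]
       der_ltr_mult mult_smul free.scale_right_distrib mult_ac C_sym)
qed (auto intro!: linmap_comp[OF linmap_der] linmap_comp[OF linmap_tw] linmap_scale linmap_tw linmap_der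
    simp: linmapD[OF linmap_tw])

lemma der_mult: "der a (p * r) = der a p * r + tw a (-1) p * der a r"
proof (rule linmap_eqI_letters[of "\<lambda>p. der a (p * r)"])
  fix c w
  assume IH: "der a (monomial w * r) = der a (monomial w) * r + tw a (-1) (monomial w) * der a r"
  show "der a (ltr c * monomial w * r) =
      der a (ltr c * monomial w) * r + tw a (-1) (ltr c * monomial w) * der a r"
    using IH by (cases "a = c") (simp_all add: mult.assoc der_ltr_mult tw_ltr_mult distrib_left distrib_right
        smul_mult mult_smul free.scale_right_distrib C_sym)
qed (auto intro!: linmap_comp[OF linmap_der] linmap_intros linmap_tw linmap_der)

text \<open>The mirror image of \<open>der\<close>, needed because the sl_2-type relation with the
  adjoint action holds for it and not for \<open>der\<close>.\<close>

definition rder :: "'a \<Rightarrow> ('a word \<Rightarrow>\<^sub>0 'k) \<Rightarrow> ('a word \<Rightarrow>\<^sub>0 'k)" where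
  "rder a p = rv (der a (rv p))"

lemma linmap_rder: "linmap (rder a)"
  unfolding rder_def by (intro linmap_comp[OF linmap_rv] linmap_comp[OF linmap_der] linmap_rv)

lemma rv_tw: "rv (tw a n p) = tw a n (rv p)"
  by (rule linmap_eqI_monomial[of "\<lambda>p. rv (tw a n p)"])
    (auto intro!: linmap_comp[OF linmap_rv] linmap_comp[OF linmap_tw] linmap_tw linmap_rv
      simp: tw_monomial rv_monomial linmapD[OF linmap_rv])

lemma rder_mult: "rder a (p * r) = p * rder a r + rder a p * tw a (-1) r"
  by (simp add: rder_def rv_mult der_mult linmapD[OF linmap_rv] rv_tw)

lemma rder_tw: "rder a (tw b n p) = smul (q powi (n * C a b)) (tw b n (rder a p))"
  by (simp add: rder_def rv_tw der_tw linmapD[OF linmap_rv])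

lemma rder_ltr: "rder a (ltr b) = (if a = b then 1 else 0)"
  by (simp add: rder_def rv_monomial der_ltr rv_one linmapD[OF linmap_rv])

section \<open>Iterated derivations and the symmetric form\<close>

definition ders :: "'a list \<Rightarrow> ('a word \<Rightarrow>\<^sub>0 'k) \<Rightarrow> ('a word \<Rightarrow>\<^sub>0 'k)" where
  "ders z = foldr der z"

lemma ders_simps [simp]: "ders [] p = p" "ders (a # z) p = der a (ders z p)"
  "ders (y @ z) p = ders y (ders z p)"
  by (auto simp: ders_def)

lemma linmap_ders: "linmap (ders z)"
proof (induction z)
  case (Cons a z)
  then show ?case using linmap_comp[OF linmap_der Cons, of a] by (simp add: ders_def o_def)
qed (simp add: ders_def id_def linmap_id)

text \<open>The word is reversed so that its first letter is the first derivation applied; left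
  multiplication by a letter in the first argument is then adjoint to \<open>der\<close>, as for
  Kashiwara's form.\<close>

definition bil :: "('a word \<Rightarrow>\<^sub>0 'k) \<Rightarrow> ('a word \<Rightarrow>\<^sub>0 'k) \<Rightarrow> 'k" where
  "bil p r = lookup (lin (\<lambda>w. ders (rev (letters w)) r) p) 0"

lemma bil_monomial: "bil (monomial w) r = lookup (ders (rev w) r) 0"
  by (simp add: bil_def monomial_def)

lemma bil_linear_left: "bil (p + p') r = bil p r + bil p' r" "bil (smul c p) r = c * bil p r" "bil 0 r = 0"
  by (simp_all add: bil_def linmapD[OF linmap_lin] lookup_add lookup_smul)

lemma bil_linear_right: "bil p (r + r') = bil p r + bil p r'" "bil p (smul c r) = c * bil p r" "bil p 0 = 0"
  by (simp_all add: bil_def lin_def linmapD[OF linmap_ders] lookup_sum lookup_add lookup_smul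
      sum.distrib sum_distrib_left algebra_simps)

lemma bil_ltr_left: "bil (ltr a * p) r = bil p (der a r)"
proof -
  have "lin (\<lambda>w. ders (rev (letters w)) r) (ltr a * p) = lin (\<lambda>w. ders (rev (letters w)) (der a r)) p"
  proof (rule linmap_eqI_monomial[of "\<lambda>p. lin _ (ltr a * p)"])
    show "lin (\<lambda>w. ders (rev (letters w)) r) (ltr a * monomial w) =
        lin (\<lambda>w. ders (rev (letters w)) (der a r)) (monomial w)" for w
      unfolding monomial_Cons[symmetric] by (simp add: monomial_def)
  qed (intro linmap_lin_comp linmap_intros)+
  then show ?thesis by (simp add: bil_def)
qed

text \<open>Adjointness in the second argument is not built into the definition. Induction on the
  left word compares the two expansions of the pairing of a w with b r; the crossed terms carry
  q^(-C a b) and q^(-C b a), and symmetry of \<open>C\<close> makes them agree.\<close>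

lemma bil_ltr_right: "bil p (ltr b * r) = bil (der b p) r"
proof -
  have mono: "bil (monomial w) (ltr b * r) = bil (der b (monomial w)) r" for w r
  proof (induction w arbitrary: r)
    case Nil
    show ?case by (simp add: bil_monomial lookup_zero_ltr_mult)
        (simp add: monomial_Nil bil_linear_left)
  next
    case (Cons a w)
    show ?case
      unfolding monomial_Cons[of a w]
      by (simp add: bil_ltr_left der_ltr_mult[of a b] der_ltr_mult[of b a] bil_linear_left bil_linear_right
          Cons C_sym[of b a])
  qed
  show ?thesis
  proof (induction p rule: poly_mapping_induct)
    case (single w c)
    have "single w c = smul c (monomial (letters w))"
      using single_eq_smul[of w c] by (simp add: single_word)
    then show ?case using mono by (simp add: bil_linear_left linmapD[OF linmap_der])
  qed (auto simp: bil_linear_left linmapD[OF linmap_der])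
qed

lemma bil_one: "bil 1 r = lookup r 0" "bil r 1 = lookup r 0"
proof -
  show "bil 1 r = lookup r 0" using bil_monomial[of "[]" r] by (simp add: monomial_Nil)
  show "bil r 1 = lookup r 0"
  proof (induction r rule: poly_mapping_induct)
    case (single w c)
    have *: "single w c = smul c (monomial (letters w))"
      using single_eq_smul[of w c] by (simp add: single_word)
    have "ders (rev v @ [a]) 1 = 0" for v a
      by (simp add: linmapD[OF linmap_ders])
    then have "lookup (ders (rev v) 1) 0 = lookup (monomial v) 0" for v
      by (cases v) (auto simp: monomial_def lookup_single zero_word_def when_def lookup_one)
    then show ?case unfolding * by (simp only: bil_linear_left bil_monomial lookup_smul)
  qed (auto simp: bil_linear_left lookup_add)
qed

text \<open>Both arguments satisfy the same adjointness, so letters can be shifted from one side to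
  the other until the empty word is left.\<close>

lemma bil_sym: "bil p r = bil r p"
proof (induction p arbitrary: r rule: poly_mapping_induct)
  case (single w c)
  have *: "single w c = smul c (monomial (letters w))"
    using single_eq_smul[of w c] by (simp add: single_word)
  have "bil (monomial w) r = bil r (monomial w)" for w
  proof (induction w arbitrary: r)
    case (Cons a w)
    then show ?case
      unfolding monomial_Cons[of a w] by (simp add: bil_ltr_left bil_ltr_right)
  qed (simp add: monomial_Nil bil_one)
  then show ?case unfolding * by (simp only: bil_linear_left bil_linear_right)
qed (auto simp: bil_linear_left bil_linear_right)

section \<open>Coproduct and antipode\<close>

text \<open>\<open>cop w\<close> lists the triples \<open>(c, u, v)\<close> with \<open>\<Delta>(w) = \<Sum> c u \<otimes> v\<close>; the letters are primitive for the
  braided multiplication of the tensor square.\<close>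

fun cop :: "'a list \<Rightarrow> ('k \<times> 'a list \<times> 'a list) list" where
  "cop [] = [(1, [], [])]"
| "cop (b # w) = map (\<lambda>(c, u, v). (c, b # u, v)) (cop w) @
     map (\<lambda>(c, u, v). (c * q powi (- wt b u), u, b # v)) (cop w)"

text \<open>Applies \<phi> \<otimes> id to the coproduct of \<open>w\<close>. The tensor square is
  never formed; its elements are represented by lists of triples.\<close>

definition copairing :: "(('a word \<Rightarrow>\<^sub>0 'k) \<Rightarrow> 'k) \<Rightarrow> 'a list \<Rightarrow> ('a word \<Rightarrow>\<^sub>0 'k)" where
  "copairing \<phi> w = (\<Sum>(c, u, v)\<leftarrow>cop w. smul (c * \<phi> (monomial u)) (monomial v))"

lemma copairing_Cons:
  assumes "linmap f"
  shows "copairing (\<lambda>p. lookup (f p) 0) (b # w) =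
    copairing (\<lambda>p. lookup (f (ltr b * p)) 0) w + ltr b * copairing (\<lambda>p. lookup (f (tw b (-1) p)) 0) w"
  unfolding copairing_def cop.simps map_append sum_list_append
proof (rule arg_cong2[of _ _ _ _ "(+)"])
  show "(\<Sum>(c, u, v)\<leftarrow>map (\<lambda>(c, u, v). (c, b # u, v)) (cop w). smul (c * lookup (f (monomial u)) 0) (monomial v))
    = (\<Sum>(c, u, v)\<leftarrow>cop w. smul (c * lookup (f (ltr b * monomial u)) 0) (monomial v))"
    unfolding monomial_Cons[symmetric] by (simp add: o_def case_prod_unfold)
  show "(\<Sum>(c, u, v)\<leftarrow>map (\<lambda>(c, u, v). (c * q powi (- wt b u), u, b # v)) (cop w).
       smul (c * lookup (f (monomial u)) 0) (monomial v)) =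
     ltr b * (\<Sum>(c, u, v)\<leftarrow>cop w. smul (c * lookup (f (tw b (- 1) (monomial u))) 0) (monomial v))"
    unfolding sum_list_const_mult[symmetric] map_map
    by (intro arg_cong[of _ _ sum_list] map_cong refl)
      (auto simp: tw_monomial linmapD[OF assms] lookup_smul mult_smul mult_ac monomial_append[symmetric])
qed

text \<open>Says that \<open>der a\<close> acts on the coproduct through the left factor alone. The
  functional has the form counit after \<open>f\<close>, with \<open>f\<close> arbitrary, because in
  the induction \<open>f\<close> absorbs a left multiplication or a twist.\<close>

lemma copairing_der:
  assumes "linmap f"
  shows "copairing (\<lambda>p. lookup (f (der a p)) 0) w = lin (\<lambda>u. copairing (\<lambda>p. lookup (f p) 0) (letters u)) (dword a w)"
  using assms
proof (induction w arbitrary: f)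
  case Nil
  show ?case
    by (simp add: copairing_def monomial_Nil linmapD[OF Nil] linmapD[OF linmap_lin])
next
  case (Cons b w)
  let ?cp = "\<lambda>g. lin (\<lambda>u. copairing (\<lambda>p. lookup (g p) 0) (letters u))"
  have lf: "linmap (\<lambda>p. f (ltr b * p))" "linmap (\<lambda>p. f (tw b (-1) p))"
    using Cons.prems by (auto intro!: linmap_comp[OF Cons.prems] linmap_intros linmap_tw)
  have cp_ltr: "?cp f (ltr b * p) = ?cp (\<lambda>p. f (ltr b * p)) p + ltr b * ?cp (\<lambda>p. f (tw b (-1) p)) p" for p
  proof (rule linmap_eqI_monomial[of "\<lambda>p. lin _ (ltr b * p)"])
    show "?cp f (ltr b * monomial w) = ?cp (\<lambda>p. f (ltr b * p)) (monomial w) + ltr b * ?cp (\<lambda>p. f (tw b (-1) p)) (monomial w)" for w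
      unfolding monomial_Cons[symmetric] by (simp add: monomial_def copairing_Cons[OF Cons.prems])
  qed (intro linmap_lin_comp linmap_intros)+
  have 1: "copairing (\<lambda>p. lookup (f (der a (ltr b * p))) 0) w =
     (if a = b then copairing (\<lambda>p. lookup (f p) 0) w else 0) +
     smul (q powi (- C a b)) (copairing (\<lambda>p. lookup (f (ltr b * der a p)) 0) w)"
    unfolding copairing_def der_ltr_mult
    by (simp add: linmapD[OF Cons.prems] lookup_add lookup_smul case_prod_unfold
      linmap_sum_list[OF linmap_scale[OF linmap_id]] sum_list_addf[symmetric] distrib_left
      free.scale_left_distrib mult_ac o_def)
  have 2: "copairing (\<lambda>p. lookup (f (der a (tw b (-1) p))) 0) w =
     smul (q powi (- C a b)) (copairing (\<lambda>p. lookup (f (tw b (-1) (der a p))) 0) w)"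
    unfolding copairing_def der_tw
    by (simp add: linmapD[OF Cons.prems] lookup_smul case_prod_unfold
      linmap_sum_list[OF linmap_scale[OF linmap_id]] mult_ac o_def)
  have "copairing (\<lambda>p. lookup (f (der a p)) 0) (b # w) =
    copairing (\<lambda>p. lookup (f (der a (ltr b * p))) 0) w + ltr b * copairing (\<lambda>p. lookup (f (der a (tw b (-1) p))) 0) w"
    by (rule copairing_Cons) (intro linmap_comp[OF Cons.prems] linmap_der)
  also have "\<dots> = (if a = b then copairing (\<lambda>p. lookup (f p) 0) w else 0) +
     smul (q powi (- C a b)) (?cp f (ltr b * dword a w))"
    unfolding 1 2 Cons.IH[OF lf(1)] Cons.IH[OF lf(2)] cp_ltr
    by (simp add: mult_smul free.scale_right_distrib add.assoc)
  also have "\<dots> = ?cp f (dword a (b # w))"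
    by (simp add: linmapD[OF linmap_lin]) (simp add: monomial_def)
  finally show ?case .
qed

lemma copairing_eps: "copairing (\<lambda>p. lookup p 0) w = monomial w"
proof (induction w)
  case (Cons b w)
  have "copairing (\<lambda>p. lookup p 0) (b # w) =
      copairing (\<lambda>p. lookup (ltr b * p) 0) w + ltr b * copairing (\<lambda>p. lookup (tw b (-1) p) 0) w"
    by (rule copairing_Cons) (rule linmap_id)
  also have "copairing (\<lambda>p. lookup (ltr b * p) 0) w = 0"
    by (simp add: copairing_def lookup_zero_ltr_mult case_prod_unfold)
  also have "copairing (\<lambda>p. lookup (tw b (-1) p) 0) w = copairing (\<lambda>p. lookup p 0) w"
    by (simp add: copairing_def tw_def lookup_scal)
  finally show ?case by (simp add: Cons monomial_append[symmetric])
qed (simp add: copairing_def monomial_Nil)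

text \<open>The coproduct is dual to multiplication: contracting its left factor with \<open>\<epsilon> \<circ> \<partial>\<^sub>z\<close> gives \<open>\<partial>\<^sub>z\<close>.\<close>

lemma copairing_ders: "copairing (\<lambda>p. lookup (ders z p) 0) w = ders z (monomial w)"
proof -
  have "lin (\<lambda>u. copairing (\<lambda>p. lookup (ders z p) 0) (letters u)) p = ders z p" for p
  proof (induction z arbitrary: p rule: rev_induct)
    case Nil
    show ?case
      by (rule linmap_eqI_monomial[of "lin _" "\<lambda>p. ders [] p"])
        (auto simp: linmap_lin linmap_id copairing_eps monomial_def)
  next
    case (snoc a z)
    show ?case
    proof (rule linmap_eqI_monomial[of "lin _" "\<lambda>p. ders (z @ [a]) p"])
      fix w
      have "lin (\<lambda>u. copairing (\<lambda>p. lookup (ders (z @ [a]) p) 0) (letters u)) (monomial w)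
        = copairing (\<lambda>p. lookup (ders z (der a p)) 0) w" by (simp add: monomial_def)
      also have "\<dots> = lin (\<lambda>u. copairing (\<lambda>p. lookup (ders z p) 0) (letters u)) (dword a w)"
        by (rule copairing_der[OF linmap_ders])
      also have "\<dots> = ders z (dword a w)" by (rule snoc)
      finally show "lin (\<lambda>u. copairing (\<lambda>p. lookup (ders (z @ [a]) p) 0) (letters u)) (monomial w)
          = ders (z @ [a]) (monomial w)" by (simp add: der_monomial)
    qed (intro linmap_lin linmap_ders)+
  qed
  from this[of "monomial w"] show ?thesis by (simp add: monomial_def)
qed

text \<open>The exponent picked up when all letters are braided past each other into reverse order.
  As \<open>C\<close> is symmetric it is half of (\<beta>|\<beta>) - \<Sum> (x|x), so it depends on
  the weight \<beta> only.\<close>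

fun crossing :: "'a list \<Rightarrow> int" where
  "crossing [] = 0"
| "crossing (a # w) = wt a w + crossing w"

lemma crossing_mset: "2 * crossing w = (\<Sum>a\<in>#mset w. (\<Sum>b\<in>#mset w. C a b) - C a a)"
proof (induction w)
  case (Cons x w)
  have *: "(\<Sum>b\<in>#mset w. C a b) = wt a w" for a
    by (metis mset_map sum_mset_sum_list wt_def)
  have "(\<Sum>a\<in>#mset w. C a x) = wt x w"
    by (simp add: C_sym[of _ x] *)
  moreover have "(\<Sum>a\<in>#mset w. C a x + wt a w - C a a) =
      (\<Sum>a\<in>#mset w. C a x) + (\<Sum>a\<in>#mset w. wt a w - C a a)"
    by (simp add: sum_mset.distrib[symmetric] add_diff_eq)
  ultimately show ?case using Cons by (simp add: * distrib_left)
qed simp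

lemma crossing_mset_eq: "mset u = mset v \<Longrightarrow> crossing u = crossing v"
  using crossing_mset[of u] crossing_mset[of v] by simp

text \<open>Closed form of the braided anti-automorphism that negates letters: a sign for each
  letter, a power of q for each pair that crosses, and reversal.\<close>

definition antipode :: "('a word \<Rightarrow>\<^sub>0 'k) \<Rightarrow> ('a word \<Rightarrow>\<^sub>0 'k)" where
  "antipode p = rv (scal (\<lambda>w. (- 1) ^ length (letters w) * q powi (- crossing (letters w))) p)"

lemma linmap_antipode: "linmap antipode"
  unfolding antipode_def by (intro linmap_comp[OF linmap_rv] linmap_scal)

lemma antipode_monomial:
  "antipode (monomial w) = smul ((- 1) ^ length w * q powi (- crossing w)) (monomial (rev w))"
  by (simp add: antipode_def monomial_def rv_def)

lemma antipode_Cons: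
  "antipode (monomial (b # u)) = - smul (q powi (- wt b u)) (antipode (monomial u) * ltr b)"
proof -
  have "q powi (- wt b u - crossing u) = q powi (- wt b u) * q powi (- crossing u)"
    using q_nz by (simp add: power_int_add[symmetric])
  then show ?thesis by (simp add: antipode_monomial monomial_append smul_mult mult_ac)
qed

text \<open>Each term of the coproduct of \<open>w'\<close> yields two terms for
  \<open>b # w'\<close>, with left factors b u and u; by \<open>antipode_Cons\<close> their
  contributions cancel.\<close>

lemma antipode_left_inverse:
  assumes "w \<noteq> []"
  shows "(\<Sum>(c, u, v)\<leftarrow>cop w. smul c (antipode (monomial u) * monomial v)) = 0"
proof (cases w)
  case (Cons b w')
  have "smul c (antipode (monomial (b # u)) * monomial v) +
      smul (c * q powi (- wt b u)) (antipode (monomial u) * monomial (b # v)) = 0" for c u v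
    unfolding antipode_Cons monomial_Cons[of b v] by (simp add: smul_mult mult_ac mult.assoc)
  then show ?thesis unfolding Cons
    by (simp add: o_def case_prod_unfold sum_list_addf[symmetric])
qed (use assms in auto)

definition mid :: "'a list \<Rightarrow> ('k \<times> 'a list \<times> 'a list) list" where
  "mid w = filter (\<lambda>(c, u, v). u \<noteq> [] \<and> v \<noteq> []) (cop w)"

lemma sum_list_filter_split:
  "(\<Sum>x\<leftarrow>xs. f x) = (\<Sum>x\<leftarrow>filter P xs. f x) + (\<Sum>x\<leftarrow>filter (\<lambda>x. \<not> P x) xs. f x)"
  for f :: "'x \<Rightarrow> 'y::comm_monoid_add"
  by (induction xs) (auto simp: add_ac)

lemma cop_left_empty: "filter (\<lambda>(c, u, v). u = []) (cop w) = [(1, [], w)]"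
proof (induction w)
  case (Cons b w)
  have "filter (\<lambda>(c, u, v). u = []) (cop (b # w)) =
    map (\<lambda>(c, u, v). (c * q powi (- wt b u), u, b # v)) (filter (\<lambda>(c, u, v). u = []) (cop w))"
    by (simp add: filter_map o_def case_prod_unfold)
  then show ?case using Cons by simp
qed simp

lemma cop_right_empty: "filter (\<lambda>(c, u, v). v = []) (cop w) = [(1, w, [])]"
proof (induction w)
  case (Cons b w)
  have "filter (\<lambda>(c, u, v). v = []) (cop (b # w)) =
    map (\<lambda>(c, u, v). (c, b # u, v)) (filter (\<lambda>(c, u, v). v = []) (cop w))"
    by (simp add: filter_map o_def case_prod_unfold)
  then show ?case using Cons by simp
qed simp

lemma cop_mset: "(c, u, v) \<in> set (cop w) \<Longrightarrow> mset u + mset v = mset w"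
  by (induction w arbitrary: c u v) auto

text \<open>For a nonempty word the terms 1 \<otimes> w and w \<otimes> 1 are different and occur
  exactly once, with coefficient 1; \<open>mid\<close> is the reduced coproduct.\<close>

lemma sum_cop_mid:
  fixes g :: "'k \<Rightarrow> 'a list \<Rightarrow> 'a list \<Rightarrow> 'y::comm_monoid_add"
  assumes "w \<noteq> []"
  shows "(\<Sum>(c, u, v)\<leftarrow>cop w. g c u v) = (\<Sum>(c, u, v)\<leftarrow>mid w. g c u v) + g 1 [] w + g 1 w []"
proof -
  let ?g = "\<lambda>(c, u, v). g c u v"
  have "(\<Sum>x\<leftarrow>cop w. ?g x) = (\<Sum>x\<leftarrow>mid w. ?g x) + (\<Sum>x\<leftarrow>filter (\<lambda>x. \<not> (case x of (c, u, v) \<Rightarrow> u \<noteq> [] \<and> v \<noteq> [])) (cop w). ?g x)"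
    unfolding mid_def by (rule sum_list_filter_split)
  also have "(\<Sum>x\<leftarrow>filter (\<lambda>x. \<not> (case x of (c, u, v) \<Rightarrow> u \<noteq> [] \<and> v \<noteq> [])) (cop w). ?g x)
     = (\<Sum>x\<leftarrow>filter (\<lambda>(c, u, v). u = []) (filter (\<lambda>x. \<not> (case x of (c, u, v) \<Rightarrow> u \<noteq> [] \<and> v \<noteq> [])) (cop w)). ?g x)
     + (\<Sum>x\<leftarrow>filter (\<lambda>x. \<not> (case x of (c, u, v) \<Rightarrow> u = [])) (filter (\<lambda>x. \<not> (case x of (c, u, v) \<Rightarrow> u \<noteq> [] \<and> v \<noteq> [])) (cop w)). ?g x)"
    by (rule sum_list_filter_split)
  also have "filter (\<lambda>(c, u, v). u = []) (filter (\<lambda>x. \<not> (case x of (c, u, v) \<Rightarrow> u \<noteq> [] \<and> v \<noteq> [])) (cop w))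
     = filter (\<lambda>(c, u, v). u = []) (cop w)"
    unfolding filter_filter by (rule filter_cong) auto
  also have "filter (\<lambda>x. \<not> (case x of (c, u, v) \<Rightarrow> u = [])) (filter (\<lambda>x. \<not> (case x of (c, u, v) \<Rightarrow> u \<noteq> [] \<and> v \<noteq> [])) (cop w))
     = filter (\<lambda>(c, u, v). v = []) (cop w)"
    unfolding filter_filter by (rule filter_cong) (use assms in \<open>auto dest: cop_mset\<close>)
  finally show ?thesis by (simp add: cop_left_empty cop_right_empty add.assoc)
qed

end

section \<open>The quantum Serre ideal\<close>

lemma map_ident [simp]: "Poly_Mapping.map (\<lambda>a. a) p = p"
  by (rule poly_mapping_eqI) (transfer, auto simp: when_def)

lemma qint_nz:
  fixes b :: "'k::field"
  assumes "b \<noteq> 0" "\<And>n. n > 0 \<Longrightarrow> b ^ n \<noteq> 1" "j > 0"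
  shows "qint b j \<noteq> 0"
proof -
  have *: "b ^ j - inverse b ^ j \<noteq> 0" if "j > 0" for j
  proof
    assume "b ^ j - inverse b ^ j = 0"
    then have "b ^ j * b ^ j = 1" using assms(1) by (simp add: field_simps power_inverse)
    then show False using assms(2)[of "j + j"] that by (simp add: power_add)
  qed
  show ?thesis using *[of j] *[of 1] assms(3) by (simp add: qint_def)
qed

lemma qfact_nz:
  fixes b :: "'k::field"
  assumes "b \<noteq> 0" "\<And>n. n > 0 \<Longrightarrow> b ^ n \<noteq> 1"
  shows "qfact b n \<noteq> 0"
  using qint_nz[OF assms] by (simp add: qfact_def)

lemma qfact_Suc: "qfact b (Suc n) = qint b (Suc n) * qfact b n"
  by (simp add: qfact_def mult.commute)

lemma qbinom_0: "(\<And>n. qfact b n \<noteq> 0) \<Longrightarrow> qbinom b n 0 = 1"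
  and qbinom_n: "(\<And>n. qfact b n \<noteq> 0) \<Longrightarrow> qbinom b n n = 1"
  by (auto simp: qbinom_def qfact_def[of b 0])

lemma qbinom_sym: "r \<le> n \<Longrightarrow> qbinom b n (n - r) = qbinom b n r"
  by (simp add: qbinom_def mult.commute)

text \<open>Divides the identity [k+1] = b^(-(r+1)) [k-r] + b^(k-r) [r+1] by common q-factorials,
  which are nonzero because b has infinite order.\<close>

lemma qbinom_pascal:
  fixes b :: "'k::field"
  assumes "b \<noteq> 0" "\<And>n. n > 0 \<Longrightarrow> b ^ n \<noteq> 1" "Suc r \<le> k"
  shows "qbinom b (Suc k) (Suc r) = inverse b ^ Suc r * qbinom b k (Suc r) + b ^ (k - r) * qbinom b k r"
proof -
  note nz = qfact_nz[OF assms(1,2)]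
  obtain t where k: "k = Suc (r + t)" using assms(3) by (metis le_Suc_ex add_Suc)
  have b1: "b - inverse b \<noteq> 0"
    using qint_nz[OF assms(1,2), of 1] by (auto simp: qint_def)
  have key: "qint b (Suc k) = inverse b ^ Suc r * qint b (Suc t) + b ^ Suc t * qint b (Suc r)"
  proof -
    have "b ^ Suc k - inverse b ^ Suc k =
      inverse b ^ Suc r * (b ^ Suc t - inverse b ^ Suc t) + b ^ Suc t * (b ^ Suc r - inverse b ^ Suc r)"
      unfolding k by (simp add: algebra_simps power_add)
    then show ?thesis using b1 by (simp add: qint_def add_divide_distrib)
  qed
  have "qbinom b (Suc k) (Suc r) = qint b (Suc k) * (qfact b k / (qfact b (Suc r) * qfact b (Suc t)))"
    by (simp add: qbinom_def qfact_Suc[of b "Suc (r + t)"] k)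
  also have "\<dots> = inverse b ^ Suc r * (qint b (Suc t) * (qfact b k / (qfact b (Suc r) * qfact b (Suc t))))
      + b ^ Suc t * (qint b (Suc r) * (qfact b k / (qfact b (Suc r) * qfact b (Suc t))))"
    unfolding key distrib_right by (simp only: mult.assoc)
  also have "qint b (Suc t) * (qfact b k / (qfact b (Suc r) * qfact b (Suc t))) = qbinom b k (Suc r)"
    using nz[of "Suc t"] by (simp add: qbinom_def qfact_Suc[of b t] k)
  also have "qint b (Suc r) * (qfact b k / (qfact b (Suc r) * qfact b (Suc t))) = qbinom b k r"
    using nz[of "Suc r"] by (simp add: qbinom_def qfact_Suc[of b r] k)
  finally show ?thesis by (simp add: k)
qed

lemma ltr_power: "ltr x ^ n = monomial (replicate n x)"
  by (induction n) (simp_all add: monomial_Nil monomial_append[symmetric])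

lemma ltr_power_mult_monomial: "ltr x * monomial w = monomial (x # w)"
  by (simp add: monomial_append[symmetric])

definition span_words :: "'a set \<Rightarrow> ('a word \<Rightarrow>\<^sub>0 'k::field) set" where
  "span_words X = {p. \<forall>w\<in>keys p. set (letters w) \<subseteq> X}"

lemma span_words_add: "p \<in> span_words X \<Longrightarrow> r \<in> span_words X \<Longrightarrow> p + r \<in> span_words X"
  using Poly_Mapping.keys_add[of p r] by (auto simp: span_words_def)

lemma keys_smul: "keys (smul c p) \<subseteq> keys p"
  by (auto simp: in_keys_iff lookup_smul)

lemma span_words_smul: "p \<in> span_words X \<Longrightarrow> smul c p \<in> span_words X"
  using keys_smul[of c p] by (auto simp: span_words_def)

lemma span_words_zero: "0 \<in> span_words X" by (simp add: span_words_def)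

lemma span_words_minus: "p \<in> span_words X \<Longrightarrow> - p \<in> span_words X"
  using span_words_smul[of p X "-1"] by (simp add: free.scale_minus_left)

lemma span_words_diff: "p \<in> span_words X \<Longrightarrow> r \<in> span_words X \<Longrightarrow> p - r \<in> span_words X"
  using span_words_add[of p X "- r"] span_words_minus[of r X] by simp

lemma span_words_sum: "(\<And>i. i \<in> A \<Longrightarrow> g i \<in> span_words X) \<Longrightarrow> sum g A \<in> span_words X"
  by (induction A rule: infinite_finite_induct) (auto simp: span_words_zero span_words_add)

lemma span_words_monomial: "w \<in> lists X \<Longrightarrow> monomial w \<in> span_words X"
  by (auto simp: span_words_def keys_monomial)

lemma span_words_one: "1 \<in> span_words X"
  using span_words_monomial[of "[]"] by (simp add: monomial_Nil)

lemma span_words_ltr: "a \<in> X \<Longrightarrow> ltr a \<in> span_words X"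
  by (rule span_words_monomial) auto

lemma span_words_mult: "p \<in> span_words X \<Longrightarrow> r \<in> span_words X \<Longrightarrow> p * r \<in> span_words X"
  using Poly_Mapping.keys_mult[of p r] by (fastforce simp: span_words_def)

lemma span_words_induct [consumes 1, case_names zero monomial add]:
  assumes "p \<in> span_words X" "P 0" "\<And>c w. w \<in> lists X \<Longrightarrow> P (smul c (monomial w))"
    "\<And>p r. P p \<Longrightarrow> P r \<Longrightarrow> P (p + r)"
  shows "P p"
proof -
  have s: "P (\<Sum>w\<in>A. single w (lookup p w))" if "finite A" "A \<subseteq> keys p" for A
    using that
  proof induction
    case (insert w A)
    have *: "single w (lookup p w) = smul (lookup p w) (monomial (letters w))"
      using single_eq_smul[of w "lookup p w"] by (simp add: single_word)
    have "letters w \<in> lists X" using insert.prems assms(1) by (auto simp: span_words_def)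
    then show ?case using insert assms(3,4) by (simp add: *)
  qed (simp add: assms(2))
  show ?thesis by (subst poly_mapping_decomp) (rule s, auto)
qed

lemma linmap_span_words:
  assumes "linmap f" "\<And>w. w \<in> lists X \<Longrightarrow> f (monomial w) \<in> span_words Y" "p \<in> span_words X"
  shows "f p \<in> span_words Y"
  using assms(3) by (induction rule: span_words_induct)
    (auto simp: linmapD[OF assms(1)] span_words_zero span_words_add span_words_smul assms(2))

lemma span_words_scal: "p \<in> span_words X \<Longrightarrow> scal \<chi> p \<in> span_words X"
  by (auto simp: span_words_def in_keys_iff lookup_scal)

lemma span_words_rv: "p \<in> span_words X \<Longrightarrow> rv p \<in> span_words X"
  by (rule linmap_span_words[OF linmap_rv]) (auto simp: rv_monomial intro: span_words_monomial)

lemma linmap_span_subset: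
  assumes "linmap f" "\<And>b. b \<in> B \<Longrightarrow> f b \<in> S" "free.subspace S" "x \<in> free.span B"
  shows "f x \<in> S"
  using assms(4) by (induction rule: free.span_induct_alt)
    (auto simp: linmapD[OF assms(1)] free.subspace_0[OF assms(3)]
      intro!: free.subspace_add[OF assms(3)] free.subspace_scale[OF assms(3)] assms(2))

text \<open>Real letters are those of positive square, \<open>d\<close> plays the role of s_i, and
  divisibility makes C x y / d x the integer a_ij. Letters rather than indices are basic: the copies
  of an imaginary index are distinct letters.\<close>

locale cartan_letters = bicharacter C q
  for C :: "'a \<Rightarrow> 'a \<Rightarrow> int" and q :: "'k::field_char_0" +
  fixes X :: "'a set" and d :: "'a \<Rightarrow> nat"
  assumes off_diag_nonpos: "x \<in> X \<Longrightarrow> y \<in> X \<Longrightarrow> x \<noteq> y \<Longrightarrow> C x y \<le> 0"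
    and real_diag: "x \<in> X \<Longrightarrow> C x x > 0 \<Longrightarrow> C x x = 2 * int (d x)"
    and real_dvd: "x \<in> X \<Longrightarrow> y \<in> X \<Longrightarrow> C x x > 0 \<Longrightarrow> x \<noteq> y \<Longrightarrow> int (d x) dvd C x y"
    and q_no_root: "n > 0 \<Longrightarrow> q ^ n \<noteq> 1"
begin

lemma q_powi_eq_1: "q powi n = 1 \<longleftrightarrow> n = 0"
proof
  assume *: "q powi n = 1"
  show "n = 0"
  proof (rule ccontr)
    assume "n \<noteq> 0"
    then have "q ^ nat \<bar>n\<bar> = 1" using * q_nz
      by (auto simp: power_int_def abs_if power_inverse split: if_splits)
    then show False using q_no_root[of "nat \<bar>n\<bar>"] \<open>n \<noteq> 0\<close> by simp
  qed
qed simp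

lemma span_words_tw: "p \<in> span_words X \<Longrightarrow> tw a n p \<in> span_words X"
  by (simp add: tw_def span_words_scal)

lemma span_words_der: "p \<in> span_words X \<Longrightarrow> der a p \<in> span_words X"
proof (rule linmap_span_words[OF linmap_der])
  fix w assume "w \<in> lists X"
  then have "dword a w \<in> span_words X"
    by (induction w) (auto intro!: span_words_add span_words_zero span_words_smul span_words_mult span_words_ltr span_words_monomial)
  then show "der a (monomial w) \<in> span_words X" by (simp add: der_monomial)
qed

lemma span_words_ders: "p \<in> span_words X \<Longrightarrow> ders z p \<in> span_words X"
  by (induction z) (auto simp: span_words_der)

definition serre_exp :: "'a \<Rightarrow> 'a \<Rightarrow> nat" where
  "serre_exp x y = nat (1 - C x y div int (d x))"

definition serre_rel :: "'a \<Rightarrow> 'a \<Rightarrow> 'a word \<Rightarrow>\<^sub>0 'k" where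
  "serre_rel x y = (\<Sum>r=0..serre_exp x y. smul ((- 1) ^ r * qbinom (q ^ d x) (serre_exp x y) r)
     (ltr x ^ (serre_exp x y - r) * ltr y * ltr x ^ r))"

definition rels :: "('a word \<Rightarrow>\<^sub>0 'k) set" where
  "rels = {serre_rel x y | x y. x \<in> X \<and> y \<in> X \<and> C x x > 0 \<and> x \<noteq> y} \<union>
     {ltr x * ltr y - ltr y * ltr x | x y. x \<in> X \<and> y \<in> X \<and> C x y = 0}"

definition SI :: "('a word \<Rightarrow>\<^sub>0 'k) set" where
  "SI = free.span {monomial u * r * monomial v | u r v. u \<in> lists X \<and> v \<in> lists X \<and> r \<in> rels}"

lemma SI_subspace: "free.subspace SI" by (simp add: SI_def)

lemma SI_zero [simp]: "0 \<in> SI"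
  and SI_add: "p \<in> SI \<Longrightarrow> r \<in> SI \<Longrightarrow> p + r \<in> SI"
  and SI_diff: "p \<in> SI \<Longrightarrow> r \<in> SI \<Longrightarrow> p - r \<in> SI"
  and SI_smul: "p \<in> SI \<Longrightarrow> smul c p \<in> SI"
  and SI_minus: "p \<in> SI \<Longrightarrow> - p \<in> SI"
  using free.subspace_0[OF SI_subspace] free.subspace_add[OF SI_subspace]
    free.subspace_diff[OF SI_subspace] free.subspace_scale[OF SI_subspace]
    free.subspace_neg[OF SI_subspace] by auto

lemma SI_sum: "(\<And>i. i \<in> A \<Longrightarrow> g i \<in> SI) \<Longrightarrow> sum g A \<in> SI"
  by (rule free.subspace_sum[OF SI_subspace])

lemma SI_smul_cancel: "c \<noteq> 0 \<Longrightarrow> smul c p \<in> SI \<Longrightarrow> p \<in> SI"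
  using SI_smul[of "smul c p" "inverse c"] by simp

lemma SI_mult_monomial_left: "p \<in> SI \<Longrightarrow> w \<in> lists X \<Longrightarrow> monomial w * p \<in> SI"
  unfolding SI_def
proof (rule linmap_span_subset[OF linmap_mult_left[OF linmap_id]])
  fix b assume "b \<in> {monomial u * r * monomial v | u r v. u \<in> lists X \<and> v \<in> lists X \<and> r \<in> rels}"
  then obtain u r v where b: "b = monomial u * r * monomial v" "u \<in> lists X" "v \<in> lists X" "r \<in> rels" by auto
  assume "w \<in> lists X"
  then have "monomial w * b = monomial (w @ u) * r * monomial v" "w @ u \<in> lists X"
    using b by (auto simp: monomial_append mult.assoc)
  then show "monomial w * b \<in> free.span {monomial u * r * monomial v | u r v. u \<in> lists X \<and> v \<in> lists X \<and> r \<in> rels}"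
    using b by (intro free.span_base) blast
qed auto

lemma SI_mult_monomial_right: "p \<in> SI \<Longrightarrow> w \<in> lists X \<Longrightarrow> p * monomial w \<in> SI"
  unfolding SI_def
proof (rule linmap_span_subset[OF linmap_mult_right[OF linmap_id]])
  fix b assume "b \<in> {monomial u * r * monomial v | u r v. u \<in> lists X \<and> v \<in> lists X \<and> r \<in> rels}"
  then obtain u r v where b: "b = monomial u * r * monomial v" "u \<in> lists X" "v \<in> lists X" "r \<in> rels" by auto
  assume "w \<in> lists X"
  then have "b * monomial w = monomial u * r * monomial (v @ w)" "v @ w \<in> lists X"
    using b by (auto simp: monomial_append mult.assoc)
  then show "b * monomial w \<in> free.span {monomial u * r * monomial v | u r v. u \<in> lists X \<and> v \<in> lists X \<and> r \<in> rels}"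
    using b by (intro free.span_base) blast
qed auto

lemma SI_mult_left:
  assumes "p \<in> SI" "r \<in> span_words X"
  shows "r * p \<in> SI"
  using assms(2) by (induction rule: span_words_induct)
    (simp_all add: assms(1) distrib_right SI_add smul_mult SI_smul SI_mult_monomial_left)

lemma SI_mult_right:
  assumes "p \<in> SI" "r \<in> span_words X"
  shows "p * r \<in> SI"
  using assms(2) by (induction rule: span_words_induct)
    (simp_all add: assms(1) distrib_left SI_add mult_smul SI_smul SI_mult_monomial_right)

lemma rels_SI: "r \<in> rels \<Longrightarrow> r \<in> SI"
proof -
  assume "r \<in> rels"
  then have "monomial [] * r * monomial [] \<in> SI"
    unfolding SI_def by (intro free.span_base) blast
  then show ?thesis by (simp add: monomial_Nil)
qed

section \<open>Grading by the multiset of letters\<close>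

definition homogeneous :: "'a multiset \<Rightarrow> ('a word \<Rightarrow>\<^sub>0 'k) \<Rightarrow> bool" where
  "homogeneous \<beta> p \<longleftrightarrow> (\<forall>w\<in>keys p. mset (letters w) = \<beta>)"

lemma homogeneous_add: "homogeneous \<beta> p \<Longrightarrow> homogeneous \<beta> r \<Longrightarrow> homogeneous \<beta> (p + r)"
  using Poly_Mapping.keys_add[of p r] by (auto simp: homogeneous_def)

lemma homogeneous_smul: "homogeneous \<beta> p \<Longrightarrow> homogeneous \<beta> (smul c p)"
  using keys_smul[of c p] by (auto simp: homogeneous_def)

lemma homogeneous_zero: "homogeneous \<beta> 0" by (simp add: homogeneous_def)

lemma homogeneous_minus: "homogeneous \<beta> p \<Longrightarrow> homogeneous \<beta> (- p)"
  using homogeneous_smul[of \<beta> p "-1"] by (simp add: free.scale_minus_left)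

lemma homogeneous_diff: "homogeneous \<beta> p \<Longrightarrow> homogeneous \<beta> r \<Longrightarrow> homogeneous \<beta> (p - r)"
  using homogeneous_add[of \<beta> p "- r"] homogeneous_minus[of \<beta> r] by simp

lemma homogeneous_sum: "(\<And>i. i \<in> A \<Longrightarrow> homogeneous \<beta> (g i)) \<Longrightarrow> homogeneous \<beta> (sum g A)"
  by (induction A rule: infinite_finite_induct) (auto simp: homogeneous_zero homogeneous_add)

lemma homogeneous_mult: "homogeneous \<beta> p \<Longrightarrow> homogeneous \<gamma> r \<Longrightarrow> homogeneous (\<beta> + \<gamma>) (p * r)"
  using Poly_Mapping.keys_mult[of p r] by (fastforce simp: homogeneous_def)

lemma homogeneous_monomial: "homogeneous (mset w) (monomial w)"
  by (simp add: homogeneous_def keys_monomial)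

lemma homogeneous_ltr_power: "homogeneous (replicate_mset n x) (ltr x ^ n)"
  unfolding ltr_power using homogeneous_monomial[of "replicate n x"] by simp

lemma homogeneous_serre: "homogeneous (add_mset y (replicate_mset (serre_exp x y) x)) (serre_rel x y)"
  unfolding serre_rel_def
proof (intro homogeneous_sum homogeneous_smul)
  fix r assume "r \<in> {0..serre_exp x y}"
  then have "replicate_mset (serre_exp x y - r) x + {#y#} + replicate_mset r x
      = add_mset y (replicate_mset (serre_exp x y) x)"
    by (intro multiset_eqI) auto
  then show "homogeneous (add_mset y (replicate_mset (serre_exp x y) x))
       (ltr x ^ (serre_exp x y - r) * ltr y * ltr x ^ r)"
    using homogeneous_mult[OF homogeneous_mult[OF homogeneous_ltr_power homogeneous_monomial[of "[y]"]] homogeneous_ltr_power,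
      of "serre_exp x y - r" x r x] by simp
qed

lemma homogeneous_commutator: "homogeneous {#x, y#} (ltr x * ltr y - ltr y * ltr x)"
  using homogeneous_monomial[of "[x, y]"] homogeneous_monomial[of "[y, x]"]
  by (auto intro!: homogeneous_diff simp: ltr_power_mult_monomial add_mset_commute)

lemma homogeneous_rels: "r \<in> rels \<Longrightarrow> \<exists>\<beta>. homogeneous \<beta> r \<and> \<beta> \<noteq> {#}"
proof -
  assume "r \<in> rels"
  then consider x y where "r = serre_rel x y" | x y where "r = ltr x * ltr y - ltr y * ltr x"
    unfolding rels_def by auto
  then show ?thesis
  proof cases
    case 1
    then show ?thesis by (metis homogeneous_serre add_mset_not_empty)
  next
    case 2
    then show ?thesis by (metis homogeneous_commutator add_mset_not_empty)
  qed
qed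

lemma scal_homogeneous:
  assumes "\<And>u v. mset (letters u) = mset (letters v) \<Longrightarrow> \<chi> u = \<chi> v" "homogeneous \<beta> p"
  shows "\<exists>c. scal \<chi> p = smul c p"
proof (cases "p = 0")
  case True then show ?thesis by (simp add: linmapD[OF linmap_scal])
next
  case False
  then obtain v where "v \<in> keys p" by fastforce
  then show ?thesis using assms
    by (intro exI[of _ "\<chi> v"] scal_const) (auto simp: homogeneous_def)
qed

text \<open>The spanning products u r v are homogeneous, so a rescaling that depends on the weight
  alone multiplies each of them by a constant.\<close>

lemma SI_scal:
  assumes "\<And>u v. mset (letters u) = mset (letters v) \<Longrightarrow> \<chi> u = \<chi> v" "p \<in> SI"
  shows "scal \<chi> p \<in> SI"
  using assms(2) unfolding SI_def
proof (rule linmap_span_subset[OF linmap_scal, rotated 2])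
  fix b assume b: "b \<in> {monomial u * r * monomial v | u r v. u \<in> lists X \<and> v \<in> lists X \<and> r \<in> rels}"
  then obtain \<beta> where "homogeneous \<beta> b"
    using homogeneous_mult[OF homogeneous_mult[OF homogeneous_monomial] homogeneous_monomial] homogeneous_rels
    by blast
  then obtain c where "scal \<chi> b = smul c b" using scal_homogeneous assms(1) by blast
  then show "scal \<chi> b \<in> free.span {monomial u * r * monomial v | u r v. u \<in> lists X \<and> v \<in> lists X \<and> r \<in> rels}"
    using free.span_scale[OF free.span_base[OF b]] by simp
qed auto

lemma SI_tw: "p \<in> SI \<Longrightarrow> tw a n p \<in> SI"
  unfolding tw_def by (rule SI_scal) (metis wt_mset)

lemma SI_tw_iff: "tw a n p \<in> SI \<longleftrightarrow> p \<in> SI"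
  using SI_tw[of p a n] SI_tw[of "tw a n p" a "- n"] by (auto simp: tw_add)

text \<open>Reversal exchanges the summands r and n - r; by the symmetry of the q-binomial
  coefficients only a sign remains.\<close>

lemma rv_serre: "rv (serre_rel x y) = smul ((- 1) ^ serre_exp x y) (serre_rel x y)"
proof -
  let ?n = "serre_exp x y"
  have rvp: "rv (ltr x ^ k) = ltr x ^ k" for k by (simp add: ltr_power rv_monomial)
  have "rv (serre_rel x y) = (\<Sum>r=0..?n. smul ((- 1) ^ r * qbinom (q ^ d x) ?n r)
     (ltr x ^ r * ltr y * ltr x ^ (?n - r)))"
    by (simp add: serre_rel_def linmap_sum[OF linmap_rv] linmapD[OF linmap_rv] rv_mult rvp rv_monomial mult.assoc)
  also have "\<dots> = (\<Sum>r=0..?n. smul ((- 1) ^ (?n - r) * qbinom (q ^ d x) ?n (?n - r))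
     (ltr x ^ (?n - r) * ltr y * ltr x ^ (?n - (?n - r))))"
    by (subst sum.atLeastAtMost_rev) simp
  also have "\<dots> = smul ((- 1) ^ ?n) (serre_rel x y)"
    unfolding serre_rel_def free.scale_sum_right
  proof (intro sum.cong refl)
    fix r assume r: "r \<in> {0..?n}"
    then have "(- 1) ^ (?n - r) = ((- 1) ^ ?n * (- 1) ^ r :: 'k)"
      by (simp add: power_add[symmetric] minus_one_power_iff)
    then show "smul ((- 1) ^ (?n - r) * qbinom (q ^ d x) ?n (?n - r)) (ltr x ^ (?n - r) * ltr y * ltr x ^ (?n - (?n - r)))
      = smul ((- 1) ^ ?n) (smul ((- 1) ^ r * qbinom (q ^ d x) ?n r) (ltr x ^ (?n - r) * ltr y * ltr x ^ r))"
      using r by (simp add: qbinom_sym)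
  qed
  finally show ?thesis .
qed

lemma SI_rv:
  assumes "p \<in> SI" shows "rv p \<in> SI"
proof (rule linmap_span_subset[OF linmap_rv _ SI_subspace assms[unfolded SI_def]])
  fix b assume "b \<in> {monomial u * r * monomial v | u r v. u \<in> lists X \<and> v \<in> lists X \<and> r \<in> rels}"
  then obtain u r v where b: "b = monomial u * r * monomial v" "u \<in> lists X" "v \<in> lists X" "r \<in> rels" by auto
  have "\<exists>c. rv r = smul c r"
    using \<open>r \<in> rels\<close> unfolding rels_def
  proof (elim UnE CollectE exE conjE)
    fix x y assume "r = ltr x * ltr y - ltr y * ltr x"
    then have "rv r = smul (-1) r"
      by (simp add: linmapD[OF linmap_rv] rv_mult rv_monomial free.scale_minus_left)
    then show ?thesis by blast
  qed (use rv_serre in blast)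
  then have "rv r \<in> SI" using rels_SI[OF \<open>r \<in> rels\<close>] SI_smul by auto
  then show "rv b \<in> SI"
    using b by (auto simp: rv_mult rv_monomial mult.assoc[symmetric] intro!: SI_mult_monomial_left SI_mult_monomial_right)
qed

lemma SI_antipode: "p \<in> SI \<Longrightarrow> antipode p \<in> SI"
  unfolding antipode_def by (intro SI_rv SI_scal) (metis crossing_mset_eq mset_eq_length)+

text \<open>The quantum adjoint action of the letter \<open>x\<close>.\<close>

definition adj :: "'a \<Rightarrow> ('a word \<Rightarrow>\<^sub>0 'k) \<Rightarrow> ('a word \<Rightarrow>\<^sub>0 'k)" where
  "adj x u = ltr x * u - tw x 1 u * ltr x"

lemma linmap_adj: "linmap (adj x)"
  unfolding adj_def by (intro linmap_intros linmap_tw)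

lemma adj_mult: "adj x (u * v) = adj x u * v + tw x 1 u * adj x v"
  by (simp add: adj_def tw_mult algebra_simps mult.assoc)

text \<open>For a = x each of the two products contributes an extra term, u and tw x (-1) (tw x 1 u)
  = u, and these cancel; hence the formula is uniform in a.\<close>

lemma der_adj: "der a (adj x u) =
    smul (q powi (- C a x)) (ltr x * der a u) - smul (q powi (C a x)) (tw x 1 (der a u) * ltr x)"
  by (cases "a = x") (simp_all add: adj_def linmapD[OF linmap_der] der_mult der_ltr der_tw tw_add tw_monomial smul_mult)

lemma adj_smul_power:
  "adj x (ltr x ^ k * ltr y * ltr x ^ r) = ltr x ^ Suc k * ltr y * ltr x ^ r -
     smul (q powi (int (k + r) * C x x + C x y)) (ltr x ^ k * ltr y * ltr x ^ Suc r)"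
proof -
  have *: "tw x 1 (ltr x ^ k) = smul (q powi (int k * C x x)) (ltr x ^ k)" for k
  proof -
    have "wt x (replicate k x) = int k * C x x" by (induction k) (auto simp: algebra_simps)
    then show ?thesis by (simp add: ltr_power tw_monomial)
  qed
  show ?thesis
    by (simp add: adj_def tw_mult * tw_monomial smul_mult mult_smul power_int_add q_nz
        mult.assoc power_commutes distrib_right distrib_left mult_ac)
qed

text \<open>A q-binomial theorem for the difference of left and twisted right multiplication by x.
  The power of q disappears when d x (k - 1) = - C x y, that is k = 1 - a_ij, and the sum is then
  the Serre element.\<close>

lemma adj_power:
  assumes "x \<in> X" "C x x > 0"
  shows "(adj x ^^ k) (ltr y) = (\<Sum>r\<le>k. smul ((- 1) ^ r * q powi (int r * (C x y + int (d x) * (int k - 1))) *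
     qbinom (q ^ d x) k r) (ltr x ^ (k - r) * ltr y * ltr x ^ r))"
proof (induction k)
  case 0
  show ?case by (simp add: qbinom_def qfact_def)
next
  case (Suc k)
  define h where "h = C x y"
  define D where "D = int (d x)"
  have D: "C x x = 2 * D" "D > 0" using real_diag[OF assms] assms(2) by (auto simp: D_def)
  define b where "b = q ^ d x"
  have b: "b \<noteq> 0" "\<And>n. n > 0 \<Longrightarrow> b ^ n \<noteq> 1" "b = q powi D"
    using q_nz q_no_root D(2) by (auto simp: b_def D_def power_mult[symmetric])
  note qb = qbinom_0[OF qfact_nz[OF b(1,2)]] qbinom_n[OF qfact_nz[OF b(1,2)]]
  define A where "A k r = (- 1) ^ r * q powi (int r * (h + D * (int k - 1))) * qbinom b k r" for k r
  define M where "M k r = ltr x ^ (k - r) * ltr y * (ltr x ^ r :: 'a word \<Rightarrow>\<^sub>0 'k)" for k r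
  \<comment> \<open>What summand r contributes to position r + 1 under one more adjoint action;
    Pascal's rule merges it with \<open>A k (Suc r)\<close>.\<close>
  define B where "B r = - (q powi (int k * (2 * D) + h) * A k r)" for r
  have "adj x (M k r) = M (Suc k) r - smul (q powi (int k * (2 * D) + h)) (M (Suc k) (Suc r))" if "r \<le> k" for r
    unfolding M_def adj_smul_power using that by (simp add: h_def D Suc_diff_le)
  moreover have IH: "(adj x ^^ k) (ltr y) = (\<Sum>r\<le>k. smul (A k r) (M k r))"
    using Suc unfolding A_def M_def h_def D_def b_def .
  ultimately have "(adj x ^^ Suc k) (ltr y) =
      (\<Sum>r\<le>k. smul (A k r) (M (Suc k) r) + smul (B r) (M (Suc k) (Suc r)))"
    using IH by (simp add: linmap_sum[OF linmap_adj] linmapD[OF linmap_adj] B_def free.scale_right_diff_distrib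
      mult.commute)
  also have "\<dots> = (\<Sum>r\<le>k. smul (A k r) (M (Suc k) r)) + (\<Sum>r\<le>k. smul (B r) (M (Suc k) (Suc r)))"
    by (simp add: sum.distrib)
  also have "(\<Sum>r\<le>k. smul (A k r) (M (Suc k) r)) =
      smul (A (Suc k) 0) (M (Suc k) 0) + (\<Sum>r<k. smul (A k (Suc r)) (M (Suc k) (Suc r)))"
    unfolding lessThan_Suc_atMost[symmetric] sum.lessThan_Suc_shift by (simp add: A_def qb)
  also have "(\<Sum>r\<le>k. smul (B r) (M (Suc k) (Suc r))) =
      (\<Sum>r<k. smul (B r) (M (Suc k) (Suc r))) + smul (A (Suc k) (Suc k)) (M (Suc k) (Suc k))"
  proof -
    have "B k = A (Suc k) (Suc k)"
      by (simp add: B_def A_def qb power_int_add[symmetric] q_nz algebra_simps)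
    then show ?thesis unfolding lessThan_Suc_atMost[symmetric] by simp
  qed
  also have "smul (A (Suc k) 0) (M (Suc k) 0) + (\<Sum>r<k. smul (A k (Suc r)) (M (Suc k) (Suc r))) +
      ((\<Sum>r<k. smul (B r) (M (Suc k) (Suc r))) + smul (A (Suc k) (Suc k)) (M (Suc k) (Suc k))) =
     smul (A (Suc k) 0) (M (Suc k) 0) + (\<Sum>r<k. smul (A k (Suc r) + B r) (M (Suc k) (Suc r))) +
      smul (A (Suc k) (Suc k)) (M (Suc k) (Suc k))"
    by (simp add: free.scale_left_distrib sum.distrib add.assoc)
  also have "(\<Sum>r<k. smul (A k (Suc r) + B r) (M (Suc k) (Suc r))) =
      (\<Sum>r<k. smul (A (Suc k) (Suc r)) (M (Suc k) (Suc r)))"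
  proof (intro sum.cong refl)
    fix r assume "r \<in> {..<k}"
    then have r: "Suc r \<le> k" by simp
    \<comment> \<open>The exponent required at k + 1 and r + 1. The exponents of the two
      contributions differ from it by exactly the powers of b in Pascal's rule.\<close>
    define t where "t = int (Suc r) * (h + D * int k)"
    have e1: "q powi (int (Suc r) * (h + D * (int k - 1))) = q powi t * inverse b ^ Suc r"
    proof -
      have "inverse b ^ Suc r = q powi (- (D * int (Suc r)))"
        unfolding b(3) by (simp only: power_int_minus power_int_mult power_int_of_nat power_inverse)
      then show ?thesis unfolding t_def
        by (simp only: power_int_add[symmetric] q_nz simp_thms) (simp add: algebra_simps)
    qed
    have e2: "q powi (int k * (2 * D) + h) * q powi (int r * (h + D * (int k - 1))) = q powi t * b ^ (k - r)"
    proof -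
      have "b ^ (k - r) = q powi (D * (int k - int r))"
        unfolding b(3) power_int_power' using r by (simp add: of_nat_diff)
      then show ?thesis unfolding t_def
        by (simp only: power_int_add[symmetric] q_nz simp_thms) (simp add: algebra_simps)
    qed
    have "A k (Suc r) + B r = (- 1) ^ Suc r * (q powi (int (Suc r) * (h + D * (int k - 1))) * qbinom b k (Suc r) +
        q powi (int k * (2 * D) + h) * q powi (int r * (h + D * (int k - 1))) * qbinom b k r)"
      unfolding A_def B_def distrib_left by (simp add: mult_ac)
    also have "\<dots> = (- 1) ^ Suc r * (q powi t * (inverse b ^ Suc r * qbinom b k (Suc r) + b ^ (k - r) * qbinom b k r))"
      unfolding e1 e2 by (simp only: distrib_left mult.assoc)
    also have "\<dots> = A (Suc k) (Suc r)"
      by (simp only: qbinom_pascal[OF b(1,2) r, symmetric] A_def t_def mult.assoc)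
        (simp add: mult_ac)
    finally show "smul (A k (Suc r) + B r) (M (Suc k) (Suc r)) = smul (A (Suc k) (Suc r)) (M (Suc k) (Suc r))" by simp
  qed
  also have "smul (A (Suc k) 0) (M (Suc k) 0) + (\<Sum>r<k. smul (A (Suc k) (Suc r)) (M (Suc k) (Suc r))) +
      smul (A (Suc k) (Suc k)) (M (Suc k) (Suc k)) = (\<Sum>r\<le>Suc k. smul (A (Suc k) r) (M (Suc k) r))"
    by (simp only: lessThan_Suc_atMost[symmetric] sum.lessThan_Suc[of _ "Suc k"] sum.lessThan_Suc_shift[of _ k])
  finally show ?case by (simp add: A_def M_def h_def D_def b_def)
qed

lemma serre_exp_eq:
  assumes "x \<in> X" "y \<in> X" "C x x > 0" "x \<noteq> y"
  shows "int (d x) * (int (serre_exp x y) - 1) = - C x y" "serre_exp x y > 0"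
proof -
  have "C x y \<le> 0" "int (d x) dvd C x y" "int (d x) > 0"
    using off_diag_nonpos real_dvd real_diag[OF assms(1,3)] assms by auto
  then have "C x y div int (d x) \<le> 0" "int (d x) * (C x y div int (d x)) = C x y"
    by (auto simp: div_nonpos_pos_le0)
  then show "int (d x) * (int (serre_exp x y) - 1) = - C x y" "serre_exp x y > 0"
    by (auto simp: serre_exp_def)
qed

lemma serre_rel_adj:
  assumes "x \<in> X" "y \<in> X" "C x x > 0" "x \<noteq> y"
  shows "serre_rel x y = (adj x ^^ serre_exp x y) (ltr y)"
  unfolding adj_power[OF assms(1,3)] serre_rel_def serre_exp_eq(1)[OF assms] atLeast0AtMost by simp

text \<open>For a distinct from y the vanishing propagates from \<open>ltr y\<close> through
  \<open>der_adj\<close>. For a = y each adjoint step contributes a factor q^(-(x|y)) - q^((x|y) + j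
  (x|x)), and the last one, at j = -a_ij, is zero.\<close>

lemma der_serre:
  assumes "x \<in> X" "y \<in> X" "C x x > 0" "x \<noteq> y"
  shows "der a (serre_rel x y) = 0"
proof (cases "a = y")
  case False
  have "der a ((adj x ^^ k) (ltr y)) = 0" for k
    by (induction k) (auto simp: der_ltr False der_adj linmapD[OF linmap_tw])
  then show ?thesis by (simp add: serre_rel_adj[OF assms])
next
  case True
  have *: "tw x 1 (ltr x ^ k) = smul (q powi (int k * C x x)) (ltr x ^ k)" for k
  proof -
    have "wt x (replicate k x) = int k * C x x" by (induction k) (auto simp: algebra_simps)
    then show ?thesis by (simp add: ltr_power tw_monomial)
  qed
  have **: "der y ((adj x ^^ k) (ltr y)) =
     smul (\<Prod>j<k. q powi (- C x y) - q powi (C x y + int j * C x x)) (ltr x ^ k)" for k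
  proof (induction k)
    case (Suc k)
    define P where "P = (\<Prod>j<k. q powi (- C x y) - q powi (C x y + int j * C x x))"
    have "der y ((adj x ^^ Suc k) (ltr y)) = smul (q powi (- C x y)) (ltr x * smul P (ltr x ^ k)) -
        smul (q powi (C x y)) (tw x 1 (smul P (ltr x ^ k)) * ltr x)"
      using Suc by (simp add: der_adj C_sym[of y x] P_def)
    also have "\<dots> = smul (q powi (- C x y) * P) (ltr x ^ Suc k) -
        smul (q powi (C x y) * (P * q powi (int k * C x x))) (ltr x ^ Suc k)"
      by (simp add: linmapD[OF linmap_tw] * mult_smul smul_mult power_commutes)
    also have "\<dots> = smul ((q powi (- C x y) - q powi (C x y) * q powi (int k * C x x)) * P) (ltr x ^ Suc k)"
      unfolding free.scale_left_diff_distrib[symmetric]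
      by (rule arg_cong[of _ _ "\<lambda>c. smul c _"]) (simp add: algebra_simps)
    also have "(q powi (- C x y) - q powi (C x y) * q powi (int k * C x x)) * P =
        (\<Prod>j<Suc k. q powi (- C x y) - q powi (C x y + int j * C x x))"
      by (simp add: P_def power_int_add q_nz mult.commute)
    finally show ?case .
  qed (simp add: der_ltr)
  obtain m where m: "serre_exp x y = Suc m" using serre_exp_eq(2)[OF assms] by (cases "serre_exp x y") auto
  have "int m * C x x = 2 * - C x y"
    using serre_exp_eq(1)[OF assms] real_diag[OF assms(1,3)] m by (simp add: mult.commute)
  then have "q powi (- C x y) - q powi (C x y + int m * C x x) = 0" by simp
  then have "(\<Prod>j<serre_exp x y. q powi (- C x y) - q powi (C x y + int j * C x x)) = 0"
    unfolding m by (intro prod_zero) auto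
  then show ?thesis using **[of "serre_exp x y"] True by (simp add: serre_rel_adj[OF assms])
qed

lemma der_rels: "r \<in> rels \<Longrightarrow> der a r = 0"
  unfolding rels_def using der_serre
  by (auto simp: linmapD[OF linmap_der] der_ltr_mult der_ltr C_sym)

text \<open>The relations are killed outright, so the skew Leibniz rule differentiates only the
  words around them.\<close>

lemma SI_der:
  assumes "p \<in> SI" shows "der a p \<in> SI"
proof (rule linmap_span_subset[OF linmap_der _ SI_subspace assms[unfolded SI_def]])
  fix b assume "b \<in> {monomial u * r * monomial v | u r v. u \<in> lists X \<and> v \<in> lists X \<and> r \<in> rels}"
  then obtain u r v where b: "b = monomial u * r * monomial v" "u \<in> lists X" "v \<in> lists X" "r \<in> rels" by auto
  have "der a b = der a (monomial u) * r * monomial v + tw a (-1) (monomial u) * tw a (-1) r * der a (monomial v)"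
    using b by (simp add: der_mult tw_mult der_rels mult.assoc)
  moreover have "der a (monomial u) * r * monomial v \<in> SI"
    by (intro SI_mult_right SI_mult_left rels_SI b span_words_der span_words_monomial)
  moreover have "tw a (-1) (monomial u) * tw a (-1) r * der a (monomial v) \<in> SI"
    by (intro SI_mult_right SI_mult_left SI_tw rels_SI b span_words_der span_words_tw span_words_monomial)
  ultimately show "der a b \<in> SI" by (simp add: SI_add)
qed

lemma SI_ders: "p \<in> SI \<Longrightarrow> ders z p \<in> SI"
  by (induction z) (auto simp: SI_der)

text \<open>All relations have positive degree.\<close>

lemma SI_lookup_zero: "p \<in> SI \<Longrightarrow> lookup p 0 = 0"
  unfolding SI_def
proof (induction rule: free.span_induct_alt)
  case (step c x y)
  then obtain u r v where x: "x = monomial u * r * monomial v" "r \<in> rels" by auto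
  have "0 \<notin> keys x"
  proof
    assume "0 \<in> keys x"
    then obtain w where "w \<in> keys r" "letters w = []"
      unfolding x using Poly_Mapping.keys_mult[of "monomial u * r" "monomial v"] Poly_Mapping.keys_mult[of "monomial u" r]
      by (fastforce simp: zero_word_def plus_word_def)
    moreover have "mset (letters w) \<noteq> {#}" if "w \<in> keys r" for w
      using homogeneous_rels[OF x(2)] that by (auto simp: homogeneous_def)
    ultimately show False by auto
  qed
  then show ?case using step by (simp add: lookup_add lookup_smul in_keys_iff)
qed simp

end

section \<open>Nondegeneracy\<close>

lemma map_zero_fun [simp]: "Poly_Mapping.map (\<lambda>a. 0) p = 0"
  by (rule poly_mapping_eqI) (transfer, auto simp: when_def)

lemma sum_mset_nonpos:
  fixes f :: "'b \<Rightarrow> int"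
  assumes "\<And>b. b \<in># M \<Longrightarrow> f b \<le> 0"
  shows "(\<Sum>b\<in>#M. f b) \<le> 0"
  using assms by (induction M) (auto simp: add_nonpos_nonpos)

lemma sum_mset_nonpos_zero:
  fixes f :: "'b \<Rightarrow> int"
  assumes "(\<Sum>b\<in>#M. f b) = 0" "\<And>b. b \<in># M \<Longrightarrow> f b \<le> 0"
  shows "b \<in># M \<Longrightarrow> f b = 0"
  using assms
proof (induction M)
  case (add x M)
  have "(\<Sum>b\<in>#M. f b) \<le> 0" using add.prems(3) by (intro sum_mset_nonpos) auto
  moreover have "f x \<le> 0" using add.prems by simp
  ultimately have "(\<Sum>b\<in>#M. f b) = 0" "f x = 0" using add.prems(2) by auto
  then show ?case using add by auto
qed simp

context cartan_letters begin

lemma dword_homogeneous: "homogeneous (mset w - {#a#}) (dword a w)" "a \<notin> set w \<Longrightarrow> dword a w = 0"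
proof -
  show z: "a \<notin> set w \<Longrightarrow> dword a w = 0" for w by (induction w) auto
  show "homogeneous (mset w - {#a#}) (dword a w)"
  proof (induction w)
    case (Cons b w)
    have 1: "homogeneous (mset (b # w) - {#a#}) (if a = b then monomial w else 0)"
      by (auto simp: homogeneous_zero homogeneous_monomial)
    have 2: "homogeneous (mset (b # w) - {#a#}) (ltr b * dword a w)"
    proof (cases "a \<in> set w")
      case True
      then have "mset (b # w) - {#a#} = mset [b] + (mset w - {#a#})" by simp
      then show ?thesis using homogeneous_mult[OF homogeneous_monomial Cons, of "[b]"] by simp
    qed (simp add: z homogeneous_zero)
    show ?case using homogeneous_add[OF 1 homogeneous_smul[OF 2]] by simp
  qed (simp add: homogeneous_zero)
qed

lemma homogeneous_der:
  assumes "homogeneous \<beta> p"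
  shows "homogeneous (\<beta> - {#a#}) (der a p)" "a \<notin># \<beta> \<Longrightarrow> der a p = 0"
proof -
  have *: "der a p = (\<Sum>w\<in>keys p. smul (lookup p w) (dword a (letters w)))"
    by (simp add: der_def lin_def)
  have b: "mset (letters w) = \<beta>" if "w \<in> keys p" for w using assms that by (auto simp: homogeneous_def)
  show "homogeneous (\<beta> - {#a#}) (der a p)"
    unfolding * by (intro homogeneous_sum homogeneous_smul) (metis b dword_homogeneous(1))
  show "a \<notin># \<beta> \<Longrightarrow> der a p = 0"
    unfolding * by (intro sum.neutral) (metis b dword_homogeneous(2) free.scale_zero_right set_mset_mset)
qed

lemma homogeneous_ders: "homogeneous \<beta> p \<Longrightarrow> mset z \<noteq> \<beta> \<Longrightarrow> lookup (ders z p) 0 = 0"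
proof (induction z arbitrary: \<beta> p rule: rev_induct)
  case Nil
  then show ?case unfolding homogeneous_def by (metis in_keys_iff letters_zero mset.simps(1) ders_simps(1))
next
  case (snoc a z)
  show ?case
  proof (cases "a \<in># \<beta>")
    case True
    then have "mset z \<noteq> \<beta> - {#a#}" using snoc.prems by auto
    then show ?thesis using snoc.IH[OF homogeneous_der(1)[OF snoc.prems(1)]] by simp
  next
    case False
    then show ?thesis using homogeneous_der(2)[OF snoc.prems(1)] by (simp add: linmapD[OF linmap_ders])
  qed
qed

lemma ders_eps_zero:
  assumes "\<And>w. w \<in> keys p \<Longrightarrow> mset (letters w) \<noteq> mset z"
  shows "lookup (ders z p) 0 = 0"
proof -
  have "lookup (ders z p) 0 = (\<Sum>w\<in>keys p. lookup (ders z (single w (lookup p w))) 0)"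
    by (subst poly_mapping_decomp) (simp add: linmap_sum[OF linmap_ders] lookup_sum)
  also have "\<dots> = 0"
  proof (intro sum.neutral ballI homogeneous_ders)
    show "homogeneous (mset (letters w)) (single w (lookup p w))" for w
      by (auto simp: homogeneous_def)
  qed (use assms in force)
  finally show ?thesis .
qed

definition component :: "'a multiset \<Rightarrow> ('a word \<Rightarrow>\<^sub>0 'k) \<Rightarrow> ('a word \<Rightarrow>\<^sub>0 'k)" where
  "component \<beta> = scal (\<lambda>w. if mset (letters w) = \<beta> then 1 else 0)"

lemma keys_component: "keys (component \<beta> p) = {w \<in> keys p. mset (letters w) = \<beta>}"
  by (auto simp: component_def in_keys_iff lookup_scal split: if_splits)

lemma homogeneous_component: "homogeneous \<beta> (component \<beta> p)"
  by (auto simp: homogeneous_def keys_component)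

lemma component_sum: "p = (\<Sum>\<beta>\<in>(\<lambda>w. mset (letters w)) ` keys p. component \<beta> p)"
proof (rule poly_mapping_eqI)
  fix w
  have "(\<Sum>\<beta>\<in>(\<lambda>w. mset (letters w)) ` keys p. lookup (component \<beta> p) w) =
      (\<Sum>\<beta>\<in>(\<lambda>w. mset (letters w)) ` keys p. if \<beta> = mset (letters w) then lookup p w else 0)"
    by (intro sum.cong refl) (auto simp: component_def lookup_scal)
  also have "\<dots> = lookup p w"
    by (auto simp: sum.delta in_keys_iff)
  finally show "lookup p w = lookup (\<Sum>\<beta>\<in>(\<lambda>w. mset (letters w)) ` keys p. component \<beta> p) w"
    by (simp add: lookup_sum)
qed

text \<open>Allows the vanishing of the functionals to be tested one degree at a time.\<close>

lemma ders_component: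
  "lookup (ders z (component \<beta> p)) 0 = (if mset z = \<beta> then lookup (ders z p) 0 else 0)"
proof (cases "mset z = \<beta>")
  case True
  have "lookup (ders z (p - component \<beta> p)) 0 = 0"
  proof (rule ders_eps_zero)
    fix w assume "w \<in> keys (p - component \<beta> p)"
    then show "mset (letters w) \<noteq> mset z"
      by (auto simp: True in_keys_iff lookup_minus component_def lookup_scal)
  qed
  then show ?thesis using True by (simp add: linmapD[OF linmap_ders] lookup_minus)
qed (simp add: homogeneous_ders[OF homogeneous_component])

subsection \<open>The antipode of a primitive element\<close>

lemma copairing_expand: "ders z (monomial w) = (\<Sum>(c, u, v)\<leftarrow>cop w. smul c (smul (lookup (ders z (monomial u)) 0) (monomial v)))"
  by (subst copairing_ders[symmetric]) (simp add: copairing_def case_prod_unfold)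

text \<open>In the antipode identity \<open>\<Sum> S(u) v = 0\<close> the terms with \<open>u\<close> and \<open>v\<close> both nonempty contribute an
  element of the ideal: contracting their left factors with any \<open>\<epsilon> \<circ> \<partial>\<^sub>z\<close> leads into the ideal, and by the
  induction hypothesis these functionals separate the left factors modulo the ideal.\<close>

lemma antipode_primitive:
  assumes p: "p \<in> span_words X" "homogeneous \<beta> p" "\<beta> \<noteq> {#}"
    and der: "\<And>a. a \<in> X \<Longrightarrow> der a p \<in> SI"
    and IH: "\<And>c. c \<in> span_words X \<Longrightarrow> (\<And>w. w \<in> keys c \<Longrightarrow> length (letters w) < size \<beta>) \<Longrightarrow>
        (\<And>z. z \<in> lists X \<Longrightarrow> lookup (ders z c) 0 = 0) \<Longrightarrow> c \<in> SI"
  shows "antipode p + p \<in> SI"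
proof -
  \<comment> \<open>\<open>A\<close> numbers the terms of the reduced coproduct of p: (w, i) is the
    i-th middle term of the word w, with scalar \<open>co\<close>, left factor \<open>uu\<close> and
    right factor \<open>vv\<close>.\<close>
  define A where "A = (SIGMA w:keys p. {..<length (mid (letters w))})"
  define co where "co t = (case t of (w, i) \<Rightarrow> lookup p w * fst (mid (letters w) ! i))" for t
  define uu where "uu t = (case t of (w, i) \<Rightarrow> fst (snd (mid (letters w) ! i)))" for t
  define vv where "vv t = (case t of (w, i) \<Rightarrow> snd (snd (mid (letters w) ! i)))" for t
  have finA: "finite A" by (auto simp: A_def)
  have wne: "letters w \<noteq> []" and wX: "letters w \<in> lists X" and wb: "mset (letters w) = \<beta>" if "w \<in> keys p" for w
    using p that by (auto simp: homogeneous_def span_words_def)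
  have uv: "uu t \<in> lists X" "vv t \<in> lists X" "length (uu t) < size \<beta>" if tA: "t \<in> A" for t
  proof -
    obtain w i where t: "t = (w, i)" "w \<in> keys p" "i < length (mid (letters w))"
      using tA unfolding A_def by blast
    define x where "x = mid (letters w) ! i"
    obtain c where x: "x = (c, uu t, vv t)" by (cases x) (simp add: uu_def vv_def t x_def[symmetric])
    have "x \<in> set (mid (letters w))" using t(3) by (simp add: x_def)
    then have "(c, uu t, vv t) \<in> set (cop (letters w))" "vv t \<noteq> []" by (auto simp: mid_def x)
    then have *: "mset (uu t) + mset (vv t) = mset (letters w)" "vv t \<noteq> []" by (auto dest: cop_mset)
    then have "size \<beta> = length (uu t) + length (vv t)" using wb[OF t(2)] by (metis size_mset size_union)
    then show "length (uu t) < size \<beta>" using *(2) by auto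
    have "set (uu t) \<union> set (vv t) = set (letters w)"
      using arg_cong[OF *(1), of set_mset] by simp
    then show "uu t \<in> lists X" "vv t \<in> lists X" using wX[OF t(2)] by auto
  qed
  have sumA: "(\<Sum>t\<in>A. smul (co t) (g (uu t) (vv t))) =
      (\<Sum>w\<in>keys p. smul (lookup p w) (\<Sum>(c, u, v)\<leftarrow>cop (letters w). smul c (g u v)))
      - (\<Sum>w\<in>keys p. smul (lookup p w) (g [] (letters w))) - (\<Sum>w\<in>keys p. smul (lookup p w) (g (letters w) []))"
    for g :: "'a list \<Rightarrow> 'a list \<Rightarrow> ('a word \<Rightarrow>\<^sub>0 'k)"
  proof -
    have "(\<Sum>t\<in>A. smul (co t) (g (uu t) (vv t))) =
        (\<Sum>w\<in>keys p. \<Sum>i<length (mid (letters w)). smul (co (w, i)) (g (uu (w, i)) (vv (w, i))))"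
      unfolding A_def by (subst sum.Sigma) auto
    also have "\<dots> = (\<Sum>w\<in>keys p. smul (lookup p w) (\<Sum>(c, u, v)\<leftarrow>mid (letters w). smul c (g u v)))"
      by (intro sum.cong refl)
        (simp add: sum_list_sum_nth atLeast0LessThan free.scale_sum_right co_def uu_def vv_def case_prod_unfold)
    also have "\<dots> = (\<Sum>w\<in>keys p. smul (lookup p w) (\<Sum>(c, u, v)\<leftarrow>cop (letters w). smul c (g u v))
       - smul (lookup p w) (g [] (letters w)) - smul (lookup p w) (g (letters w) []))"
    proof (intro sum.cong refl)
      fix w assume w: "w \<in> keys p"
      show "smul (lookup p w) (\<Sum>(c, u, v)\<leftarrow>mid (letters w). smul c (g u v)) =
        smul (lookup p w) (\<Sum>(c, u, v)\<leftarrow>cop (letters w). smul c (g u v))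
       - smul (lookup p w) (g [] (letters w)) - smul (lookup p w) (g (letters w) [])"
        unfolding sum_cop_mid[OF wne[OF w], of "\<lambda>c u v. smul c (g u v)"]
        by (simp add: free.scale_right_distrib)
    qed
    finally show ?thesis by (simp add: sum_subtractf)
  qed
  have lin_p: "(\<Sum>w\<in>keys p. smul (lookup p w) (f (monomial (letters w)))) = f p" if "linmap f"
    for f :: "('a word \<Rightarrow>\<^sub>0 'k) \<Rightarrow> ('a word \<Rightarrow>\<^sub>0 'k)"
  proof -
    have "f p = f (\<Sum>w\<in>keys p. smul (lookup p w) (monomial (letters w)))"
      by (subst poly_mapping_decomp)
        (intro arg_cong[of _ _ f] sum.cong refl, metis single_eq_smul single_word)
    then show ?thesis by (simp add: linmap_sum[OF that] linmapD[OF that])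
  qed
  have sumS: "(\<Sum>t\<in>A. smul (co t) (antipode (monomial (uu t)) * monomial (vv t))) = - (antipode p + p)"
  proof -
    have a1: "antipode (monomial []) = 1" unfolding antipode_monomial by (simp add: monomial_Nil)
    have "(\<Sum>w\<in>keys p. smul (lookup p w) (\<Sum>(c, u, v)\<leftarrow>cop (letters w). smul c (antipode (monomial u) * monomial v))) = 0"
      by (intro sum.neutral ballI) (simp add: antipode_left_inverse wne)
    then show ?thesis
      unfolding sumA[of "\<lambda>u v. antipode (monomial u) * monomial v"] a1
      by (simp add: monomial_Nil lin_p[OF linmap_id] lin_p[OF linmap_antipode])
  qed
  have sumD: "(\<Sum>t\<in>A. smul (co t * lookup (ders z (monomial (uu t))) 0) (monomial (vv t))) \<in> SI"
    if z: "z \<in> lists X" for z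
  proof -
    let ?\<phi> = "\<lambda>r. lookup (ders z r) 0"
    have l1: "linmap (\<lambda>r. smul (?\<phi> r) 1)"
      by (rule linmapI) (simp_all add: linmapD[OF linmap_ders] lookup_add lookup_smul free.scale_left_distrib)
    have "(\<Sum>t\<in>A. smul (co t) (smul (?\<phi> (monomial (uu t))) (monomial (vv t)))) =
       ders z p - smul (?\<phi> 1) p - smul (?\<phi> p) 1"
      unfolding sumA[of "\<lambda>u v. smul (?\<phi> (monomial u)) (monomial v)"] copairing_expand[symmetric] monomial_Nil lin_p[OF linmap_ders] lin_p[OF l1]
      using lin_p[OF linmap_scale[OF linmap_id], of "?\<phi> 1"] by simp
    \<comment> \<open>The subtracted terms come from 1 \<otimes> p and p \<otimes> 1. For z = []
      they leave p - p. Otherwise the last letter of z acts first; it sends p into the ideal and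
      kills 1.\<close>
    moreover have "ders z p - smul (?\<phi> 1) p - smul (?\<phi> p) 1 \<in> SI"
    proof (cases z rule: rev_cases)
      case Nil
      have "0 \<notin> keys p" using wne by force
      then show ?thesis using Nil by (simp add: in_keys_iff)
    next
      case (snoc z' a)
      then have "ders z p \<in> SI" using z der by (auto intro!: SI_ders)
      then show ?thesis using snoc SI_lookup_zero by (simp add: linmapD[OF linmap_ders])
    qed
    ultimately show ?thesis by simp
  qed
  \<comment> \<open>One row for each left factor, one column for each word. The left factors may be
    dependent modulo the ideal, which is why G H G = G is used in place of a dual basis.\<close>
  define G where "G t z = co t * lookup (ders z (monomial (uu t))) 0" for t z
  obtain \<Psi> H where \<Psi>: "finite \<Psi> \<and> \<Psi> \<subseteq> lists X \<and>
    (\<forall>t\<in>A. \<forall>z\<in>lists X. (\<Sum>s\<in>A. (\<Sum>y\<in>\<Psi>. G t y * H y s) * G s z) = G t z)"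
    using generalized_inverse[OF finA, of "lists X" G] by (elim exE)
  define Q where "Q t s = (\<Sum>y\<in>\<Psi>. G t y * H y s)" for t s
  define c where "c t = smul (co t) (monomial (uu t) :: 'a word \<Rightarrow>\<^sub>0 'k)" for t
  have \<phi>c: "lookup (ders z (c t)) 0 = G t z" for z t
    by (simp add: c_def linmapD[OF linmap_ders] lookup_smul G_def)
  \<comment> \<open>Since Q G = G, the element has value zero under every functional; it involves
    only words shorter than p, so the induction hypothesis applies.\<close>
  have 1: "c t - (\<Sum>s\<in>A. smul (Q t s) (c s)) \<in> SI" if t: "t \<in> A" for t
  proof (rule IH)
    show "c t - (\<Sum>s\<in>A. smul (Q t s) (c s)) \<in> span_words X"
      unfolding c_def by (intro span_words_diff span_words_sum span_words_smul span_words_monomial uv t)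
    show "length (letters w) < size \<beta>" if w: "w \<in> keys (c t - (\<Sum>s\<in>A. smul (Q t s) (c s)))" for w
    proof (rule ccontr)
      assume *: "\<not> length (letters w) < size \<beta>"
      have "lookup (c s) w = 0" if "s \<in> A" for s
        using uv(3)[OF that] * by (auto simp: c_def lookup_smul monomial_def lookup_single when_def)
      then show False using w t by (simp add: in_keys_iff lookup_minus lookup_sum lookup_smul)
    qed
    show "lookup (ders z (c t - (\<Sum>s\<in>A. smul (Q t s) (c s)))) 0 = 0" if "z \<in> lists X" for z
      using \<Psi> t that by (simp add: linmapD[OF linmap_ders] linmap_sum[OF linmap_ders] lookup_minus lookup_sum
          lookup_smul \<phi>c Q_def)
  qed
  \<comment> \<open>A column of Q is a combination of columns of G, and each column of G is one of
    the contractions in \<open>sumD\<close>.\<close>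
  have 2: "(\<Sum>t\<in>A. smul (Q t s) (monomial (vv t))) \<in> SI" for s
  proof -
    have "(\<Sum>t\<in>A. smul (Q t s) (monomial (vv t))) =
        (\<Sum>y\<in>\<Psi>. smul (H y s) (\<Sum>t\<in>A. smul (G t y) (monomial (vv t))))"
      unfolding Q_def free.scale_sum_left free.scale_sum_right
      by (subst sum.swap) (simp add: mult.commute)
    also have "\<dots> \<in> SI"
    proof (rule SI_sum, rule SI_smul)
      fix y assume "y \<in> \<Psi>"
      then have "y \<in> lists X" using \<Psi> by blast
      then show "(\<Sum>t\<in>A. smul (G t y) (monomial (vv t))) \<in> SI" unfolding G_def by (rule sumD)
    qed
    finally show ?thesis .
  qed
  have "(\<Sum>t\<in>A. smul (co t) (antipode (monomial (uu t)) * monomial (vv t))) = (\<Sum>t\<in>A. antipode (c t) * monomial (vv t))"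
    by (simp add: c_def linmapD[OF linmap_antipode] smul_mult)
  \<comment> \<open>Each \<open>c t\<close> is replaced by an element of the ideal plus a
    combination of the \<open>c s\<close>; exchanging the sums then moves the coefficients Q to the
    right factors, where \<open>2\<close> applies.\<close>
  also have "\<dots> = (\<Sum>t\<in>A. antipode (c t - (\<Sum>s\<in>A. smul (Q t s) (c s))) * monomial (vv t)) +
      (\<Sum>t\<in>A. \<Sum>s\<in>A. smul (Q t s) (antipode (c s)) * monomial (vv t))"
    by (simp add: linmapD[OF linmap_antipode] linmap_sum[OF linmap_antipode] left_diff_distrib sum_subtractf sum_distrib_right)
  also have "(\<Sum>t\<in>A. \<Sum>s\<in>A. smul (Q t s) (antipode (c s)) * monomial (vv t)) =
      (\<Sum>s\<in>A. antipode (c s) * (\<Sum>t\<in>A. smul (Q t s) (monomial (vv t))))"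
    by (subst sum.swap) (simp add: sum_distrib_left smul_mult mult_smul)
  finally have "- (antipode p + p) = (\<Sum>t\<in>A. antipode (c t - (\<Sum>s\<in>A. smul (Q t s) (c s))) * monomial (vv t)) +
      (\<Sum>s\<in>A. antipode (c s) * (\<Sum>t\<in>A. smul (Q t s) (monomial (vv t))))"
    unfolding sumS .
  moreover have "antipode (c s) \<in> span_words X" if "s \<in> A" for s
    using uv(1)[OF that] by (auto simp: c_def linmapD[OF linmap_antipode] antipode_monomial intro!: span_words_smul span_words_monomial)
  ultimately have "- (antipode p + p) \<in> SI"
    using SI_mult_right[OF SI_antipode[OF 1] span_words_monomial[OF uv(2)]] SI_mult_left[OF 2]
    by (auto intro!: SI_add SI_sum)
  then show ?thesis using SI_minus[of "- (antipode p + p)"] by (simp only: minus_minus)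
qed

text \<open>On a homogeneous element the antipode is \<kappa> times reversal. Applying \<kappa> rv p
  \<equiv> -p twice gives \<kappa>^2 p \<equiv> p, and \<kappa>^2 is q to the power -2
  crossing.\<close>

lemma primitive_rv:
  assumes "antipode p + p \<in> SI" "homogeneous (mset w) p"
  shows "smul ((- 1) ^ length w * q powi (- crossing w)) (rv p) + p \<in> SI"
    and "crossing w = 0 \<or> p \<in> SI"
proof -
  let ?\<kappa> = "(- 1) ^ length w * q powi (- crossing w)"
  have "antipode p = smul ?\<kappa> (rv p)"
  proof -
    have "scal (\<lambda>w. (- 1) ^ length (letters w) * q powi (- crossing (letters w))) p = smul ?\<kappa> p"
    proof (rule scal_const)
      fix v assume "v \<in> keys p"
      then have "mset (letters v) = mset w" using assms(2) by (auto simp: homogeneous_def)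
      then show "(- 1) ^ length (letters v) * q powi (- crossing (letters v)) = ?\<kappa>"
        using crossing_mset_eq mset_eq_length by metis
    qed
    then show ?thesis by (simp add: antipode_def linmapD[OF linmap_rv])
  qed
  then show 1: "smul ?\<kappa> (rv p) + p \<in> SI" using assms(1) by simp
  have "rv (smul ?\<kappa> (rv p) + p) \<in> SI" by (rule SI_rv[OF 1])
  then have "smul ?\<kappa> p + rv p \<in> SI" by (simp add: linmapD[OF linmap_rv])
  then have "smul ?\<kappa> (smul ?\<kappa> p + rv p) - (smul ?\<kappa> (rv p) + p) \<in> SI"
    by (intro SI_diff SI_smul 1)
  moreover have "smul ?\<kappa> (smul ?\<kappa> p + rv p) - (smul ?\<kappa> (rv p) + p) = smul (?\<kappa> * ?\<kappa> - 1) p"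
    by (simp add: free.scale_right_distrib free.scale_left_diff_distrib del: mult_minus_left)
  moreover have "?\<kappa> * ?\<kappa> = q powi (- 2 * crossing w)"
  proof -
    have "?\<kappa> * ?\<kappa> = ((- 1) ^ length w * (- 1) ^ length w) * (q powi (- crossing w) * q powi (- crossing w))"
      by (simp only: mult_ac)
    also have "\<dots> = q powi (- crossing w + - crossing w)"
      by (simp only: minus_one_mult_self mult_1 power_int_add[OF disjI1[OF q_nz]])
    finally show ?thesis by simp
  qed
  ultimately have "smul (q powi (- 2 * crossing w) - 1) p \<in> SI" by simp
  then show "crossing w = 0 \<or> p \<in> SI"
    using SI_smul_cancel[of "q powi (- 2 * crossing w) - 1" p] q_powi_eq_1[of "- 2 * crossing w"] by auto
qed

subsection \<open>Weights of primitive elements with respect to real letters\<close>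

lemma tw_homogeneous: "homogeneous \<beta> p \<Longrightarrow> tw x n p = smul (q powi (n * (\<Sum>b\<in>#\<beta>. C x b))) p"
  unfolding tw_def
proof (rule scal_const)
  fix w assume "homogeneous \<beta> p" "w \<in> keys p"
  then have "wt x (letters w) = (\<Sum>b\<in>#\<beta>. C x b)"
    by (auto simp: homogeneous_def wt_def sum_mset_sum_list[symmetric])
  then show "q powi (n * wt x (letters w)) = q powi (n * (\<Sum>b\<in>#\<beta>. C x b))" by simp
qed

lemma homogeneous_adj: "homogeneous \<beta> p \<Longrightarrow> homogeneous (add_mset x \<beta>) (adj x p)"
  unfolding adj_def tw_homogeneous[of \<beta> p]
  using homogeneous_mult[OF homogeneous_monomial[of "[x]"], of \<beta> p]
    homogeneous_mult[OF homogeneous_smul homogeneous_monomial[of "[x]"], of \<beta> p]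
  by (intro homogeneous_diff) (auto simp: tw_homogeneous)

text \<open>Up to normalization the relation e f - f e = (K - K^(-1)) / (q - q^(-1)): the right
  derivation and the adjoint action form an sl_2-type pair.\<close>

lemma rder_adj: "rder x (adj x u) = tw x (-1) u - tw x 1 u + adj x (rder x u)"
  by (simp add: adj_def linmapD[OF linmap_rder] rder_mult rder_ltr rder_tw tw_monomial mult_smul smul_mult
      power_int_minus q_nz algebra_simps)

lemma SI_rder: "p \<in> SI \<Longrightarrow> rder a p \<in> SI"
  unfolding rder_def by (intro SI_rv SI_der)

context
  fixes x assumes x: "x \<in> X" "C x x > 0"
begin

lemma SI_adj: "p \<in> SI \<Longrightarrow> adj x p \<in> SI"
  unfolding adj_def using x by (intro SI_diff SI_mult_left SI_mult_right SI_tw span_words_ltr)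

lemma SI_adj_power: "p \<in> SI \<Longrightarrow> (adj x ^^ k) p \<in> SI"
  by (induction k) (auto simp: SI_adj)

lemma span_words_adj: "p \<in> span_words X \<Longrightarrow> adj x p \<in> span_words X"
  unfolding adj_def using x by (intro span_words_diff span_words_mult span_words_tw span_words_ltr)

lemma adj_power_tw: "(adj x ^^ k) (tw x n u) = smul (q powi (- (int k * n * C x x))) (tw x n ((adj x ^^ k) u))"
proof (induction k)
  case (Suc k)
  have "adj x (tw x n u) = smul (q powi (- (n * C x x))) (tw x n (adj x u))" for u
    by (simp add: adj_def linmapD[OF linmap_tw] tw_mult tw_monomial smul_mult mult_smul tw_tw[of x n x 1]
        free.scale_right_diff_distrib power_int_minus q_nz)
  then have "(adj x ^^ Suc k) (tw x n u) =
      smul (q powi (- (int k * n * C x x)) * q powi (- (n * C x x))) (tw x n ((adj x ^^ Suc k) u))"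
    using Suc by (simp only: funpow.simps comp_apply linmapD[OF linmap_adj] free.scale_scale)
  also have "q powi (- (int k * n * C x x)) * q powi (- (n * C x x)) = q powi (- (int (Suc k) * n * C x x))"
    by (simp add: power_int_add[OF disjI1[OF q_nz], symmetric] algebra_simps)
  finally show ?case .
qed simp

text \<open>The adjoint action is a skew derivation, so among j + k applications at least j fall on
  u or at least k on v. The twist on u is harmless, as it commutes with the action up to a
  scalar.\<close>

lemma adj_power_mult:
  "u \<in> span_words X \<Longrightarrow> v \<in> span_words X \<Longrightarrow> (adj x ^^ j) u \<in> SI \<Longrightarrow> (adj x ^^ k) v \<in> SI \<Longrightarrow>
    (adj x ^^ (j + k)) (u * v) \<in> SI"
proof (induction "j + k" arbitrary: j k u v)
  case 0
  then show ?case by (auto intro: SI_mult_right)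
next
  case (Suc n)
  show ?case
  proof (cases "j = 0 \<or> k = 0")
    case True
    then have "u \<in> SI \<or> v \<in> SI" using Suc.prems by auto
    then show ?thesis using Suc.prems(1,2) by (auto intro: SI_adj_power SI_mult_right SI_mult_left)
  next
    case False
    then obtain j' k' where jk: "j = Suc j'" "k = Suc k'" by (meson not0_implies_Suc)
    have n: "n = j' + k" "n = j + k'" using Suc.hyps(2) jk by auto
    have "(adj x ^^ (j' + k)) (adj x u * v) \<in> SI"
      using Suc.prems jk by (intro Suc.hyps(1)[OF n(1)] span_words_adj) (auto simp: funpow_swap1)
    moreover have "(adj x ^^ (j + k')) (tw x 1 u * adj x v) \<in> SI"
    proof (intro Suc.hyps(1)[OF n(2)] span_words_adj span_words_tw Suc.prems)
      show "(adj x ^^ j) (tw x 1 u) \<in> SI" unfolding adj_power_tw by (intro SI_smul SI_tw Suc.prems)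
      show "(adj x ^^ k') (adj x v) \<in> SI"
        using Suc.prems(4) unfolding jk by (simp add: funpow_Suc_right del: funpow.simps)
    qed
    moreover have "(adj x ^^ (j + k)) (u * v) = (adj x ^^ n) (adj x u * v) + (adj x ^^ n) (tw x 1 u * adj x v)"
      using Suc.hyps(2)[symmetric] by (simp add: funpow_Suc_right adj_mult linmap_add[OF linmap_funpow[OF linmap_adj]] del: funpow.simps)
    ultimately show ?thesis using n SI_add by metis
  qed
qed

text \<open>The admissible coefficients in expansions by powers of \<open>ltr x\<close>: constants
  for \<open>der x\<close> on which the adjoint action is nilpotent, both modulo the ideal.\<close>

definition PX :: "('a word \<Rightarrow>\<^sub>0 'k) set" where
  "PX = {u \<in> span_words X. der x u \<in> SI \<and> (\<exists>k. (adj x ^^ k) u \<in> SI)}"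

lemma PX_mult: "u \<in> PX \<Longrightarrow> v \<in> PX \<Longrightarrow> u * v \<in> PX"
proof -
  assume uv: "u \<in> PX" "v \<in> PX"
  then obtain j k where "(adj x ^^ j) u \<in> SI" "(adj x ^^ k) v \<in> SI" by (auto simp: PX_def)
  then have "(adj x ^^ (j + k)) (u * v) \<in> SI" using uv by (intro adj_power_mult) (auto simp: PX_def)
  moreover have "der x u * v \<in> SI" "tw x (- 1) u * der x v \<in> SI"
    using uv by (auto simp: PX_def intro: SI_mult_right SI_mult_left span_words_tw)
  ultimately show "u * v \<in> PX" using uv by (auto simp: PX_def der_mult SI_add span_words_mult)
qed

lemma PX_adj_power_mono: "(adj x ^^ k) u \<in> SI \<Longrightarrow> k \<le> l \<Longrightarrow> (adj x ^^ l) u \<in> SI"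
  using SI_adj_power[of "(adj x ^^ k) u" "l - k"] by (simp flip: funpow_add[THEN fun_cong, unfolded comp_def])

lemma PX_add:
  assumes "u \<in> PX" "v \<in> PX" shows "u + v \<in> PX"
proof -
  obtain j k where "(adj x ^^ j) u \<in> SI" "(adj x ^^ k) v \<in> SI" using assms by (auto simp: PX_def)
  then have "(adj x ^^ (max j k)) (u + v) \<in> SI"
    using PX_adj_power_mono by (simp add: linmap_add[OF linmap_funpow[OF linmap_adj]] SI_add)
  then show ?thesis using assms by (auto simp: PX_def linmapD[OF linmap_der] SI_add span_words_add)
qed

lemma PX_SI: "u \<in> SI \<Longrightarrow> u \<in> span_words X \<Longrightarrow> u \<in> PX"
  unfolding PX_def by (auto simp: SI_der intro!: exI[of _ 0])

lemma PX_zero: "0 \<in> PX" by (rule PX_SI) (auto simp: span_words_zero)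

lemma PX_one: "1 \<in> PX"
proof -
  have "(adj x ^^ 1) 1 \<in> SI" by (simp add: adj_def)
  then have "\<exists>k. (adj x ^^ k) 1 \<in> SI" by (rule exI)
  moreover have "der x 1 \<in> SI" unfolding der_one by (rule SI_zero)
  ultimately show ?thesis unfolding PX_def by (intro CollectI conjI span_words_one)
qed

lemma PX_ltr: "y \<in> X \<Longrightarrow> y \<noteq> x \<Longrightarrow> ltr y \<in> PX"
proof -
  assume y: "y \<in> X" "y \<noteq> x"
  have "(adj x ^^ serre_exp x y) (ltr y) \<in> SI"
    unfolding serre_rel_adj[OF x(1) y(1) x(2) y(2)[symmetric], symmetric]
    using x y by (intro rels_SI) (auto simp: rels_def)
  then show ?thesis using y unfolding PX_def by (auto simp: span_words_ltr der_ltr)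
qed

lemma PX_tw: "u \<in> PX \<Longrightarrow> tw x n u \<in> PX"
proof -
  assume "u \<in> PX"
  then obtain k where k: "u \<in> span_words X" "der x u \<in> SI" "(adj x ^^ k) u \<in> SI" by (auto simp: PX_def)
  have "(adj x ^^ k) (tw x n u) \<in> SI" unfolding adj_power_tw by (intro SI_smul SI_tw k)
  moreover have "der x (tw x n u) \<in> SI" unfolding der_tw by (intro SI_smul SI_tw k)
  ultimately show ?thesis using span_words_tw[OF k(1)] unfolding PX_def by blast
qed

lemma PX_adj: "u \<in> PX \<Longrightarrow> adj x u \<in> PX"
proof -
  assume "u \<in> PX"
  then obtain k where k: "u \<in> span_words X" "der x u \<in> SI" "(adj x ^^ k) u \<in> SI" by (auto simp: PX_def)
  have "(adj x ^^ k) (adj x u) \<in> SI" using SI_adj[OF k(3)] by (simp add: funpow_swap1)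
  moreover have "ltr x * der x u \<in> SI" "tw x 1 (der x u) * ltr x \<in> SI"
    using k x by (auto intro: SI_mult_left SI_mult_right SI_tw span_words_ltr)
  then have "der x (adj x u) \<in> SI" unfolding der_adj by (intro SI_diff SI_smul)
  ultimately show ?thesis using k unfolding PX_def by (auto simp: span_words_adj)
qed

text \<open>Every element turns out to be a polynomial in \<open>ltr x\<close> with coefficients from \<open>PX\<close> on the left;
  iterating \<open>der x\<close> isolates its leading coefficient.\<close>

definition DX :: "('a word \<Rightarrow>\<^sub>0 'k) set" where
  "DX = {(\<Sum>i<m. g i * ltr x ^ i) | m g. \<forall>i. g i \<in> PX}"

lemma DX_add:
  assumes "p \<in> DX" "r \<in> DX" shows "p + r \<in> DX"
proof -
  obtain m g n h where p: "p = (\<Sum>i<m. g i * ltr x ^ i)" "\<And>i. g i \<in> PX"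
    and r: "r = (\<Sum>i<n. h i * ltr x ^ i)" "\<And>i. h i \<in> PX"
    using assms by (auto simp: DX_def)
  let ?g = "\<lambda>i. if i < m then g i else 0" and ?h = "\<lambda>i. if i < n then h i else 0"
  have "p = (\<Sum>i<max m n. ?g i * ltr x ^ i)"
    unfolding p by (rule sum.mono_neutral_cong_left) auto
  moreover have "r = (\<Sum>i<max m n. ?h i * ltr x ^ i)"
    unfolding r by (rule sum.mono_neutral_cong_left) auto
  ultimately have "p + r = (\<Sum>i<max m n. (?g i + ?h i) * ltr x ^ i)"
    by (simp only: distrib_right sum.distrib)
  moreover have "\<forall>i. ?g i + ?h i \<in> PX" using p r by (auto intro!: PX_add PX_zero)
  ultimately show ?thesis unfolding DX_def by (intro CollectI exI conjI)
qed

lemma DX_PX_power: "u \<in> PX \<Longrightarrow> u * ltr x ^ n \<in> DX"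
proof -
  assume u: "u \<in> PX"
  have "u * ltr x ^ n = (\<Sum>i<Suc n. (if i = n then u else 0) * ltr x ^ i)" by simp
  moreover have "\<forall>i. (if i = n then u else 0) \<in> PX" using u PX_zero by simp
  ultimately show ?thesis unfolding DX_def by (intro CollectI exI conjI)
qed

lemma DX_ltr_mult:
  assumes "y \<in> X" "p \<in> DX" shows "ltr y * p \<in> DX"
proof -
  obtain m g where p: "p = (\<Sum>i<m. g i * ltr x ^ i)" "\<And>i. g i \<in> PX"
    using assms by (auto simp: DX_def)
  have "ltr y * (g i * ltr x ^ i) \<in> DX" for i
  proof (cases "y = x")
    case False
    then have "ltr y * g i \<in> PX" using p assms by (intro PX_mult PX_ltr)
    then show ?thesis by (simp add: DX_PX_power mult.assoc[symmetric])
  next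
    case True
    \<comment> \<open>The definition of the adjoint action, read as the rule for moving x from the
      left of a coefficient to its right.\<close>
    have "ltr x * (g i * ltr x ^ i) = adj x (g i) * ltr x ^ i + tw x 1 (g i) * ltr x ^ Suc i"
      by (simp add: adj_def left_diff_distrib mult.assoc)
    then show ?thesis unfolding True using p by (simp only: DX_add DX_PX_power PX_adj PX_tw)
  qed
  moreover have "0 \<in> DX" unfolding DX_def using PX_zero by (auto intro!: exI[of _ 0])
  ultimately have "(\<Sum>i\<in>J. ltr y * (g i * ltr x ^ i)) \<in> DX" for J
    by (induction J rule: infinite_finite_induct) (auto simp: DX_add)
  then show ?thesis by (simp add: p sum_distrib_left)
qed

lemma span_words_DX: "p \<in> span_words X \<Longrightarrow> p \<in> DX"
proof (induction rule: span_words_induct)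
  case (monomial c w)
  have "smul c 1 \<in> PX"
    using PX_one linmapD[OF linmap_funpow[OF linmap_adj]] unfolding PX_def
    by (auto simp: span_words_smul linmapD[OF linmap_der]) (metis SI_smul)
  then have 1: "smul c 1 \<in> DX" using DX_PX_power[of "smul c 1" 0] by simp
  have "monomial w * smul c 1 \<in> DX" using monomial
  proof (induction w)
    case (Cons a w)
    then show ?case by (subst monomial_Cons) (simp only: mult.assoc, auto intro: DX_ltr_mult)
  qed (use 1 in \<open>simp add: monomial_Nil\<close>)
  then show ?case by (simp add: mult_smul)
next
  case zero
  then show ?case using DX_PX_power[OF PX_zero, of 0] by simp
qed (auto simp: DX_add)

text \<open>A vanishing sum would make a nontrivial power of q equal to 1.\<close>

lemma geometric_nz: "j > 0 \<Longrightarrow> n \<noteq> 0 \<Longrightarrow> (\<Sum>t<j. (q powi n) ^ t) \<noteq> 0"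
proof
  assume j: "j > 0" "n \<noteq> 0" and "(\<Sum>t<j. (q powi n) ^ t) = 0"
  then have "(q powi n) ^ j = 1" using power_diff_1_eq[of "q powi n" j] by simp
  then have "q powi (n * int j) = 1" by (simp add: power_int_power')
  then show False using j q_powi_eq_1 by auto
qed

lemma der_power: "\<exists>c. c \<noteq> 0 \<and> der x (ltr x ^ Suc j) = smul c (ltr x ^ j)"
proof -
  have "der x (ltr x ^ j) = smul (\<Sum>t<j. (q powi (- C x x)) ^ t) (ltr x ^ (j - 1))" for j
  proof (induction j)
    case (Suc j)
    show ?case
    proof (cases j)
      case (Suc i)
      define c where "c = (\<Sum>t<j. (q powi (- C x x)) ^ t)"
      have "der x (ltr x ^ j) = smul c (ltr x ^ i)" using Suc.IH Suc by (simp add: c_def)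
      then have "der x (ltr x ^ Suc j) = smul (1 + q powi (- C x x) * c) (ltr x ^ j)"
        by (simp add: der_ltr_mult mult_smul free.scale_left_distrib Suc)
      also have "1 + q powi (- C x x) * c = (\<Sum>t<Suc j. (q powi (- C x x)) ^ t)"
        unfolding c_def by (subst sum.lessThan_Suc_shift) (simp add: sum_distrib_left)
      finally show ?thesis by simp
    qed (simp add: der_ltr)
  qed simp
  from this[of "Suc j"] show ?thesis
    using geometric_nz[of "Suc j" "- C x x"] x by (intro exI[of _ "\<Sum>t<Suc j. (q powi (- C x x)) ^ t"]) auto
qed

lemma der_iter_lower: "i < m \<Longrightarrow> (der x ^^ m) (ltr x ^ i) = 0"
proof (induction m arbitrary: i)
  case (Suc m)
  note l = linmapD[OF linmap_funpow[OF linmap_der]]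
  show ?case
  proof (cases i)
    case 0
    then show ?thesis by (simp add: funpow_Suc_right l del: funpow.simps)
  next
    case (Suc j)
    then obtain c where "der x (ltr x ^ i) = smul c (ltr x ^ j)" using der_power by blast
    then show ?thesis using Suc Suc.IH[of j] Suc.prems
      by (simp add: funpow_Suc_right l del: funpow.simps power.simps)
  qed
qed simp

lemma der_iter_top: "\<exists>c. c \<noteq> 0 \<and> (der x ^^ m) (ltr x ^ m) = smul c 1"
proof (induction m)
  case (Suc m)
  note l = linmapD[OF linmap_funpow[OF linmap_der]]
  obtain c where c: "c \<noteq> 0" "(der x ^^ m) (ltr x ^ m) = smul c 1" using Suc by blast
  obtain c' where c': "c' \<noteq> 0" "der x (ltr x ^ Suc m) = smul c' (ltr x ^ m)" using der_power by blast
  have "(der x ^^ Suc m) (ltr x ^ Suc m) = smul (c' * c) 1"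
    by (simp add: funpow_Suc_right l c c' del: funpow.simps power.simps)
  then show ?case using c c' by (metis mult_eq_0_iff)
qed (auto intro: exI[of _ 1])

text \<open>Coefficients from \<open>PX\<close> are constants for \<open>der x\<close>, except that
  each derivation twists them once.\<close>

lemma der_iter_mult:
  "u \<in> PX \<Longrightarrow> r \<in> span_words X \<Longrightarrow> (der x ^^ m) (u * r) - tw x (- int m) u * (der x ^^ m) r \<in> SI"
proof (induction m)
  case (Suc m)
  let ?v = "tw x (- int m) u" and ?r = "(der x ^^ m) r"
  have v: "?v \<in> PX" by (rule PX_tw[OF Suc.prems(1)])
  have r: "?r \<in> span_words X" using Suc.prems(2) by (induction m) (auto simp: span_words_der)
  have "der x ((der x ^^ m) (u * r) - ?v * ?r) \<in> SI" by (rule SI_der[OF Suc.IH[OF Suc.prems]])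
  moreover have "der x ?v * ?r \<in> SI" using v r by (auto simp: PX_def intro: SI_mult_right)
  ultimately have "der x ((der x ^^ m) (u * r) - ?v * ?r) + der x ?v * ?r \<in> SI" by (rule SI_add)
  moreover have "der x ((der x ^^ m) (u * r) - ?v * ?r) + der x ?v * ?r =
      (der x ^^ Suc m) (u * r) - tw x (- int (Suc m)) u * (der x ^^ Suc m) r"
    by (simp add: linmapD[OF linmap_der] der_mult tw_add)
  ultimately show ?case by simp
qed simp

lemma SI_der_iter: "p \<in> SI \<Longrightarrow> (der x ^^ m) p \<in> SI"
  by (induction m) (auto simp: SI_der)

lemma PX_kernel:
  assumes "der x p \<in> SI" "p \<in> span_words X" shows "p \<in> PX"
proof -
  have "(\<forall>i. g i \<in> PX) \<Longrightarrow> der x (\<Sum>i<m. g i * ltr x ^ i) \<in> SI \<Longrightarrow> (\<Sum>i<m. g i * ltr x ^ i) \<in> PX" for g m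
  proof (induction m)
    case (Suc m)
    let ?s = "\<Sum>i<m. g i * ltr x ^ i"
    have g: "g i \<in> PX" "g i \<in> span_words X" for i using Suc.prems by (auto simp: PX_def)
    have pw: "ltr x ^ i \<in> span_words X" for i using x by (auto simp: ltr_power intro!: span_words_monomial)
    show ?case
    proof (cases "m = 0")
      case True then show ?thesis using g by simp
    next
      case False
      then obtain m' where m': "m = Suc m'" by (cases m) auto
      note l = linmapD[OF linmap_funpow[OF linmap_der]] linmap_sum[OF linmap_funpow[OF linmap_der]]
      have low: "(der x ^^ m) (g i * ltr x ^ i) \<in> SI" if "i < m" for i
        using der_iter_mult[OF g(1) pw, of m i i] that by (simp add: der_iter_lower)
      have "(der x ^^ m) (?s + g m * ltr x ^ m) \<in> SI"
        using SI_der_iter[of "der x (?s + g m * ltr x ^ m)" m'] Suc.prems(2)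
        by (simp add: m' funpow_Suc_right del: funpow.simps)
      then have "(der x ^^ m) (?s + g m * ltr x ^ m) - (\<Sum>i<m. (der x ^^ m) (g i * ltr x ^ i)) -
         ((der x ^^ m) (g m * ltr x ^ m) - tw x (- int m) (g m) * (der x ^^ m) (ltr x ^ m)) \<in> SI"
        using low by (intro SI_diff[OF SI_diff[OF _ SI_sum] der_iter_mult[OF g(1) pw]]) auto
      then have "tw x (- int m) (g m) * (der x ^^ m) (ltr x ^ m) \<in> SI"
        by (simp add: l)
      moreover obtain c where c: "c \<noteq> 0" "(der x ^^ m) (ltr x ^ m) = smul c 1" using der_iter_top by blast
      ultimately have "smul c (tw x (- int m) (g m)) \<in> SI" by (simp add: mult_smul)
      then have "tw x (- int m) (g m) \<in> SI" by (rule SI_smul_cancel[OF c(1)])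
      then have "g m \<in> SI" by (simp only: SI_tw_iff)
      then have gm: "g m * ltr x ^ m \<in> SI" using pw by (intro SI_mult_right)
      then have "der x (?s + g m * ltr x ^ m) - der x (g m * ltr x ^ m) \<in> SI"
        using Suc.prems(2) by (intro SI_diff[OF _ SI_der]) simp_all
      then have "?s \<in> PX" using Suc.IH Suc.prems(1) by (simp add: linmapD[OF linmap_der])
      moreover have "g m * ltr x ^ m \<in> PX" using gm g pw by (intro PX_SI span_words_mult)
      ultimately show ?thesis by (simp add: PX_add)
    qed
  qed (simp add: PX_zero)
  then show ?thesis using span_words_DX[OF assms(2)] assms(1) by (auto simp: DX_def)
qed

text \<open>The least \<open>k\<close> for which the \<open>k\<close>-th adjoint power of \<open>p\<close> lies in the ideal must be \<open>0\<close>: the right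
  derivation returns the power \<open>k\<close> to a multiple of the power \<open>k - 1\<close>, with a scalar that is nonzero when
  the weight is positive.\<close>

lemma real_weight_nonpos:
  assumes p: "p \<in> span_words X" "homogeneous \<beta> p" "der x p \<in> SI" "rder x p \<in> SI"
    and h: "(\<Sum>b\<in>#\<beta>. C x b) > 0"
  shows "p \<in> SI"
proof -
  \<comment> \<open>\<open>h k\<close> is the pairing of x with the weight of the k-th adjoint
    power, and \<open>s k\<close> collects the scalars that \<open>rder_adj\<close>
    produces.\<close>
  define h where "h k = (\<Sum>b\<in>#\<beta>. C x b) + int k * C x x" for k
  define s where "s k = (\<Sum>j<k. q powi (- h j) - q powi (h j))" for k
  have hom: "homogeneous (\<beta> + replicate_mset k x) ((adj x ^^ k) p)" for k
  proof (induction k)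
    case (Suc k)
    then show ?case using homogeneous_adj[OF Suc, of x] by simp
  qed (use p in simp)
  have tw: "tw x n ((adj x ^^ k) p) = smul (q powi (n * h k)) ((adj x ^^ k) p)" for n k
    using tw_homogeneous[OF hom, of x n k] by (simp add: h_def)
  have rd: "rder x ((adj x ^^ k) p) = smul (s k) ((adj x ^^ (k - 1)) p) + (adj x ^^ k) (rder x p)" for k
  proof (induction k)
    case (Suc k)
    have "adj x (smul (s k) ((adj x ^^ (k - 1)) p)) = smul (s k) ((adj x ^^ k) p)"
      by (cases k) (auto simp: s_def linmapD[OF linmap_adj])
    then have "rder x ((adj x ^^ Suc k) p) = smul (q powi (- h k)) ((adj x ^^ k) p) - smul (q powi (h k)) ((adj x ^^ k) p) +
        (smul (s k) ((adj x ^^ k) p) + (adj x ^^ Suc k) (rder x p))"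
      using Suc by (simp add: rder_adj tw linmapD[OF linmap_adj])
    also have "\<dots> = smul (s k + (q powi (- h k) - q powi (h k))) ((adj x ^^ k) p) + (adj x ^^ Suc k) (rder x p)"
      by (simp only: free.scale_left_distrib free.scale_left_diff_distrib add_ac)
    finally show ?case by (simp add: s_def)
  qed (simp add: s_def)
  have s_nz: "s (Suc k) \<noteq> 0" for k
  proof -
    \<comment> \<open>M = h 0 + h k. Reversing the order of summation turns -h (k - j) into h j - M,
      so \<open>s (Suc k)\<close> is q^(-M) - 1 times a multiple of a geometric sum, and neither
      factor vanishes.\<close>
    define M where "M = 2 * (\<Sum>b\<in>#\<beta>. C x b) + int k * C x x"
    have M: "M > 0" using assms(5) x by (simp add: M_def add_pos_nonneg)
    have "(\<Sum>j<Suc k. q powi (- h j)) = (\<Sum>j<Suc k. q powi (- h (Suc k - Suc j)))"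
      by (rule sum.nat_diff_reindex[symmetric])
    also have "\<dots> = (\<Sum>j<Suc k. q powi (- M) * q powi (h j))"
    proof (intro sum.cong refl)
      fix j assume "j \<in> {..<Suc k}"
      then have "- h (Suc k - Suc j) = - M + h j"
        by (simp add: h_def M_def of_nat_diff algebra_simps)
      then show "q powi (- h (Suc k - Suc j)) = q powi (- M) * q powi (h j)"
        by (simp only: power_int_add[OF disjI1[OF q_nz]])
    qed
    finally have "(\<Sum>j<Suc k. q powi (- h j)) = q powi (- M) * (\<Sum>j<Suc k. q powi (h j))"
      by (simp only: sum_distrib_left)
    then have "s (Suc k) = (q powi (- M) - 1) * (\<Sum>j<Suc k. q powi (h j))"
      by (simp only: s_def sum_subtractf left_diff_distrib mult_1)
    moreover have "(\<Sum>j<Suc k. q powi (h j)) = q powi (h 0) * (\<Sum>j<Suc k. (q powi (C x x)) ^ j)"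
      unfolding sum_distrib_left by (intro sum.cong refl)
        (simp add: h_def power_int_add[OF disjI1[OF q_nz]] power_int_power' mult.commute)
    ultimately show ?thesis
      using geometric_nz[of "Suc k" "C x x"] q_powi_eq_1[of "- M"] M x q_nz by (simp del: sum.lessThan_Suc)
  qed
  obtain K where K: "(adj x ^^ K) p \<in> SI" using PX_kernel[OF p(3,1)] by (auto simp: PX_def)
  have step: "(adj x ^^ k) p \<in> SI" if "(adj x ^^ Suc k) p \<in> SI" for k
  proof -
    have "rder x ((adj x ^^ Suc k) p) - (adj x ^^ Suc k) (rder x p) \<in> SI"
      by (intro SI_diff SI_rder that SI_adj_power p(4))
    then have "smul (s (Suc k)) ((adj x ^^ k) p) \<in> SI" unfolding rd by simp
    then show ?thesis by (rule SI_smul_cancel[OF s_nz])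
  qed
  have "(adj x ^^ (K - k)) p \<in> SI" for k
  proof (induction k)
    case (Suc k)
    then show ?case using step[of "K - Suc k"] by (cases "k < K") (auto simp: Suc_diff_Suc simp del: funpow.simps)
  qed (use K in simp)
  from this[of K] show ?thesis by simp
qed

end

subsection \<open>The radical is the Serre ideal\<close>

lemma commutator_SI: "a \<in> X \<Longrightarrow> b \<in> X \<Longrightarrow> C a b = 0 \<Longrightarrow> ltr a * ltr b - ltr b * ltr a \<in> SI"
  by (rule rels_SI) (unfold rels_def, blast)

text \<open>Pairwise orthogonal letters produce no powers of q and commute modulo the ideal, so the
  letter restored by \<open>ltr a\<close> can return to its place and each occurrence contributes
  the word once. Removing one copy from the multiset means that (a|a) = 0 is demanded of repeated
  letters only.\<close>

lemma euler:
  assumes "finite Y" "set w \<subseteq> Y" "Y \<subseteq> X" "\<forall>a\<in>#mset w. \<forall>b\<in>#mset w - {#a#}. C a b = 0"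
  shows "(\<Sum>a\<in>Y. ltr a * der a (monomial w)) - smul (of_nat (length w)) (monomial w) \<in> SI"
  using assms(2,4)
proof (induction w)
  case Nil
  show ?case by (simp add: monomial_Nil)
next
  case (Cons b w)
  have b: "b \<in> Y" "set w \<subseteq> Y" using Cons.prems by auto
  have c: "C a b = 0" if "a \<in> set w" for a
    using Cons.prems(2) that by (cases "a = b") auto
  have IH: "(\<Sum>a\<in>Y. ltr a * der a (monomial w)) - smul (of_nat (length w)) (monomial w) \<in> SI"
  proof (rule Cons.IH[OF b(2)], intro ballI)
    fix a a' assume "a \<in># mset w" "a' \<in># mset w - {#a#}"
    then have "a \<in># mset (b # w)" "a' \<in># mset (b # w) - {#a#}"
      by (auto simp: add_mset_commute dest: in_diffD)
    then show "C a a' = 0" using Cons.prems(2) by blast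
  qed
  have d: "der a (monomial (b # w)) = (if a = b then monomial w else 0) + ltr b * der a (monomial w)" for a
  proof (cases "a \<in> set w")
    case True
    then show ?thesis using c[of a] by (subst monomial_Cons) (simp add: der_ltr_mult)
  next
    case False
    then show ?thesis using dword_homogeneous(2)[of a w]
      by (subst monomial_Cons) (simp add: der_ltr_mult der_monomial)
  qed
  have "(\<Sum>a\<in>Y. ltr a * der a (monomial (b # w))) =
      (\<Sum>a\<in>Y. if a = b then monomial (b # w) else 0) + (\<Sum>a\<in>Y. ltr a * ltr b * der a (monomial w))"
    unfolding d distrib_left sum.distrib
    by (intro arg_cong2[of _ _ _ _ "(+)"] sum.cong refl) (simp add: ltr_power_mult_monomial, simp add: mult.assoc)
  also have "(\<Sum>a\<in>Y. if a = b then monomial (b # w) else 0) = monomial (b # w)"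
    using assms(1) b by simp
  finally have "(\<Sum>a\<in>Y. ltr a * der a (monomial (b # w))) - smul (of_nat (length (b # w))) (monomial (b # w)) =
     (\<Sum>a\<in>Y. (ltr a * ltr b - ltr b * ltr a) * der a (monomial w)) +
      ltr b * ((\<Sum>a\<in>Y. ltr a * der a (monomial w)) - smul (of_nat (length w)) (monomial w))"
    by (simp add: left_diff_distrib sum_subtractf right_diff_distrib sum_distrib_left mult_smul mult.assoc
       ltr_power_mult_monomial[of b w] free.scale_left_distrib)
  moreover have "(ltr a * ltr b - ltr b * ltr a) * der a (monomial w) \<in> SI" if "a \<in> Y" for a
  proof (cases "a \<in> set w")
    case True
    then have "ltr a * ltr b - ltr b * ltr a \<in> SI"
      using c that b assms(3) by (intro commutator_SI) auto
    then show ?thesis using b assms(3) by (intro SI_mult_right span_words_der span_words_monomial) auto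
  qed (simp add: der_monomial dword_homogeneous(2))
  moreover have "ltr b * ((\<Sum>a\<in>Y. ltr a * der a (monomial w)) - smul (of_nat (length w)) (monomial w)) \<in> SI"
    using b assms(3) by (intro SI_mult_left IH span_words_ltr) auto
  ultimately show ?case by (simp only: SI_add SI_sum)
qed

lemma primitive_SI:
  assumes p: "p \<in> span_words X" "homogeneous \<beta> p" "\<beta> \<noteq> {#}"
    and der: "\<And>a. a \<in> X \<Longrightarrow> der a p \<in> SI"
    and IH: "\<And>c. c \<in> span_words X \<Longrightarrow> (\<And>w. w \<in> keys c \<Longrightarrow> length (letters w) < size \<beta>) \<Longrightarrow>
        (\<And>z. z \<in> lists X \<Longrightarrow> lookup (ders z c) 0 = 0) \<Longrightarrow> c \<in> SI"
  shows "p \<in> SI"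
proof (rule ccontr)
  assume pS: "p \<notin> SI"
  then have "p \<noteq> 0" by auto
  then obtain w0 where w0: "w0 \<in> keys p" by fastforce
  define w where "w = letters w0"
  have w: "mset w = \<beta>" "set w \<subseteq> X" using p w0 by (auto simp: w_def homogeneous_def span_words_def)
  have bX: "b \<in> X" if "b \<in># \<beta>" for b using w that by auto
  have S: "antipode p + p \<in> SI" using antipode_primitive assms by blast
  have cr: "crossing w = 0" using primitive_rv(2)[OF S, of w] w p pS by simp
  define \<kappa> where "\<kappa> = (- 1) ^ length w * q powi (- crossing w)"
  have \<kappa>: "\<kappa> \<noteq> 0" using q_nz by (simp add: \<kappa>_def)
  have rv: "smul \<kappa> (rv p) + p \<in> SI" using primitive_rv(1)[OF S, of w] w p by (simp add: \<kappa>_def)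
  \<comment> \<open>Modulo the ideal \<open>rv p\<close> is a multiple of p, so the left derivatives
    control the right ones.\<close>
  have rder: "rder a p \<in> SI" if "a \<in> X" for a
  proof -
    have "der a (smul \<kappa> (rv p) + p) - der a p \<in> SI" by (intro SI_diff SI_der rv der that)
    then have "smul \<kappa> (der a (rv p)) \<in> SI" by (simp add: linmapD[OF linmap_der])
    then show ?thesis unfolding rder_def by (intro SI_rv) (use SI_smul_cancel \<kappa> in blast)
  qed
  \<comment> \<open>Summed over the letters of p this is twice \<open>crossing w\<close>, hence
    zero. All summands being nonpositive, they vanish one by one, and a real letter would make its
    own summand negative.\<close>
  define T where "T a = (\<Sum>b\<in>#\<beta>. C a b) - C a a" for a
  have T_eq: "T a = (\<Sum>b\<in>#\<beta> - {#a#}. C a b)" if "a \<in># \<beta>" for a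
    using that by (metis T_def add_diff_cancel_left' image_mset_add_mset insert_DiffM sum_mset.add_mset)
  have T: "T a \<le> 0 \<and> (C a a > 0 \<longrightarrow> T a < 0)" if a: "a \<in># \<beta>" for a
  proof (cases "C a a > 0")
    case True
    then have "(\<Sum>b\<in>#\<beta>. C a b) \<le> 0"
      using real_weight_nonpos[OF bX[OF a] True p(1,2) der[OF bX[OF a]] rder[OF bX[OF a]]] pS by force
    then show ?thesis using True by (simp add: T_def)
  next
    case False
    have "C a b \<le> 0" if "b \<in># \<beta> - {#a#}" for b
      using False off_diag_nonpos[OF bX[OF a] bX[OF in_diffD[OF that]]] by (cases "a = b") auto
    then show ?thesis using False by (simp add: T_eq[OF a] sum_mset_nonpos)
  qed
  have "(\<Sum>a\<in>#\<beta>. T a) = 0" using crossing_mset[of w] cr w by (simp add: T_def)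
  then have T0: "T a = 0" if "a \<in># \<beta>" for a using sum_mset_nonpos_zero T that by metis
  have comm: "C a b = 0" if "a \<in># \<beta>" "b \<in># \<beta> - {#a#}" for a b
  proof (rule sum_mset_nonpos_zero[OF _ _ that(2)])
    show "(\<Sum>b\<in>#\<beta> - {#a#}. C a b) = 0" using T_eq T0 that by simp
    show "C a b \<le> 0" if "b \<in># \<beta> - {#a#}" for b
      using T[OF \<open>a \<in># \<beta>\<close>] T0[OF \<open>a \<in># \<beta>\<close>] off_diag_nonpos[OF bX[OF \<open>a \<in># \<beta>\<close>] bX[OF in_diffD[OF that]]]
      by (cases "a = b") auto
  qed
  have lm: "linmap (\<lambda>p. (\<Sum>a\<in>set_mset \<beta>. ltr a * der a p) - smul (of_nat (size \<beta>)) p)"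
    by (rule linmapI) (simp_all add: linmapD[OF linmap_der] distrib_left sum.distrib free.scale_right_distrib
        mult_smul free.scale_sum_right free.scale_right_diff_distrib mult.commute)
  have "(\<Sum>a\<in>set_mset \<beta>. ltr a * der a p) - smul (of_nat (size \<beta>)) p =
     (\<Sum>v\<in>keys p. smul (lookup p v) ((\<Sum>a\<in>set_mset \<beta>. ltr a * der a (monomial (letters v))) - smul (of_nat (size \<beta>)) (monomial (letters v))))"
  proof -
    have "p = (\<Sum>v\<in>keys p. smul (lookup p v) (monomial (letters v)))"
      by (subst poly_mapping_decomp) (intro sum.cong refl, metis single_eq_smul single_word)
    then show ?thesis using linmap_sum[OF lm, of "\<lambda>v. smul (lookup p v) (monomial (letters v))" "keys p"]
      by (simp only: linmap_smul[OF lm])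
  qed
  also have "\<dots> \<in> SI"
  proof (intro SI_sum SI_smul)
    fix v assume "v \<in> keys p"
    then have v: "mset (letters v) = \<beta>" using p by (auto simp: homogeneous_def)
    then have sz: "size \<beta> = length (letters v)" by auto
    have "(\<Sum>a\<in>set_mset \<beta>. ltr a * der a (monomial (letters v))) - smul (of_nat (length (letters v))) (monomial (letters v)) \<in> SI"
      using comm bX v by (intro euler) auto
    then show "(\<Sum>a\<in>set_mset \<beta>. ltr a * der a (monomial (letters v))) - smul (of_nat (size \<beta>)) (monomial (letters v)) \<in> SI"
      by (simp only: sz)
  qed
  finally have "(\<Sum>a\<in>set_mset \<beta>. ltr a * der a p) -
     ((\<Sum>a\<in>set_mset \<beta>. ltr a * der a p) - smul (of_nat (size \<beta>)) p) \<in> SI"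
    by (rule SI_diff[OF SI_sum, rotated]) (intro SI_mult_left der span_words_ltr bX, assumption+)
  then have "smul (of_nat (size \<beta>)) p \<in> SI" by simp
  \<comment> \<open>In characteristic zero the length of p is an invertible scalar.\<close>
  then show False using pS p(3) SI_smul_cancel[of "of_nat (size \<beta>)" p] by (simp add: size_eq_0_iff_empty)
qed

text \<open>Induction on a bound for the length of the words. A functional sees only the component
  whose degree is the multiset of its word, so components are treated separately. In positive degree
  the derivatives are shorter by one, which makes \<open>primitive_SI\<close> applicable; in degree
  zero the counit is itself one of the functionals.\<close>

theorem radical_SI:
  assumes "p \<in> span_words X" "\<And>z. z \<in> lists X \<Longrightarrow> lookup (ders z p) 0 = 0"
  shows "p \<in> SI"
proof -
  have "\<And>p. p \<in> span_words X \<Longrightarrow> (\<And>w. w \<in> keys p \<Longrightarrow> length (letters w) < n) \<Longrightarrow>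
      (\<And>z. z \<in> lists X \<Longrightarrow> lookup (ders z p) 0 = 0) \<Longrightarrow> p \<in> SI" for n
  proof (induction n)
    case 0
    then have "keys p = {}" by blast
    then show ?case by simp
  next
    case (Suc n)
    have "component \<beta> p \<in> SI" if \<beta>: "\<beta> \<in> (\<lambda>w. mset (letters w)) ` keys p" for \<beta>
    proof -
      have sz: "size \<beta> \<le> n" using \<beta> Suc.prems(2) by (auto simp: less_Suc_eq_le[symmetric])
      have c: "component \<beta> p \<in> span_words X" "homogeneous \<beta> (component \<beta> p)"
        using Suc.prems(1) by (auto simp: span_words_def keys_component homogeneous_def)
      have cz: "lookup (ders z (component \<beta> p)) 0 = 0" if "z \<in> lists X" for z
        using Suc.prems(3)[OF that] by (simp add: ders_component)
      show ?thesis
      proof (cases "\<beta> = {#}")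
        case True
        have "lookup (component \<beta> p) 0 = 0" using cz[of "[]"] by simp
        moreover have "w = 0" if "w \<in> keys (component \<beta> p)" for w
          using that True by (cases w) (auto simp: keys_component zero_word_def)
        ultimately have "keys (component \<beta> p) = {}" by (metis equals0I in_keys_iff)
        then show ?thesis by simp
      next
        case False
        show ?thesis
        proof (rule primitive_SI[OF c False])
          fix a assume a: "a \<in> X"
          show "der a (component \<beta> p) \<in> SI"
          proof (cases "a \<in># \<beta>")
            case True
            show ?thesis
            proof (rule Suc.IH)
              show "der a (component \<beta> p) \<in> span_words X" by (rule span_words_der[OF c(1)])
              fix w assume "w \<in> keys (der a (component \<beta> p))"
              then have "mset (letters w) = \<beta> - {#a#}"
                using homogeneous_der(1)[OF c(2), of a] by (auto simp: homogeneous_def)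
              then have "length (letters w) = size \<beta> - 1"
                using True by (metis size_Diff_singleton size_mset)
              then show "length (letters w) < n" using sz False by (cases "size \<beta>") auto
            next
              fix z assume "z \<in> lists X"
              then show "lookup (ders z (der a (component \<beta> p))) 0 = 0"
                using cz[of "z @ [a]"] a by simp
            qed
          qed (simp add: homogeneous_der(2)[OF c(2)])
        next
          fix c assume "c \<in> span_words X" "\<And>w. w \<in> keys c \<Longrightarrow> length (letters w) < size \<beta>"
            "\<And>z. z \<in> lists X \<Longrightarrow> lookup (ders z c) 0 = 0"
          then show "c \<in> SI" using Suc.IH sz by (meson order_less_le_trans)
        qed
      qed
    qed
    then show ?case using SI_sum[of "(\<lambda>w. mset (letters w)) ` keys p" "\<lambda>\<beta>. component \<beta> p"]
      by (simp only: component_sum[symmetric])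
  qed
  from this[of p "Suc (Max ((\<lambda>w. length (letters w)) ` keys p))"] show ?thesis
    using assms by (simp add: less_Suc_eq_le)
qed

lemma SI_radical: "p \<in> SI \<Longrightarrow> lookup (ders z p) 0 = 0"
  by (intro SI_lookup_zero SI_ders)

end

section \<open>Vector spaces as records\<close>

abbreviation "scalars \<equiv> (ring_of_type_algebra :: 'k::field ring)"

lemma scalars_simps [simp]: "carrier scalars = UNIV" "(x \<oplus>\<^bsub>scalars\<^esub> y) = x + y"
  "(x \<otimes>\<^bsub>scalars\<^esub> y) = x * y" "\<one>\<^bsub>scalars\<^esub> = 1" "\<zero>\<^bsub>scalars\<^esub> = 0"
  by (auto simp: ring_of_type_algebra_def)

lemma cring_scalars: "cring scalars"
  by (rule cring_from_type_algebra)

locale vspace =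
  fixes V :: "('k::field, 'v, 'x) module_scheme" (structure)
  assumes vector_space_rec: "vector_space_rec V"

sublocale vspace \<subseteq> module "scalars :: 'k ring" V
  using vector_space_rec by (simp add: vector_space_rec_def)

context vspace begin

lemma smult_mem [simp, intro]: "x \<in> carrier V \<Longrightarrow> c \<odot> x \<in> carrier V"
  by (simp add: smult_closed)

lemma smult_add_left: "x \<in> carrier V \<Longrightarrow> (c + d) \<odot> x = c \<odot> x \<oplus> d \<odot> x"
  using smult_l_distr[of c d x] by simp

lemma smult_add_right: "x \<in> carrier V \<Longrightarrow> y \<in> carrier V \<Longrightarrow> c \<odot> (x \<oplus> y) = c \<odot> x \<oplus> c \<odot> y"
  using smult_r_distr[of c x y] by simp

lemma smult_smult: "x \<in> carrier V \<Longrightarrow> c \<odot> (d \<odot> x) = (c * d) \<odot> x"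
  using smult_assoc1[of c d x] by simp

lemma smult_1 [simp]: "x \<in> carrier V \<Longrightarrow> 1 \<odot> x = x"
  using smult_one[of x] by simp

lemma smult_0 [simp]: "x \<in> carrier V \<Longrightarrow> 0 \<odot> x = \<zero>"
  using smult_l_null[of x] by simp

lemma smult_zero [simp]: "c \<odot> \<zero> = \<zero>"
  using smult_r_null[of c] by simp

lemma smult_minus1: "x \<in> carrier V \<Longrightarrow> (- 1) \<odot> x = \<ominus> x"
  using smult_add_left[of x "- 1" 1] by (intro minus_equality[symmetric]) auto

end

lemma vector_space_recI:
  fixes V :: "('k::field, 'v, 'x) module_scheme"
  assumes "\<zero>\<^bsub>V\<^esub> \<in> carrier V"
    "\<And>x y. x \<in> carrier V \<Longrightarrow> y \<in> carrier V \<Longrightarrow> x \<oplus>\<^bsub>V\<^esub> y \<in> carrier V"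
    "\<And>c x. x \<in> carrier V \<Longrightarrow> c \<odot>\<^bsub>V\<^esub> x \<in> carrier V"
    "\<And>x y z. x \<in> carrier V \<Longrightarrow> y \<in> carrier V \<Longrightarrow> z \<in> carrier V \<Longrightarrow>
      (x \<oplus>\<^bsub>V\<^esub> y) \<oplus>\<^bsub>V\<^esub> z = x \<oplus>\<^bsub>V\<^esub> (y \<oplus>\<^bsub>V\<^esub> z)"
    "\<And>x y. x \<in> carrier V \<Longrightarrow> y \<in> carrier V \<Longrightarrow> x \<oplus>\<^bsub>V\<^esub> y = y \<oplus>\<^bsub>V\<^esub> x"
    "\<And>x. x \<in> carrier V \<Longrightarrow> \<zero>\<^bsub>V\<^esub> \<oplus>\<^bsub>V\<^esub> x = x"
    "\<And>x. x \<in> carrier V \<Longrightarrow> (- 1) \<odot>\<^bsub>V\<^esub> x \<oplus>\<^bsub>V\<^esub> x = \<zero>\<^bsub>V\<^esub>"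
    "\<And>c d x. x \<in> carrier V \<Longrightarrow> (c + d) \<odot>\<^bsub>V\<^esub> x = c \<odot>\<^bsub>V\<^esub> x \<oplus>\<^bsub>V\<^esub> d \<odot>\<^bsub>V\<^esub> x"
    "\<And>c x y. x \<in> carrier V \<Longrightarrow> y \<in> carrier V \<Longrightarrow>
      c \<odot>\<^bsub>V\<^esub> (x \<oplus>\<^bsub>V\<^esub> y) = c \<odot>\<^bsub>V\<^esub> x \<oplus>\<^bsub>V\<^esub> c \<odot>\<^bsub>V\<^esub> y"
    "\<And>c d x. x \<in> carrier V \<Longrightarrow> (c * d) \<odot>\<^bsub>V\<^esub> x = c \<odot>\<^bsub>V\<^esub> (d \<odot>\<^bsub>V\<^esub> x)"
    "\<And>x. x \<in> carrier V \<Longrightarrow> 1 \<odot>\<^bsub>V\<^esub> x = x"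
  shows "vector_space_rec V"
  unfolding vector_space_rec_def
proof (rule moduleI)
  show "abelian_group V"
  proof (rule abelian_groupI)
    show "\<exists>y\<in>carrier V. y \<oplus>\<^bsub>V\<^esub> x = \<zero>\<^bsub>V\<^esub>" if "x \<in> carrier V" for x
      using assms(3,7) that by blast
  qed (use assms in auto)
qed (use assms cring_scalars in auto)

text \<open>The next locale covers both \<^const>\<open>free_space\<close> and \<^const>\<open>free_algebra\<close>.\<close>

locale formal_space =
  fixes V :: "('k::field, 'b \<Rightarrow>\<^sub>0 'k) module"
  assumes zero_V: "\<zero>\<^bsub>V\<^esub> = 0" and add_V: "add V = (+)" and smult_V: "module.smult V = smul"
    and subspace_V: "free.subspace (carrier V)"
begin

lemma vector_space_rec_V: "vector_space_rec V"
  by (rule vector_space_recI)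
    (auto simp: zero_V add_V smult_V free.subspace_0 free.subspace_add free.subspace_scale subspace_V
      free.scale_left_distrib free.scale_right_distrib free.scale_minus_left)

lemma a_inv_V:
  assumes "x \<in> carrier V" shows "\<ominus>\<^bsub>V\<^esub> x = - x"
proof -
  interpret V: vspace V by standard (rule vector_space_rec_V)
  have "- x \<in> carrier V" using free.subspace_neg[OF subspace_V assms] .
  then show ?thesis using assms by (intro V.minus_equality) (auto simp: add_V zero_V)
qed

lemma submodule_V: "submodule N scalars V \<longleftrightarrow> N \<subseteq> carrier V \<and> free.subspace N"
proof
  interpret V: vspace V by standard (rule vector_space_rec_V)
  assume N: "submodule N scalars V"
  then interpret submodule N scalars V .
  show "N \<subseteq> carrier V \<and> free.subspace N"
  proof (intro conjI free.subspaceI)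
    show "N \<subseteq> carrier V" using subset by simp
    show "0 \<in> N" using one_closed by (simp add: zero_V)
    show "x + y \<in> N" if "x \<in> N" "y \<in> N" for x y using m_closed[OF that] by (simp add: add_V)
    show "smul c x \<in> N" if "x \<in> N" for c x using smult_closed[of c x] that by (simp add: smult_V)
  qed
next
  interpret V: vspace V by standard (rule vector_space_rec_V)
  assume N: "N \<subseteq> carrier V \<and> free.subspace N"
  then have sN: "free.subspace N" and sub: "N \<subseteq> carrier V" by auto
  show "submodule N scalars V"
  proof (rule V.submoduleI)
    show "\<ominus>\<^bsub>V\<^esub> x \<in> N" if "x \<in> N" for x
      using free.subspace_neg[OF sN that] a_inv_V[OF subsetD[OF sub that]] by simp
  qed (use sub in \<open>auto simp: zero_V add_V smult_V free.subspace_0[OF sN]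
      intro: free.subspace_add[OF sN] free.subspace_scale[OF sN]\<close>)
qed

end

locale formal_quotient = formal_space V for V :: "('k::field, 'b \<Rightarrow>\<^sub>0 'k) module" +
  fixes N :: "('b \<Rightarrow>\<^sub>0 'k) set"
  assumes subspace_N: "free.subspace N" and N_subset: "N \<subseteq> carrier V"
begin

definition coset :: "('b \<Rightarrow>\<^sub>0 'k) \<Rightarrow> ('b \<Rightarrow>\<^sub>0 'k) set" where "coset x = N +>\<^bsub>V\<^esub> x"

lemma coset_alt: "coset x = {y. y - x \<in> N}"
  by (force simp: coset_def a_r_coset_def r_coset_def add_V intro: exI[of _ "_ - x"])

lemma coset_eq: "coset x = coset y \<longleftrightarrow> x - y \<in> N"
proof
  assume "coset x = coset y"
  moreover have "x \<in> coset x" using subspace_N by (simp add: coset_alt free.subspace_0)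
  ultimately show "x - y \<in> N" by (simp add: coset_alt)
next
  assume *: "x - y \<in> N"
  show "coset x = coset y"
  proof (intro Set.set_eqI iffI)
    fix z assume "z \<in> coset x"
    then have "z - x \<in> N" by (simp add: coset_alt)
    then have "(z - x) + (x - y) \<in> N" using * by (rule free.subspace_add[OF subspace_N])
    then show "z \<in> coset y" by (simp add: coset_alt)
  next
    fix z assume "z \<in> coset y"
    then have "z - y \<in> N" by (simp add: coset_alt)
    then have "(z - y) - (x - y) \<in> N" using * by (rule free.subspace_diff[OF subspace_N])
    then show "z \<in> coset x" by (simp add: coset_alt)
  qed
qed

lemma coset_self: "x \<in> coset x" using subspace_N by (simp add: coset_alt free.subspace_0)

lemma coset_memD: "y \<in> coset x \<Longrightarrow> coset y = coset x"
  by (subst coset_eq) (simp add: coset_alt)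

abbreviation "Q \<equiv> quotient_space V N"

lemma carrier_Q: "carrier Q = coset ` carrier V"
  by (auto simp: quotient_space_def ring.defs module.defs FactRing_def A_RCOSETS_def RCOSETS_def coset_def a_r_coset_def)

lemma zero_Q: "\<zero>\<^bsub>Q\<^esub> = coset 0"
  by (simp add: quotient_space_def ring.defs module.defs FactRing_def coset_alt)

lemma add_Q: "coset x \<oplus>\<^bsub>Q\<^esub> coset y = coset (x + y)"
proof -
  have "coset x \<oplus>\<^bsub>Q\<^esub> coset y = {u + v | u v. u \<in> coset x \<and> v \<in> coset y}"
    by (auto simp: quotient_space_def ring.defs module.defs FactRing_def set_add_def set_mult_def add_V)
  also have "\<dots> = coset (x + y)"
  proof (intro Set.set_eqI iffI)
    fix z assume "z \<in> {u + v | u v. u \<in> coset x \<and> v \<in> coset y}"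
    then obtain u v where "z = u + v" "u - x \<in> N" "v - y \<in> N" by (auto simp: coset_alt)
    then show "z \<in> coset (x + y)"
      using free.subspace_add[OF subspace_N, of "u - x" "v - y"] by (simp add: coset_alt algebra_simps)
  next
    fix z assume "z \<in> coset (x + y)"
    then have "z = (z - y) + y" "z - y \<in> coset x" by (auto simp: coset_alt algebra_simps)
    then show "z \<in> {u + v | u v. u \<in> coset x \<and> v \<in> coset y}" using coset_self by blast
  qed
  finally show ?thesis .
qed

lemma smult_Q: "c \<odot>\<^bsub>Q\<^esub> coset x = coset (smul c x)"
proof -
  have "c \<odot>\<^bsub>Q\<^esub> coset x = (\<Union>y\<in>coset x. coset (smul c y))"
    by (simp add: quotient_space_def ring.defs module.defs smult_V coset_def)
  also have "\<dots> = coset (smul c x)"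
  proof -
    have "coset (smul c y) = coset (smul c x)" if "y \<in> coset x" for y
      using that free.subspace_scale[OF subspace_N, of "y - x" c]
      by (subst coset_eq) (simp add: coset_alt free.scale_right_diff_distrib)
    then show ?thesis using coset_self by blast
  qed
  finally show ?thesis .
qed

lemma vector_space_rec_Q: "vector_space_rec Q"
proof (rule vector_space_recI)
  note sp = free.subspace_0[OF subspace_V] free.subspace_add[OF subspace_V] free.subspace_scale[OF subspace_V]
  show "\<zero>\<^bsub>Q\<^esub> \<in> carrier Q" by (simp add: carrier_Q zero_Q sp)
qed (auto simp: carrier_Q zero_Q add_Q smult_Q free.subspace_0[OF subspace_V] free.subspace_add[OF subspace_V]
    free.subspace_scale[OF subspace_V] add_ac free.scale_left_distrib free.scale_right_distrib free.scale_minus_left)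

lemma finsum_coset:
  assumes "finite A" "\<And>i. i \<in> A \<Longrightarrow> g i \<in> carrier V"
  shows "(\<Oplus>\<^bsub>Q\<^esub>i\<in>A. coset (g i)) = coset (\<Sum>i\<in>A. g i)"
proof -
  interpret Q: vspace Q by standard (rule vector_space_rec_Q)
  show ?thesis using assms
  proof (induction A)
    case (insert i A)
    have "(\<lambda>i. coset (g i)) \<in> A \<rightarrow> carrier Q" "coset (g i) \<in> carrier Q"
      using insert.prems by (auto simp: carrier_Q)
    then show ?case using insert by (simp add: Q.finsum_insert add_Q)
  qed (simp add: zero_Q)
qed

end

lemma formal_space_free_algebra: "formal_space (free_algebra S)"
  by standard (auto simp: free_algebra_def free.subspace_def dest: subsetD[OF Poly_Mapping.keys_add] subsetD[OF keys_smul])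

lemma formal_space_free_space: "formal_space (free_space S)"
  by standard (auto simp: free_space_def free.subspace_def dest: subsetD[OF Poly_Mapping.keys_add] subsetD[OF keys_smul])

lemma carrier_free_algebra: "carrier (free_algebra S) = span_words S"
  by (simp add: free_algebra_def span_words_def)

lemma ring_free_algebra: "ring (free_algebra S)"
proof (rule ringI)
  interpret V: formal_space "free_algebra S" by (rule formal_space_free_algebra)
  interpret V: vspace "free_algebra S" by standard (rule V.vector_space_rec_V)
  show "abelian_group (free_algebra S)" by (rule V.abelian_group_axioms)
  show "Group.monoid (free_algebra S)"
    by standard (auto simp: carrier_free_algebra span_words_mult span_words_one, auto simp: free_algebra_def mult.assoc
       span_words_def[symmetric] intro: span_words_mult span_words_one)
qed (auto simp: free_algebra_def algebra_simps)

lemma quotient_space_mult: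
  assumes "ideal J (free_algebra S)" "x \<in> span_words S" "y \<in> span_words S"
  shows "(J +>\<^bsub>free_algebra S\<^esub> x) \<otimes>\<^bsub>quotient_space (free_algebra S) J\<^esub> (J +>\<^bsub>free_algebra S\<^esub> y)
    = J +>\<^bsub>free_algebra S\<^esub> (x * y)"
  using ideal.rcoset_mult_add[OF assms(1), of x y] assms(2,3)
  by (simp add: quotient_space_def ring.defs module.defs FactRing_def carrier_free_algebra)
    (simp add: free_algebra_def)

context cartan_letters begin

subsection \<open>The dual of the Serre ideal\<close>

lemma bil_SI: "r \<in> SI \<Longrightarrow> bil p r = 0"
  unfolding bil_def lin_def by (simp add: lookup_sum lookup_smul SI_radical)

text \<open>Linear extension in the word turns r into a differential operator. Its order of
  composition is opposite to the one in \<open>bil\<close>, whence the reversal; ideal membership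
  can now be tested through the form.\<close>

lemma bil_rv: "bil (rv (monomial z * r)) p = lookup (ders z (lin (\<lambda>w. ders (letters w) p) r)) 0"
proof (induction r rule: poly_mapping_induct)
  case (single w c)
  have *: "single w c = smul c (monomial (letters w))"
    using single_eq_smul[of w c] by (simp add: single_word)
  have "bil (rv (monomial z * monomial v)) p = lookup (ders z (ders v p)) 0" for v
    by (simp add: monomial_append[symmetric] rv_monomial bil_monomial)
  moreover have "lin (\<lambda>w. ders (letters w) p) (monomial v) = ders v p" for v by (simp add: monomial_def)
  ultimately show ?case unfolding *
    by (simp add: mult_smul linmapD[OF linmap_rv] linmapD[OF linmap_lin] linmapD[OF linmap_ders] bil_linear_left lookup_smul)
qed (auto simp: distrib_left linmapD[OF linmap_rv] linmapD[OF linmap_lin] linmapD[OF linmap_ders] bil_linear_left lookup_add)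

lemma span_words_lin:
  assumes "\<And>w. w \<in> lists X \<Longrightarrow> f w \<in> span_words Y" "r \<in> span_words X"
  shows "lin (\<lambda>w. f (letters w)) r \<in> span_words Y"
proof (rule linmap_span_words[OF linmap_lin _ assms(2)])
  fix w assume "w \<in> lists X"
  moreover have "lin (\<lambda>w. f (letters w)) (monomial w) = f w" by (simp add: monomial_def)
  ultimately show "lin (\<lambda>w. f (letters w)) (monomial w) \<in> span_words Y" by (simp only: assms(1))
qed

text \<open>The relations of the \<open>f'\<close> also hold for the skew derivations, because the form is symmetric.\<close>

lemma ders_SI:
  assumes "r \<in> SI" "r \<in> span_words X" "p \<in> span_words X"
  shows "lin (\<lambda>w. ders (letters w) p) r \<in> SI"
proof (rule radical_SI)
  show "lin (\<lambda>w. ders (letters w) p) r \<in> span_words X"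
    by (rule span_words_lin[OF _ assms(2)]) (rule span_words_ders[OF assms(3)])
  fix z assume "z \<in> lists X"
  then have "rv (monomial z * r) \<in> SI" using assms by (intro SI_rv SI_mult_monomial_left)
  then show "lookup (ders z (lin (\<lambda>w. ders (letters w) p) r)) 0 = 0"
    unfolding bil_rv[symmetric] by (subst bil_sym) (rule bil_SI)
qed

text \<open>A faithfulness statement for differential operators: the given values are the pairings
  of \<open>rv r\<close> with words, so by symmetry \<open>rv r\<close> lies in the radical, and the
  ideal is stable under reversal.\<close>

lemma SI_of_ders:
  assumes "r \<in> span_words X"
    and "\<And>v. v \<in> lists X \<Longrightarrow> lookup (lin (\<lambda>w. ders (letters w) (monomial v)) r) 0 = 0"
  shows "r \<in> SI"
proof -
  have "rv r \<in> SI"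
  proof (rule radical_SI)
    show "rv r \<in> span_words X" by (rule span_words_rv[OF assms(1)])
    fix z assume "z \<in> lists X"
    then have z: "rev z \<in> lists X" by auto
    have "lookup (ders z (rv r)) 0 = bil (monomial (rev z)) (rv r)" by (simp add: bil_monomial)
    also have "\<dots> = bil (rv (monomial [] * r)) (monomial (rev z))" by (simp add: bil_sym monomial_Nil)
    also have "\<dots> = 0" unfolding bil_rv by (simp add: assms(2)[OF z])
    finally show "lookup (ders z (rv r)) 0 = 0" .
  qed
  then have "rv (rv r) \<in> SI" by (rule SI_rv)
  then show ?thesis by simp
qed

end

section \<open>The q-boson algebra and its action on the free algebra\<close>

locale q_boson = q_boson_data I a s m q
  for I :: "'i set" and a s m and q :: "'k::field_char_0" +
  assumes q_nonzero: "q \<noteq> 0" and q_transcendental: "\<not> algebraic q"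
begin

text \<open>A root of unity is a root of X^n - 1, which has integer coefficients.\<close>

lemma q_pow_neq_1: "n > 0 \<Longrightarrow> q ^ n \<noteq> 1"
proof
  assume n: "n > 0" "q ^ n = 1"
  let ?p = "Polynomial.monom 1 n - 1 :: 'k poly"
  have "coeff ?p i \<in> \<int>" for i by (auto simp: one_pCons coeff_pCons split: nat.split)
  moreover have "?p \<noteq> 0"
  proof
    assume "?p = 0"
    then have "coeff ?p n = 0" by simp
    then show False using n by (auto simp: one_pCons coeff_pCons split: nat.splits)
  qed
  moreover have "poly ?p q = 0" using n by (simp add: poly_monom)
  ultimately show False using q_transcendental algebraicI[of ?p q] by blast
qed

definition "FL = (\<lambda>(i, k). F i k) ` idx"
definition "EL = (\<lambda>(i, k). E i k) ` idx"
definition "GL = EL \<union> FL"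

lemma FL_iff [simp]: "F i k \<in> FL \<longleftrightarrow> (i, k) \<in> idx" "E i k \<notin> FL"
  and EL_iff [simp]: "E i k \<in> EL \<longleftrightarrow> (i, k) \<in> idx" "F i k \<notin> EL"
  and GL_iff [simp]: "F i k \<in> GL \<longleftrightarrow> (i, k) \<in> idx" "E i k \<in> GL \<longleftrightarrow> (i, k) \<in> idx"
  by (force simp: FL_def EL_def GL_def)+

lemma FL_E: "x \<in> FL \<Longrightarrow> (\<And>i k. x = F i k \<Longrightarrow> (i, k) \<in> idx \<Longrightarrow> P) \<Longrightarrow> P"
  by (cases x) auto

lemma FL_GL: "FL \<subseteq> GL" by (auto simp: GL_def)

lemma span_FL_GL: "p \<in> span_words FL \<Longrightarrow> p \<in> span_words GL"
  using FL_GL by (auto simp: span_words_def)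

lemma idx_I: "(i, k) \<in> idx \<Longrightarrow> i \<in> I" by (simp add: idx_def)

text \<open>Off the index set the form is set to \<open>0\<close>, which makes it symmetric on the whole type.\<close>

fun lform :: "'i boson_gen \<Rightarrow> 'i boson_gen \<Rightarrow> int" where
  "lform (F i k) (F j l) = (if i \<in> I \<and> j \<in> I then int (s i) * a i j else 0)"
| "lform _ _ = 0"

fun ldeg :: "'i boson_gen \<Rightarrow> nat" where
  "ldeg (F i k) = s i" | "ldeg (E i k) = 0"

lemma lform_real: "(i, k) \<in> idx \<Longrightarrow> lform (F i k) (F i k) > 0 \<longleftrightarrow> a i i = 2"
  using diag[of i] s_pos[of i] idx_I[of i k] by (auto simp: zero_less_mult_iff)

lemma idx_real: "(i, k) \<in> idx \<Longrightarrow> (i, l) \<in> idx \<Longrightarrow> a i i = 2 \<Longrightarrow> k = l"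
  using m_real[of i] by (auto simp: idx_def)

sublocale L: cartan_letters lform q FL ldeg
proof
  show "lform x y = lform y x" for x y
    using symmetrizable by (cases "(x, y)" rule: lform.cases) auto
  show "q \<noteq> 0" by (rule q_nonzero)
  show "n > 0 \<Longrightarrow> q ^ n \<noteq> 1" for n by (rule q_pow_neq_1)
next
  fix x assume x: "x \<in> FL" "0 < lform x x"
  then obtain i k where i: "x = F i k" "(i, k) \<in> idx" by (auto elim: FL_E)
  then show "lform x x = 2 * int (ldeg x)" using x lform_real idx_I by simp
next
  fix x y assume xy: "x \<in> FL" "y \<in> FL" "x \<noteq> y"
  then obtain i k j l where i: "x = F i k" "(i, k) \<in> idx" "y = F j l" "(j, l) \<in> idx" by (auto elim!: FL_E)
  have "a i j \<le> 0"
  proof (cases "i = j")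
    case True
    \<comment> \<open>Two copies of a real index would have positive mutual form; its charge is 1,
      so distinct letters with equal index are imaginary.\<close>
    then have "a i i \<noteq> 2" using i xy idx_real by auto
    then show ?thesis using True diag[of i] idx_I i by auto
  qed (use off_diag idx_I i in auto)
  then show "lform x y \<le> 0" using i idx_I by (simp add: mult_nonneg_nonpos)
next
  fix x y assume "x \<in> FL" "y \<in> FL"
  then obtain i k j l where "x = F i k" "(i, k) \<in> idx" "y = F j l" "(j, l) \<in> idx" by (auto elim!: FL_E)
  then show "int (ldeg x) dvd lform x y" by simp
qed

lemma qq_lform: "i \<in> I \<Longrightarrow> j \<in> I \<Longrightarrow> qq i j = q powi (- lform (F i k) (F j l))"
  by (simp add: qq_def)

lemma serre_F:
  assumes "(i, k) \<in> idx" "(j, l) \<in> idx"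
  shows "serre F i k j l = L.serre_rel (F i k) (F j l)"
proof -
  have "L.serre_exp (F i k) (F j l) = nat (1 - a i j)"
    using idx_I assms s_pos by (simp add: L.serre_exp_def)
  then show ?thesis by (simp add: serre_def L.serre_rel_def Let_def qi_def)
qed

section \<open>From words in the f' to words in the e\<close>

fun dual :: "'i boson_gen \<Rightarrow> 'i boson_gen" where
  "dual (E i k) = F i k" | "dual (F i k) = E i k"

definition to_e :: "('i boson_gen word \<Rightarrow>\<^sub>0 'k) \<Rightarrow> ('i boson_gen word \<Rightarrow>\<^sub>0 'k)" where
  "to_e = lin (\<lambda>w. monomial (map dual (letters w)))"

lemma linmap_to_e: "linmap to_e" by (simp add: to_e_def linmap_lin)

lemma to_e_monomial: "to_e (monomial w) = monomial (map dual w)"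
  by (simp add: to_e_def monomial_def)

lemma to_e_mult: "to_e (p * r) = to_e p * to_e r"
proof -
  have "to_e (monomial u * r) = to_e (monomial u) * to_e r" for u
  proof (rule linmap_eqI_monomial[of "\<lambda>r. to_e (monomial u * r)" "\<lambda>r. to_e (monomial u) * to_e r"])
    show "to_e (monomial u * monomial v) = to_e (monomial u) * to_e (monomial v)" for v
      by (simp add: monomial_append[symmetric] to_e_monomial)
  qed (intro linmap_comp[OF linmap_to_e] linmap_intros linmap_to_e)+
  then show ?thesis
    by (rule linmap_eqI_monomial[of "\<lambda>p. to_e (p * r)" "\<lambda>p. to_e p * to_e r", rotated -1])
      (intro linmap_comp[OF linmap_to_e] linmap_intros linmap_to_e)+
qed

lemma to_e_power: "to_e (ltr x ^ n) = ltr (dual x) ^ n"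
  by (simp add: ltr_power to_e_monomial)

lemma serre_E: "serre E i k j l = to_e (serre F i k j l)"
  by (simp add: serre_def Let_def linmap_sum[OF linmap_to_e] linmapD[OF linmap_to_e] to_e_mult to_e_power to_e_monomial)

lemma rels_cases:
  "r \<in> L.rels \<longleftrightarrow> (\<exists>i k j l. (i, k) \<in> idx \<and> (j, l) \<in> idx \<and> a i i = 2 \<and> i \<noteq> j \<and> r = serre F i k j l) \<or>
    (\<exists>i k j l. (i, k) \<in> idx \<and> (j, l) \<in> idx \<and> a i j = 0 \<and> r = monomial [F i k, F j l] - monomial [F j l, F i k])"
    (is "_ \<longleftrightarrow> ?S \<or> ?C")
proof
  assume "r \<in> L.rels"
  then consider (S) x y where "x \<in> FL" "y \<in> FL" "0 < lform x x" "x \<noteq> y" "r = L.serre_rel x y"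
    | (C) x y where "x \<in> FL" "y \<in> FL" "lform x y = 0" "r = ltr x * ltr y - ltr y * ltr x"
    unfolding L.rels_def by blast
  then show "?S \<or> ?C"
  proof cases
    case S
    obtain i k j l where i: "x = F i k" "(i, k) \<in> idx" "y = F j l" "(j, l) \<in> idx"
      using S(1,2) by (auto elim!: FL_E)
    then have "a i i = 2" using S lform_real by metis
    moreover from this have "i \<noteq> j" using i S(4) idx_real by auto
    ultimately show ?thesis using i S(5) serre_F by metis
  next
    case C
    obtain i k j l where i: "x = F i k" "(i, k) \<in> idx" "y = F j l" "(j, l) \<in> idx"
      using C(1,2) by (auto elim!: FL_E)
    then have "a i j = 0" using C(3) idx_I s_pos[of i] by simp
    then show ?thesis using i C(4) by (metis ltr_power_mult_monomial)
  qed
next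
  assume "?S \<or> ?C"
  then show "r \<in> L.rels"
  proof
    assume ?S
    then obtain i k j l where i: "(i, k) \<in> idx" "(j, l) \<in> idx" "a i i = 2" "i \<noteq> j" "r = serre F i k j l" by blast
    then have "F i k \<in> FL" "F j l \<in> FL" "0 < lform (F i k) (F i k)" "F i k \<noteq> F j l" "r = L.serre_rel (F i k) (F j l)"
      using lform_real serre_F by auto
    then show ?thesis unfolding L.rels_def by blast
  next
    assume ?C
    then obtain i k j l where i: "(i, k) \<in> idx" "(j, l) \<in> idx" "a i j = 0"
      "r = monomial [F i k, F j l] - monomial [F j l, F i k]" by blast
    then have "F i k \<in> FL" "F j l \<in> FL" "lform (F i k) (F j l) = 0"
      "r = ltr (F i k) * ltr (F j l) - ltr (F j l) * ltr (F i k)"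
      using idx_I by (auto simp: ltr_power_mult_monomial)
    then show ?thesis unfolding L.rels_def by blast
  qed
qed

text \<open>The relations among the e are the \<open>to_e\<close>-images of those among the f', so
  the one ideal \<open>L.SI\<close> governs both halves of the algebra.\<close>

lemma relations_eq: "relations = L.rels \<union> to_e ` L.rels \<union>
     {monomial [E i k, F j l] - smul (qq i j) (monomial [F j l, E i k])
        - (if i = j \<and> k = l then 1 else 0) | i k j l. (i, k) \<in> idx \<and> (j, l) \<in> idx}" (is "_ = _ \<union> ?M")
proof -
  have c: "to_e (monomial [F i k, F j l] - monomial [F j l, F i k]) = monomial [E i k, E j l] - monomial [E j l, E i k]" for i k j l
    by (simp add: linmapD[OF linmap_to_e] to_e_monomial)
  have "r \<in> relations \<longleftrightarrow> r \<in> L.rels \<or> r \<in> to_e ` L.rels \<or> r \<in> ?M" for r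
  proof
    assume "r \<in> relations"
    then consider (S) X i k j l where "r = serre X i k j l" "X \<in> {E, F}" "(i, k) \<in> idx" "(j, l) \<in> idx" "a i i = 2" "i \<noteq> j"
      | (C) X i k j l where "r = monomial [X i k, X j l] - monomial [X j l, X i k]" "X \<in> {E, F}" "(i, k) \<in> idx" "(j, l) \<in> idx" "a i j = 0"
      | (M) "r \<in> ?M"
      unfolding relations_def by blast
    then show "r \<in> L.rels \<or> r \<in> to_e ` L.rels \<or> r \<in> ?M"
    proof cases
      case S
      then have "serre F i k j l \<in> L.rels" unfolding rels_cases by blast
      then show ?thesis using S(1,2) serre_E by auto
    next
      case C
      then have "monomial [F i k, F j l] - monomial [F j l, F i k] \<in> L.rels" unfolding rels_cases by blast
      then show ?thesis using C(1,2) c[of i k j l, symmetric] by auto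
    qed simp
  next
    have F: "r \<in> relations \<and> to_e r \<in> relations" if "r \<in> L.rels" for r
      using that unfolding rels_cases
    proof (elim disjE exE conjE)
      fix i k j l assume *: "(i, k) \<in> idx" "(j, l) \<in> idx" "a i i = 2" "i \<noteq> j" and r: "r = serre F i k j l"
      have "serre F i k j l \<in> relations" "serre E i k j l \<in> relations"
        using * unfolding relations_def by blast+
      then show ?thesis using r serre_E by simp
    next
      fix i k j l assume *: "(i, k) \<in> idx" "(j, l) \<in> idx" "a i j = 0" and r: "r = monomial [F i k, F j l] - monomial [F j l, F i k]"
      have "monomial [F i k, F j l] - monomial [F j l, F i k] \<in> relations"
        "monomial [E i k, E j l] - monomial [E j l, E i k] \<in> relations"
        using * unfolding relations_def by blast+
      then show ?thesis using r c by simp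
    qed
    assume "r \<in> L.rels \<or> r \<in> to_e ` L.rels \<or> r \<in> ?M"
    then show "r \<in> relations" using F unfolding relations_def by blast
  qed
  then show ?thesis by blast
qed

lemma span_words_serre: "x \<in> FL \<Longrightarrow> y \<in> FL \<Longrightarrow> L.serre_rel x y \<in> span_words FL"
  unfolding L.serre_rel_def ltr_power
  by (intro span_words_sum span_words_smul span_words_mult span_words_monomial) auto

lemma span_words_rels: "r \<in> L.rels \<Longrightarrow> r \<in> span_words FL"
  unfolding L.rels_def
  by (auto intro!: span_words_serre span_words_diff span_words_mult span_words_monomial)

lemma span_words_to_e: "r \<in> span_words FL \<Longrightarrow> to_e r \<in> span_words EL"
proof (rule linmap_span_words[OF linmap_to_e])
  fix w assume "w \<in> lists FL"
  then have "map dual w \<in> lists EL" by (induction w) (auto elim: FL_E)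
  then show "to_e (monomial w) \<in> span_words EL" by (simp only: to_e_monomial span_words_monomial)
qed

lemma span_EL_GL: "p \<in> span_words EL \<Longrightarrow> p \<in> span_words GL"
  by (auto simp: span_words_def GL_def)

lemma free_boson_eq: "free_boson = free_algebra GL"
  by (simp add: free_boson_def GL_def EL_def FL_def)

lemma carrier_free_boson: "carrier free_boson = span_words GL"
  by (simp add: free_boson_eq carrier_free_algebra)

lemma ring_free_boson: "ring free_boson"
  by (simp add: free_boson_eq ring_free_algebra)

lemma relations_carrier: "relations \<subseteq> span_words GL"
proof -
  have "monomial [E i k, F j l] - smul (qq i j) (monomial [F j l, E i k]) - (if i = j \<and> k = l then 1 else 0) \<in> span_words GL"
    if "(i, k) \<in> idx" "(j, l) \<in> idx" for i k j l
    using that by (auto intro!: span_words_diff span_words_smul span_words_monomial span_words_one span_words_zero)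
  then show ?thesis unfolding relations_eq
    using span_words_rels span_FL_GL span_words_to_e span_EL_GL by blast
qed

lemma ideal_relations: "ideal relation_ideal free_boson"
  unfolding relation_ideal_def
  by (rule ring.genideal_ideal[OF ring_free_boson]) (simp add: carrier_free_boson relations_carrier)

lemma relations_RI: "relations \<subseteq> relation_ideal"
  unfolding relation_ideal_def
  by (rule ring.genideal_self[OF ring_free_boson]) (simp add: carrier_free_boson relations_carrier)

lemma free_boson_ops: "x \<otimes>\<^bsub>free_boson\<^esub> y = x * y" "\<one>\<^bsub>free_boson\<^esub> = 1" "x \<oplus>\<^bsub>free_boson\<^esub> y = x + y" "\<zero>\<^bsub>free_boson\<^esub> = 0"
  by (simp_all add: free_boson_eq free_algebra_def)

lemma RI_mult_left: "x \<in> relation_ideal \<Longrightarrow> y \<in> span_words GL \<Longrightarrow> y * x \<in> relation_ideal"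
  using ideal.I_l_closed[OF ideal_relations, of x y] by (simp add: carrier_free_boson free_boson_ops)

lemma RI_mult_right: "x \<in> relation_ideal \<Longrightarrow> y \<in> span_words GL \<Longrightarrow> x * y \<in> relation_ideal"
  using ideal.I_r_closed[OF ideal_relations, of x y] by (simp add: carrier_free_boson free_boson_ops)

sublocale B: formal_quotient free_boson relation_ideal
  rewrites "B.coset = cls" and "quotient_space free_boson relation_ideal = boson"
proof -
  interpret additive_subgroup relation_ideal free_boson
    by (rule ideal.axioms(1)[OF ideal_relations])
  interpret formal_space free_boson unfolding free_boson_eq by (rule formal_space_free_algebra)
  show fq: "formal_quotient free_boson relation_ideal"
  proof
    show sub: "relation_ideal \<subseteq> carrier free_boson" by (rule a_subset)
    show "free.subspace relation_ideal"
    proof (rule free.subspaceI)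
      show "0 \<in> relation_ideal" using zero_closed by (simp add: free_boson_ops)
      show "x + y \<in> relation_ideal" if "x \<in> relation_ideal" "y \<in> relation_ideal" for x y
        using a_closed[OF that] by (simp add: free_boson_ops)
      show "smul c x \<in> relation_ideal" if "x \<in> relation_ideal" for c x
        using RI_mult_left[OF that, of "smul c 1"] by (simp add: span_words_smul span_words_one smul_mult)
    qed
  qed
  show "formal_quotient.coset free_boson relation_ideal = cls"
    by (rule ext) (simp add: formal_quotient.coset_def[OF fq] cls_def)
  show "quotient_space free_boson relation_ideal = boson" by (simp add: boson_def)
qed

lemmas RI_subspace = B.subspace_N

lemma rels_RI:
  assumes "r \<in> L.rels" shows "r \<in> relation_ideal" "to_e r \<in> relation_ideal"
proof -
  show "r \<in> relation_ideal"
    by (rule subsetD[OF relations_RI], unfold relations_eq) (rule UnI1, rule UnI1, rule assms)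
  show "to_e r \<in> relation_ideal"
    by (rule subsetD[OF relations_RI], unfold relations_eq) (rule UnI1, rule UnI2, rule imageI, rule assms)
qed

lemma SI_RI:
  assumes "p \<in> L.SI" shows "p \<in> relation_ideal"
proof (rule linmap_span_subset[OF linmap_id _ RI_subspace assms[unfolded L.SI_def]])
    fix b assume "b \<in> {monomial u * r * monomial v | u r v. u \<in> lists FL \<and> v \<in> lists FL \<and> r \<in> L.rels}"
    then obtain u r v where b: "b = monomial u * r * monomial v" "u \<in> lists FL" "v \<in> lists FL" "r \<in> L.rels" by blast
    have "r \<in> relation_ideal" by (rule rels_RI(1)[OF b(4)])
    then show "b \<in> relation_ideal" unfolding b(1)
      by (intro RI_mult_left RI_mult_right span_FL_GL span_words_monomial b)
qed

lemma to_e_SI: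
  assumes "p \<in> L.SI" shows "to_e p \<in> relation_ideal"
proof (rule linmap_span_subset[OF linmap_to_e _ RI_subspace assms[unfolded L.SI_def]])
  fix b assume "b \<in> {monomial u * r * monomial v | u r v. u \<in> lists FL \<and> v \<in> lists FL \<and> r \<in> L.rels}"
  then obtain u r v where b: "b = monomial u * r * monomial v" "u \<in> lists FL" "v \<in> lists FL" "r \<in> L.rels" by blast
  have "to_e r \<in> relation_ideal" by (rule rels_RI(2)[OF b(4)])
  then show "to_e b \<in> relation_ideal" unfolding b(1) to_e_mult
    by (intro RI_mult_left RI_mult_right span_EL_GL span_words_to_e span_words_monomial b)
qed

lemma mixed_RI: "(i, k) \<in> idx \<Longrightarrow> (j, l) \<in> idx \<Longrightarrow>
    ltr (E i k) * ltr (F j l) - smul (qq i j) (ltr (F j l) * ltr (E i k)) - (if i = j \<and> k = l then 1 else 0) \<in> relation_ideal"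
  unfolding ltr_power_mult_monomial using relations_RI unfolding relations_eq by blast

section \<open>The representation by multiplications and skew derivations\<close>

fun gact :: "'i boson_gen \<Rightarrow> ('i boson_gen word \<Rightarrow>\<^sub>0 'k) \<Rightarrow> ('i boson_gen word \<Rightarrow>\<^sub>0 'k)" where
  "gact (E i k) p = L.der (F i k) p"
| "gact (F i k) p = ltr (F i k) * p"

text \<open>Defined on the free algebra rather than on R, since the e- and f'-relations are
  satisfied only modulo \<open>L.SI\<close>; it descends to classes afterwards.\<close>

definition rho :: "('i boson_gen word \<Rightarrow>\<^sub>0 'k) \<Rightarrow> ('i boson_gen word \<Rightarrow>\<^sub>0 'k) \<Rightarrow> ('i boson_gen word \<Rightarrow>\<^sub>0 'k)" where
  "rho r p = lin (\<lambda>w. foldr gact (letters w) p) r"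

lemma linmap_rho_left: "linmap (\<lambda>r. rho r p)" unfolding rho_def by (rule linmap_lin)

lemma linmap_gact: "linmap (gact x)"
proof -
  have "gact x = (case x of E i k \<Rightarrow> L.der (F i k) | F i k \<Rightarrow> (\<lambda>p. ltr (F i k) * p))"
    by (cases x) auto
  then show ?thesis by (cases x) (auto intro: L.linmap_der linmap_intros)
qed

lemma linmap_foldr_gact: "linmap (foldr gact w)"
proof (induction w)
  case (Cons x w)
  then show ?case using linmap_comp[OF linmap_gact Cons, of x] by (simp add: o_def)
qed (simp add: id_def linmap_id)

lemma linmap_rho_right: "linmap (rho r)"
proof (rule linmapI)
  note l = linmapD[OF linmap_foldr_gact]
  show "rho r (p + p') = rho r p + rho r p'" for p p'
    by (simp add: rho_def lin_def l free.scale_right_distrib sum.distrib)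
  show "rho r (smul c p) = smul c (rho r p)" for c p
    by (simp add: rho_def lin_def l free.scale_sum_right) (simp add: mult.commute)
qed

lemma rho_monomial: "rho (monomial w) p = foldr gact w p" by (simp add: rho_def monomial_def)

lemma rho_one: "rho 1 p = p" using rho_monomial[of "[]"] by (simp add: monomial_Nil)

lemma rho_mult: "rho (r * r') p = rho r (rho r' p)"
proof -
  have "rho (monomial u * r') p = rho (monomial u) (rho r' p)" for u
  proof (rule linmap_eqI_monomial[of "\<lambda>r'. rho (monomial u * r') p" "\<lambda>r'. rho (monomial u) (rho r' p)"])
    show "rho (monomial u * monomial v) p = rho (monomial u) (rho (monomial v) p)" for v
      by (simp add: monomial_append[symmetric] rho_monomial)
  qed (intro linmap_comp[OF linmap_rho_left] linmap_comp[OF linmap_rho_right] linmap_intros linmap_rho_left)+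
  then show ?thesis
    by (rule linmap_eqI_monomial[of "\<lambda>r. rho (r * r') p" "\<lambda>r. rho r (rho r' p)", rotated -1])
      (intro linmap_comp[OF linmap_rho_left] linmap_intros linmap_rho_left)+
qed

lemma rho_FL: "r \<in> span_words FL \<Longrightarrow> rho r p = r * p"
proof (induction rule: span_words_induct)
  case (monomial c w)
  then have "foldr gact w p = monomial w * p"
  proof (induction w)
    case (Cons x w)
    then show ?case by (subst monomial_Cons) (auto elim!: FL_E simp: mult.assoc)
  qed (simp add: monomial_Nil)
  then show ?case by (simp add: linmapD[OF linmap_rho_left] rho_monomial smul_mult)
qed (simp_all add: linmapD[OF linmap_rho_left] distrib_right)

lemma rho_to_e: "r \<in> span_words FL \<Longrightarrow> rho (to_e r) p = lin (\<lambda>w. L.ders (letters w) p) r"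
proof (induction rule: span_words_induct)
  case (monomial c w)
  then have "foldr gact (map dual w) p = L.ders w p"
    by (induction w) (auto elim!: FL_E)
  moreover have "lin (\<lambda>w. L.ders (letters w) p) (monomial w) = L.ders w p" by (simp add: monomial_def)
  ultimately show ?case by (simp add: linmapD[OF linmap_rho_left] linmapD[OF linmap_to_e] linmapD[OF linmap_lin]
      to_e_monomial rho_monomial)
qed (simp_all add: linmapD[OF linmap_rho_left] linmapD[OF linmap_to_e] linmapD[OF linmap_lin])

lemma span_words_gact: "x \<in> GL \<Longrightarrow> p \<in> span_words FL \<Longrightarrow> gact x p \<in> span_words FL"
  by (cases x) (auto intro!: L.span_words_der span_words_mult span_words_ltr)

lemma SI_gact: "x \<in> GL \<Longrightarrow> p \<in> L.SI \<Longrightarrow> gact x p \<in> L.SI"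
  by (cases x) (auto intro!: L.SI_der L.SI_mult_left span_words_ltr)

lemma span_words_rho: "r \<in> span_words GL \<Longrightarrow> p \<in> span_words FL \<Longrightarrow> rho r p \<in> span_words FL"
proof (induction rule: span_words_induct)
  case (monomial c w)
  then have "foldr gact w p \<in> span_words FL" by (induction w) (auto simp: span_words_gact)
  then show ?case by (simp add: linmapD[OF linmap_rho_left] rho_monomial span_words_smul)
qed (auto simp: linmapD[OF linmap_rho_left] span_words_zero span_words_add)

lemma SI_rho: "r \<in> span_words GL \<Longrightarrow> p \<in> L.SI \<Longrightarrow> rho r p \<in> L.SI"
proof (induction rule: span_words_induct)
  case (monomial c w)
  then have "foldr gact w p \<in> L.SI" by (induction w) (auto simp: SI_gact)
  then show ?case by (simp add: linmapD[OF linmap_rho_left] rho_monomial L.SI_smul)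
qed (auto simp: linmapD[OF linmap_rho_left] L.SI_add)

text \<open>An f'-relation acts as left multiplication by an element of the ideal, an e-relation as
  the operator treated in \<open>ders_SI\<close>, and a mixed relation acts as zero because it is
  the letter rule for \<open>der\<close>.\<close>

lemma rho_relations:
  assumes "r \<in> relations" "p \<in> span_words FL" shows "rho r p \<in> L.SI"
proof -
  consider (F) "r \<in> L.rels" | (E) t where "t \<in> L.rels" "r = to_e t"
    | (M) i k j l where "(i, k) \<in> idx" "(j, l) \<in> idx"
      "r = monomial [E i k, F j l] - smul (qq i j) (monomial [F j l, E i k]) - (if i = j \<and> k = l then 1 else 0)"
    using assms(1) unfolding relations_eq by blast
  then show ?thesis
  proof cases
    case F
    then show ?thesis using assms(2) by (simp add: rho_FL span_words_rels L.SI_mult_right L.rels_SI)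
  next
    case E
    then show ?thesis using assms(2)
      by (simp add: rho_to_e span_words_rels L.ders_SI L.rels_SI)
  next
    case M
    have "rho r p = 0"
      unfolding M(3) linmapD[OF linmap_rho_left] rho_monomial
      using qq_lform[OF idx_I[OF M(1)] idx_I[OF M(2)], of k l]
      by (auto simp: rho_one linmapD[OF linmap_rho_left] L.der_ltr_mult simp del: lform.simps)
    then show ?thesis by simp
  qed
qed

text \<open>The elements that act into \<open>L.SI\<close> form a two-sided ideal, because the
  action preserves \<open>L.SI\<close>.\<close>

lemma rho_RI:
  assumes "r \<in> relation_ideal" "p \<in> span_words FL" shows "rho r p \<in> L.SI"
proof -
  let ?K = "{r \<in> span_words GL. \<forall>p\<in>span_words FL. rho r p \<in> L.SI}"
  interpret V: vspace free_boson by standard (rule B.vector_space_rec_V)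
  have "ideal ?K free_boson"
  proof (rule idealI[OF ring_free_boson])
    have "free.subspace ?K"
      by (rule free.subspaceI) (auto simp: span_words_zero span_words_add span_words_smul
          linmapD[OF linmap_rho_left] L.SI_add L.SI_smul)
    then have "submodule ?K scalars free_boson"
      unfolding B.submodule_V by (auto simp: carrier_free_boson)
    then show "subgroup ?K (add_monoid free_boson)" by (rule submodule.axioms(1))
  qed (auto simp: carrier_free_boson free_boson_ops span_words_mult rho_mult SI_rho span_words_rho)
  moreover have "relations \<subseteq> ?K" using relations_carrier rho_relations by auto
  ultimately have "relation_ideal \<subseteq> ?K"
    unfolding relation_ideal_def by (rule ring.genideal_minimal[OF ring_free_boson])
  then show ?thesis using assms by auto
qed

text \<open>An f'-polynomial acting on 1 returns itself, so the e-relations and mixed relations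
  impose nothing new on the f'. This identifies R with the free algebra modulo
  \<open>L.SI\<close>.\<close>

lemma SI_iff_RI: "p \<in> span_words FL \<Longrightarrow> p \<in> relation_ideal \<longleftrightarrow> p \<in> L.SI"
  using rho_RI[of p 1] SI_RI[of p] by (auto simp: rho_FL span_words_one)

lemma carrier_boson: "carrier boson = cls ` span_words GL"
  by (simp add: B.carrier_Q carrier_free_boson)

lemma one_boson: "\<one>\<^bsub>boson\<^esub> = cls 1"
  by (simp add: boson_def quotient_space_def ring.defs module.defs FactRing_def cls_def free_boson_ops)

lemma mult_boson: "x \<in> span_words GL \<Longrightarrow> y \<in> span_words GL \<Longrightarrow> cls x \<otimes>\<^bsub>boson\<^esub> cls y = cls (x * y)"
  using quotient_space_mult[of relation_ideal GL x y] ideal_relations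
  by (simp add: cls_def boson_def free_boson_eq)

sublocale BV: vspace boson
  by standard (rule B.vector_space_rec_Q)

lemma ring_boson: "ring boson"
proof (rule ringI)
  show "abelian_group boson" by (rule BV.abelian_group_axioms)
  show "Group.monoid boson"
    by (rule monoidI) (auto simp: carrier_boson one_boson mult_boson span_words_mult span_words_one mult.assoc)
qed (auto simp: carrier_boson mult_boson B.add_Q span_words_add span_words_mult distrib_left distrib_right)

lemma a_inv_boson: "x \<in> span_words GL \<Longrightarrow> \<ominus>\<^bsub>boson\<^esub> cls x = cls (- x)"
  using BV.smult_minus1[of "cls x"] by (simp add: carrier_boson B.smult_Q free.scale_minus_left)

lemma carrier_R: "carrier R_alg = cls ` span_words FL"
proof -
  interpret R: ring boson by (rule ring_boson)
  have sub: "subring (cls ` span_words FL) boson"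
  proof (rule R.subringI)
    show "cls ` span_words FL \<subseteq> carrier boson" by (auto simp: carrier_boson span_FL_GL)
    show "\<one>\<^bsub>boson\<^esub> \<in> cls ` span_words FL" unfolding one_boson by (intro imageI span_words_one)
    fix x assume "x \<in> cls ` span_words FL"
    then obtain p where p: "x = cls p" "p \<in> span_words FL" by blast
    show "\<ominus>\<^bsub>boson\<^esub> x \<in> cls ` span_words FL"
      unfolding p(1) a_inv_boson[OF span_FL_GL[OF p(2)]] by (intro imageI span_words_minus p)
    fix y assume "y \<in> cls ` span_words FL"
    then obtain r where r: "y = cls r" "r \<in> span_words FL" by blast
    show "x \<otimes>\<^bsub>boson\<^esub> y \<in> cls ` span_words FL"
      unfolding p(1) r(1) mult_boson[OF span_FL_GL[OF p(2)] span_FL_GL[OF r(2)]]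
      by (intro imageI span_words_mult p r)
    show "x \<oplus>\<^bsub>boson\<^esub> y \<in> cls ` span_words FL"
      unfolding p(1) r(1) B.add_Q by (intro imageI span_words_add p r)
  qed
  have "fprod [x] \<in> cls ` span_words FL" if "x \<in> idx" for x
    unfolding fprod_def using that by (cases x) (auto intro!: imageI span_words_monomial)
  then have 1: "generated_subalgebra boson {fprod [x] | x. x \<in> idx} \<subseteq> cls ` span_words FL"
    unfolding generated_subalgebra_def using sub
    by (intro Inter_lower) (auto simp: B.smult_Q intro!: imageI span_words_smul)
  have "cls p \<in> T" if T: "subring T boson" "\<forall>c. \<forall>x\<in>T. c \<odot>\<^bsub>boson\<^esub> x \<in> T" "{fprod [x] | x. x \<in> idx} \<subseteq> T"
    and "p \<in> span_words FL" for p T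
    using that(4)
  proof (induction rule: span_words_induct)
    case zero
    then show ?case using subringE(2)[OF T(1)] by (simp add: B.zero_Q)
  next
    case (monomial c w)
    then have "cls (monomial w) \<in> T"
    proof (induction w)
      case Nil
      then show ?case using subringE(3)[OF T(1)] by (simp add: one_boson monomial_Nil)
    next
      case (Cons x w)
      then obtain i k where x: "x = F i k" "(i, k) \<in> idx" by (auto elim: FL_E)
      have "fprod [(i, k)] \<in> T" using T(3) x by blast
      then have "cls (ltr x) \<in> T" by (simp add: fprod_def x)
      then have "cls (ltr x) \<otimes>\<^bsub>boson\<^esub> cls (monomial w) \<in> T"
        using Cons subringE(6)[OF T(1)] by auto
      moreover have g: "ltr x \<in> span_words GL" "monomial w \<in> span_words GL"
        using Cons.hyps FL_GL by (auto intro!: span_words_monomial)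
      ultimately have "cls (ltr x * monomial w) \<in> T" using mult_boson[OF g] by (simp only:)
      then show ?case by (simp only: ltr_power_mult_monomial)
    qed
    then show ?case using T(2) by (simp add: B.smult_Q[symmetric])
  next
    case (add p r)
    then show ?case using subringE(7)[OF T(1)] by (simp add: B.add_Q[symmetric])
  qed
  then have 2: "cls ` span_words FL \<subseteq> generated_subalgebra boson {fprod [x] | x. x \<in> idx}"
    unfolding generated_subalgebra_def by blast
  show ?thesis using 1 2 by (simp add: R_alg_def)
qed

end

section \<open>Modules over the q-boson algebra\<close>

context cartan_letters begin

text \<open>Turns the letter-by-letter recursion into the sum over struck positions by which the
  action on R is specified.\<close>

lemma der_positions:
  "der b (monomial v) = (\<Sum>p\<in>{p. p < length v \<and> v ! p = b}.
     smul (\<Prod>t<p. q powi (- C b (v ! t))) (monomial (take p v @ drop (Suc p) v)))"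
proof -
  have "der b (monomial v) = (\<Sum>p<length v. if v ! p = b then
     smul (\<Prod>t<p. q powi (- C b (v ! t))) (monomial (take p v @ drop (Suc p) v)) else 0)"
  proof (induction v)
    case Nil
    show ?case by (simp add: monomial_Nil)
  next
    case (Cons c v)
    have "der b (monomial (c # v)) = (if b = c then monomial v else 0) + smul (q powi (- C b c)) (ltr c * der b (monomial v))"
      by (subst monomial_Cons) (rule der_ltr_mult)
    also have "smul (q powi (- C b c)) (ltr c * der b (monomial v)) =
       (\<Sum>p<length v. if v ! p = b then smul (q powi (- C b c) * (\<Prod>t<p. q powi (- C b (v ! t))))
          (monomial (c # take p v @ drop (Suc p) v)) else 0)"
      unfolding Cons sum_distrib_left free.scale_sum_right
      by (intro sum.cong refl) (simp add: mult_smul ltr_power_mult_monomial)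
    finally show ?case
      by (simp add: sum.lessThan_Suc_shift prod.lessThan_Suc_shift eq_commute[of b c]
          del: sum.lessThan_Suc prod.lessThan_Suc cong: if_cong)
  qed
  also have "\<dots> = (\<Sum>p\<in>{p. p < length v \<and> v ! p = b}.
     smul (\<Prod>t<p. q powi (- C b (v ! t))) (monomial (take p v @ drop (Suc p) v)))"
    by (subst sum.inter_filter[symmetric]) (auto intro!: sum.cong)
  finally show ?thesis .
qed

lemma ders_monomial:
  "homogeneous (mset v - mset z) (ders z (monomial v))"
  "\<not> mset z \<subseteq># mset v \<Longrightarrow> ders z (monomial v) = 0"
proof -
  have "homogeneous (mset v - mset z) (ders z (monomial v)) \<and>
      (\<not> mset z \<subseteq># mset v \<longrightarrow> ders z (monomial v) = 0)"
  proof (induction z)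
    case (Cons a z)
    let ?\<beta> = "mset v - mset z"
    have "homogeneous (?\<beta> - {#a#}) (der a (ders z (monomial v)))" using Cons homogeneous_der(1) by blast
    moreover have "der a (ders z (monomial v)) = 0" if "\<not> mset (a # z) \<subseteq># mset v"
    proof (cases "mset z \<subseteq># mset v")
      case True
      then have "a \<notin># ?\<beta>" using that
        by (metis insert_subset_eq_iff mset.simps(2) subset_mset.le_diff_conv2 single_subset_iff add_mset_add_single union_commute)
      then show ?thesis using Cons homogeneous_der(2) by blast
    qed (use Cons in \<open>simp add: linmapD[OF linmap_der]\<close>)
    ultimately show ?case by simp
  qed (simp add: homogeneous_monomial)
  then show "homogeneous (mset v - mset z) (ders z (monomial v))"
    "\<not> mset z \<subseteq># mset v \<Longrightarrow> ders z (monomial v) = 0" by auto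
qed

text \<open>Striking as many letters as the word has leaves degree zero, hence a scalar; these
  scalars are the entries of the Gram matrix.\<close>

lemma ders_monomial_length:
  assumes "length z = length v"
  shows "ders z (monomial v) = smul (lookup (ders z (monomial v)) 0) 1"
proof (cases "mset z \<subseteq># mset v")
  case True
  then have "mset z = mset v" using assms by (metis mset_subset_size nless_le order.strict_iff_order size_mset subset_mset.le_imp_less_or_eq)
  then have h: "homogeneous {#} (ders z (monomial v))" using ders_monomial(1)[of v z] by simp
  show ?thesis
  proof (rule poly_mapping_eqI)
    fix w
    show "lookup (ders z (monomial v)) w = lookup (smul (lookup (ders z (monomial v)) 0) 1) w"
    proof (cases "w = 0")
      case False
      then have "letters w \<noteq> []" by (cases w) (auto simp: zero_word_def)
      then have "w \<notin> keys (ders z (monomial v))" using h by (auto simp: homogeneous_def)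
      then show ?thesis using False by (simp add: in_keys_iff lookup_smul lookup_one)
    qed (simp add: lookup_smul lookup_one)
  qed
next
  case False
  then show ?thesis using ders_monomial(2) by simp
qed

end

lemma span_words_induct' [consumes 1, case_names zero monomial add]:
  assumes "p \<in> span_words X" "P 0" "\<And>c w. w \<in> lists X \<Longrightarrow> P (smul c (monomial w))"
    "\<And>p r. p \<in> span_words X \<Longrightarrow> r \<in> span_words X \<Longrightarrow> P p \<Longrightarrow> P r \<Longrightarrow> P (p + r)"
  shows "P p"
proof -
  have "p \<in> span_words X \<and> P p" using assms(1)
    by (induction rule: span_words_induct)
      (auto intro!: assms(2-4) span_words_zero span_words_add span_words_smul span_words_monomial)
  then show ?thesis by simp
qed

context q_boson begin

definition rep_GL :: "('i boson_gen word \<Rightarrow>\<^sub>0 'k) set \<Rightarrow> ('i boson_gen word \<Rightarrow>\<^sub>0 'k)" where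
  "rep_GL b = (SOME p. p \<in> span_words GL \<and> cls p = b)"

definition rep_FL :: "('i boson_gen word \<Rightarrow>\<^sub>0 'k) set \<Rightarrow> ('i boson_gen word \<Rightarrow>\<^sub>0 'k)" where
  "rep_FL r = (SOME p. p \<in> span_words FL \<and> cls p = r)"

definition R_action where "R_action b r = cls (rho (rep_GL b) (rep_FL r))"

text \<open>A change of representative is absorbed by \<open>rho_RI\<close> in the acting element
  and by \<open>SI_rho\<close> in the argument.\<close>

lemma R_action_cls:
  assumes "p \<in> span_words GL" "t \<in> span_words FL"
  shows "R_action (cls p) (cls t) = cls (rho p t)"
proof -
  define p' t' where "p' = rep_GL (cls p)" and "t' = rep_FL (cls t)"
  have p': "p' \<in> span_words GL \<and> cls p' = cls p" unfolding p'_def rep_GL_def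
    by (rule someI[of _ p]) (use assms in simp)
  have t': "t' \<in> span_words FL \<and> cls t' = cls t" unfolding t'_def rep_FL_def
    by (rule someI[of _ t]) (use assms in simp)
  have "p' - p \<in> relation_ideal" "t' - t \<in> relation_ideal" using p' t' B.coset_eq by auto
  then have "t' - t \<in> L.SI" "rho (p' - p) t' \<in> L.SI"
    using t' assms by (auto simp: SI_iff_RI[symmetric] span_words_diff intro: rho_RI)
  then have "rho (p' - p) t' + rho p (t' - t) \<in> L.SI" using assms(1) by (simp only: L.SI_add SI_rho)
  then have "rho p' t' - rho p t \<in> L.SI"
    by (simp add: linmapD[OF linmap_rho_left] linmapD[OF linmap_rho_right])
  then show ?thesis using SI_RI B.coset_eq by (auto simp: R_action_def p'_def t'_def)
qed

lemma carrier_R_extend: "carrier (module.extend R_alg (left_module.fields \<alpha>)) = cls ` span_words FL"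
  "add (module.extend R_alg (left_module.fields \<alpha>)) = add boson"
  "zero (module.extend R_alg (left_module.fields \<alpha>)) = zero boson"
  "module.smult (module.extend R_alg (left_module.fields \<alpha>)) = module.smult boson"
  "act (module.extend R_alg (left_module.fields \<alpha>)) = \<alpha>"
  using carrier_R by (simp_all add: module.defs left_module.defs R_alg_def)

lemma vector_space_rec_R:
  fixes \<alpha> :: "'c \<Rightarrow> ('i boson_gen word \<Rightarrow>\<^sub>0 'k) set \<Rightarrow> ('i boson_gen word \<Rightarrow>\<^sub>0 'k) set"
  shows "vector_space_rec (module.extend R_alg (left_module.fields \<alpha>))"
  by (rule vector_space_recI)
    (auto simp: carrier_R_extend B.zero_Q B.add_Q B.smult_Q add_ac free.scale_left_distrib free.scale_right_distrib
      free.scale_minus_left intro!: imageI span_words_zero span_words_add span_words_smul)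

lemma map_F_lists: "w \<in> lists idx \<Longrightarrow> map (\<lambda>(i, k). F i k) w \<in> lists FL"
  by (induction w) auto

lemma lists_FL_E:
  assumes "v \<in> lists FL"
  obtains w where "w \<in> lists idx" "v = map (\<lambda>(i, k). F i k) w" "map dual v = map (\<lambda>(i, k). E i k) w"
proof -
  have "\<exists>w\<in>lists idx. v = map (\<lambda>(i, k). F i k) w \<and> map dual v = map (\<lambda>(i, k). E i k) w"
    using assms
  proof (induction v rule: list.induct)
    case (Cons x v)
    then have "x \<in> FL" "v \<in> lists FL" by auto
    then obtain i k w where "x = F i k" "(i, k) \<in> idx" "w \<in> lists idx" "v = map (\<lambda>(i, k). F i k) w"
      "map dual v = map (\<lambda>(i, k). E i k) w" using Cons.IH by (metis FL_E)
    then show ?case by (intro bexI[of _ "(i, k) # w"]) auto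
  qed simp
  then show ?thesis using that by blast
qed

lemma action_formula:
  assumes "x \<in> idx" "w \<in> lists idx"
  shows "cls (L.der (case x of (i, k) \<Rightarrow> F i k) (monomial (map (\<lambda>(i, k). F i k) w))) =
     (\<Oplus>\<^bsub>boson\<^esub>p\<in>{p. p < length w \<and> w ! p = x}.
           (\<Prod>t<p. qq (fst x) (fst (w ! t))) \<odot>\<^bsub>boson\<^esub> fprod (take p w @ drop (Suc p) w))"
proof -
  let ?f = "\<lambda>(i, k). F i k :: 'i boson_gen"
  let ?A = "{p. p < length w \<and> w ! p = x}"
  let ?v = "map ?f w"
  have inj: "?f y = ?f z \<longleftrightarrow> y = z" for y z by (cases y; cases z) auto
  have A: "{p. p < length ?v \<and> ?v ! p = ?f x} = ?A" by (auto simp: inj)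
  have w: "w ! p \<in> idx" if "p < length w" for p using assms(2) that nth_mem by blast
  let ?g = "\<lambda>p. smul (\<Prod>t<p. qq (fst x) (fst (w ! t))) (monomial (map ?f (take p w @ drop (Suc p) w)))"
  have "L.der (?f x) (monomial ?v) = (\<Sum>p\<in>?A. ?g p)"
    unfolding L.der_positions A
  proof (intro sum.cong refl)
    fix p assume "p \<in> ?A"
    then have p: "p < length w" by simp
    have "(\<Prod>t<p. q powi (- lform (?f x) (?v ! t))) = (\<Prod>t<p. qq (fst x) (fst (w ! t)))"
    proof (intro prod.cong refl)
      fix t assume "t \<in> {..<p}"
      then have t: "t < length w" using p by simp
      obtain i k j l where x: "x = (i, k)" "w ! t = (j, l)" by (cases x; cases "w ! t")
      then have "i \<in> I" "j \<in> I" using w[OF t] assms(1) idx_I by auto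
      then show "q powi (- lform (?f x) (?v ! t)) = qq (fst x) (fst (w ! t))"
        using x t qq_lform[of i j k l] by simp
    qed
    then show "smul (\<Prod>t<p. q powi (- lform (?f x) (?v ! t))) (monomial (take p ?v @ drop (Suc p) ?v)) = ?g p"
      by (simp only: take_map drop_map map_append)
  qed
  moreover have "map ?f (take p w @ drop (Suc p) w) \<in> lists FL" for p
    by (intro map_F_lists) (use assms(2) in \<open>auto dest: in_set_takeD in_set_dropD\<close>)
  then have "(\<Oplus>\<^bsub>boson\<^esub>p\<in>?A. cls (?g p)) = cls (\<Sum>p\<in>?A. ?g p)"
    unfolding carrier_free_boson[symmetric]
    by (intro B.finsum_coset, simp, unfold carrier_free_boson) (intro span_words_smul span_FL_GL span_words_monomial)
  ultimately show ?thesis by (simp add: fprod_def B.smult_Q)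
qed

text \<open>\<open>R_mod\<close> is chosen among all actions with these properties, so a witness is
  needed before anything can be said about it.\<close>

lemma is_R_action_R_action: "is_R_action R_action"
  unfolding is_R_action_def
proof (intro conjI ballI)
  show "is_left_module boson (module.extend R_alg (left_module.fields R_action))"
    unfolding is_left_module_def carrier_R_extend carrier_boson
    by (intro conjI vector_space_rec_R allI ballI; elim imageE; simp add: one_boson)
      (simp_all add: R_action_cls B.add_Q B.smult_Q mult_boson span_words_rho span_words_add span_words_smul
        span_words_mult span_words_one linmapD[OF linmap_rho_left] linmapD[OF linmap_rho_right] rho_mult rho_one)
next
  fix x r assume x: "x \<in> idx" and "r \<in> carrier R_alg"
  then obtain t where t: "r = cls t" "t \<in> span_words FL" by (auto simp: carrier_R)
  obtain i k where i: "x = (i, k)" by (cases x)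
  have "fprod [x] = cls (ltr (F i k))" "(ltr (F i k) :: _ \<Rightarrow>\<^sub>0 'k) \<in> span_words FL"
    using x i by (auto simp: fprod_def intro!: span_words_monomial)
  then show "R_action (fprod [x]) r = fprod [x] \<otimes>\<^bsub>boson\<^esub> r"
    using t by (simp add: R_action_cls mult_boson span_FL_GL rho_FL)
next
  fix x w assume x: "x \<in> idx" and w: "w \<in> lists idx"
  obtain i k where i: "x = (i, k)" by (cases x)
  have "(ltr (E i k) :: _ \<Rightarrow>\<^sub>0 'k) \<in> span_words GL" using x i by (auto intro!: span_words_monomial)
  moreover have "(monomial (map (\<lambda>(i, k). F i k) w) :: _ \<Rightarrow>\<^sub>0 'k) \<in> span_words FL" using map_F_lists[OF w] by (rule span_words_monomial)
  ultimately have "R_action (eprod [x]) (fprod w) = cls (L.der (F i k) (monomial (map (\<lambda>(i, k). F i k) w)))"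
    by (simp add: eprod_def fprod_def i R_action_cls rho_monomial)
  then show "R_action (eprod [x]) (fprod w) = (\<Oplus>\<^bsub>boson\<^esub>p\<in>{p. p < length w \<and> w ! p = x}.
           (\<Prod>t<p. qq (fst x) (fst (w ! t))) \<odot>\<^bsub>boson\<^esub> fprod (take p w @ drop (Suc p) w))"
    using action_formula[OF x w] by (simp add: i)
qed

lemma is_R_action_R_mod: "is_R_action (act R_mod)"
  unfolding R_mod_def carrier_R_extend(5) by (rule someI[of is_R_action, OF is_R_action_R_action])

lemma R_mod_simps: "carrier R_mod = cls ` span_words FL" "add R_mod = add boson" "zero R_mod = zero boson"
  "module.smult R_mod = module.smult boson"
  by (simp_all add: R_mod_def carrier_R_extend)

lemma left_module_R_mod: "is_left_module boson R_mod"
  using is_R_action_R_mod unfolding is_R_action_def R_mod_def carrier_R_extend(5) by blast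

end

locale boson_module = q_boson I a s m q
  for I :: "'i set" and a s m and q :: "'k::field_char_0" +
  fixes M :: "('k, ('i boson_gen word \<Rightarrow>\<^sub>0 'k) set, 'v) left_module"
  assumes left_module: "is_left_module boson M"
begin

sublocale M: vspace M
  by standard (use left_module in \<open>simp add: is_left_module_def\<close>)

text \<open>The action through representatives, so that computations take place with words instead
  of cosets.\<close>

definition dot :: "('i boson_gen word \<Rightarrow>\<^sub>0 'k) \<Rightarrow> 'v \<Rightarrow> 'v" where "dot p x = act M (cls p) x"

lemma cls_carrier: "p \<in> span_words GL \<Longrightarrow> cls p \<in> carrier boson" by (simp add: carrier_boson)

lemma dot_closed [simp, intro]: "p \<in> span_words GL \<Longrightarrow> x \<in> carrier M \<Longrightarrow> dot p x \<in> carrier M"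
  using left_module cls_carrier by (simp add: is_left_module_def dot_def)

lemma dot_add: "p \<in> span_words GL \<Longrightarrow> r \<in> span_words GL \<Longrightarrow> x \<in> carrier M \<Longrightarrow> dot (p + r) x = dot p x \<oplus>\<^bsub>M\<^esub> dot r x"
  using left_module cls_carrier[of p] cls_carrier[of r] by (simp add: is_left_module_def dot_def B.add_Q[symmetric])

lemma dot_smul: "p \<in> span_words GL \<Longrightarrow> x \<in> carrier M \<Longrightarrow> dot (smul c p) x = c \<odot>\<^bsub>M\<^esub> dot p x"
  using left_module cls_carrier[of p] by (simp add: is_left_module_def dot_def B.smult_Q[symmetric])

lemma dot_mult: "p \<in> span_words GL \<Longrightarrow> r \<in> span_words GL \<Longrightarrow> x \<in> carrier M \<Longrightarrow> dot (p * r) x = dot p (dot r x)"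
  using left_module cls_carrier[of p] cls_carrier[of r] by (simp add: is_left_module_def dot_def mult_boson[symmetric])

lemma dot_one [simp]: "x \<in> carrier M \<Longrightarrow> dot 1 x = x"
  using left_module by (simp add: is_left_module_def dot_def one_boson[symmetric])

lemma dot_add_right: "p \<in> span_words GL \<Longrightarrow> x \<in> carrier M \<Longrightarrow> y \<in> carrier M \<Longrightarrow>
    dot p (x \<oplus>\<^bsub>M\<^esub> y) = dot p x \<oplus>\<^bsub>M\<^esub> dot p y"
  using left_module cls_carrier[of p] by (simp add: is_left_module_def dot_def)

lemma dot_smult_right: "p \<in> span_words GL \<Longrightarrow> x \<in> carrier M \<Longrightarrow> dot p (c \<odot>\<^bsub>M\<^esub> x) = c \<odot>\<^bsub>M\<^esub> dot p x"
  using left_module cls_carrier[of p] by (simp add: is_left_module_def dot_def)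

lemma dot_zero [simp]: "x \<in> carrier M \<Longrightarrow> dot 0 x = \<zero>\<^bsub>M\<^esub>"
  using dot_smul[of 1 x 0] by (simp add: span_words_one)

lemma dot_zero_right [simp]: "p \<in> span_words GL \<Longrightarrow> dot p \<zero>\<^bsub>M\<^esub> = \<zero>\<^bsub>M\<^esub>"
  using dot_smult_right[of p "\<zero>\<^bsub>M\<^esub>" 0] by simp

lemma dot_congruent:
  assumes "p - r \<in> relation_ideal" shows "dot p x = dot r x"
  using assms B.coset_eq[of p r] by (simp add: dot_def)

lemma dot_sum_cong:
  assumes "\<And>v. v \<in> A \<Longrightarrow> c v \<in> span_words GL \<and> c' v \<in> span_words GL \<and> dot (c v) x = dot (c' v) x" "x \<in> carrier M"
  shows "dot (\<Sum>v\<in>A. c v) x = dot (\<Sum>v\<in>A. c' v) x"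
  using assms
proof (induction A rule: infinite_finite_induct)
  case (insert v A)
  have "(\<Sum>v\<in>A. c v) \<in> span_words GL" "(\<Sum>v\<in>A. c' v) \<in> span_words GL"
    using insert.prems by (auto intro!: span_words_sum)
  then show ?case using insert by (simp add: dot_add)
qed auto

lemma invariants_alt: "y \<in> invariants M \<longleftrightarrow> y \<in> carrier M \<and> (\<forall>i k. (i, k) \<in> idx \<longrightarrow> dot (ltr (E i k)) y = \<zero>\<^bsub>M\<^esub>)"
  by (auto simp: invariants_def dot_def eprod_def)

lemma ltr_E_GL: "(i, k) \<in> idx \<Longrightarrow> (ltr (E i k) :: _ \<Rightarrow>\<^sub>0 'k) \<in> span_words GL" by (auto intro!: span_words_monomial)
lemma ltr_F_GL: "(i, k) \<in> idx \<Longrightarrow> (ltr (F i k) :: _ \<Rightarrow>\<^sub>0 'k) \<in> span_words GL" by (auto intro!: span_words_monomial)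

lemma invariants_add: "x \<in> invariants M \<Longrightarrow> y \<in> invariants M \<Longrightarrow> x \<oplus>\<^bsub>M\<^esub> y \<in> invariants M"
  and invariants_smult: "x \<in> invariants M \<Longrightarrow> c \<odot>\<^bsub>M\<^esub> x \<in> invariants M"
  and invariants_zero: "\<zero>\<^bsub>M\<^esub> \<in> invariants M"
  by (auto simp: invariants_alt dot_add_right dot_smult_right ltr_E_GL)

text \<open>Moving e through a word in the f' by the mixed relation reproduces the recursion of
  \<open>der\<close>; the final term, in which e reaches y, vanishes.\<close>

lemma dot_E_invariant:
  assumes y: "y \<in> invariants M" and i: "(i, k) \<in> idx" and t: "t \<in> span_words FL"
  shows "dot (ltr (E i k)) (dot t y) = dot (L.der (F i k) t) y"
  using t
proof (induction rule: span_words_induct')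
  case zero
  then show ?case using y ltr_E_GL[OF i] by (simp add: linmapD[OF L.linmap_der] invariants_alt)
next
  case (monomial c w)
  have yM: "y \<in> carrier M" using y by (simp add: invariants_alt)
  note E = ltr_E_GL[OF i]
  have "dot (ltr (E i k)) (dot (monomial w) y) = dot (L.der (F i k) (monomial w)) y"
    using monomial
  proof (induction w rule: list.induct)
    case Nil
    then show ?case using y i yM by (simp add: monomial_Nil invariants_alt)
  next
    case (Cons x w)
    then obtain j l where x: "x = F j l" and j: "(j, l) \<in> idx" by (auto elim: FL_E)
    have w: "w \<in> lists FL" using Cons.prems by auto
    have wG: "(monomial w :: _ \<Rightarrow>\<^sub>0 'k) \<in> span_words GL" using w by (intro span_FL_GL span_words_monomial)
    have dG: "L.der (F i k) (monomial w) \<in> span_words GL"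
      using w by (intro span_FL_GL L.span_words_der span_words_monomial)
    note Fj = ltr_F_GL[OF j]
    let ?\<delta> = "if i = j \<and> k = l then 1 else 0 :: 'i boson_gen word \<Rightarrow>\<^sub>0 'k"
    have \<delta>: "?\<delta> \<in> span_words GL" by (auto intro: span_words_one span_words_zero)
    have "dot (ltr (E i k)) (dot (monomial (x # w)) y) = dot (ltr (E i k) * ltr (F j l) * monomial w) y"
      unfolding x ltr_power_mult_monomial[of _ w, symmetric] using E Fj wG yM
      by (simp only: dot_mult[symmetric] span_words_mult mult.assoc)
    also have "\<dots> = dot ((smul (qq i j) (ltr (F j l) * ltr (E i k)) + ?\<delta>) * monomial w) y"
    proof (rule dot_congruent)
      have "(ltr (E i k) * ltr (F j l) - smul (qq i j) (ltr (F j l) * ltr (E i k)) - ?\<delta>) * monomial w \<in> relation_ideal"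
        by (rule RI_mult_right[OF mixed_RI[OF i j] wG])
      then show "ltr (E i k) * ltr (F j l) * monomial w -
          (smul (qq i j) (ltr (F j l) * ltr (E i k)) + ?\<delta>) * monomial w \<in> relation_ideal"
        by (simp only: left_diff_distrib distrib_right diff_diff_eq)
    qed
    also have "\<dots> = qq i j \<odot>\<^bsub>M\<^esub> dot (ltr (F j l)) (dot (ltr (E i k)) (dot (monomial w) y)) \<oplus>\<^bsub>M\<^esub> dot (?\<delta> * monomial w) y"
      unfolding distrib_right smul_mult
      by (simp only: dot_add dot_smul dot_mult span_words_mult span_words_smul E Fj wG \<delta> yM dot_closed)
    also have "\<dots> = dot (smul (qq i j) (ltr (F j l) * L.der (F i k) (monomial w)) + ?\<delta> * monomial w) y"
      unfolding Cons.IH[OF w]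
      by (simp only: dot_add dot_smul dot_mult span_words_mult span_words_smul dG Fj wG \<delta> yM dot_closed)
    also have "smul (qq i j) (ltr (F j l) * L.der (F i k) (monomial w)) + ?\<delta> * monomial w = L.der (F i k) (monomial (x # w))"
      unfolding x using qq_lform[OF idx_I[OF i] idx_I[OF j], of k l]
      by (subst monomial_Cons) (simp add: L.der_ltr_mult del: lform.simps)
    finally show ?case .
  qed
  moreover have "(monomial w :: _ \<Rightarrow>\<^sub>0 'k) \<in> span_words GL" "L.der (F i k) (monomial w) \<in> span_words GL"
    by (intro span_FL_GL L.span_words_der span_words_monomial monomial)+
  ultimately show ?case using yM E by (simp add: linmapD[OF L.linmap_der] dot_smul dot_smult_right)
next
  case (add p r)
  then have "p \<in> span_words GL" "r \<in> span_words GL" "L.der (F i k) p \<in> span_words GL" "L.der (F i k) r \<in> span_words GL"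
    by (auto intro!: span_FL_GL L.span_words_der)
  then show ?case using add y ltr_E_GL[OF i]
    by (simp add: linmapD[OF L.linmap_der] dot_add dot_add_right invariants_alt)
qed

text \<open>An invariant vector generates an image of R: on f'-words times y the algebra acts by the
  same formulas as on the words themselves.\<close>

lemma dot_invariant:
  assumes y: "y \<in> invariants M" and t: "t \<in> span_words FL" and r: "r \<in> span_words GL"
  shows "dot r (dot t y) = dot (rho r t) y"
proof -
  have yM: "y \<in> carrier M" using y by (simp add: invariants_alt)
  have tG: "t \<in> span_words GL" using t by (rule span_FL_GL)
  show ?thesis using r
  proof (induction rule: span_words_induct')
    case zero
    then show ?case using yM tG by (simp add: linmapD[OF linmap_rho_left])
  next
    case (monomial c w)
    have "dot (monomial w) (dot t y) = dot (foldr gact w t) y \<and> foldr gact w t \<in> span_words FL"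
      using monomial
    proof (induction w rule: list.induct)
      case Nil
      then show ?case using yM tG t by (simp add: monomial_Nil)
    next
      case (Cons x w)
      then have x: "x \<in> GL" and w: "w \<in> lists GL" by auto
      have wG: "(monomial w :: _ \<Rightarrow>\<^sub>0 'k) \<in> span_words GL" by (rule span_words_monomial[OF w])
      have xG: "(ltr x :: _ \<Rightarrow>\<^sub>0 'k) \<in> span_words GL" using x by (rule span_words_ltr)
      let ?t = "foldr gact w t"
      have IH: "dot (monomial w) (dot t y) = dot ?t y" "?t \<in> span_words FL" using Cons.IH[OF w] by auto
      have "dot (monomial (x # w)) (dot t y) = dot (ltr x) (dot ?t y)"
        unfolding ltr_power_mult_monomial[of x w, symmetric] IH(1)[symmetric]
        using xG wG yM tG by (intro dot_mult) auto
      also have "\<dots> = dot (gact x ?t) y"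
      proof (cases x)
        case (E i k)
        then show ?thesis using x dot_E_invariant[OF y _ IH(2), of i k] by simp
      next
        case (F i k)
        then show ?thesis using xG yM span_FL_GL[OF IH(2)] by (simp add: dot_mult)
      qed
      finally show ?case using span_words_gact[OF x IH(2)] by simp
    qed
    moreover have "(monomial w :: _ \<Rightarrow>\<^sub>0 'k) \<in> span_words GL" by (rule span_words_monomial[OF monomial])
    ultimately show ?case using yM tG
      by (simp add: linmapD[OF linmap_rho_left] rho_monomial dot_smul span_FL_GL)
  next
    case (add p r)
    then have "rho p t \<in> span_words GL" "rho r t \<in> span_words GL"
      using t by (auto intro!: span_FL_GL span_words_rho)
    then show ?case using add yM tG by (simp add: linmapD[OF linmap_rho_left] dot_add)
  qed
qed

text \<open>Words over \<open>FL\<close> index the products of the e as well, so that both sides of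
  the pairing use one alphabet.\<close>

definition eact :: "'i boson_gen list \<Rightarrow> 'v \<Rightarrow> 'v" where "eact v = dot (monomial (map dual v))"

lemma dual_GL: "v \<in> lists FL \<Longrightarrow> (monomial (map dual v) :: _ \<Rightarrow>\<^sub>0 'k) \<in> span_words GL"
  unfolding to_e_monomial[symmetric] by (intro span_EL_GL span_words_to_e span_words_monomial)

lemma eact_closed [simp, intro]: "v \<in> lists FL \<Longrightarrow> x \<in> carrier M \<Longrightarrow> eact v x \<in> carrier M"
  by (simp add: eact_def dual_GL del: in_lists_conv_set)

lemma eact_Nil [simp]: "x \<in> carrier M \<Longrightarrow> eact [] x = x"
  by (simp add: eact_def monomial_Nil)

lemma eact_Cons: "(i, k) \<in> idx \<Longrightarrow> v \<in> lists FL \<Longrightarrow> x \<in> carrier M \<Longrightarrow> eact (F i k # v) x = dot (ltr (E i k)) (eact v x)"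
  unfolding eact_def list.map dual.simps ltr_power_mult_monomial[of "E i k" "map dual v", symmetric]
  by (rule dot_mult) (auto simp: ltr_E_GL dual_GL simp del: in_lists_conv_set)

lemma eact_add: "v \<in> lists FL \<Longrightarrow> x \<in> carrier M \<Longrightarrow> y \<in> carrier M \<Longrightarrow> eact v (x \<oplus>\<^bsub>M\<^esub> y) = eact v x \<oplus>\<^bsub>M\<^esub> eact v y"
  unfolding eact_def by (rule dot_add_right[OF dual_GL])

lemma eact_smult: "v \<in> lists FL \<Longrightarrow> x \<in> carrier M \<Longrightarrow> eact v (c \<odot>\<^bsub>M\<^esub> x) = c \<odot>\<^bsub>M\<^esub> eact v x"
  unfolding eact_def by (rule dot_smult_right[OF dual_GL])

lemma eact_invariant:
  "y \<in> invariants M \<Longrightarrow> v \<in> lists FL \<Longrightarrow> t \<in> span_words FL \<Longrightarrow> eact v (dot t y) = dot (L.ders v t) y"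
proof -
  assume y: "y \<in> invariants M" and v: "v \<in> lists FL" and t: "t \<in> span_words FL"
  have "rho (monomial (map dual v)) t = L.ders v t"
    using rho_to_e[OF span_words_monomial[OF v], of t] by (simp add: to_e_monomial) (simp add: monomial_def)
  then show ?thesis using dot_invariant[OF y t dual_GL[OF v]] by (simp add: eact_def)
qed

text \<open>A finite set of letters replaces the finite set of indices, which is possible as each
  index carries finitely many letters. Words of fixed length over such a set are finite in
  number.\<close>

lemma integrable_iff: "integrable M \<longleftrightarrow> (\<forall>x\<in>carrier M. \<exists>n Y. finite Y \<and> Y \<subseteq> FL \<and>
    (\<forall>v\<in>lists FL. v \<noteq> [] \<and> (n \<le> length v \<or> \<not> set v \<subseteq> Y) \<longrightarrow> eact v x = \<zero>\<^bsub>M\<^esub>))"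
proof
  assume int: "integrable M"
  show "\<forall>x\<in>carrier M. \<exists>n Y. finite Y \<and> Y \<subseteq> FL \<and>
    (\<forall>v\<in>lists FL. v \<noteq> [] \<and> (n \<le> length v \<or> \<not> set v \<subseteq> Y) \<longrightarrow> eact v x = \<zero>\<^bsub>M\<^esub>)"
  proof
    fix x assume "x \<in> carrier M"
    then obtain n J where J: "finite J" "J \<subseteq> I" and
      z: "\<And>w. w \<in> lists idx \<Longrightarrow> w \<noteq> [] \<Longrightarrow> n \<le> length w \<or> (\<exists>(i, k)\<in>set w. i \<notin> J) \<Longrightarrow> act M (eprod w) x = \<zero>\<^bsub>M\<^esub>"
      using int unfolding integrable_def by meson
    define Y where "Y = (\<lambda>(i, k). F i k) ` {(i, k) \<in> idx. i \<in> J}"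
    have "{(i, k) \<in> idx. i \<in> J} \<subseteq> (SIGMA i:J. {..m i})" by (auto simp: idx_def)
    then have "finite Y" unfolding Y_def using J(1) by (intro finite_imageI) (rule finite_subset, auto)
    moreover have "Y \<subseteq> FL" by (auto simp: Y_def)
    moreover have "eact v x = \<zero>\<^bsub>M\<^esub>" if v: "v \<in> lists FL" "v \<noteq> []" "n \<le> length v \<or> \<not> set v \<subseteq> Y" for v
    proof -
      obtain w where w: "w \<in> lists idx" "v = map (\<lambda>(i, k). F i k) w" "map dual v = map (\<lambda>(i, k). E i k) w"
        using lists_FL_E[OF v(1)] .
      have "n \<le> length w \<or> (\<exists>(i, k)\<in>set w. i \<notin> J)"
        using v(3) w(1) unfolding w(2) Y_def by fastforce
      then have "act M (eprod w) x = \<zero>\<^bsub>M\<^esub>" using z w v(2) by auto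
      then show ?thesis by (simp add: eact_def dot_def w(3) eprod_def)
    qed
    ultimately show "\<exists>n Y. finite Y \<and> Y \<subseteq> FL \<and>
      (\<forall>v\<in>lists FL. v \<noteq> [] \<and> (n \<le> length v \<or> \<not> set v \<subseteq> Y) \<longrightarrow> eact v x = \<zero>\<^bsub>M\<^esub>)" by blast
  qed
next
  assume *: "\<forall>x\<in>carrier M. \<exists>n Y. finite Y \<and> Y \<subseteq> FL \<and>
    (\<forall>v\<in>lists FL. v \<noteq> [] \<and> (n \<le> length v \<or> \<not> set v \<subseteq> Y) \<longrightarrow> eact v x = \<zero>\<^bsub>M\<^esub>)"
  show "integrable M"
    unfolding integrable_def
  proof
    fix x assume "x \<in> carrier M"
    then obtain n Y where Y: "finite Y" "Y \<subseteq> FL"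
      and z: "\<And>v. v \<in> lists FL \<Longrightarrow> v \<noteq> [] \<Longrightarrow> n \<le> length v \<or> \<not> set v \<subseteq> Y \<Longrightarrow> eact v x = \<zero>\<^bsub>M\<^esub>"
      using * by meson
    define J where "J = (\<lambda>x. case x of F i k \<Rightarrow> i | E i k \<Rightarrow> i) ` Y"
    have J: "finite J" "J \<subseteq> I" using Y by (auto simp: J_def idx_I elim!: FL_E dest!: subsetD)
    \<comment> \<open>\<open>Suc n\<close> because the definition asks for a positive bound.\<close>
    have "act M (eprod w) x = \<zero>\<^bsub>M\<^esub>"
      if w: "w \<in> lists idx" "w \<noteq> []" "Suc n \<le> length w \<or> (\<exists>(i, k)\<in>set w. i \<notin> J)" for w
    proof -
      let ?v = "map (\<lambda>(i, k). F i k) w"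
      have d: "map dual ?v = map (\<lambda>(i, k). E i k) w" by auto
      have "n \<le> length ?v \<or> \<not> set ?v \<subseteq> Y"
        using w(3)
      proof
        assume "\<exists>(i, k)\<in>set w. i \<notin> J"
        then obtain i k where ik: "(i, k) \<in> set w" "i \<notin> J" by auto
        have "F i k \<notin> Y"
        proof
          assume "F i k \<in> Y"
          then have "i \<in> J" unfolding J_def by (rule rev_image_eqI) simp
          then show False using ik by simp
        qed
        moreover have "F i k \<in> set ?v" using ik(1) by force
        ultimately show ?thesis by blast
      qed simp
      then have "eact ?v x = \<zero>\<^bsub>M\<^esub>" using w map_F_lists by (intro z) auto
      then show ?thesis unfolding eact_def dot_def d eprod_def .
    qed
    then show "\<exists>n>0. \<exists>J. finite J \<and> J \<subseteq> I \<and> (\<forall>w\<in>lists idx. w \<noteq> [] \<and> (n \<le> length w \<or> (\<exists>(i, k)\<in>set w. i \<notin> J)) \<longrightarrow>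
        act M (eprod w) x = \<zero>\<^bsub>M\<^esub>)"
      using J by (intro exI[of _ "Suc n"] conjI exI[of _ J]) auto
  qed
qed

text \<open>One further e would produce a product of the next length, which annihilates x.\<close>

lemma top_invariant:
  assumes "x \<in> carrier M" "v \<in> lists FL" "\<And>w. w \<in> lists FL \<Longrightarrow> length w = Suc (length v) \<Longrightarrow> eact w x = \<zero>\<^bsub>M\<^esub>"
  shows "eact v x \<in> invariants M"
  unfolding invariants_alt
proof (intro conjI allI impI)
  show "eact v x \<in> carrier M" using assms by (simp del: in_lists_conv_set)
  fix i k assume ik: "(i, k) \<in> idx"
  have "F i k # v \<in> lists FL" using ik assms(2) by simp
  then show "dot (ltr (E i k)) (eact v x) = \<zero>\<^bsub>M\<^esub>"
    using assms(3)[of "F i k # v"] eact_Cons[OF ik assms(2,1)] by simp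
qed

text \<open>\<open>P\<close> will be membership in the kernel of a module map. A longest product not
  killing x would produce a nonzero invariant vector in \<open>P\<close>; the length bound is
  therefore lowered until the empty product, that is x itself, is reached.\<close>

lemma injective_of_invariants:
  assumes int: "integrable M" and f0: "\<And>y. y \<in> invariants M \<Longrightarrow> P y \<Longrightarrow> y = \<zero>\<^bsub>M\<^esub>"
    and P: "\<And>x v. x \<in> carrier M \<Longrightarrow> P x \<Longrightarrow> v \<in> lists FL \<Longrightarrow> P (eact v x)"
    and x: "x \<in> carrier M" "P x"
  shows "x = \<zero>\<^bsub>M\<^esub>"
proof -
  obtain n where n: "\<And>v. v \<in> lists FL \<Longrightarrow> v \<noteq> [] \<Longrightarrow> n \<le> length v \<Longrightarrow> eact v x = \<zero>\<^bsub>M\<^esub>"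
    using int x(1) unfolding integrable_iff by meson
  have "(\<And>v. v \<in> lists FL \<Longrightarrow> n \<le> length v \<Longrightarrow> eact v x = \<zero>\<^bsub>M\<^esub>) \<Longrightarrow> x = \<zero>\<^bsub>M\<^esub>" for n
  proof (induction n)
    case 0
    then show ?case using x(1) by (metis eact_Nil le0 lists.Nil)
  next
    case (Suc n)
    show ?case
    proof (rule Suc.IH)
      fix v assume v: "v \<in> lists FL" "n \<le> length v"
      show "eact v x = \<zero>\<^bsub>M\<^esub>"
      proof (cases "length v = n")
        case True
        then have "eact v x \<in> invariants M" using v x(1) Suc.prems by (intro top_invariant) auto
        then show ?thesis using f0 P x v(1) by blast
      qed (use v Suc.prems in auto)
    qed
  qed
  \<comment> \<open>\<open>Suc n\<close> excludes the empty word, about which integrability says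
    nothing.\<close>
  from this[of "Suc n"] show ?thesis using n by (metis Suc_leD Suc_n_not_le_n list.size(3) not_less_eq_eq zero_less_Suc less_Suc_eq_le le_zero_eq)
qed

text \<open>The vectors \<open>e\<^sub>w x\<close> with \<open>w\<close> of maximal length are invariant; pairing them with a generalized
  inverse of the Gram matrix of the form on words of that length produces a vector of \<open>R M\<^sub>0\<close> with
  the same \<open>e\<^sub>w\<close>-images, whose subtraction lowers the length.\<close>

lemma generated_by_invariants:
  assumes int: "integrable M"
    and T: "\<And>t y. t \<in> span_words FL \<Longrightarrow> y \<in> invariants M \<Longrightarrow> dot t y \<in> T"
      "\<And>x y. x \<in> T \<Longrightarrow> y \<in> T \<Longrightarrow> x \<oplus>\<^bsub>M\<^esub> y \<in> T"
    and x: "x \<in> carrier M"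
  shows "x \<in> T"
proof -
  have T0: "\<zero>\<^bsub>M\<^esub> \<in> T" using T(1)[OF span_words_zero invariants_zero] by simp
  obtain n Y where Y: "finite Y" "Y \<subseteq> FL"
    and n: "\<And>v. v \<in> lists FL \<Longrightarrow> v \<noteq> [] \<Longrightarrow> n \<le> length v \<or> \<not> set v \<subseteq> Y \<Longrightarrow> eact v x = \<zero>\<^bsub>M\<^esub>"
    using int x unfolding integrable_iff by meson
  have "x \<in> carrier M \<Longrightarrow> (\<And>v. v \<in> lists FL \<Longrightarrow> n \<le> length v \<or> \<not> set v \<subseteq> Y \<Longrightarrow> eact v x = \<zero>\<^bsub>M\<^esub>) \<Longrightarrow> x \<in> T" for n x
  proof (induction n arbitrary: x)
    case 0
    then have "x = \<zero>\<^bsub>M\<^esub>" by (metis eact_Nil le0 lists.Nil)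
    then show ?case using T0 by simp
  next
    case (Suc n)
    note xM = Suc.prems(1)
    \<comment> \<open>The words of top length over \<open>Y\<close>; finiteness of \<open>Y\<close>
      makes this Gram matrix finite.\<close>
    define W where "W = {v. set v \<subseteq> Y \<and> length v = n}"
    have W: "v \<in> lists FL" "length v = n" if "v \<in> W" for v using that Y by (auto simp: W_def)
    have finW: "finite W" unfolding W_def by (rule finite_lists_length_eq[OF Y(1)])
    define G where "G w v = lookup (L.ders w (monomial v)) 0" for w v
    obtain \<Psi> H where \<Psi>H: "finite \<Psi> \<and> \<Psi> \<subseteq> W \<and>
      (\<forall>t\<in>W. \<forall>z\<in>W. (\<Sum>s\<in>W. (\<Sum>y\<in>\<Psi>. G t y * H y s) * G s z) = G t z)"
      using generalized_inverse[OF finW, of W G] by (elim exE)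
    then have \<Psi>: "finite \<Psi>" "\<Psi> \<subseteq> W" by auto
    define Q where "Q t s = (\<Sum>y\<in>\<Psi>. G t y * H y s)" for t s
    \<comment> \<open>The combination of top words attached to v by the generalized inverse. Applied
      to x as products of the e it gives an invariant vector, and z is the sum of the f'-words v
      times these vectors.\<close>
    define h where "h v = (\<Sum>s\<in>W. smul (H v s) (monomial s) :: 'i boson_gen word \<Rightarrow>\<^sub>0 'k)" for v
    have mono: "(monomial v :: _ \<Rightarrow>\<^sub>0 'k) \<in> span_words FL" if "v \<in> W" for v using W(1)[OF that] by (rule span_words_monomial)
    have hF: "h v \<in> span_words FL" for v unfolding h_def by (intro span_words_sum span_words_smul mono)
    have hG: "to_e (h v) \<in> span_words GL" for v by (intro span_EL_GL span_words_to_e hF)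
    have h_inv: "dot (to_e (h v)) x \<in> invariants M" for v
    proof -
      have "dot (to_e (\<Sum>s\<in>A. smul (H v s) (monomial s))) x \<in> invariants M" if "A \<subseteq> W" for A
        using that
      proof (induction A rule: infinite_finite_induct)
        case (insert s A)
        have s: "s \<in> W" using insert.prems by simp
        have "eact s x \<in> invariants M" using W[OF s] xM Suc.prems(2) by (intro top_invariant) auto
        moreover have "(\<Sum>s\<in>A. smul (H v s) (monomial s)) \<in> span_words FL"
          using insert.prems by (intro span_words_sum span_words_smul mono) auto
        ultimately show ?case using insert xM dual_GL[OF W(1)[OF s]]
          by (simp add: linmapD[OF linmap_to_e] to_e_monomial dot_add dot_smul span_words_smul
             span_EL_GL[OF span_words_to_e] eact_def invariants_add invariants_smult)
      qed (use xM in \<open>auto simp: linmapD[OF linmap_to_e] invariants_zero\<close>)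
      then show ?thesis by (simp add: h_def)
    qed
    define z where "z = dot (\<Sum>v\<in>\<Psi>. monomial v * to_e (h v)) x"
    have zsum: "dot (\<Sum>v\<in>A. monomial v * to_e (h v)) x \<in> T \<inter> carrier M" if "A \<subseteq> W" for A
      using that
    proof (induction A rule: infinite_finite_induct)
      case (insert v A)
      have v: "v \<in> W" using insert.prems by simp
      have mv: "(monomial v :: _ \<Rightarrow>\<^sub>0 'k) \<in> span_words GL" by (rule span_FL_GL[OF mono[OF v]])
      have "(\<Sum>v\<in>A. monomial v * to_e (h v)) \<in> span_words GL"
        using insert.prems by (intro span_words_sum span_words_mult hG span_FL_GL mono) auto
      then have "dot (\<Sum>v\<in>insert v A. monomial v * to_e (h v)) x =
          dot (monomial v) (dot (to_e (h v)) x) \<oplus>\<^bsub>M\<^esub> dot (\<Sum>v\<in>A. monomial v * to_e (h v)) x"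
        using insert.hyps mv hG xM by (simp add: dot_add dot_mult span_words_mult)
      moreover have "dot (monomial v) (dot (to_e (h v)) x) \<in> T" by (rule T(1)[OF mono[OF v] h_inv])
      moreover have "dot (monomial v) (dot (to_e (h v)) x) \<in> carrier M" using mv hG xM by auto
      ultimately show ?case using insert T(2) by auto
    qed (use xM T0 in auto)
    then have z: "z \<in> T" "z \<in> carrier M" using \<Psi>(2) by (auto simp: z_def)
    have zG: "monomial v * to_e (h v) \<in> span_words GL" if "v \<in> \<Psi>" for v
      using \<Psi>(2) that by (intro span_words_mult hG span_FL_GL mono) auto
    have eact_z: "eact w z = dot (\<Sum>v\<in>\<Psi>. L.ders w (monomial v) * to_e (h v)) x" if w: "w \<in> lists FL" for w
    proof -
      have "eact w z = dot (monomial (map dual w) * (\<Sum>v\<in>\<Psi>. monomial v * to_e (h v))) x"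
        unfolding eact_def z_def using xM zG by (intro dot_mult[symmetric] dual_GL[OF w] span_words_sum) auto
      also have "\<dots> = dot (\<Sum>v\<in>\<Psi>. monomial (map dual w) * (monomial v * to_e (h v))) x"
        by (simp add: sum_distrib_left)
      also have "\<dots> = dot (\<Sum>v\<in>\<Psi>. L.ders w (monomial v) * to_e (h v)) x"
      proof (rule dot_sum_cong[OF _ xM])
        fix v assume v: "v \<in> \<Psi>"
        have mF: "(monomial v :: _ \<Rightarrow>\<^sub>0 'k) \<in> span_words FL" using v \<Psi>(2) by (intro mono) auto
        have dF: "L.ders w (monomial v) \<in> span_words GL" by (intro span_FL_GL L.span_words_ders mF)
        have "dot (monomial (map dual w) * (monomial v * to_e (h v))) x =
            eact w (dot (monomial v) (dot (to_e (h v)) x))"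
          using xM hG dual_GL[OF w] span_FL_GL[OF mF] by (simp add: eact_def dot_mult span_words_mult)
        also have "\<dots> = dot (L.ders w (monomial v)) (dot (to_e (h v)) x)"
          by (rule eact_invariant[OF h_inv w mF])
        also have "\<dots> = dot (L.ders w (monomial v) * to_e (h v)) x"
          using xM hG dF by (simp add: dot_mult)
        finally show "monomial (map dual w) * (monomial v * to_e (h v)) \<in> span_words GL \<and>
            L.ders w (monomial v) * to_e (h v) \<in> span_words GL \<and>
            dot (monomial (map dual w) * (monomial v * to_e (h v))) x = dot (L.ders w (monomial v) * to_e (h v)) x"
          using zG[OF v] dF hG dual_GL[OF w] by (auto intro: span_words_mult)
      qed
      finally show ?thesis .
    qed
    \<comment> \<open>Striking the letters of w from v leaves the scalar G w v, so e_w z is the sum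
      of Q w s times e_s x. The word w and the combination \<Sum> Q w s s agree modulo
      \<open>L.SI\<close>, because their difference pairs to zero with all words.\<close>
    have top: "eact w z = eact w x" if w: "w \<in> W" for w
    proof -
      have "monomial w - (\<Sum>s\<in>W. smul (Q w s) (monomial s)) \<in> L.SI"
      proof (rule L.SI_of_ders)
        show "monomial w - (\<Sum>s\<in>W. smul (Q w s) (monomial s)) \<in> span_words FL"
          by (intro span_words_diff span_words_sum span_words_smul mono w)
        fix v assume v: "v \<in> lists FL"
        have lm: "lin (\<lambda>w. L.ders (letters w) (monomial v)) (monomial s) = L.ders s (monomial v)" for s
          by (simp add: monomial_def)
        have "lookup (lin (\<lambda>w. L.ders (letters w) (monomial v)) (monomial w - (\<Sum>s\<in>W. smul (Q w s) (monomial s)))) 0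
            = G w v - (\<Sum>s\<in>W. Q w s * G s v)"
          by (simp add: linmapD[OF linmap_lin] linmap_sum[OF linmap_lin] lm lookup_minus lookup_sum lookup_smul G_def)
        also have "\<dots> = 0"
        proof (cases "v \<in> W")
          case True
          then show ?thesis using \<Psi>H w by (simp add: Q_def)
        next
          case False
          \<comment> \<open>Words outside \<open>W\<close> differ from those in \<open>W\<close> in
            their multiset of letters.\<close>
          have "G s v = 0" if "s \<in> W" for s
          proof -
            have "mset s \<noteq> mset v" using that False by (auto simp: W_def dest: mset_eq_setD mset_eq_length)
            then show ?thesis unfolding G_def by (intro L.homogeneous_ders[OF L.homogeneous_monomial])
          qed
          then show ?thesis using w by simp
        qed
        finally show "lookup (lin (\<lambda>w. L.ders (letters w) (monomial v)) (monomial w - (\<Sum>s\<in>W. smul (Q w s) (monomial s)))) 0 = 0" .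
      qed
      then have "to_e (monomial w - (\<Sum>s\<in>W. smul (Q w s) (monomial s))) \<in> relation_ideal" by (rule to_e_SI)
      then have "dot (to_e (monomial w)) x = dot (to_e (\<Sum>s\<in>W. smul (Q w s) (monomial s))) x"
        by (intro dot_congruent) (simp add: linmapD[OF linmap_to_e])
      also have "to_e (\<Sum>s\<in>W. smul (Q w s) (monomial s)) = (\<Sum>v\<in>\<Psi>. L.ders w (monomial v) * to_e (h v))"
      proof -
        have "L.ders w (monomial v) = smul (G w v) 1" if "v \<in> \<Psi>" for v
          unfolding G_def using that \<Psi>(2) W(2) w by (intro L.ders_monomial_length) auto
        then have "(\<Sum>v\<in>\<Psi>. L.ders w (monomial v) * to_e (h v)) = (\<Sum>v\<in>\<Psi>. smul (G w v) (to_e (h v)))"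
          by (intro sum.cong refl) (simp add: smul_mult)
        also have "\<dots> = to_e (\<Sum>v\<in>\<Psi>. \<Sum>s\<in>W. smul (G w v * H v s) (monomial s))"
          by (simp add: h_def linmapD[OF linmap_to_e] linmap_sum[OF linmap_to_e] free.scale_sum_right)
        also have "(\<Sum>v\<in>\<Psi>. \<Sum>s\<in>W. smul (G w v * H v s) (monomial s)) = (\<Sum>s\<in>W. smul (Q w s) (monomial s))"
          unfolding Q_def free.scale_sum_left by (rule sum.swap)
        finally show ?thesis ..
      qed
      finally show ?thesis using eact_z[OF W(1)[OF w]] by (simp add: eact_def to_e_monomial)
    qed
    \<comment> \<open>Subtracting z must not spoil the vanishing already known: a longer word, or
      one with a letter outside \<open>Y\<close>, is not contained in any v as a multiset.\<close>
    have low: "eact w z = \<zero>\<^bsub>M\<^esub>" if w: "w \<in> lists FL" "Suc n \<le> length w \<or> \<not> set w \<subseteq> Y" for w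
    proof -
      have "L.ders w (monomial v) = 0" if v: "v \<in> \<Psi>" for v
      proof (rule L.ders_monomial(2))
        have vW: "set v \<subseteq> Y" "length v = n" using v \<Psi>(2) by (auto simp: W_def)
        show "\<not> mset w \<subseteq># mset v"
        proof
          assume *: "mset w \<subseteq># mset v"
          have "length w \<le> n" using size_mset_mono[OF *] vW by simp
          moreover have "set w \<subseteq> Y" using set_mset_mono[OF *] vW by auto
          ultimately show False using w(2) by auto
        qed
      qed
      then have "(\<Sum>v\<in>\<Psi>. L.ders w (monomial v) * to_e (h v)) = 0" by simp
      then show ?thesis using eact_z[OF w(1)] xM by simp
    qed
    define x' where "x' = x \<oplus>\<^bsub>M\<^esub> (- 1) \<odot>\<^bsub>M\<^esub> z"
    have x': "x' \<in> carrier M" using xM z by (simp add: x'_def)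
    have "x' \<in> T"
    proof (rule Suc.IH[OF x'])
      fix v assume v: "v \<in> lists FL" "n \<le> length v \<or> \<not> set v \<subseteq> Y"
      have "eact v z = eact v x"
      proof (cases "v \<in> W")
        case False
        then have "Suc n \<le> length v \<or> \<not> set v \<subseteq> Y" using v(2) by (auto simp: W_def)
        then show ?thesis using low[OF v(1)] Suc.prems(2)[OF v(1)] by simp
      qed (rule top)
      then have "eact v x' = eact v x \<oplus>\<^bsub>M\<^esub> (- 1) \<odot>\<^bsub>M\<^esub> eact v x"
        using v(1) xM z by (simp add: x'_def eact_add eact_smult del: in_lists_conv_set)
      also have "\<dots> = \<zero>\<^bsub>M\<^esub>" using eact_closed[OF v(1) xM] by (simp add: M.smult_minus1 M.r_neg)
      finally show "eact v x' = \<zero>\<^bsub>M\<^esub>" .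
    qed
    moreover have "x = x' \<oplus>\<^bsub>M\<^esub> z"
      using xM z by (simp add: x'_def M.smult_minus1 M.a_assoc M.l_neg)
    ultimately show ?case using T(2) z by metis
  qed
  moreover have "eact v x = \<zero>\<^bsub>M\<^esub>" if "v \<in> lists FL" "Suc n \<le> length v \<or> \<not> set v \<subseteq> Y" for v
    using n[OF that(1)] that(2) by (cases v) auto
  ultimately show ?thesis using x by blast
qed

end

section \<open>The universal property of tensor products\<close>

text \<open>Unlike \<open>linear_maps\<close> it does not demand extensionality and is thus closed
  under plain composition.\<close>

definition is_linear :: "('k::field, 'v, 'x) module_scheme \<Rightarrow> ('k, 'w, 'y) module_scheme \<Rightarrow> ('v \<Rightarrow> 'w) \<Rightarrow> bool" where
  "is_linear V W f \<longleftrightarrow> (\<forall>x\<in>carrier V. f x \<in> carrier W) \<and>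
     (\<forall>x\<in>carrier V. \<forall>y\<in>carrier V. f (x \<oplus>\<^bsub>V\<^esub> y) = f x \<oplus>\<^bsub>W\<^esub> f y) \<and>
     (\<forall>c. \<forall>x\<in>carrier V. f (c \<odot>\<^bsub>V\<^esub> x) = c \<odot>\<^bsub>W\<^esub> f x)"

lemma is_linearD:
  assumes "is_linear V W f"
  shows "x \<in> carrier V \<Longrightarrow> f x \<in> carrier W"
    "x \<in> carrier V \<Longrightarrow> y \<in> carrier V \<Longrightarrow> f (x \<oplus>\<^bsub>V\<^esub> y) = f x \<oplus>\<^bsub>W\<^esub> f y"
    "x \<in> carrier V \<Longrightarrow> f (c \<odot>\<^bsub>V\<^esub> x) = c \<odot>\<^bsub>W\<^esub> f x"
  using assms by (auto simp: is_linear_def)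

lemma linear_maps_iff: "f \<in> linear_maps V W \<longleftrightarrow> is_linear V W f \<and> f \<in> extensional (carrier V)"
  by (auto simp: linear_maps_def is_linear_def PiE_iff)

lemma is_linear_zero:
  assumes "is_linear V W f" "vspace V" "vspace W"
  shows "f \<zero>\<^bsub>V\<^esub> = \<zero>\<^bsub>W\<^esub>"
proof -
  interpret V: vspace V by fact
  interpret W: vspace W by fact
  have "f (0 \<odot>\<^bsub>V\<^esub> \<zero>\<^bsub>V\<^esub>) = 0 \<odot>\<^bsub>W\<^esub> f \<zero>\<^bsub>V\<^esub>" using is_linearD(3)[OF assms(1)] by blast
  then show ?thesis using is_linearD(1)[OF assms(1), of "\<zero>\<^bsub>V\<^esub>"] by simp
qed

locale tensor_product = V: vspace V + W: vspace W
  for V :: "('k::field, 'v, 'x) module_scheme" and W :: "('k, 'w, 'y) module_scheme"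
begin

abbreviation FS :: "('k, 'v \<times> 'w \<Rightarrow>\<^sub>0 'k) module" where
  "FS \<equiv> free_space (carrier V \<times> carrier W)"

lemma FS_simps: "carrier FS = {p. keys p \<subseteq> carrier V \<times> carrier W}" "add FS = (+)" "zero FS = 0"
  "module.smult FS = smul"
  by (simp_all add: free_space_def)

lemma single_FS: "v \<in> carrier V \<Longrightarrow> w \<in> carrier W \<Longrightarrow> single (v, w) c \<in> carrier FS"
  by (simp add: FS_simps)

lemma relations_FS: "bilinearity_relations V W \<subseteq> carrier FS"
proof -
  interpret formal_space FS by (rule formal_space_free_space)
  have *: "x - y - z \<in> carrier FS" "x - y \<in> carrier FS" if "x \<in> carrier FS" "y \<in> carrier FS" "z \<in> carrier FS" for x y z
    using that free.subspace_diff[OF subspace_V] by auto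
  show ?thesis unfolding bilinearity_relations_def
    by (auto intro!: * single_FS)
qed

lemma tensor_kernel_eq: "tensor_kernel V W = free.span (bilinearity_relations V W)"
proof -
  interpret formal_space FS by (rule formal_space_free_space)
  show ?thesis
    unfolding tensor_kernel_def submodule_V
  proof
    have "free.span (bilinearity_relations V W) \<subseteq> carrier FS"
      using relations_FS subspace_V by (rule free.span_minimal)
    then show "\<Inter> {N. (N \<subseteq> carrier FS \<and> free.subspace N) \<and> bilinearity_relations V W \<subseteq> N}
        \<subseteq> free.span (bilinearity_relations V W)"
      using free.span_superset by (intro Inter_lower) auto
  qed (auto dest: subsetD[OF free.span_minimal])
qed

sublocale fq: formal_quotient FS "tensor_kernel V W"
proof -
  interpret formal_space FS by (rule formal_space_free_space)
  show "formal_quotient FS (tensor_kernel V W)"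
    by standard (auto simp: tensor_kernel_eq dest: subsetD[OF free.span_minimal[OF relations_FS subspace_V]])
qed

abbreviation "VW \<equiv> tensor_space V W"

lemma VW_Q: "VW = quotient_space FS (tensor_kernel V W)" by (simp add: tensor_space_def)

sublocale VW: vspace VW
  by standard (simp add: VW_Q fq.vector_space_rec_Q)

definition tens :: "'v \<Rightarrow> 'w \<Rightarrow> ('v \<times> 'w \<Rightarrow>\<^sub>0 'k) set" where "tens v w = fq.coset (single (v, w) 1)"

lemma tens_closed [simp, intro]: "v \<in> carrier V \<Longrightarrow> w \<in> carrier W \<Longrightarrow> tens v w \<in> carrier VW"
  by (simp add: VW_Q fq.carrier_Q tens_def single_FS)

lemma kernel_base: "r \<in> bilinearity_relations V W \<Longrightarrow> r \<in> tensor_kernel V W"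
  by (simp add: tensor_kernel_eq free.span_base)

lemma coset_single: "v \<in> carrier V \<Longrightarrow> w \<in> carrier W \<Longrightarrow> fq.coset (single (v, w) c) = tens (c \<odot>\<^bsub>V\<^esub> v) w"
  unfolding tens_def fq.coset_eq
  by (subst minus_diff_eq[symmetric], rule free.subspace_neg[OF fq.subspace_N], rule kernel_base)
    (unfold bilinearity_relations_def, blast)

lemma tens_smult_left: "v \<in> carrier V \<Longrightarrow> w \<in> carrier W \<Longrightarrow> tens (c \<odot>\<^bsub>V\<^esub> v) w = c \<odot>\<^bsub>VW\<^esub> tens v w"
  by (subst coset_single[symmetric]) (simp_all add: tens_def VW_Q fq.smult_Q)

lemma tens_smult_right: "v \<in> carrier V \<Longrightarrow> w \<in> carrier W \<Longrightarrow> tens v (c \<odot>\<^bsub>W\<^esub> w) = c \<odot>\<^bsub>VW\<^esub> tens v w"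
proof -
  assume vw: "v \<in> carrier V" "w \<in> carrier W"
  have "single (v, c \<odot>\<^bsub>W\<^esub> w) 1 - single (v, w) c \<in> tensor_kernel V W"
    using vw by (intro kernel_base) (unfold bilinearity_relations_def, blast)
  then have "tens v (c \<odot>\<^bsub>W\<^esub> w) = fq.coset (single (v, w) c)" unfolding tens_def fq.coset_eq .
  then show ?thesis by (simp add: tens_def VW_Q fq.smult_Q)
qed

lemma tens_add_left: "v \<in> carrier V \<Longrightarrow> v' \<in> carrier V \<Longrightarrow> w \<in> carrier W \<Longrightarrow>
    tens (v \<oplus>\<^bsub>V\<^esub> v') w = tens v w \<oplus>\<^bsub>VW\<^esub> tens v' w"
  unfolding tens_def VW_Q fq.add_Q fq.coset_eq diff_diff_eq[symmetric]
  by (rule kernel_base) (unfold bilinearity_relations_def, blast)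

lemma tens_add_right: "v \<in> carrier V \<Longrightarrow> w \<in> carrier W \<Longrightarrow> w' \<in> carrier W \<Longrightarrow>
    tens v (w \<oplus>\<^bsub>W\<^esub> w') = tens v w \<oplus>\<^bsub>VW\<^esub> tens v w'"
  unfolding tens_def VW_Q fq.add_Q fq.coset_eq diff_diff_eq[symmetric]
  by (rule kernel_base) (unfold bilinearity_relations_def, blast)

lemma tensor_list:
  assumes "t \<in> carrier VW"
  shows "\<exists>A g h. finite (A :: nat set) \<and> (\<forall>i\<in>A. g i \<in> carrier V \<and> h i \<in> carrier W) \<and> t = (\<Oplus>\<^bsub>VW\<^esub>i\<in>A. tens (g i) (h i))"
proof -
  obtain p where p: "p \<in> carrier FS" "t = fq.coset p" using assms by (auto simp: VW_Q fq.carrier_Q)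
  obtain f :: "nat \<Rightarrow> 'v \<times> 'w" and n where f: "bij_betw f {..<n} (keys p)"
    using ex_bij_betw_nat_finite[of "keys p"] by (auto simp: atLeast0LessThan)
  have k: "f i \<in> keys p" if "i < n" for i using f that by (auto simp: bij_betw_def)
  have vw: "fst (f i) \<in> carrier V" "snd (f i) \<in> carrier W" if "i < n" for i
    using p(1) k[OF that] by (auto simp: FS_simps)
  have "p = (\<Sum>i<n. single (f i) (lookup p (f i)))"
    by (subst poly_mapping_decomp) (rule sum.reindex_bij_betw[OF f, symmetric])
  then have "t = fq.coset (\<Sum>i<n. single (f i) (lookup p (f i)))" by (simp add: p(2))
  also have "\<dots> = (\<Oplus>\<^bsub>VW\<^esub>i\<in>{..<n}. fq.coset (single (f i) (lookup p (f i))))"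
    unfolding VW_Q using vw by (intro fq.finsum_coset[symmetric]) (auto simp: FS_simps mem_Times_iff)
  also have "\<dots> = (\<Oplus>\<^bsub>VW\<^esub>i\<in>{..<n}. tens (lookup p (f i) \<odot>\<^bsub>V\<^esub> fst (f i)) (snd (f i)))"
  proof (rule VW.finsum_cong')
    fix i assume "i \<in> {..<n}"
    then show "fq.coset (single (f i) (lookup p (f i))) = tens (lookup p (f i) \<odot>\<^bsub>V\<^esub> fst (f i)) (snd (f i))"
      using coset_single[of "fst (f i)" "snd (f i)"] vw by simp
  qed (use vw in auto)
  finally show ?thesis using vw
    by (intro exI[of _ "{..<n}"] exI[of _ "\<lambda>i. lookup p (f i) \<odot>\<^bsub>V\<^esub> fst (f i)"] exI[of _ "\<lambda>i. snd (f i)"]) auto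
qed

lemma tensor_induct [consumes 1, case_names tens add]:
  assumes "t \<in> carrier VW" "\<And>v w. v \<in> carrier V \<Longrightarrow> w \<in> carrier W \<Longrightarrow> P (tens v w)"
    "\<And>x y. x \<in> carrier VW \<Longrightarrow> y \<in> carrier VW \<Longrightarrow> P x \<Longrightarrow> P y \<Longrightarrow> P (x \<oplus>\<^bsub>VW\<^esub> y)"
  shows "P t"
proof -
  obtain A g h where t: "finite (A :: nat set)" "\<And>i. i \<in> A \<Longrightarrow> g i \<in> carrier V \<and> h i \<in> carrier W"
    "t = (\<Oplus>\<^bsub>VW\<^esub>i\<in>A. tens (g i) (h i))"
    using tensor_list[OF assms(1)] by blast
  have z: "\<zero>\<^bsub>VW\<^esub> = tens \<zero>\<^bsub>V\<^esub> \<zero>\<^bsub>W\<^esub>"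
    using tens_smult_left[of "\<zero>\<^bsub>V\<^esub>" "\<zero>\<^bsub>W\<^esub>" 0] by simp
  have "P (\<Oplus>\<^bsub>VW\<^esub>i\<in>A. tens (g i) (h i))" using t(1,2)
  proof (induction A)
    case (insert i A)
    have "(\<lambda>i. tens (g i) (h i)) \<in> A \<rightarrow> carrier VW" "tens (g i) (h i) \<in> carrier VW" using insert.prems by auto
    then show ?case using insert by (simp add: VW.finsum_insert) (intro assms(2,3); auto)
  qed (simp add: z assms(2))
  then show ?thesis by (simp add: t(3))
qed

lemma linear_eqI:
  assumes "is_linear VW Z f" "is_linear VW Z g" "\<And>v w. v \<in> carrier V \<Longrightarrow> w \<in> carrier W \<Longrightarrow> f (tens v w) = g (tens v w)"
    "t \<in> carrier VW"
  shows "f t = g t"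
  using assms(4) by (induction rule: tensor_induct) (auto simp: assms(3) is_linearD[OF assms(1)] is_linearD[OF assms(2)])

end

locale bilinear_map = tensor_product V W + Z: vspace Z
  for V :: "('k::field, 'v, 'x) module_scheme" and W :: "('k, 'w, 'y) module_scheme"
    and Z :: "('k, 'z, 'u) module_scheme" +
  fixes B :: "'v \<Rightarrow> 'w \<Rightarrow> 'z"
  assumes B_closed: "v \<in> carrier V \<Longrightarrow> w \<in> carrier W \<Longrightarrow> B v w \<in> carrier Z"
    and B_add_left: "v \<in> carrier V \<Longrightarrow> v' \<in> carrier V \<Longrightarrow> w \<in> carrier W \<Longrightarrow> B (v \<oplus>\<^bsub>V\<^esub> v') w = B v w \<oplus>\<^bsub>Z\<^esub> B v' w"
    and B_add_right: "v \<in> carrier V \<Longrightarrow> w \<in> carrier W \<Longrightarrow> w' \<in> carrier W \<Longrightarrow> B v (w \<oplus>\<^bsub>W\<^esub> w') = B v w \<oplus>\<^bsub>Z\<^esub> B v w'"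
    and B_smult_left: "v \<in> carrier V \<Longrightarrow> w \<in> carrier W \<Longrightarrow> B (c \<odot>\<^bsub>V\<^esub> v) w = c \<odot>\<^bsub>Z\<^esub> B v w"
    and B_smult_right: "v \<in> carrier V \<Longrightarrow> w \<in> carrier W \<Longrightarrow> B v (c \<odot>\<^bsub>W\<^esub> w) = c \<odot>\<^bsub>Z\<^esub> B v w"
begin

definition pre_lift :: "('v \<times> 'w \<Rightarrow>\<^sub>0 'k) \<Rightarrow> 'z" where
  "pre_lift p = (\<Oplus>\<^bsub>Z\<^esub>k\<in>keys p. lookup p k \<odot>\<^bsub>Z\<^esub> B (fst k) (snd k))"

lemma pre_lift_superset:
  assumes "finite A" "keys p \<subseteq> A" "A \<subseteq> carrier V \<times> carrier W"
  shows "pre_lift p = (\<Oplus>\<^bsub>Z\<^esub>k\<in>A. lookup p k \<odot>\<^bsub>Z\<^esub> B (fst k) (snd k))"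
  unfolding pre_lift_def using assms
  by (intro Z.add.finprod_mono_neutral_cong_left) (auto simp: in_keys_iff B_closed subset_iff)

lemma pre_lift_closed: "p \<in> carrier FS \<Longrightarrow> pre_lift p \<in> carrier Z"
  unfolding pre_lift_def by (rule Z.finsum_closed) (auto simp: FS_simps B_closed)

lemma pre_lift_add:
  assumes "p \<in> carrier FS" "r \<in> carrier FS" shows "pre_lift (p + r) = pre_lift p \<oplus>\<^bsub>Z\<^esub> pre_lift r"
proof -
  let ?A = "keys p \<union> keys r"
  have A: "?A \<subseteq> carrier V \<times> carrier W" using assms by (auto simp: FS_simps)
  have B: "B (fst k) (snd k) \<in> carrier Z" if "k \<in> ?A" for k using A that by (intro B_closed) auto
  have "pre_lift (p + r) = (\<Oplus>\<^bsub>Z\<^esub>k\<in>?A. lookup (p + r) k \<odot>\<^bsub>Z\<^esub> B (fst k) (snd k))"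
    using A Poly_Mapping.keys_add[of p r] by (intro pre_lift_superset) auto
  also have "\<dots> = (\<Oplus>\<^bsub>Z\<^esub>k\<in>?A. lookup p k \<odot>\<^bsub>Z\<^esub> B (fst k) (snd k) \<oplus>\<^bsub>Z\<^esub> lookup r k \<odot>\<^bsub>Z\<^esub> B (fst k) (snd k))"
    by (intro Z.finsum_cong') (auto simp: lookup_add Z.smult_add_left B)
  also have "\<dots> = (\<Oplus>\<^bsub>Z\<^esub>k\<in>?A. lookup p k \<odot>\<^bsub>Z\<^esub> B (fst k) (snd k)) \<oplus>\<^bsub>Z\<^esub> (\<Oplus>\<^bsub>Z\<^esub>k\<in>?A. lookup r k \<odot>\<^bsub>Z\<^esub> B (fst k) (snd k))"
    by (rule Z.finsum_addf) (use B in auto)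
  also have "\<dots> = pre_lift p \<oplus>\<^bsub>Z\<^esub> pre_lift r"
    using A by (simp add: pre_lift_superset[of ?A])
  finally show ?thesis .
qed

lemma pre_lift_smul:
  assumes "p \<in> carrier FS" shows "pre_lift (smul c p) = c \<odot>\<^bsub>Z\<^esub> pre_lift p"
proof -
  have A: "keys p \<subseteq> carrier V \<times> carrier W" using assms by (auto simp: FS_simps)
  have B: "B (fst k) (snd k) \<in> carrier Z" if "k \<in> keys p" for k using A that by (intro B_closed) auto
  have "pre_lift (smul c p) = (\<Oplus>\<^bsub>Z\<^esub>k\<in>keys p. lookup (smul c p) k \<odot>\<^bsub>Z\<^esub> B (fst k) (snd k))"
    using A keys_smul[of c p] by (intro pre_lift_superset) auto
  also have "\<dots> = (\<Oplus>\<^bsub>Z\<^esub>k\<in>keys p. c \<odot>\<^bsub>Z\<^esub> (lookup p k \<odot>\<^bsub>Z\<^esub> B (fst k) (snd k)))"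
    by (intro Z.finsum_cong') (auto simp: lookup_smul Z.smult_smult B)
  also have "\<dots> = c \<odot>\<^bsub>Z\<^esub> pre_lift p"
    unfolding pre_lift_def using B by (intro Z.finsum_smult_ldistr[symmetric]) auto
  finally show ?thesis .
qed

lemma pre_lift_single: "v \<in> carrier V \<Longrightarrow> w \<in> carrier W \<Longrightarrow> pre_lift (single (v, w) c) = c \<odot>\<^bsub>Z\<^esub> B v w"
  by (subst pre_lift_superset[of "{(v, w)}"]) (auto simp: Z.finsum_insert B_closed)

lemma pre_lift_diff: "p \<in> carrier FS \<Longrightarrow> r \<in> carrier FS \<Longrightarrow> pre_lift (p - r) = pre_lift p \<oplus>\<^bsub>Z\<^esub> (- 1) \<odot>\<^bsub>Z\<^esub> pre_lift r"
proof -
  assume p: "p \<in> carrier FS" "r \<in> carrier FS"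
  have "p - r = p + smul (- 1) r" by (simp add: free.scale_minus_left)
  moreover have "smul (- 1) r \<in> carrier FS" using p free.subspace_scale[OF fq.subspace_V] by blast
  ultimately show ?thesis using p by (simp only: pre_lift_add pre_lift_smul)
qed

lemma pre_lift_kernel: "p \<in> tensor_kernel V W \<Longrightarrow> pre_lift p = \<zero>\<^bsub>Z\<^esub>"
proof -
  let ?N = "{p \<in> carrier FS. pre_lift p = \<zero>\<^bsub>Z\<^esub>}"
  have z: "pre_lift 0 = \<zero>\<^bsub>Z\<^esub>" by (simp add: pre_lift_def)
  have sub: "free.subspace ?N"
    by (rule free.subspaceI)
      (auto simp: z free.subspace_0[OF fq.subspace_V] free.subspace_add[OF fq.subspace_V] free.subspace_scale[OF fq.subspace_V]
        pre_lift_add pre_lift_smul)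
  have "bilinearity_relations V W \<subseteq> ?N"
  proof
    fix r assume r: "r \<in> bilinearity_relations V W"
    have sd: "single (v, w) c - single (v', w') c' \<in> carrier FS"
      if "v \<in> carrier V" "w \<in> carrier W" "v' \<in> carrier V" "w' \<in> carrier W" for v w v' w' c c'
      using that single_FS free.subspace_diff[OF fq.subspace_V] by blast
    have neg: "x \<oplus>\<^bsub>Z\<^esub> (- 1) \<odot>\<^bsub>Z\<^esub> x = \<zero>\<^bsub>Z\<^esub>" if "x \<in> carrier Z" for x
      using that by (simp add: Z.smult_minus1 Z.r_neg)
    have neg2: "x \<oplus>\<^bsub>Z\<^esub> y \<oplus>\<^bsub>Z\<^esub> (- 1) \<odot>\<^bsub>Z\<^esub> x \<oplus>\<^bsub>Z\<^esub> (- 1) \<odot>\<^bsub>Z\<^esub> y = \<zero>\<^bsub>Z\<^esub>" if xy: "x \<in> carrier Z" "y \<in> carrier Z" for x y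
    proof -
      have "x \<oplus>\<^bsub>Z\<^esub> y \<oplus>\<^bsub>Z\<^esub> (- 1) \<odot>\<^bsub>Z\<^esub> x \<oplus>\<^bsub>Z\<^esub> (- 1) \<odot>\<^bsub>Z\<^esub> y = (x \<oplus>\<^bsub>Z\<^esub> (- 1) \<odot>\<^bsub>Z\<^esub> x) \<oplus>\<^bsub>Z\<^esub> (y \<oplus>\<^bsub>Z\<^esub> (- 1) \<odot>\<^bsub>Z\<^esub> y)"
        using xy by (simp add: Z.a_ac)
      then show ?thesis using xy by (simp add: neg)
    qed
    from r relations_FS have "r \<in> carrier FS" by blast
    moreover have "pre_lift r = \<zero>\<^bsub>Z\<^esub>"
      using r unfolding bilinearity_relations_def
    proof (elim UnE CollectE exE conjE)
      fix v v' w assume "r = single (v \<oplus>\<^bsub>V\<^esub> v', w) 1 - single (v, w) 1 - single (v', w) 1"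
        "v \<in> carrier V" "v' \<in> carrier V" "w \<in> carrier W"
      then show ?thesis by (simp add: pre_lift_diff sd single_FS pre_lift_single B_closed B_add_left neg2)
    next
      fix v w w' assume "r = single (v, w \<oplus>\<^bsub>W\<^esub> w') 1 - single (v, w) 1 - single (v, w') 1"
        "v \<in> carrier V" "w \<in> carrier W" "w' \<in> carrier W"
      then show ?thesis by (simp add: pre_lift_diff sd single_FS pre_lift_single B_closed B_add_right neg2)
    next
      fix c v w assume "r = single (c \<odot>\<^bsub>V\<^esub> v, w) 1 - single (v, w) c" "v \<in> carrier V" "w \<in> carrier W"
      then show ?thesis by (simp add: pre_lift_diff single_FS pre_lift_single B_closed B_smult_left neg)
    next
      fix c v w assume "r = single (v, c \<odot>\<^bsub>W\<^esub> w) 1 - single (v, w) c" "v \<in> carrier V" "w \<in> carrier W"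
      then show ?thesis by (simp add: pre_lift_diff single_FS pre_lift_single B_closed B_smult_right neg)
    qed
    ultimately show "r \<in> ?N" by simp
  qed
  then have "tensor_kernel V W \<subseteq> ?N" unfolding tensor_kernel_eq using sub by (rule free.span_minimal)
  then show "p \<in> tensor_kernel V W \<Longrightarrow> ?thesis" by blast
qed

lemma pre_lift_coset:
  assumes "p \<in> carrier FS" "r \<in> fq.coset p" shows "r \<in> carrier FS" "pre_lift r = pre_lift p"
proof -
  have d: "r - p \<in> tensor_kernel V W" using assms by (simp add: fq.coset_alt)
  then have "p + (r - p) \<in> carrier FS" using assms fq.N_subset free.subspace_add[OF fq.subspace_V] by blast
  then show "r \<in> carrier FS" by simp
  have "pre_lift (p + (r - p)) = pre_lift p"
    using assms d fq.N_subset pre_lift_closed by (subst pre_lift_add) (auto simp: pre_lift_kernel)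
  then show "pre_lift r = pre_lift p" by simp
qed

definition lift :: "('v \<times> 'w \<Rightarrow>\<^sub>0 'k) set \<Rightarrow> 'z" where "lift t = pre_lift (SOME p. p \<in> t)"

lemma lift_coset: "p \<in> carrier FS \<Longrightarrow> lift (fq.coset p) = pre_lift p"
  unfolding lift_def by (rule pre_lift_coset(2)) (auto intro: someI fq.coset_self)

lemma lift_tens: "v \<in> carrier V \<Longrightarrow> w \<in> carrier W \<Longrightarrow> lift (tens v w) = B v w"
  by (simp add: tens_def lift_coset single_FS pre_lift_single B_closed)

lemma lift_linear: "is_linear VW Z lift"
  unfolding is_linear_def VW_Q fq.carrier_Q
  by (auto simp: lift_coset fq.add_Q fq.smult_Q pre_lift_add pre_lift_smul pre_lift_closed
      free.subspace_add[OF fq.subspace_V] free.subspace_scale[OF fq.subspace_V])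

end

text \<open>\<open>tensor_map\<close> is a union over all representatives. By the universal property
  applied to (v, w) \<mapsto> g v \<otimes> f w, every representative contributes the same
  coset.\<close>

lemma tensor_map_props:
  assumes "vspace V" "vspace W" "vspace V'" "vspace W'" "is_linear V V' g" "is_linear W W' f"
  shows "is_linear (tensor_space V W) (tensor_space V' W') (tensor_map V' W' g f)"
    and "\<And>v w. v \<in> carrier V \<Longrightarrow> w \<in> carrier W \<Longrightarrow>
      tensor_map V' W' g f (tensor_product.tens V W v w) = tensor_product.tens V' W' (g v) (f w)"
proof -
  interpret V: vspace V by fact
  interpret W: vspace W by fact
  interpret V': vspace V' by fact
  interpret W': vspace W' by fact
  interpret T: tensor_product V W ..
  interpret T': tensor_product V' W' ..
  note g = is_linearD[OF assms(5)] and f = is_linearD[OF assms(6)]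
  interpret bilinear_map V W "tensor_space V' W'" "\<lambda>v w. T'.tens (g v) (f w)"
    by standard (auto simp: g f T'.tens_add_left T'.tens_add_right T'.tens_smult_left T'.tens_smult_right)
  have eq: "tensor_map V' W' g f t = lift t" if t: "t \<in> carrier T.VW" for t
  proof -
    obtain p where p: "p \<in> carrier T.FS" "t = T.fq.coset p" using t by (auto simp: T.VW_Q T.fq.carrier_Q)
    have "tensor_kernel V' W' +>\<^bsub>T'.FS\<^esub> (\<Sum>(v, w)\<in>keys r. single (g v, f w) (lookup r (v, w))) = lift t" if r: "r \<in> t" for r
    proof -
      have rF: "r \<in> carrier T.FS" and rt: "t = T.fq.coset r"
        using r p pre_lift_coset(1) T.fq.coset_memD by auto
      have k: "fst x \<in> carrier V" "snd x \<in> carrier W" if "x \<in> keys r" for x using rF that by (auto simp: T.FS_simps)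
      have gf: "g v \<in> carrier V'" "f w \<in> carrier W'" if "(v, w) \<in> keys r" for v w
        using k[OF that] g f by auto
      have "lift t = (\<Oplus>\<^bsub>T'.VW\<^esub>x\<in>keys r. lookup r x \<odot>\<^bsub>T'.VW\<^esub> T'.tens (g (fst x)) (f (snd x)))"
        by (simp add: rt lift_coset rF pre_lift_def)
      also have "\<dots> = (\<Oplus>\<^bsub>T'.VW\<^esub>x\<in>keys r. T'.fq.coset (single (g (fst x), f (snd x)) (lookup r x)))"
        by (rule T'.VW.finsum_cong')
          (auto simp: T'.tens_def T'.VW_Q T'.fq.smult_Q T'.fq.carrier_Q gf intro!: imageI T'.single_FS)
      also have "\<dots> = T'.fq.coset (\<Sum>x\<in>keys r. single (g (fst x), f (snd x)) (lookup r x))"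
        unfolding T'.VW_Q by (rule T'.fq.finsum_coset) (auto intro!: T'.single_FS simp: gf)
      finally show ?thesis by (simp add: T'.fq.coset_def case_prod_unfold)
    qed
    then show ?thesis unfolding tensor_map_def using p(2) T.fq.coset_self[of p] by auto
  qed
  show "is_linear T.VW T'.VW (tensor_map V' W' g f)"
    using lift_linear by (simp add: is_linear_def eq)
  show "tensor_map V' W' g f (T.tens v w) = T'.tens (g v) (f w)" if "v \<in> carrier V" "w \<in> carrier W" for v w
    using that by (simp add: eq lift_tens)
qed

section \<open>Encoding lists in an infinite set\<close>

text \<open>Lists are folded with a bijection from S \<times> S to S. The fold is injective only
  among lists of equal length, so the length is stored as an additional component.\<close>

lemma infinite_lists_embed:
  assumes "infinite S"
  shows "\<exists>f :: 'u list \<Rightarrow> 'u. inj_on f (lists S) \<and> f ` lists S \<subseteq> S"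
proof -
  obtain pr where pr: "bij_betw pr (S \<times> S) S"
    using card_of_Times_same_infinite[OF assms] card_of_ordIso by blast
  obtain e :: "nat \<Rightarrow> 'u" where e: "inj e" "range e \<subseteq> S"
    using infinite_countable_subset[OF assms] by blast
  have pr_in: "pr (x, y) \<in> S" if "x \<in> S" "y \<in> S" for x y using pr that by (auto simp: bij_betw_def)
  have pr_eq: "x = x' \<and> y = y'" if "pr (x, y) = pr (x', y')" "x \<in> S" "y \<in> S" "x' \<in> S" "y' \<in> S" for x y x' y'
    using pr that by (auto simp: bij_betw_def inj_on_def)
  define g where "g l = foldr (\<lambda>a b. pr (a, b)) l (e 0)" for l
  have g_in: "g l \<in> S" if "l \<in> lists S" for l
    using that by (induction l) (use e in \<open>auto simp: g_def pr_in\<close>)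
  have g_inj: "length l = length l' \<Longrightarrow> l \<in> lists S \<Longrightarrow> l' \<in> lists S \<Longrightarrow> g l = g l' \<Longrightarrow> l = l'" for l l'
  proof (induction l l' rule: list_induct2)
    case (Cons a l a' l')
    then have "pr (a, g l) = pr (a', g l')" by (simp add: g_def)
    then have "a = a' \<and> g l = g l'" using Cons.prems g_in by (intro pr_eq) auto
    then show ?case using Cons by auto
  qed simp
  let ?f = "\<lambda>l. pr (e (length l), g l)"
  have "inj_on ?f (lists S)"
  proof (rule inj_onI)
    fix l l' assume l: "l \<in> lists S" "l' \<in> lists S" "?f l = ?f l'"
    have "e (length l) = e (length l') \<and> g l = g l'" using l e g_in by (intro pr_eq) auto
    then show "l = l'" using g_inj l e by (auto dest: injD)
  qed
  moreover have "?f ` lists S \<subseteq> S" using e g_in by (auto intro!: pr_in simp del: in_lists_conv_set)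
  ultimately show ?thesis by blast
qed

lemma infinite_nat_lists_embed:
  assumes "infinite S"
  shows "\<exists>f :: (nat \<times> 'u) list \<Rightarrow> 'u. inj_on f (lists (UNIV \<times> S))"
proof -
  obtain f :: "'u list \<Rightarrow> 'u" where f: "inj_on f (lists S)" "f ` lists S \<subseteq> S"
    using infinite_lists_embed[OF assms] by blast
  obtain e :: "nat \<Rightarrow> 'u" where e: "inj e" "range e \<subseteq> S"
    using infinite_countable_subset[OF assms] by blast
  define g where "g = (\<lambda>(n, x). f [e n, x])"
  have g: "inj_on g (UNIV \<times> S)"
  proof (rule inj_onI, clarsimp simp: g_def)
    fix n x n' x' assume *: "x \<in> S" "x' \<in> S" "f [e n, x] = f [e n', x']"
    then have "[e n, x] = [e n', x']" using e by (intro inj_onD[OF f(1)]) auto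
    then show "n = n' \<and> x = x'" using e by (auto dest: injD)
  qed
  have "g (n, x) \<in> S" if "x \<in> S" for n x
    unfolding g_def using f(2) e that by (auto simp: image_subset_iff)
  then have gS: "g p \<in> S" if "p \<in> UNIV \<times> S" for p using that by (cases p) auto
  have m: "map g l \<in> lists S" if "l \<in> lists (UNIV \<times> S)" for l
  proof (rule in_listsI, rule ballI)
    fix y assume "y \<in> set (map g l)"
    then obtain p where "p \<in> set l" "y = g p" by (metis imageE set_map)
    then show "y \<in> S" using gS in_listsD[OF that] by blast
  qed
  have "inj_on (\<lambda>l. f (map g l)) (lists (UNIV \<times> S))"
  proof (rule inj_onI)
    fix l l' assume l: "l \<in> lists (UNIV \<times> S)" "l' \<in> lists (UNIV \<times> S)" "f (map g l) = f (map g l')"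
    then have "map g l = map g l'" using m by (intro inj_onD[OF f(1)])
    moreover have "inj_on g (set l \<union> set l')" using l by (intro inj_on_subset[OF g]) auto
    ultimately show "l = l'" by (simp add: inj_on_map_eq_map)
  qed
  then show ?thesis by blast
qed

section \<open>The module R\<close>

context q_boson begin

sublocale RM: boson_module I a s m q R_mod
  by standard (rule left_module_R_mod)

text \<open>The defining equation of the action at the empty word. As the action on
  \<open>R_mod\<close> is an unspecified choice, all knowledge of it has to come from such
  equations.\<close>

lemma one_R_invariant: "cls 1 \<in> invariants R_mod"
proof -
  have "act R_mod (eprod [x]) (cls 1) = \<zero>\<^bsub>R_mod\<^esub>" if "x \<in> idx" for x
    using is_R_action_R_mod[unfolded is_R_action_def, THEN conjunct2, THEN conjunct2, rule_format, OF that lists.Nil]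
    by (simp add: fprod_def monomial_Nil R_mod_simps)
  moreover have "cls 1 \<in> carrier R_mod" unfolding R_mod_simps by (intro imageI span_words_one)
  ultimately show ?thesis by (auto simp: invariants_def)
qed

lemma R_dot_one: "t \<in> span_words FL \<Longrightarrow> RM.dot t (cls 1) = cls t"
proof (induction rule: span_words_induct')
  case (monomial c w)
  have one: "cls 1 \<in> carrier R_mod" using one_R_invariant by (simp add: invariants_def)
  have "RM.dot (monomial w) (cls 1) = cls (monomial w)" using monomial
  proof (induction w rule: list.induct)
    case Nil
    then show ?case using one by (simp add: monomial_Nil)
  next
    case (Cons x w)
    then obtain i k where x: "x = F i k" "(i, k) \<in> idx" by (auto elim: FL_E)
    have w: "w \<in> lists FL" using Cons.prems by auto
    have G: "(ltr x :: _ \<Rightarrow>\<^sub>0 'k) \<in> span_words GL" "(monomial w :: _ \<Rightarrow>\<^sub>0 'k) \<in> span_words GL"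
      using x span_FL_GL[OF span_words_monomial[OF w]] by (auto intro!: span_words_monomial)
    have r: "cls (monomial w) \<in> carrier R_alg" unfolding carrier_R by (intro imageI span_words_monomial w)
    have "RM.dot (monomial (x # w)) (cls 1) = RM.dot (ltr x) (cls (monomial w))"
      unfolding ltr_power_mult_monomial[of x w, symmetric] Cons.IH[OF w, symmetric] by (rule RM.dot_mult[OF G one])
    also have "\<dots> = act R_mod (fprod [(i, k)]) (cls (monomial w))"
      by (simp add: RM.dot_def fprod_def x)
    also have "\<dots> = fprod [(i, k)] \<otimes>\<^bsub>boson\<^esub> cls (monomial w)"
      using is_R_action_R_mod x(2) r unfolding is_R_action_def by blast
    also have "fprod [(i, k)] = cls (ltr x)" by (simp add: fprod_def x)
    finally show ?case unfolding mult_boson[OF G] ltr_power_mult_monomial .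
  qed
  then show ?case unfolding RM.dot_smul[OF span_FL_GL[OF span_words_monomial[OF monomial]] one]
    by (simp add: R_mod_simps B.smult_Q)
next
  case (add p r)
  have one: "cls 1 \<in> carrier R_mod" using one_R_invariant by (simp add: invariants_def)
  show ?case unfolding RM.dot_add[OF span_FL_GL[OF add(1)] span_FL_GL[OF add(2)] one] add(3,4)
    by (simp add: R_mod_simps B.add_Q)
next
  case zero
  have one: "cls 1 \<in> carrier R_mod" using one_R_invariant by (simp add: invariants_def)
  then show ?case unfolding RM.dot_zero[OF one] by (simp add: R_mod_simps B.zero_Q)
qed

text \<open>Identifies the chosen action with the one induced by \<open>rho\<close>: R is generated
  by 1, and 1 is invariant.\<close>

lemma R_dot: "p \<in> span_words GL \<Longrightarrow> t \<in> span_words FL \<Longrightarrow> RM.dot p (cls t) = cls (rho p t)"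
  using RM.dot_invariant[OF one_R_invariant, of t p] by (simp add: R_dot_one span_words_rho)

lemma countable_FL: "countable FL"
proof -
  have "idx \<subseteq> I \<times> UNIV" by (auto simp: idx_def)
  then have "countable idx" using countable_index by (intro countable_subset[of idx "I \<times> UNIV"]) auto
  then show ?thesis by (simp add: FL_def)
qed

end

section \<open>The module R tensor X\<close>

locale R_tensor_module = q_boson I a s m q
  for I :: "'i set" and a s m and q :: "'k::field_char_0" +
  fixes X :: "('k, 'u) module"
  assumes vector_space_X: "vector_space_rec X"
begin

sublocale X: vspace X by standard (rule vector_space_X)

sublocale T: tensor_product R_mod X ..

abbreviation "RX \<equiv> R_tensor_space X"

lemma RX_simps: "carrier RX = carrier T.VW" "add RX = add T.VW" "zero RX = zero T.VW"
  "module.smult RX = module.smult T.VW" "act RX = (\<lambda>b. tensor_map R_mod X (act R_mod b) (\<lambda>x. x))"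
  by (simp_all add: R_tensor_space_def module.defs left_module.defs)

lemma is_linear_id: "is_linear X X (\<lambda>x. x)" by (simp add: is_linear_def)

lemma is_linear_R_act: "b \<in> carrier boson \<Longrightarrow> is_linear R_mod R_mod (act R_mod b)"
  using left_module_R_mod by (simp add: is_left_module_def is_linear_def)

lemma is_linear_act: "b \<in> carrier boson \<Longrightarrow> is_linear T.VW T.VW (act RX b)"
  unfolding RX_simps by (intro tensor_map_props is_linear_R_act is_linear_id RM.M.vspace_axioms X.vspace_axioms)

lemma act_tens: "b \<in> carrier boson \<Longrightarrow> r \<in> carrier R_mod \<Longrightarrow> x \<in> carrier X \<Longrightarrow>
    act RX b (T.tens r x) = T.tens (act R_mod b r) x"
  unfolding RX_simps by (intro tensor_map_props is_linear_R_act is_linear_id RM.M.vspace_axioms X.vspace_axioms)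

lemma left_module_RX: "is_left_module boson RX"
proof -
  note R = left_module_R_mod[unfolded is_left_module_def]
  note Bo = BV.a_closed BV.smult_mem monoid.m_closed[OF ring.is_monoid[OF ring_boson]]
    monoid.one_closed[OF ring.is_monoid[OF ring_boson]]
  note lin = is_linearD[OF is_linear_act]
  have cl: "act R_mod b r \<in> carrier R_mod" if "b \<in> carrier boson" "r \<in> carrier R_mod" for b r
    using is_linearD(1)[OF is_linear_R_act] that by simp
  have "act RX (b \<oplus>\<^bsub>boson\<^esub> d) t = act RX b t \<oplus>\<^bsub>T.VW\<^esub> act RX d t"
    if "b \<in> carrier boson" "d \<in> carrier boson" "t \<in> carrier T.VW" for b d t
    using that(3)
  proof (induction rule: T.tensor_induct)
    case (tens r x)
    then show ?case using that R cl Bo by (simp add: act_tens T.tens_add_left)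
  next
    case (add x y)
    then show ?case using that lin(1)[OF _ add(1)] lin(1)[OF _ add(2)] Bo
      by (simp add: lin(2) T.VW.a_ac)
  qed
  moreover have "act RX (b \<otimes>\<^bsub>boson\<^esub> d) t = act RX b (act RX d t)"
    if "b \<in> carrier boson" "d \<in> carrier boson" "t \<in> carrier T.VW" for b d t
    using that(3)
  proof (induction rule: T.tensor_induct)
    case (tens r x)
    then show ?case using that R cl Bo by (simp add: act_tens)
  next
    case (add x y)
    then show ?case using that lin(1)[OF _ add(1)] lin(1)[OF _ add(2)] Bo by (simp add: lin(2))
  qed
  moreover have "act RX \<one>\<^bsub>boson\<^esub> t = t" if "t \<in> carrier T.VW" for t
    using that
  proof (induction rule: T.tensor_induct)
    case (tens r x)
    then show ?case using R Bo by (simp add: act_tens)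
  qed (use Bo in \<open>simp add: lin(2)\<close>)
  moreover have "act RX (c \<odot>\<^bsub>boson\<^esub> b) t = c \<odot>\<^bsub>T.VW\<^esub> act RX b t"
    if "b \<in> carrier boson" "t \<in> carrier T.VW" for b c t
    using that(2)
  proof (induction rule: T.tensor_induct)
    case (tens r x)
    then show ?case using that R cl Bo by (simp add: act_tens T.tens_smult_left)
  next
    case (add x y)
    then show ?case using that lin(1)[OF _ add(1)] lin(1)[OF _ add(2)] Bo
      by (simp add: lin(2) T.VW.smult_add_right)
  qed
  moreover have "vector_space_rec RX"
    by (rule vector_space_recI)
      (simp_all add: RX_simps T.VW.smult_add_left T.VW.smult_add_right T.VW.smult_smult
        T.VW.smult_minus1 T.VW.l_neg T.VW.r_neg T.VW.a_ac)
  ultimately show ?thesis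
    using lin unfolding is_left_module_def RX_simps(1-4) by simp
qed

sublocale RX: boson_module I a s m q RX
  by standard (rule left_module_RX)

lemma cls_R: "t \<in> span_words FL \<Longrightarrow> cls t \<in> carrier R_mod" by (simp add: R_mod_simps)

lemma R_E: "r \<in> carrier R_mod \<Longrightarrow> (\<And>t. r = cls t \<Longrightarrow> t \<in> span_words FL \<Longrightarrow> P) \<Longrightarrow> P"
  by (auto simp: R_mod_simps)

lemma dot_tens: "p \<in> span_words GL \<Longrightarrow> t \<in> span_words FL \<Longrightarrow> x \<in> carrier X \<Longrightarrow>
    RX.dot p (T.tens (cls t) x) = T.tens (cls (rho p t)) x"
  using R_dot[of p t] by (simp add: RX.dot_def RM.dot_def act_tens cls_R RX.cls_carrier)

lemma eact_tens: "v \<in> lists FL \<Longrightarrow> t \<in> span_words FL \<Longrightarrow> x \<in> carrier X \<Longrightarrow>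
    RX.eact v (T.tens (cls t) x) = T.tens (cls (L.ders v t)) x"
proof -
  assume v: "v \<in> lists FL" and t: "t \<in> span_words FL" "x \<in> carrier X"
  have "rho (monomial (map dual v)) t = L.ders v t"
    using rho_to_e[OF span_words_monomial[OF v], of t] by (simp add: to_e_monomial) (simp add: monomial_def)
  then show ?thesis using dot_tens[OF RX.dual_GL[OF v] t] by (simp add: RX.eact_def)
qed

lemma tens_zero_left: "x \<in> carrier X \<Longrightarrow> T.tens (cls 0) x = \<zero>\<^bsub>T.VW\<^esub>"
  using T.tens_smult_left[of "cls 0" x 0] cls_R[OF span_words_zero] by (simp add: R_mod_simps B.smult_Q)

lemma tens_cls_add: "p \<in> span_words FL \<Longrightarrow> r \<in> span_words FL \<Longrightarrow> x \<in> carrier X \<Longrightarrow>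
    T.tens (cls (p + r)) x = T.tens (cls p) x \<oplus>\<^bsub>T.VW\<^esub> T.tens (cls r) x"
  using T.tens_add_left[OF cls_R cls_R, of p r x] by (simp add: R_mod_simps B.add_Q)

lemma tens_cls_smul: "p \<in> span_words FL \<Longrightarrow> x \<in> carrier X \<Longrightarrow> T.tens (cls (smul c p)) x = T.tens (cls p) (c \<odot>\<^bsub>X\<^esub> x)"
  using T.tens_smult_left[OF cls_R, of p x c] T.tens_smult_right[OF cls_R, of p x c]
  by (simp add: R_mod_simps B.smult_Q)

text \<open>Scalars can be moved into the right factor, so words alone suffice on the left.\<close>

lemma tensor_words_induct [consumes 1, case_names monomial add]:
  assumes "t \<in> carrier T.VW" "\<And>w x. w \<in> lists FL \<Longrightarrow> x \<in> carrier X \<Longrightarrow> P (T.tens (cls (monomial w)) x)"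
    "\<And>x y. x \<in> carrier T.VW \<Longrightarrow> y \<in> carrier T.VW \<Longrightarrow> P x \<Longrightarrow> P y \<Longrightarrow> P (x \<oplus>\<^bsub>T.VW\<^esub> y)"
  shows "P t"
  using assms(1)
proof (induction rule: T.tensor_induct)
  case (tens r x)
  obtain p where p: "r = cls p" "p \<in> span_words FL" using tens(1) by (rule R_E)
  have "P (T.tens (cls p) x)" using p(2)
  proof (induction rule: span_words_induct')
    case zero
    have "T.tens (cls (monomial [])) \<zero>\<^bsub>X\<^esub> = \<zero>\<^bsub>T.VW\<^esub>"
      using T.tens_smult_right[of "cls (monomial [])" "\<zero>\<^bsub>X\<^esub>" 0] cls_R[OF span_words_monomial[of "[]"]] by simp
    then show ?case using assms(2)[of "[]" "\<zero>\<^bsub>X\<^esub>"] tens(2) by (simp add: tens_zero_left)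
  next
    case (monomial c w)
    then show ?case using tens(2) assms(2)[OF monomial] by (simp add: tens_cls_smul span_words_monomial del: in_lists_conv_set)
  next
    case (add p r)
    then show ?case using tens(2) assms(3) cls_R by (simp add: tens_cls_add)
  qed
  then show ?case by (simp add: p)
qed (rule assms(3))

text \<open>A product of e that is longer than w, or involves a letter absent from w, kills w
  \<otimes> x; for sums one takes the maximum of the bounds and the union of the letter
  sets.\<close>

lemma integrable_RX: "integrable RX"
  unfolding RX.integrable_iff RX_simps(1)
proof
  let ?P = "\<lambda>t n Y. finite Y \<and> Y \<subseteq> FL \<and> (\<forall>v\<in>lists FL. v \<noteq> [] \<and> (n \<le> length v \<or> \<not> set v \<subseteq> Y) \<longrightarrow> RX.eact v t = \<zero>\<^bsub>RX\<^esub>)"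
  fix t assume "t \<in> carrier T.VW"
  then show "\<exists>n Y. ?P t n Y"
  proof (induction rule: tensor_words_induct)
    case (monomial w x)
    have "RX.eact v (T.tens (cls (monomial w)) x) = \<zero>\<^bsub>RX\<^esub>"
      if v: "v \<in> lists FL" "Suc (length w) \<le> length v \<or> \<not> set v \<subseteq> set w" for v
    proof -
      have "\<not> mset v \<subseteq># mset w" using v(2) size_mset_mono[of "mset v" "mset w"] set_mset_mono[of "mset v" "mset w"] by auto
      then show ?thesis using monomial v by (simp add: eact_tens span_words_monomial L.ders_monomial(2) tens_zero_left RX_simps(3) del: in_lists_conv_set)
    qed
    moreover have "finite (set w)" "set w \<subseteq> FL" using monomial by auto
    ultimately show ?case by blast
  next
    case (add x y)
    then obtain n Y n' Y' where P: "?P x n Y" "?P y n' Y'" by blast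
    have "RX.eact v (x \<oplus>\<^bsub>T.VW\<^esub> y) = \<zero>\<^bsub>RX\<^esub>"
      if v: "v \<in> lists FL" "v \<noteq> []" "max n n' \<le> length v \<or> \<not> set v \<subseteq> Y \<union> Y'" for v
    proof -
      have "RX.eact v x = \<zero>\<^bsub>RX\<^esub>" "RX.eact v y = \<zero>\<^bsub>RX\<^esub>"
        using P v by (meson Un_upper1 Un_upper2 max.bounded_iff order_trans)+
      then show ?thesis using RX.eact_add[OF v(1), of x y] add(1,2) by (simp add: RX_simps(1-3))
    qed
    moreover have "finite (Y \<union> Y')" "Y \<union> Y' \<subseteq> FL" using P by auto
    ultimately show ?case by blast
  qed
qed

section \<open>Contractions of the left tensor factor\<close>

definition pairing :: "'i boson_gen list \<Rightarrow> ('i boson_gen word \<Rightarrow>\<^sub>0 'k) set \<Rightarrow> 'k" where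
  "pairing z r = lookup (L.ders z (rep_FL r)) 0"

lemma pairing_cls: "t \<in> span_words FL \<Longrightarrow> pairing z (cls t) = lookup (L.ders z t) 0"
proof -
  assume t: "t \<in> span_words FL"
  define p where "p = rep_FL (cls t)"
  have p: "p \<in> span_words FL \<and> cls p = cls t" unfolding p_def rep_FL_def
    by (rule someI[of _ t]) (use t in simp)
  then have "p - t \<in> L.SI" using t SI_iff_RI[of "p - t"] B.coset_eq by (auto simp: span_words_diff)
  then have "lookup (L.ders z (p - t)) 0 = 0" by (rule L.SI_radical)
  then show ?thesis by (simp add: pairing_def p_def[symmetric] linmapD[OF L.linmap_ders] lookup_minus)
qed

lemma bilinear_pairing: "bilinear_map R_mod X X (\<lambda>r x. pairing z r \<odot>\<^bsub>X\<^esub> x)"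
proof unfold_locales
  fix r r' x assume "r \<in> carrier R_mod" "r' \<in> carrier R_mod" "x \<in> carrier X"
  then show "pairing z (r \<oplus>\<^bsub>R_mod\<^esub> r') \<odot>\<^bsub>X\<^esub> x = pairing z r \<odot>\<^bsub>X\<^esub> x \<oplus>\<^bsub>X\<^esub> pairing z r' \<odot>\<^bsub>X\<^esub> x"
    by (elim R_E) (simp add: R_mod_simps B.add_Q pairing_cls span_words_add linmapD[OF L.linmap_ders] lookup_add X.smult_add_left)
next
  fix r x c assume "r \<in> carrier R_mod" "x \<in> carrier X"
  then show "pairing z (c \<odot>\<^bsub>R_mod\<^esub> r) \<odot>\<^bsub>X\<^esub> x = c \<odot>\<^bsub>X\<^esub> (pairing z r \<odot>\<^bsub>X\<^esub> x)"
    by (elim R_E) (simp add: R_mod_simps B.smult_Q pairing_cls span_words_smul linmapD[OF L.linmap_ders] lookup_smul X.smult_smult)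
qed (auto simp: X.smult_add_right X.smult_smult mult.commute)

text \<open>The counit after \<partial>_z, tensored with the identity of X; these maps serve as
  coordinates on R \<otimes> X.\<close>

definition contract :: "'i boson_gen list \<Rightarrow> (('i boson_gen word \<Rightarrow>\<^sub>0 'k) set \<times> 'u \<Rightarrow>\<^sub>0 'k) set \<Rightarrow> 'u" where
  "contract z = bilinear_map.lift X (\<lambda>r x. pairing z r \<odot>\<^bsub>X\<^esub> x)"

lemma contract_linear: "is_linear T.VW X (contract z)"
  unfolding contract_def by (rule bilinear_map.lift_linear[OF bilinear_pairing])

lemma contract_tens: "t \<in> span_words FL \<Longrightarrow> x \<in> carrier X \<Longrightarrow> contract z (T.tens (cls t) x) = lookup (L.ders z t) 0 \<odot>\<^bsub>X\<^esub> x"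
  unfolding contract_def using bilinear_map.lift_tens[OF bilinear_pairing cls_R] by (simp add: pairing_cls)

text \<open>\<open>tsums ps\<close> consists of the tensors whose left factors are the classes of the members of \<open>ps\<close>; a left factor
  on which a functional \<open>\<epsilon> \<circ> \<partial>\<^sub>z\<close> does not vanish can be eliminated from the others.\<close>

fun tsums :: "('i boson_gen word \<Rightarrow>\<^sub>0 'k) list \<Rightarrow> (('i boson_gen word \<Rightarrow>\<^sub>0 'k) set \<times> 'u \<Rightarrow>\<^sub>0 'k) set set" where
  "tsums [] = {\<zero>\<^bsub>T.VW\<^esub>}"
| "tsums (p # ps) = {T.tens (cls p) x \<oplus>\<^bsub>T.VW\<^esub> t | x t. x \<in> carrier X \<and> t \<in> tsums ps}"

lemma tsums_closed: "ps \<in> lists (span_words FL) \<Longrightarrow> t \<in> tsums ps \<Longrightarrow> t \<in> carrier T.VW"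
  by (induction ps arbitrary: t) (auto simp: cls_R)

lemma tsums_append:
  "ps \<in> lists (span_words FL) \<Longrightarrow> rs \<in> lists (span_words FL) \<Longrightarrow> t \<in> tsums ps \<Longrightarrow> u \<in> tsums rs \<Longrightarrow>
    t \<oplus>\<^bsub>T.VW\<^esub> u \<in> tsums (ps @ rs)"
proof (induction ps arbitrary: t rule: list.induct)
  case Nil
  then show ?case using tsums_closed by simp
next
  case (Cons p ps)
  then obtain x t' where t: "t = T.tens (cls p) x \<oplus>\<^bsub>T.VW\<^esub> t'" "x \<in> carrier X" "t' \<in> tsums ps" by auto
  have ps: "ps \<in> lists (span_words FL)" "cls p \<in> carrier R_mod" using Cons.prems cls_R by auto
  have "t \<oplus>\<^bsub>T.VW\<^esub> u = T.tens (cls p) x \<oplus>\<^bsub>T.VW\<^esub> (t' \<oplus>\<^bsub>T.VW\<^esub> u)"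
    using t ps Cons.prems tsums_closed by (simp add: T.VW.a_assoc del: in_lists_conv_set)
  then show ?case using Cons.IH[OF ps(1) Cons.prems(2) t(3) Cons.prems(4)] t(2) by auto
qed

lemma tsums_exist: "t \<in> carrier T.VW \<Longrightarrow> \<exists>ps\<in>lists (span_words FL). t \<in> tsums ps"
proof (induction rule: T.tensor_induct)
  case (tens r x)
  obtain p where p: "r = cls p" "p \<in> span_words FL" using tens(1) by (rule R_E)
  have "T.tens r x \<in> tsums [p]" using p tens cls_R by force
  then show ?case using p by (intro bexI[of _ "[p]"]) auto
next
  case (add x y)
  then show ?case by (meson append_in_lists_conv tsums_append)
qed

text \<open>Each left factor r is corrected by a multiple of p so that the functional at z vanishes
  on it. Bilinearity collects the removed multiples into a single tensor p \<otimes> y, with y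
  determined by the contraction of t.\<close>

lemma tsums_eliminate:
  assumes p: "p \<in> span_words FL" "lookup (L.ders z p) 0 \<noteq> 0"
  shows "ps \<in> lists (span_words FL) \<Longrightarrow> t \<in> tsums ps \<Longrightarrow>
    \<exists>t'\<in>tsums (map (\<lambda>r. r - smul (lookup (L.ders z r) 0 / lookup (L.ders z p) 0) p) ps).
      t = t' \<oplus>\<^bsub>T.VW\<^esub> T.tens (cls p) ((1 / lookup (L.ders z p) 0) \<odot>\<^bsub>X\<^esub> contract z t)"
proof (induction ps arbitrary: t rule: list.induct)
  case Nil
  have "contract z \<zero>\<^bsub>T.VW\<^esub> = \<zero>\<^bsub>X\<^esub>" by (rule is_linear_zero[OF contract_linear T.VW.vspace_axioms X.vspace_axioms])
  moreover have "T.tens (cls p) \<zero>\<^bsub>X\<^esub> = \<zero>\<^bsub>T.VW\<^esub>"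
    using T.tens_smult_right[of "cls p" "\<zero>\<^bsub>X\<^esub>" 0] cls_R[OF p(1)] by simp
  ultimately show ?case using Nil by simp
next
  case (Cons r ps)
  let ?\<phi> = "\<lambda>r. lookup (L.ders z r) 0"
  let ?c = "?\<phi> r / ?\<phi> p"
  let ?f = "\<lambda>r. r - smul (?\<phi> r / ?\<phi> p) p"
  obtain x t1 where t: "t = T.tens (cls r) x \<oplus>\<^bsub>T.VW\<^esub> t1" "x \<in> carrier X" "t1 \<in> tsums ps" using Cons.prems by auto
  have ps: "ps \<in> lists (span_words FL)" and r: "r \<in> span_words FL" using Cons.prems by auto
  obtain t' where t': "t' \<in> tsums (map ?f ps)" "t1 = t' \<oplus>\<^bsub>T.VW\<^esub> T.tens (cls p) ((1 / ?\<phi> p) \<odot>\<^bsub>X\<^esub> contract z t1)"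
    using Cons.IH[OF ps t(3)] by blast
  have fr: "?f r \<in> span_words FL" using r p by (intro span_words_diff span_words_smul)
  have mf: "map ?f ps \<in> lists (span_words FL)" using ps p by (auto intro!: span_words_diff span_words_smul)
  have t1: "t1 \<in> carrier T.VW" using tsums_closed ps t(3) by blast
  have t'c: "t' \<in> carrier T.VW" using tsums_closed mf t'(1) by blast
  have c1: "contract z t1 \<in> carrier X" using is_linearD(1)[OF contract_linear t1] .
  have "T.tens (cls r) x = T.tens (cls (?f r + smul ?c p)) x" by simp
  also have "\<dots> = T.tens (cls (?f r)) x \<oplus>\<^bsub>T.VW\<^esub> T.tens (cls p) (?c \<odot>\<^bsub>X\<^esub> x)"
    using fr p t(2) by (simp only: tens_cls_add tens_cls_smul span_words_smul)
  finally have e: "T.tens (cls r) x = T.tens (cls (?f r)) x \<oplus>\<^bsub>T.VW\<^esub> T.tens (cls p) (?c \<odot>\<^bsub>X\<^esub> x)" .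
  have "contract z t = ?\<phi> r \<odot>\<^bsub>X\<^esub> x \<oplus>\<^bsub>X\<^esub> contract z t1"
    using is_linearD(2)[OF contract_linear _ t1] r t(2) by (simp add: t(1) cls_R contract_tens)
  then have "(1 / ?\<phi> p) \<odot>\<^bsub>X\<^esub> contract z t = ?c \<odot>\<^bsub>X\<^esub> x \<oplus>\<^bsub>X\<^esub> (1 / ?\<phi> p) \<odot>\<^bsub>X\<^esub> contract z t1"
    using t(2) c1 by (simp add: X.smult_add_right X.smult_smult)
  then have "T.tens (cls p) ((1 / ?\<phi> p) \<odot>\<^bsub>X\<^esub> contract z t) = T.tens (cls p) (?c \<odot>\<^bsub>X\<^esub> x) \<oplus>\<^bsub>T.VW\<^esub>
      T.tens (cls p) ((1 / ?\<phi> p) \<odot>\<^bsub>X\<^esub> contract z t1)"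
    using t(2) c1 cls_R[OF p(1)] by (simp add: T.tens_add_right)
  moreover have "t = T.tens (cls (?f r)) x \<oplus>\<^bsub>T.VW\<^esub> T.tens (cls p) (?c \<odot>\<^bsub>X\<^esub> x) \<oplus>\<^bsub>T.VW\<^esub>
      (t' \<oplus>\<^bsub>T.VW\<^esub> T.tens (cls p) ((1 / ?\<phi> p) \<odot>\<^bsub>X\<^esub> contract z t1))"
    unfolding t(1) e using t'(2) by simp
  ultimately have "t = (T.tens (cls (?f r)) x \<oplus>\<^bsub>T.VW\<^esub> t') \<oplus>\<^bsub>T.VW\<^esub> T.tens (cls p) ((1 / ?\<phi> p) \<odot>\<^bsub>X\<^esub> contract z t)"
    using t'c t(2) c1 cls_R[OF p(1)] cls_R[OF fr] by (simp add: T.VW.a_ac)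
  moreover have "T.tens (cls (?f r)) x \<oplus>\<^bsub>T.VW\<^esub> t' \<in> tsums (map ?f (r # ps))" using t(2) t'(1) by auto
  ultimately show ?case by blast
qed

text \<open>Nondegeneracy enters here. A first left factor outside the ideal is detected by some z;
  the vanishing contraction at z says that its right factor cancels what elimination has collected,
  and one summand fewer remains. A first left factor inside the ideal is simply dropped.\<close>

lemma contract_separates:
  assumes "t \<in> carrier T.VW" "\<And>z. z \<in> lists FL \<Longrightarrow> contract z t = \<zero>\<^bsub>X\<^esub>"
  shows "t = \<zero>\<^bsub>T.VW\<^esub>"
proof -
  have "ps \<in> lists (span_words FL) \<Longrightarrow> t \<in> tsums ps \<Longrightarrow> t = \<zero>\<^bsub>T.VW\<^esub>" for ps
  proof (induction "length ps" arbitrary: ps)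
    case 0
    then show ?case by simp
  next
    case (Suc n)
    then obtain p rs where ps: "ps = p # rs" by (cases ps) auto
    have p: "p \<in> span_words FL" and rs: "rs \<in> lists (span_words FL)" using Suc.prems ps by auto
    obtain x t1 where t: "t = T.tens (cls p) x \<oplus>\<^bsub>T.VW\<^esub> t1" "x \<in> carrier X" "t1 \<in> tsums rs" using Suc.prems ps by auto
    have t1: "t1 \<in> carrier T.VW" using tsums_closed rs t(3) by blast
    show ?case
    proof (cases "p \<in> L.SI")
      case True
      then have "cls p = cls 0" using B.coset_eq SI_RI by simp
      then have "t = t1" using t t1 by (simp add: tens_zero_left)
      then show ?thesis using Suc.hyps(1)[of rs] Suc.hyps(2) ps rs t(3) by auto
    next
      case False
      then obtain z where z: "z \<in> lists FL" "lookup (L.ders z p) 0 \<noteq> 0" using L.radical_SI[OF p] by blast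
      let ?\<phi> = "\<lambda>r. lookup (L.ders z r) 0"
      let ?f = "\<lambda>r. r - smul (?\<phi> r / ?\<phi> p) p"
      have mf: "map ?f rs \<in> lists (span_words FL)" using rs p by (auto intro!: span_words_diff span_words_smul)
      obtain t' where t': "t' \<in> tsums (map ?f rs)" "t1 = t' \<oplus>\<^bsub>T.VW\<^esub> T.tens (cls p) ((1 / ?\<phi> p) \<odot>\<^bsub>X\<^esub> contract z t1)"
        using tsums_eliminate[OF p z(2) rs t(3)] by blast
      have t'c: "t' \<in> carrier T.VW" using tsums_closed mf t'(1) by blast
      have c1: "contract z t1 \<in> carrier X" using is_linearD(1)[OF contract_linear t1] .
      have "?\<phi> p \<odot>\<^bsub>X\<^esub> x \<oplus>\<^bsub>X\<^esub> contract z t1 = \<zero>\<^bsub>X\<^esub>"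
        using assms(2)[OF z(1)] is_linearD(2)[OF contract_linear _ t1] p t(2) by (simp add: t(1) cls_R contract_tens)
      then have "(1 / ?\<phi> p) \<odot>\<^bsub>X\<^esub> (?\<phi> p \<odot>\<^bsub>X\<^esub> x \<oplus>\<^bsub>X\<^esub> contract z t1) = \<zero>\<^bsub>X\<^esub>" by simp
      then have x0: "x \<oplus>\<^bsub>X\<^esub> (1 / ?\<phi> p) \<odot>\<^bsub>X\<^esub> contract z t1 = \<zero>\<^bsub>X\<^esub>"
        using t(2) c1 z(2) by (simp add: X.smult_add_right X.smult_smult)
      have "T.tens (cls p) x \<oplus>\<^bsub>T.VW\<^esub> T.tens (cls p) ((1 / ?\<phi> p) \<odot>\<^bsub>X\<^esub> contract z t1) = T.tens (cls p) \<zero>\<^bsub>X\<^esub>"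
        using t(2) c1 cls_R[OF p] by (simp add: T.tens_add_right[symmetric] x0)
      also have "\<dots> = \<zero>\<^bsub>T.VW\<^esub>" using T.tens_smult_right[of "cls p" "\<zero>\<^bsub>X\<^esub>" 0] cls_R[OF p] by simp
      finally have k: "T.tens (cls p) x \<oplus>\<^bsub>T.VW\<^esub> T.tens (cls p) ((1 / ?\<phi> p) \<odot>\<^bsub>X\<^esub> contract z t1) = \<zero>\<^bsub>T.VW\<^esub>" .
      have "t = T.tens (cls p) x \<oplus>\<^bsub>T.VW\<^esub> (t' \<oplus>\<^bsub>T.VW\<^esub> T.tens (cls p) ((1 / ?\<phi> p) \<odot>\<^bsub>X\<^esub> contract z t1))"
        unfolding t(1) using t'(2) by simp
      also have "\<dots> = t' \<oplus>\<^bsub>T.VW\<^esub> (T.tens (cls p) x \<oplus>\<^bsub>T.VW\<^esub> T.tens (cls p) ((1 / ?\<phi> p) \<odot>\<^bsub>X\<^esub> contract z t1))"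
        using t'c t(2) c1 cls_R[OF p] by (simp add: T.VW.a_ac)
      also have "\<dots> = t'" using t'c by (simp add: k)
      finally have "t \<in> tsums (map ?f rs)" using t'(1) by simp
      then show ?thesis using Suc.hyps(1)[of "map ?f rs"] Suc.hyps(2) ps mf by auto
    qed
  qed
  then show ?thesis using tsums_exist[OF assms(1)] by blast
qed

lemma contract_eact: "z \<in> lists FL \<Longrightarrow> t \<in> carrier T.VW \<Longrightarrow> contract z t = contract [] (RX.eact z t)"
proof -
  assume z: "z \<in> lists FL" and "t \<in> carrier T.VW"
  from this(2) show ?thesis
  proof (induction rule: T.tensor_induct)
    case (tens r x)
    obtain p where p: "r = cls p" "p \<in> span_words FL" using tens(1) by (rule R_E)
    then show ?case using tens z by (simp add: eact_tens contract_tens L.span_words_ders del: in_lists_conv_set)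
  next
    case (add x y)
    have "RX.eact z (x \<oplus>\<^bsub>T.VW\<^esub> y) = RX.eact z x \<oplus>\<^bsub>T.VW\<^esub> RX.eact z y"
      using RX.eact_add[OF z, of x y] add(1,2) by (simp add: RX_simps(1,2))
    moreover have "RX.eact z x \<in> carrier T.VW" "RX.eact z y \<in> carrier T.VW"
      using RX.eact_closed[OF z] add(1,2) by (simp_all add: RX_simps(1))
    ultimately show ?case using add by (simp add: is_linearD(2)[OF contract_linear])
  qed
qed

text \<open>The last letter of z acts first, so an invariant t has zero contraction for every
  nonempty z; hence t and 1 \<otimes> \<open>contract [] t\<close> have the same
  contractions.\<close>

lemma invariants_RX: "invariants RX = T.tens (cls 1) ` carrier X"
proof (intro equalityI subsetI)
  fix t assume "t \<in> T.tens (cls 1) ` carrier X"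
  then obtain x where x: "t = T.tens (cls 1) x" "x \<in> carrier X" by auto
  have "RX.dot (ltr (E i k)) t = \<zero>\<^bsub>RX\<^esub>" if "(i, k) \<in> idx" for i k
    using x that by (simp add: dot_tens RX.ltr_E_GL span_words_one rho_monomial tens_zero_left RX_simps(3))
  then show "t \<in> invariants RX" using x by (simp add: RX.invariants_alt RX_simps(1) cls_R span_words_one)
next
  fix t assume inv: "t \<in> invariants RX"
  then have t: "t \<in> carrier T.VW" by (simp add: RX.invariants_alt RX_simps(1))
  define x where "x = contract [] t"
  have x: "x \<in> carrier X" unfolding x_def by (rule is_linearD(1)[OF contract_linear t])
  have one: "cls 1 \<in> carrier R_mod" by (rule cls_R[OF span_words_one])
  define u where "u = T.tens (cls 1) ((- 1) \<odot>\<^bsub>X\<^esub> x)"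
  have u: "u \<in> carrier T.VW" using x one by (simp add: u_def)
  have "t \<oplus>\<^bsub>T.VW\<^esub> u = \<zero>\<^bsub>T.VW\<^esub>"
  proof (rule contract_separates)
    show "t \<oplus>\<^bsub>T.VW\<^esub> u \<in> carrier T.VW" using t u by simp
    fix z assume z: "z \<in> lists FL"
    have cu: "contract z u = lookup (L.ders z 1) 0 \<odot>\<^bsub>X\<^esub> ((- 1) \<odot>\<^bsub>X\<^esub> x)"
      unfolding u_def by (rule contract_tens[OF span_words_one]) (use x in simp)
    have "contract z t \<oplus>\<^bsub>X\<^esub> contract z u = \<zero>\<^bsub>X\<^esub>"
    proof (cases z rule: rev_cases)
      case Nil
      then show ?thesis using x cu by (simp add: x_def[symmetric] X.smult_minus1 X.r_neg)
    next
      case (snoc z' b)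
      then obtain i k where b: "b = F i k" "(i, k) \<in> idx" and z': "z' \<in> lists FL" using z by (auto elim: FL_E)
      have "L.ders z 1 = 0" by (simp add: snoc linmapD[OF L.linmap_ders])
      then have "contract z u = \<zero>\<^bsub>X\<^esub>" using cu x by simp
      moreover have "RX.eact z t = RX.eact z' (RX.dot (ltr (E i k)) t)"
      proof -
        have "monomial (map dual z) = monomial (map dual z') * (ltr (E i k) :: _ \<Rightarrow>\<^sub>0 'k)"
          by (simp add: snoc b monomial_append)
        then show ?thesis unfolding RX.eact_def
          using RX.dot_mult[OF RX.dual_GL[OF z'] RX.ltr_E_GL[OF b(2)], of t] t by (simp add: RX_simps(1))
      qed
      then have "RX.eact z t = \<zero>\<^bsub>T.VW\<^esub>"
        using inv b RX.dot_zero_right[OF RX.dual_GL[OF z']] by (simp add: RX.invariants_alt RX.eact_def RX_simps(3))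
      then have "contract z t = \<zero>\<^bsub>X\<^esub>"
        using contract_eact[OF z t] is_linear_zero[OF contract_linear T.VW.vspace_axioms X.vspace_axioms] by simp
      ultimately show ?thesis by simp
    qed
    then show "contract z (t \<oplus>\<^bsub>T.VW\<^esub> u) = \<zero>\<^bsub>X\<^esub>" by (simp add: is_linearD(2)[OF contract_linear t u])
  qed
  moreover have "u = \<ominus>\<^bsub>T.VW\<^esub> T.tens (cls 1) x"
    unfolding u_def using x one by (simp add: T.tens_smult_right T.VW.smult_minus1)
  ultimately have "t = T.tens (cls 1) x"
    using t x one by (metis T.VW.add.inv_closed T.VW.add.inv_inv T.VW.minus_equality T.VW.a_comm T.tens_closed T.VW.r_neg)
  then show "t \<in> T.tens (cls 1) ` carrier X" using x by blast
qed

lemma tens_one_inj: "inj_on (T.tens (cls 1)) (carrier X)"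
proof (rule inj_onI)
  fix x y assume xy: "x \<in> carrier X" "y \<in> carrier X" "T.tens (cls 1) x = T.tens (cls 1) y"
  have "contract [] (T.tens (cls 1) x) = x" if "x \<in> carrier X" for x
    using that by (simp add: contract_tens span_words_one)
  then show "x = y" using xy by metis
qed

section \<open>Injecting R \<otimes> X into the universe\<close>

fun decode :: "(nat \<times> 'u) list \<Rightarrow> (('i boson_gen word \<Rightarrow>\<^sub>0 'k) set \<times> 'u \<Rightarrow>\<^sub>0 'k) set" where
  "decode [] = \<zero>\<^bsub>T.VW\<^esub>"
| "decode ((n, x) # l) = T.tens (cls (monomial (from_nat_into (lists FL) n))) x \<oplus>\<^bsub>T.VW\<^esub> decode l"

lemma enum_lists_FL: "from_nat_into (lists FL) n \<in> lists FL"
  by (rule from_nat_into) auto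

lemma decode_closed: "l \<in> lists (UNIV \<times> carrier X) \<Longrightarrow> decode l \<in> carrier T.VW"
proof (induction l rule: list.induct)
  case (Cons p l)
  obtain n x where p: "p = (n, x)" by (cases p)
  have "cls (monomial (from_nat_into (lists FL) n)) \<in> carrier R_mod" by (rule cls_R[OF span_words_monomial[OF enum_lists_FL]])
  then show ?case using Cons p by auto
qed simp

lemma decode_append:
  "l \<in> lists (UNIV \<times> carrier X) \<Longrightarrow> l' \<in> lists (UNIV \<times> carrier X) \<Longrightarrow> decode (l @ l') = decode l \<oplus>\<^bsub>T.VW\<^esub> decode l'"
proof (induction l rule: list.induct)
  case (Cons p l)
  obtain n x where p: "p = (n, x)" by (cases p)
  have "cls (monomial (from_nat_into (lists FL) n)) \<in> carrier R_mod" by (rule cls_R[OF span_words_monomial[OF enum_lists_FL]])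
  moreover have "l \<in> lists (UNIV \<times> carrier X)" "x \<in> carrier X" using Cons.prems p by auto
  ultimately show ?case using Cons p decode_closed[of l] decode_closed[of l']
    by (simp add: T.VW.a_assoc del: in_lists_conv_set)
qed (simp add: decode_closed del: in_lists_conv_set)

text \<open>Countability of the letters allows words to be replaced by numbers, so lists over nat
  \<times> X surject onto the tensor product.\<close>

lemma decode_surj: "t \<in> carrier T.VW \<Longrightarrow> \<exists>l\<in>lists (UNIV \<times> carrier X). t = decode l"
proof (induction rule: tensor_words_induct)
  case (monomial w x)
  have "countable (lists FL)" using countable_FL by (rule countable_lists)
  then obtain n where "w = from_nat_into (lists FL) n" using monomial(1) from_nat_into_surj by metis
  then have "T.tens (cls (monomial w)) x = decode [(n, x)]"
    using monomial cls_R[OF span_words_monomial[OF monomial(1)]] by simp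
  then show ?case using monomial by (intro bexI[of _ "[(n, x)]"]) auto
next
  case (add x y)
  then show ?case by (metis append_in_lists_conv decode_append)
qed

text \<open>The choice in \<open>R_embed\<close> is legitimate for reasons of cardinality: a nonzero
  X is infinite because the field is, so lists over nat \<times> X embed into \<open>'u\<close>,
  while for X = 0 the tensor product is a point.\<close>

lemma R_embed_inj: "inj_on (R_embed X) (carrier RX)"
proof -
  have "\<exists>\<phi> :: _ \<Rightarrow> 'u. inj_on \<phi> (carrier T.VW)"
  proof (cases "carrier X = {\<zero>\<^bsub>X\<^esub>}")
    case True
    have "t = \<zero>\<^bsub>T.VW\<^esub>" if "t \<in> carrier T.VW" for t
      using that
    proof (induction rule: T.tensor_induct)
      case (tens r x)
      then show ?case using True T.tens_smult_right[of r "\<zero>\<^bsub>X\<^esub>" 0] by simp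
    qed simp
    then have "inj_on (\<lambda>_. undefined) (carrier T.VW)" unfolding inj_on_def by metis
    then show ?thesis by blast
  next
    case False
    then obtain x where x: "x \<in> carrier X" "x \<noteq> \<zero>\<^bsub>X\<^esub>" using X.zero_closed by blast
    have "inj (\<lambda>c. c \<odot>\<^bsub>X\<^esub> x)"
    proof (rule injI, rule ccontr)
      fix c d assume cd: "c \<odot>\<^bsub>X\<^esub> x = d \<odot>\<^bsub>X\<^esub> x" "c \<noteq> d"
      have "(c + - d) \<odot>\<^bsub>X\<^esub> x = c \<odot>\<^bsub>X\<^esub> x \<oplus>\<^bsub>X\<^esub> (- 1) \<odot>\<^bsub>X\<^esub> (d \<odot>\<^bsub>X\<^esub> x)"
        using x by (simp only: X.smult_add_left X.smult_smult) simp
      also have "\<dots> = \<zero>\<^bsub>X\<^esub>" using x cd by (simp add: X.smult_minus1 X.r_neg)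
      finally have "(1 / (c + - d)) \<odot>\<^bsub>X\<^esub> ((c + - d) \<odot>\<^bsub>X\<^esub> x) = \<zero>\<^bsub>X\<^esub>" by simp
      then show False using x cd by (simp add: X.smult_smult)
    qed
    moreover have "infinite (UNIV :: 'k set)" by (rule infinite_UNIV_char_0)
    ultimately have "infinite (range (\<lambda>c. c \<odot>\<^bsub>X\<^esub> x))" using finite_imageD by blast
    moreover have "range (\<lambda>c. c \<odot>\<^bsub>X\<^esub> x) \<subseteq> carrier X" using x by auto
    ultimately have "infinite (carrier X)" using finite_subset by blast
    then obtain f :: "(nat \<times> 'u) list \<Rightarrow> 'u" where f: "inj_on f (lists (UNIV \<times> carrier X))"
      using infinite_nat_lists_embed by blast
    define g where "g t = (SOME l. l \<in> lists (UNIV \<times> carrier X) \<and> t = decode l)" for t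
    have g: "g t \<in> lists (UNIV \<times> carrier X) \<and> t = decode (g t)" if "t \<in> carrier T.VW" for t
      unfolding g_def by (rule someI_ex) (use decode_surj[OF that] in blast)
    have "inj_on (\<lambda>t. f (g t)) (carrier T.VW)"
    proof (rule inj_onI)
      fix t u assume tu: "t \<in> carrier T.VW" "u \<in> carrier T.VW" "f (g t) = f (g u)"
      then have "g t = g u" using g by (intro inj_onD[OF f]) auto
      then show "t = u" using g tu by metis
    qed
    then show ?thesis by blast
  qed
  then show ?thesis unfolding R_embed_def RX_simps(1) by (rule someI_ex)
qed

end

section \<open>The category of vector spaces and categories of modules\<close>

lemma Vec_simps: "Obj Vec = {V. vector_space_rec V}" "Hom Vec = linear_maps"
  "Ident Vec V = restrict (\<lambda>x. x) (carrier V)" "Comp Vec V W X g f = compose (carrier V) g f"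
  by (simp_all add: Vec_def)

lemma LMod_simps: "Obj (LMod B) = {M. is_left_module B M}" "Hom (LMod B) = left_module_homs B"
  "Ident (LMod B) M = restrict (\<lambda>x. x) (carrier M)" "Comp (LMod B) M N L g f = compose (carrier M) g f"
  by (simp_all add: LMod_def)

lemma full_subcategory_simps: "Obj (full_subcategory C P) = {X \<in> Obj C. P X}"
  "Hom (full_subcategory C P) = Hom C" "Ident (full_subcategory C P) = Ident C"
  "Comp (full_subcategory C P) = Comp C"
  by (simp_all add: full_subcategory_def)

lemma is_category_full_subcategory: "is_category C \<Longrightarrow> is_category (full_subcategory C P)"
  unfolding is_category_def full_subcategory_simps by blast

definition is_module_map ::
  "('k::field, 'b, 'y) module_scheme \<Rightarrow> ('k, 'b, 'v, 'x) left_module_scheme \<Rightarrow>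
   ('k, 'b, 'w, 'z) left_module_scheme \<Rightarrow> ('v \<Rightarrow> 'w) \<Rightarrow> bool" where
  "is_module_map B M N f \<longleftrightarrow> is_linear M N f \<and>
     (\<forall>b\<in>carrier B. \<forall>x\<in>carrier M. f (act M b x) = act N b (f x))"

lemma is_module_mapD: "is_module_map B M N f \<Longrightarrow> is_linear M N f"
  by (simp add: is_module_map_def)

lemma left_module_homs_iff:
  "f \<in> left_module_homs B M N \<longleftrightarrow> is_module_map B M N f \<and> f \<in> extensional (carrier M)"
  by (auto simp: left_module_homs_def is_module_map_def linear_maps_iff)

lemma is_linear_comp: "is_linear V W f \<Longrightarrow> is_linear W Z g \<Longrightarrow> is_linear V Z (\<lambda>x. g (f x))"
  by (simp add: is_linear_def)

lemma is_module_map_comp: "is_module_map B M N f \<Longrightarrow> is_module_map B N L g \<Longrightarrow> is_module_map B M L (\<lambda>x. g (f x))"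
  by (simp add: is_module_map_def is_linear_comp) (simp add: is_linear_def)

lemma is_linear_restrict: "vspace V \<Longrightarrow> is_linear V W (restrict f (carrier V)) \<longleftrightarrow> is_linear V W f"
proof -
  assume "vspace V"
  then interpret vspace V .
  show ?thesis by (simp add: is_linear_def)
qed

lemma vspace_left_module: "is_left_module B M \<Longrightarrow> vspace M"
  by (simp add: is_left_module_def vspace_def)

lemma act_closed: "is_left_module B M \<Longrightarrow> b \<in> carrier B \<Longrightarrow> x \<in> carrier M \<Longrightarrow> act M b x \<in> carrier M"
  by (simp add: is_left_module_def)

lemma is_module_map_restrict:
  "is_left_module B M \<Longrightarrow> is_module_map B M N (restrict f (carrier M)) \<longleftrightarrow> is_module_map B M N f"
  by (simp add: is_module_map_def is_linear_restrict vspace_left_module act_closed)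

lemma is_linear_inv:
  assumes "vspace V" "is_linear V W f" "bij_betw f (carrier V) (carrier W)"
  shows "is_linear W V (inv_into (carrier V) f)"
proof -
  interpret vspace V by fact
  have i: "\<And>x. x \<in> carrier V \<Longrightarrow> inv_into (carrier V) f (f x) = x"
    using assms(3) by (simp add: bij_betw_def)
  have W: "carrier W = f ` carrier V" using assms(3) by (simp add: bij_betw_def)
  show ?thesis
    unfolding is_linear_def W by (auto simp: i is_linearD(2,3)[OF assms(2), symmetric])
qed

lemma is_module_map_inv:
  assumes "is_left_module B M" "is_module_map B M N f" "bij_betw f (carrier M) (carrier N)"
  shows "is_module_map B N M (inv_into (carrier M) f)"
proof -
  have i: "\<And>x. x \<in> carrier M \<Longrightarrow> inv_into (carrier M) f (f x) = x"
    using assms(3) by (simp add: bij_betw_def)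
  have N: "carrier N = f ` carrier M" using assms(3) by (simp add: bij_betw_def)
  have "act N b (f x) = f (act M b x)" if "b \<in> carrier B" "x \<in> carrier M" for b x
    using assms(2) that by (simp add: is_module_map_def)
  moreover have "is_linear N M (inv_into (carrier M) f)"
    using assms by (intro is_linear_inv vspace_left_module) (auto simp: is_module_map_def)
  ultimately show ?thesis
    unfolding is_module_map_def N by (auto simp: i act_closed[OF assms(1)])
qed

lemma compose_inv_restrict:
  assumes "bij_betw f A B"
  shows "compose A (restrict (inv_into A f) B) f = restrict (\<lambda>x. x) A"
    "compose B f (restrict (inv_into A f) B) = restrict (\<lambda>x. x) B"
  using assms by (auto simp: compose_def restrict_def bij_betw_def fun_eq_iff f_inv_into_f)

lemma is_iso_Vec:
  assumes "vspace V" "vspace W" "is_linear V W f" "f \<in> extensional (carrier V)" "bij_betw f (carrier V) (carrier W)"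
  shows "is_iso Vec V W f"
  unfolding is_iso_def Vec_simps linear_maps_iff
  using assms compose_inv_restrict[OF assms(5)]
  by (intro conjI bexI[of _ "restrict (inv_into (carrier V) f) (carrier W)"])
    (auto simp: linear_maps_iff is_linear_restrict is_linear_inv)

lemma is_iso_LMod:
  assumes "is_left_module B M" "is_left_module B N" "is_module_map B M N f" "f \<in> extensional (carrier M)"
    "bij_betw f (carrier M) (carrier N)"
  shows "is_iso (LMod B) M N f"
  unfolding is_iso_def LMod_simps left_module_homs_iff
  using assms compose_inv_restrict[OF assms(5)]
  by (intro conjI bexI[of _ "restrict (inv_into (carrier M) f) (carrier N)"])
    (auto simp: left_module_homs_iff is_module_map_restrict is_module_map_inv)

lemma is_linear_ident: "is_linear V V (\<lambda>x. x)" by (simp add: is_linear_def)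

lemma is_module_map_ident: "is_module_map B M M (\<lambda>x. x)"
  by (simp add: is_module_map_def is_linear_ident)

lemma is_linear_compose:
  assumes "vspace V" "is_linear V W f" "is_linear W Z g" shows "is_linear V Z (compose (carrier V) g f)"
  unfolding compose_def is_linear_restrict[OF assms(1)] by (rule is_linear_comp[OF assms(2,3)])

lemma is_module_map_compose:
  assumes "is_left_module B M" "is_module_map B M N f" "is_module_map B N L g"
  shows "is_module_map B M L (compose (carrier M) g f)"
  unfolding compose_def is_module_map_restrict[OF assms(1)] by (rule is_module_map_comp[OF assms(2,3)])

lemma compose_ident:
  assumes "f \<in> extensional A" "f ` A \<subseteq> B"
  shows "compose A f (restrict (\<lambda>x. x) A) = f" "compose A (restrict (\<lambda>x. x) B) f = f"
  using assms by (auto simp: compose_def restrict_def extensional_def fun_eq_iff)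

lemma compose_assoc': "f ` A \<subseteq> B \<Longrightarrow> compose A (compose B h g) f = compose A h (compose A g f)"
  by (auto simp: compose_def restrict_def fun_eq_iff)

lemma is_category_Vec: "is_category Vec"
  unfolding is_category_def Vec_simps linear_maps_iff
  by (auto simp: linear_maps_iff is_linear_restrict is_linear_ident is_linear_compose vspace_def
      intro!: compose_ident compose_assoc' dest: is_linearD(1))

lemma is_module_map_closed: "is_module_map B M N f \<Longrightarrow> x \<in> carrier M \<Longrightarrow> f x \<in> carrier N"
  by (simp add: is_module_map_def is_linear_def)

lemma is_category_LMod: "is_category (LMod B)"
  unfolding is_category_def LMod_simps
  by (auto simp: left_module_homs_iff is_module_map_restrict is_module_map_ident is_module_map_compose
      intro!: compose_ident compose_assoc' dest: is_module_map_closed)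

lemma transport_simps:
  assumes "inj_on \<phi> (carrier M)"
  shows "carrier (transport \<phi> M) = \<phi> ` carrier M" "\<zero>\<^bsub>transport \<phi> M\<^esub> = \<phi> \<zero>\<^bsub>M\<^esub>"
    "x \<in> carrier M \<Longrightarrow> y \<in> carrier M \<Longrightarrow> \<phi> x \<oplus>\<^bsub>transport \<phi> M\<^esub> \<phi> y = \<phi> (x \<oplus>\<^bsub>M\<^esub> y)"
    "x \<in> carrier M \<Longrightarrow> c \<odot>\<^bsub>transport \<phi> M\<^esub> \<phi> x = \<phi> (c \<odot>\<^bsub>M\<^esub> x)"
    "x \<in> carrier M \<Longrightarrow> act (transport \<phi> M) b (\<phi> x) = \<phi> (act M b x)"
  using assms by (simp_all add: transport_def Let_def)

lemma left_module_transport: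
  assumes "is_left_module B M" "inj_on \<phi> (carrier M)"
  shows "is_left_module B (transport \<phi> M)"
proof -
  interpret vspace M using assms(1) by (rule vspace_left_module)
  note t = transport_simps[OF assms(2)]
  have "vector_space_rec (transport \<phi> M)"
    by (rule vector_space_recI)
      (auto simp: t smult_add_left smult_add_right smult_smult smult_minus1 l_neg a_assoc intro!: a_comm arg_cong[of _ _ \<phi>])
  then show ?thesis
    using assms(1) unfolding is_left_module_def t(1) by (auto simp: t)
qed

lemma is_module_map_transport:
  assumes "is_left_module B M" "inj_on \<phi> (carrier M)"
  shows "is_module_map B M (transport \<phi> M) \<phi>"
  using transport_simps[OF assms(2)] by (simp add: is_module_map_def is_linear_def)

lemma is_module_map_inv_transport:
  assumes "is_left_module B M" "inj_on \<phi> (carrier M)"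
  shows "is_module_map B (transport \<phi> M) M (inv_into (carrier M) \<phi>)"
  by (rule is_module_map_inv[OF assms(1) is_module_map_transport[OF assms]])
    (use assms(2) in \<open>simp add: bij_betw_def transport_simps\<close>)

section \<open>The equivalence of categories\<close>

context q_boson begin

lemma OB_simps: "Obj OB = {M. is_left_module boson M \<and> integrable M}" "Hom OB = left_module_homs boson"
  "Ident OB M = restrict (\<lambda>x. x) (carrier M)" "Comp OB M N L g f = compose (carrier M) g f"
  by (auto simp: OB_def full_subcategory_simps LMod_simps)

lemma is_iso_OB: "is_iso OB M N f \<longleftrightarrow> is_iso (LMod boson) M N f"
  by (simp add: is_iso_def OB_simps LMod_simps)

abbreviation "inv_space M \<equiv> (module.truncate M)\<lparr>carrier := invariants M\<rparr>"

lemma inv_space_simps: "carrier (inv_space M) = invariants M" "add (inv_space M) = add M"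
  "zero (inv_space M) = zero M" "module.smult (inv_space M) = module.smult M"
  by (simp_all add: module.defs)

lemma eprod_closed: "w \<in> lists idx \<Longrightarrow> eprod w \<in> carrier boson"
proof -
  assume "w \<in> lists idx"
  then have "map (\<lambda>(i, k). E i k) w \<in> lists GL" by (induction w) auto
  then show ?thesis unfolding eprod_def carrier_boson by (intro imageI span_words_monomial)
qed

lemma invariants_iff: "x \<in> invariants M \<longleftrightarrow> x \<in> carrier M \<and> (\<forall>y\<in>idx. act M (eprod [y]) x = \<zero>\<^bsub>M\<^esub>)"
  by (auto simp: invariants_def)

lemma transport_invariants:
  assumes "is_left_module boson M" "inj_on \<phi> (carrier M)"
  shows "invariants (transport \<phi> M) = \<phi> ` invariants M"
proof -
  interpret boson_module I a s m q M by standard fact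
  have "\<phi> (act M (eprod [x]) y) = \<phi> \<zero>\<^bsub>M\<^esub> \<longleftrightarrow> act M (eprod [x]) y = \<zero>\<^bsub>M\<^esub>" if "x \<in> idx" "y \<in> carrier M" for x y
    using inj_on_eq_iff[OF assms(2) act_closed[OF assms(1) eprod_closed[of "[x]"] that(2)] M.zero_closed] that by simp
  then have "\<phi> y \<in> invariants (transport \<phi> M) \<longleftrightarrow> y \<in> invariants M" if "y \<in> carrier M" for y
    using that transport_simps[OF assms(2)] by (simp add: invariants_iff)
  moreover have "invariants (transport \<phi> M) \<subseteq> \<phi> ` carrier M" "invariants M \<subseteq> carrier M"
    using transport_simps(1)[OF assms(2)] by (auto simp: invariants_def)
  ultimately show ?thesis by blast
qed

lemma transport_integrable:
  assumes "is_left_module boson M" "inj_on \<phi> (carrier M)" "integrable M"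
  shows "integrable (transport \<phi> M)"
  unfolding integrable_def transport_simps(1,2)[OF assms(2)]
proof
  fix y assume "y \<in> \<phi> ` carrier M"
  then obtain x where x: "y = \<phi> x" "x \<in> carrier M" by blast
  from bspec[OF assms(3)[unfolded integrable_def] x(2)] obtain n J where *: "n > 0" "finite J" "J \<subseteq> I"
    "\<forall>w\<in>lists idx. w \<noteq> [] \<and> (length w \<ge> n \<or> (\<exists>(i, k)\<in>set w. i \<notin> J)) \<longrightarrow> act M (eprod w) x = \<zero>\<^bsub>M\<^esub>"
    by (elim exE conjE) (rule that)
  show "\<exists>n>0. \<exists>J. finite J \<and> J \<subseteq> I \<and> (\<forall>w\<in>lists idx. w \<noteq> [] \<and> (length w \<ge> n \<or> (\<exists>(i, k)\<in>set w. i \<notin> J)) \<longrightarrow>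
      act (transport \<phi> M) (eprod w) y = \<phi> \<zero>\<^bsub>M\<^esub>)"
    unfolding x(1) transport_simps(5)[OF assms(2) x(2)]
    by (intro exI[of _ n] exI[of _ J] conjI ballI impI arg_cong[of _ _ \<phi>] *(1-3))
      (rule mp[OF bspec[OF *(4)]]; blast)
qed

lemma vector_space_inv_space:
  assumes "is_left_module boson M" shows "vector_space_rec (inv_space M)"
proof -
  interpret boson_module I a s m q M by standard fact
  have [simp]: "x \<in> invariants M \<Longrightarrow> x \<in> carrier M" for x by (simp add: invariants_def)
  show ?thesis
    by (rule vector_space_recI)
      (auto simp: inv_space_simps invariants_add invariants_smult invariants_zero M.smult_add_left M.smult_add_right
        M.smult_smult M.smult_minus1 M.l_neg M.a_assoc intro: M.a_comm)
qed

lemma module_map_invariants: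
  assumes "is_left_module boson M" "is_left_module boson N" "is_module_map boson M N f" "x \<in> invariants M"
  shows "f x \<in> invariants N"
proof -
  have lin: "is_linear M N f" using assms(3) by (simp add: is_module_map_def)
  have x: "x \<in> carrier M" using assms(4) by (simp add: invariants_def)
  have z: "f \<zero>\<^bsub>M\<^esub> = \<zero>\<^bsub>N\<^esub>" using lin assms(1,2) by (intro is_linear_zero vspace_left_module)
  have "act N (eprod [y]) (f x) = f (act M (eprod [y]) x)" if "y \<in> idx" for y
    using assms(3) x eprod_closed[of "[y]"] that by (simp add: is_module_map_def)
  then show ?thesis using assms(4) is_linearD(1)[OF lin x] z by (auto simp: invariants_def)
qed

lemma is_functor_invariants: "is_functor OB Vec invariants_functor"
proof -
  have sub: "invariants M \<subseteq> carrier M" for M :: "('k, ('i boson_gen word \<Rightarrow>\<^sub>0 'k) set, 'v) left_module"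
    by (auto simp: invariants_def)
  have h1: "restrict f (invariants M) \<in> linear_maps (inv_space M) (inv_space N)"
    if M: "is_left_module boson M" and N: "is_left_module boson N" and f: "is_module_map boson M N f"
    for M N :: "('k, ('i boson_gen word \<Rightarrow>\<^sub>0 'k) set, 'v) left_module" and f
  proof -
    have v: "vspace (inv_space M)" using vector_space_inv_space[OF M] by (simp add: vspace_def)
    have "is_linear (inv_space M) (inv_space N) f"
      using module_map_invariants[OF M N f] f subsetD[OF sub[of M]]
      by (simp add: is_linear_def inv_space_simps is_module_map_def)
    then show ?thesis by (simp add: linear_maps_iff is_linear_restrict[OF v, unfolded inv_space_simps(1)] inv_space_simps(1))
  qed
  have h2: "restrict (compose (carrier M) g f) (invariants M) =
      compose (invariants M) (restrict g (invariants N)) (restrict f (invariants M))"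
    if M: "is_left_module boson M" and N: "is_left_module boson N" and f: "is_module_map boson M N f"
    for M N :: "('k, ('i boson_gen word \<Rightarrow>\<^sub>0 'k) set, 'v) left_module" and f g
    using module_map_invariants[OF M N f] sub[of M] by (auto simp: compose_def restrict_def fun_eq_iff)
  have h3: "restrict (restrict (\<lambda>x. x) (carrier M)) (invariants M) = restrict (\<lambda>x. x) (invariants M)"
    for M :: "('k, ('i boson_gen word \<Rightarrow>\<^sub>0 'k) set, 'v) left_module"
    using sub[of M] by (auto simp: restrict_def fun_eq_iff)
  show ?thesis
    unfolding is_functor_def OB_simps Vec_simps
    by (auto simp: invariants_functor_def vector_space_inv_space inv_space_simps(1) left_module_homs_iff h3
        simp del: restrict_restrict intro: h1 h2)
qed

lemma R_tensor_module: "vector_space_rec X \<Longrightarrow> R_tensor_module I a s m q X"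
  by unfold_locales

lemma R_tensor_map:
  assumes X: "vector_space_rec X" and Y: "vector_space_rec Y" and f: "is_linear X Y f"
  shows "is_linear (tensor_space R_mod X) (tensor_space R_mod Y) (tensor_map R_mod Y (\<lambda>r. r) f)"
    and "is_module_map boson (R_tensor_space X) (R_tensor_space Y) (tensor_map R_mod Y (\<lambda>r. r) f)"
    and "\<And>r x. r \<in> carrier R_mod \<Longrightarrow> x \<in> carrier X \<Longrightarrow>
      tensor_map R_mod Y (\<lambda>r. r) f (tensor_product.tens R_mod X r x) = tensor_product.tens R_mod Y r (f x)"
proof -
  interpret X: R_tensor_module I a s m q X using X by (rule R_tensor_module)
  interpret Y: R_tensor_module I a s m q Y using Y by (rule R_tensor_module)
  let ?T = "tensor_map R_mod Y (\<lambda>r. r) f"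
  note tm = tensor_map_props[OF RM.M.vspace_axioms X.X.vspace_axioms RM.M.vspace_axioms Y.X.vspace_axioms is_linear_ident f]
  show lin: "is_linear X.T.VW Y.T.VW ?T" by (rule tm(1))
  show tens: "?T (X.T.tens r x) = Y.T.tens r (f x)" if "r \<in> carrier R_mod" "x \<in> carrier X" for r x
    using that by (rule tm(2))
  have "?T (act X.RX b t) = act Y.RX b (?T t)" if b: "b \<in> carrier boson" and t: "t \<in> carrier X.T.VW" for b t
  proof (rule X.T.linear_eqI[OF _ _ _ t])
    show "is_linear X.T.VW Y.T.VW (\<lambda>t. ?T (act X.RX b t))"
      by (rule is_linear_comp[OF X.is_linear_act[OF b] lin])
    show "is_linear X.T.VW Y.T.VW (\<lambda>t. act Y.RX b (?T t))"
      by (rule is_linear_comp[OF lin Y.is_linear_act[OF b]])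
    fix r x assume rx: "r \<in> carrier R_mod" "x \<in> carrier X"
    have "act R_mod b r \<in> carrier R_mod" using left_module_R_mod b rx(1) by (rule act_closed)
    then show "?T (act X.RX b (X.T.tens r x)) = act Y.RX b (?T (X.T.tens r x))"
      using rx is_linearD(1)[OF f] by (simp add: X.act_tens[OF b] Y.act_tens[OF b] tens)
  qed
  then show "is_module_map boson X.RX Y.RX ?T"
    using lin by (simp add: is_module_map_def is_linear_def X.RX_simps(1-4) Y.RX_simps(1-4))
qed

lemma on_obj_R_tensor: "on_obj R_tensor X = transport (R_embed X) (R_tensor_space X)"
  by (simp add: R_tensor_def)

lemma on_hom_R_tensor:
  assumes "vector_space_rec X" "t \<in> carrier (R_tensor_space X)"
  shows "on_hom R_tensor X Y f (R_embed X t) = R_embed Y (tensor_map R_mod Y (\<lambda>r. r) f t)"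
  using assms R_tensor_module.R_embed_inj[OF R_tensor_module[OF assms(1)]] by (simp add: R_tensor_def)

lemma on_hom_R_tensor_extensional:
  "on_hom R_tensor X Y f \<in> extensional (R_embed X ` carrier (R_tensor_space X))"
  by (simp add: R_tensor_def)

lemma R_tensor_object:
  assumes "vector_space_rec X"
  shows "carrier (on_obj R_tensor X) = R_embed X ` carrier (R_tensor_space X)"
    and "is_left_module boson (on_obj R_tensor X)" and "integrable (on_obj R_tensor X)"
    and "is_module_map boson (R_tensor_space X) (on_obj R_tensor X) (R_embed X)"
    and "is_module_map boson (on_obj R_tensor X) (R_tensor_space X) (inv_into (carrier (R_tensor_space X)) (R_embed X))"
    and "invariants (on_obj R_tensor X) = R_embed X ` invariants (R_tensor_space X)"
proof -
  interpret R_tensor_module I a s m q X using assms by (rule R_tensor_module)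
  note * = left_module_RX R_embed_inj
  show "carrier (on_obj R_tensor X) = R_embed X ` carrier RX" "is_left_module boson (on_obj R_tensor X)"
    "integrable (on_obj R_tensor X)" "is_module_map boson RX (on_obj R_tensor X) (R_embed X)"
    "is_module_map boson (on_obj R_tensor X) RX (inv_into (carrier RX) (R_embed X))"
    "invariants (on_obj R_tensor X) = R_embed X ` invariants RX"
    unfolding on_obj_R_tensor
    by (rule transport_simps(1)[OF *(2)] left_module_transport[OF *] transport_integrable[OF * integrable_RX]
        is_module_map_transport[OF *] is_module_map_inv_transport[OF *] transport_invariants[OF *])+
qed

lemma is_functor_R_tensor: "is_functor Vec OB R_tensor"
proof -
  have hom: "on_hom R_tensor X Y f \<in> left_module_homs boson (on_obj R_tensor X) (on_obj R_tensor Y)"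
    if X: "vector_space_rec X" and Y: "vector_space_rec Y" and f: "is_linear X Y f"
    for X Y :: "('k, 'u) module" and f
  proof -
    have "is_module_map boson (on_obj R_tensor X) (on_obj R_tensor Y)
       (\<lambda>x. R_embed Y (tensor_map R_mod Y (\<lambda>r. r) f (inv_into (carrier (R_tensor_space X)) (R_embed X) x)))"
      by (rule is_module_map_comp[OF R_tensor_object(5)[OF X] is_module_map_comp[OF R_tensor_map(2)[OF X Y f] R_tensor_object(4)[OF Y]]])
    then show ?thesis
      unfolding left_module_homs_iff R_tensor_object(1)[OF X]
      using on_hom_R_tensor_extensional
      by (simp add: R_tensor_def is_module_map_restrict[OF R_tensor_object(2)[OF X],
          unfolded R_tensor_object(1)[OF X], unfolded on_obj_R_tensor])
  qed
  have id: "on_hom R_tensor X X (restrict (\<lambda>x. x) (carrier X)) = restrict (\<lambda>x. x) (carrier (on_obj R_tensor X))"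
    if X: "vector_space_rec X" for X :: "('k, 'u) module"
  proof -
    interpret R_tensor_module I a s m q X using X by (rule R_tensor_module)
    have l: "is_linear X X (restrict (\<lambda>x. x) (carrier X))"
      using is_linear_restrict[OF X.vspace_axioms] is_linear_ident by blast
    have "tensor_map R_mod X (\<lambda>r. r) (restrict (\<lambda>x. x) (carrier X)) t = t" if "t \<in> carrier T.VW" for t
      by (rule T.linear_eqI[OF R_tensor_map(1)[OF X X l] is_linear_ident _ that])
        (simp add: R_tensor_map(3)[OF X X l])
    then have "on_hom R_tensor X X (restrict (\<lambda>x. x) (carrier X)) y = restrict (\<lambda>x. x) (R_embed X ` carrier RX) y"
      if "y \<in> R_embed X ` carrier RX" for y
      using that by (auto simp: on_hom_R_tensor[OF X] RX_simps(1))
    then show ?thesis unfolding R_tensor_object(1)[OF X]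
      by (intro extensionalityI[OF on_hom_R_tensor_extensional restrict_extensional])
  qed
  have comp: "on_hom R_tensor X Z (compose (carrier X) g f) =
      compose (carrier (on_obj R_tensor X)) (on_hom R_tensor Y Z g) (on_hom R_tensor X Y f)"
    if X: "vector_space_rec X" and Y: "vector_space_rec Y" and Z: "vector_space_rec Z"
      and f: "is_linear X Y f" and g: "is_linear Y Z g"
    for X Y Z :: "('k, 'u) module" and f g
  proof -
    interpret X: R_tensor_module I a s m q X using X by (rule R_tensor_module)
    interpret Y: R_tensor_module I a s m q Y using Y by (rule R_tensor_module)
    have gf: "is_linear X Z (compose (carrier X) g f)" by (rule is_linear_compose[OF X.X.vspace_axioms f g])
    let ?T = "\<lambda>Y f. tensor_map R_mod Y (\<lambda>r. r) f"
    have Tc: "?T Y f t \<in> carrier Y.T.VW" if "t \<in> carrier X.T.VW" for t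
      using is_linearD(1)[OF R_tensor_map(1)[OF X Y f]] that .
    have T: "?T Z (compose (carrier X) g f) t = ?T Z g (?T Y f t)" if "t \<in> carrier X.T.VW" for t
    proof (rule X.T.linear_eqI[OF _ _ _ that])
      show "is_linear X.T.VW (tensor_space R_mod Z) (?T Z (compose (carrier X) g f))" by (rule R_tensor_map(1)[OF X Z gf])
      show "is_linear X.T.VW (tensor_space R_mod Z) (\<lambda>t. ?T Z g (?T Y f t))"
        by (rule is_linear_comp[OF R_tensor_map(1)[OF X Y f] R_tensor_map(1)[OF Y Z g]])
      fix r x assume "r \<in> carrier R_mod" "x \<in> carrier X"
      then show "?T Z (compose (carrier X) g f) (X.T.tens r x) = ?T Z g (?T Y f (X.T.tens r x))"
        using is_linearD(1)[OF f] by (simp add: R_tensor_map(3) X Y Z f g gf compose_eq)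
    qed
    have "on_hom R_tensor X Z (compose (carrier X) g f) y =
        compose (R_embed X ` carrier X.RX) (on_hom R_tensor Y Z g) (on_hom R_tensor X Y f) y"
      if "y \<in> R_embed X ` carrier X.RX" for y
    proof -
      obtain t where t: "y = R_embed X t" "t \<in> carrier X.T.VW" using \<open>y \<in> _\<close> by (auto simp: X.RX_simps(1))
      then show ?thesis using that Tc[OF t(2)] T[OF t(2)]
        by (simp add: compose_eq on_hom_R_tensor X Y X.RX_simps(1) Y.RX_simps(1))
    qed
    then show ?thesis unfolding R_tensor_object(1)[OF X]
      by (intro extensionalityI[OF on_hom_R_tensor_extensional compose_extensional])
  qed
  show ?thesis
    unfolding is_functor_def OB_simps Vec_simps
    by (auto simp: linear_maps_iff R_tensor_object(2,3) intro: hom id comp)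
qed

end

locale integrable_boson_module = boson_module I a s m q M
  for I :: "'i set" and a s m and q :: "'k::field_char_0"
    and M :: "('k, ('i boson_gen word \<Rightarrow>\<^sub>0 'k) set, 'u) left_module" +
  assumes integrable_M: "integrable M"
begin

lemma vector_space_M0: "vector_space_rec (inv_space M)"
  by (rule vector_space_inv_space[OF left_module])

sublocale M0: R_tensor_module I a s m q "inv_space M"
  by standard (rule vector_space_M0)

lemma R_boson: "r \<in> carrier R_mod \<Longrightarrow> r \<in> carrier boson"
  by (auto simp: R_mod_simps carrier_boson intro: span_FL_GL)

lemma M0_M: "x \<in> invariants M \<Longrightarrow> x \<in> carrier M" by (simp add: invariants_def)

text \<open>Elements of R belong to the boson algebra and so act on M; the induced map is the
  multiplication R \<otimes> M_0 \<rightarrow> M.\<close>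

sublocale A: bilinear_map R_mod "inv_space M" M "\<lambda>r x. act M r x"
proof unfold_locales
qed (use left_module in \<open>simp_all add: is_left_module_def inv_space_simps R_boson M0_M R_mod_simps(2,4)\<close>)

abbreviation "counit \<equiv> A.lift"

lemma counit_tens: "t \<in> span_words FL \<Longrightarrow> x \<in> invariants M \<Longrightarrow> counit (M0.T.tens (cls t) x) = dot t x"
  using A.lift_tens[OF M0.cls_R, of t x] by (simp add: inv_space_simps(1) dot_def)

text \<open>On pure tensors this is \<open>dot_invariant\<close>: the algebra acts on u x, for
  invariant x, as it acts on u in R.\<close>

lemma is_module_map_counit: "is_module_map boson M0.RX M counit"
proof -
  have "counit (act M0.RX b t) = act M b (counit t)" if b: "b \<in> carrier boson" and t: "t \<in> carrier M0.T.VW" for b t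
  proof (rule M0.T.linear_eqI[OF _ _ _ t])
    have lb: "is_linear M M (act M b)" using left_module b by (simp add: is_left_module_def is_linear_def)
    show "is_linear M0.T.VW M (\<lambda>t. counit (act M0.RX b t))"
      by (rule is_linear_comp[OF M0.is_linear_act[OF b] A.lift_linear])
    show "is_linear M0.T.VW M (\<lambda>t. act M b (counit t))"
      by (rule is_linear_comp[OF A.lift_linear lb])
    fix r x assume "r \<in> carrier R_mod" and x: "x \<in> carrier (inv_space M)"
    then obtain u where u: "r = cls u" "u \<in> span_words FL" by (auto elim: M0.R_E)
    obtain p where p: "b = cls p" "p \<in> span_words GL" using b by (auto simp: carrier_boson)
    have x: "x \<in> invariants M" using x by (simp add: inv_space_simps(1))
    have "act M0.RX b (M0.T.tens r x) = M0.T.tens (cls (rho p u)) x"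
      using M0.dot_tens[OF p(2) u(2), of x] x by (simp add: M0.RX.dot_def p u inv_space_simps(1))
    then show "counit (act M0.RX b (M0.T.tens r x)) = act M b (counit (M0.T.tens r x))"
      using dot_invariant[OF x u(2) p(2)] x u p(2)
      by (simp add: counit_tens span_words_rho p(1)) (simp add: dot_def)
  qed
  then show ?thesis using A.lift_linear by (simp add: is_module_map_def is_linear_def M0.RX_simps(1-4))
qed

lemma counit_eact: "v \<in> lists FL \<Longrightarrow> t \<in> carrier M0.RX \<Longrightarrow> counit (M0.RX.eact v t) = eact v (counit t)"
  using is_module_map_counit cls_carrier[OF dual_GL[of v]]
  by (simp add: M0.RX.eact_def eact_def M0.RX.dot_def dot_def is_module_map_def del: in_lists_conv_set)

text \<open>Invariants of R \<otimes> M_0 have the form 1 \<otimes> x and are mapped to x, so the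
  kernel contains no nonzero invariant.\<close>

lemma counit_kernel:
  assumes t: "t \<in> carrier M0.RX" "counit t = \<zero>\<^bsub>M\<^esub>"
  shows "t = \<zero>\<^bsub>M0.RX\<^esub>"
proof (rule M0.RX.injective_of_invariants[OF M0.integrable_RX, where P = "\<lambda>t. counit t = \<zero>\<^bsub>M\<^esub>"])
  fix y assume "y \<in> invariants M0.RX" and y0: "counit y = \<zero>\<^bsub>M\<^esub>"
  then obtain x where x: "y = M0.T.tens (cls 1) x" "x \<in> invariants M"
    by (auto simp: M0.invariants_RX inv_space_simps(1))
  then have "x = \<zero>\<^bsub>M\<^esub>" using y0 by (simp add: counit_tens span_words_one M0_M)
  then show "y = \<zero>\<^bsub>M0.RX\<^esub>"
    using M0.T.tens_smult_right[OF M0.cls_R[OF span_words_one], of "\<zero>\<^bsub>M\<^esub>" 0] invariants_zero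
    by (simp add: x(1) M0.RX_simps(3) inv_space_simps M0.cls_R span_words_one)
next
  fix x v assume "x \<in> carrier M0.RX" "counit x = \<zero>\<^bsub>M\<^esub>" "v \<in> lists FL"
  then show "counit (M0.RX.eact v x) = \<zero>\<^bsub>M\<^esub>"
    using dual_GL[of v] by (simp add: counit_eact eact_def del: in_lists_conv_set)
qed (use t in auto)

text \<open>The image contains R M_0 and is closed under addition, so
  \<open>generated_by_invariants\<close> gives surjectivity.\<close>

lemma bij_counit: "bij_betw counit (carrier M0.RX) (carrier M)"
  unfolding bij_betw_def
proof
  have lin: "is_linear M0.RX M counit" using is_module_map_counit by (simp add: is_module_map_def)
  show "inj_on counit (carrier M0.RX)"
  proof (rule inj_onI)
    fix t u assume tu: "t \<in> carrier M0.RX" "u \<in> carrier M0.RX" "counit t = counit u"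
    have "counit (t \<oplus>\<^bsub>M0.RX\<^esub> (- 1) \<odot>\<^bsub>M0.RX\<^esub> u) = \<zero>\<^bsub>M\<^esub>"
      using tu is_linearD[OF lin] by (simp add: M.smult_minus1 M.r_neg)
    then have "t \<oplus>\<^bsub>M0.RX\<^esub> \<ominus>\<^bsub>M0.RX\<^esub> u = \<zero>\<^bsub>M0.RX\<^esub>"
      using counit_kernel tu by (simp add: M0.RX.M.smult_minus1)
    then show "t = u" using tu M0.RX.M.minus_equality[of t "\<ominus>\<^bsub>M0.RX\<^esub> u"] by (simp add: M0.RX.M.minus_minus)
  qed
  have "x \<in> counit ` carrier M0.RX" if "x \<in> carrier M" for x
  proof (rule generated_by_invariants[OF integrable_M _ _ that])
    fix t :: "'i boson_gen word \<Rightarrow>\<^sub>0 'k" and y assume "t \<in> span_words FL" "y \<in> invariants M"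
    then have "dot t y = counit (M0.T.tens (cls t) y)" "M0.T.tens (cls t) y \<in> carrier M0.RX"
      by (simp_all add: counit_tens M0.RX_simps(1) M0.cls_R inv_space_simps(1))
    then show "dot t y \<in> counit ` carrier M0.RX" by simp
  next
    fix x y assume "x \<in> counit ` carrier M0.RX" "y \<in> counit ` carrier M0.RX"
    then show "x \<oplus>\<^bsub>M\<^esub> y \<in> counit ` carrier M0.RX"
      by (auto simp: is_linearD(2)[OF lin, symmetric])
  qed
  then show "counit ` carrier M0.RX = carrier M" using is_linearD(1)[OF lin] by auto
qed

end

context q_boson begin

definition R_unit :: "('k, 'u) module \<Rightarrow> 'u \<Rightarrow> 'u" where
  "R_unit X = restrict (\<lambda>x. R_embed X (tensor_product.tens R_mod X (cls 1) x)) (carrier X)"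

definition R_counit :: "('k, ('i boson_gen word \<Rightarrow>\<^sub>0 'k) set, 'u) left_module \<Rightarrow> 'u \<Rightarrow> 'u" where
  "R_counit M = restrict
     (\<lambda>y. bilinear_map.lift M (act M)
        (inv_into (carrier (R_tensor_space (inv_space M))) (R_embed (inv_space M)) y))
     (carrier (on_obj R_tensor (inv_space M)))"

text \<open>The component at X is 1 \<otimes> x; it reaches all invariants by
  \<open>invariants_RX\<close>, and contraction with the counit shows injectivity.\<close>

lemma natural_unit: "natural_iso Vec Vec id_functor (comp_functor invariants_functor R_tensor) R_unit"
proof -
  have one: "cls 1 \<in> carrier R_mod" using one_R_invariant by (simp add: invariants_def)
  have iso: "is_iso Vec X (inv_space (on_obj R_tensor X)) (R_unit X)"
    if X: "vector_space_rec X" for X :: "('k, 'u) module"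
  proof -
    interpret R_tensor_module I a s m q X using X by (rule R_tensor_module)
    let ?f = "\<lambda>x. R_embed X (T.tens (cls 1) x)"
    have img: "?f ` carrier X = invariants (on_obj R_tensor X)"
      by (simp add: R_tensor_object(6)[OF X] invariants_RX image_image)
    have "is_linear X RX (T.tens (cls 1))"
      using one by (simp add: is_linear_def RX_simps(1-4) T.tens_add_right T.tens_smult_right)
    then have "is_linear X (on_obj R_tensor X) ?f"
      by (rule is_linear_comp[OF _ is_module_mapD[OF R_tensor_object(4)[OF X]]])
    moreover have "?f x \<in> invariants (on_obj R_tensor X)" if "x \<in> carrier X" for x
      using img that by blast
    ultimately have "is_linear X (inv_space (on_obj R_tensor X)) ?f"
      by (simp add: is_linear_def inv_space_simps)
    then have lin: "is_linear X (inv_space (on_obj R_tensor X)) (R_unit X)"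
      by (simp add: R_unit_def is_linear_restrict[OF X.vspace_axioms])
    have "inj_on (R_embed X) (T.tens (cls 1) ` carrier X)"
      by (rule inj_on_subset[OF R_embed_inj]) (use one in \<open>auto simp: RX_simps(1)\<close>)
    then have "inj_on ?f (carrier X)" using comp_inj_on[OF tens_one_inj] by (simp add: comp_def)
    then have "bij_betw (R_unit X) (carrier X) (carrier (inv_space (on_obj R_tensor X)))"
      using img by (simp add: bij_betw_def R_unit_def inv_space_simps(1))
    then show ?thesis
      using vector_space_inv_space[OF R_tensor_object(2)[OF X]]
      by (intro is_iso_Vec lin X.vspace_axioms) (simp_all add: vspace_def R_unit_def)
  qed
  have nat: "compose (carrier X) (R_unit Y) f =
      compose (carrier X) (restrict (on_hom R_tensor X Y f) (invariants (on_obj R_tensor X))) (R_unit X)"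
    if X: "vector_space_rec X" and Y: "vector_space_rec Y" and f: "is_linear X Y f"
    for X Y :: "('k, 'u) module" and f
  proof (rule extensionalityI[OF compose_extensional compose_extensional])
    interpret R_tensor_module I a s m q X using X by (rule R_tensor_module)
    fix x assume x: "x \<in> carrier X"
    have t: "T.tens (cls 1) x \<in> carrier RX" using x one by (simp add: RX_simps(1))
    have "R_embed X (T.tens (cls 1) x) \<in> invariants (on_obj R_tensor X)"
      using x by (simp add: R_tensor_object(6)[OF X] invariants_RX)
    then show "compose (carrier X) (R_unit Y) f x =
      compose (carrier X) (restrict (on_hom R_tensor X Y f) (invariants (on_obj R_tensor X))) (R_unit X) x"
      using x is_linearD(1)[OF f x]
      by (simp add: compose_eq R_unit_def on_hom_R_tensor[OF X t] R_tensor_map(3)[OF X Y f one x])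
  qed
  show ?thesis
    unfolding natural_iso_def Vec_simps
    by (auto simp: comp_functor_def id_functor_def invariants_functor_def linear_maps_iff intro: iso nat)
qed

text \<open>The embedding into the universe is undone before multiplying, so naturality reduces to
  pure tensors, where it reads f (r x) = r (f x).\<close>

lemma natural_counit: "natural_iso OB OB (comp_functor R_tensor invariants_functor) id_functor R_counit"
proof -
  have iso: "is_iso OB (on_obj R_tensor (inv_space M)) M (R_counit M)"
    if M: "is_left_module boson M" "integrable M"
    for M :: "('k, ('i boson_gen word \<Rightarrow>\<^sub>0 'k) set, 'u) left_module"
  proof -
    interpret integrable_boson_module I a s m q M by unfold_locales fact+
    note obj = R_tensor_object[OF vector_space_M0]
    let ?g = "inv_into (carrier M0.RX) (R_embed (inv_space M))"
    let ?f = "\<lambda>y. counit (?g y)"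
    have "bij_betw ?g (carrier (on_obj R_tensor (inv_space M))) (carrier M0.RX)"
      unfolding obj(1) using M0.R_embed_inj by (intro bij_betw_inv_into) (simp add: bij_betw_def)
    then have "bij_betw ?f (carrier (on_obj R_tensor (inv_space M))) (carrier M)"
      using bij_betw_trans[OF _ bij_counit] by (simp add: comp_def)
    then have "bij_betw (R_counit M) (carrier (on_obj R_tensor (inv_space M))) (carrier M)"
      by (rule bij_betw_cong[THEN iffD1, rotated]) (simp add: R_counit_def)
    moreover have "is_module_map boson (on_obj R_tensor (inv_space M)) M (R_counit M)"
      unfolding R_counit_def is_module_map_restrict[OF obj(2)]
      by (rule is_module_map_comp[OF obj(5) is_module_map_counit])
    ultimately show ?thesis
      unfolding is_iso_OB by (intro is_iso_LMod obj(2) M) (simp_all add: R_counit_def)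
  qed
  have nat: "compose (carrier (on_obj R_tensor (inv_space M))) (R_counit N)
        (on_hom R_tensor (inv_space M) (inv_space N) (restrict f (invariants M))) =
      compose (carrier (on_obj R_tensor (inv_space M))) f (R_counit M)"
    if M: "is_left_module boson M" "integrable M" and N: "is_left_module boson N" "integrable N"
      and f: "is_module_map boson M N f"
    for M N :: "('k, ('i boson_gen word \<Rightarrow>\<^sub>0 'k) set, 'u) left_module" and f
  proof (rule extensionalityI[OF compose_extensional compose_extensional])
    interpret M: integrable_boson_module I a s m q M using M by unfold_locales
    interpret N: integrable_boson_module I a s m q N using N by unfold_locales
    note V = M.vector_space_M0 N.vector_space_M0
    let ?T = "tensor_map R_mod (inv_space N) (\<lambda>r. r) (restrict f (invariants M))"
    have lf: "is_linear M N f" using f by (simp add: is_module_map_def)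
    have f0: "is_linear (inv_space M) (inv_space N) (restrict f (invariants M))"
    proof -
      have "is_linear (inv_space M) (inv_space N) f"
        using module_map_invariants[OF M(1) N(1) f] lf M.M0_M by (simp add: is_linear_def inv_space_simps)
      then show ?thesis by (simp add: is_linear_restrict[OF M.M0.X.vspace_axioms, unfolded inv_space_simps(1)])
    qed
    have eq: "N.counit (?T t) = f (M.counit t)" if "t \<in> carrier M.M0.T.VW" for t
    proof (rule M.M0.T.linear_eqI[OF _ _ _ that])
      show "is_linear M.M0.T.VW N (\<lambda>t. N.counit (?T t))"
        by (rule is_linear_comp[OF R_tensor_map(1)[OF V f0] N.A.lift_linear])
      show "is_linear M.M0.T.VW N (\<lambda>t. f (M.counit t))"
        by (rule is_linear_comp[OF M.A.lift_linear lf])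
      fix r x assume r: "r \<in> carrier R_mod" and x: "x \<in> carrier (inv_space M)"
      have "x \<in> invariants M" "f x \<in> carrier (inv_space N)"
        using x module_map_invariants[OF M(1) N(1) f] by (simp_all add: inv_space_simps(1))
      then show "N.counit (?T (M.M0.T.tens r x)) = f (M.counit (M.M0.T.tens r x))"
        using r x f M.R_boson[OF r] M.M0_M[of x]
        by (simp add: R_tensor_map(3)[OF V f0] N.A.lift_tens M.A.lift_tens is_module_map_def)
    qed
    note oM = R_tensor_object[OF V(1)] and oN = R_tensor_object[OF V(2)]
    fix y assume y: "y \<in> carrier (on_obj R_tensor (inv_space M))"
    then obtain t where t: "y = R_embed (inv_space M) t" "t \<in> carrier M.M0.RX" by (auto simp: oM(1))
    have Tt: "?T t \<in> carrier N.M0.RX"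
      using is_linearD(1)[OF R_tensor_map(1)[OF V f0]] t(2) by (simp add: M.M0.RX_simps(1) N.M0.RX_simps(1))
    then have "R_embed (inv_space N) (?T t) \<in> carrier (on_obj R_tensor (inv_space N))" by (simp add: oN(1))
    then show "compose (carrier (on_obj R_tensor (inv_space M))) (R_counit N)
        (on_hom R_tensor (inv_space M) (inv_space N) (restrict f (invariants M))) y =
      compose (carrier (on_obj R_tensor (inv_space M))) f (R_counit M) y"
      using y t Tt eq[of t] M.M0.R_embed_inj N.M0.R_embed_inj
      by (simp add: compose_eq R_counit_def on_hom_R_tensor[OF V(1) t(2)] M.M0.RX_simps(1))
  qed
  show ?thesis
    unfolding natural_iso_def OB_simps
    by (auto simp: comp_functor_def id_functor_def invariants_functor_def left_module_homs_iff intro: iso nat)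
qed

lemma quasi_inverse: "quasi_inverse_equivalence Vec OB R_tensor invariants_functor"
  unfolding quasi_inverse_equivalence_def
  using is_category_Vec is_category_full_subcategory[OF is_category_LMod] is_functor_R_tensor
    is_functor_invariants natural_unit natural_counit OB_def by metis

end

theorem theorem4p4:
  fixes I :: "'i set" and a :: "'i \<Rightarrow> 'i \<Rightarrow> int" and s m :: "'i \<Rightarrow> nat"
    and q :: "'k::field_char_0"
  assumes "borcherds_cartan_charge I a s m"
    and "q \<noteq> 0"
    and "\<not> algebraic q"
  shows "quasi_inverse_equivalence
    (Vec :: (('k, 'u) module, 'u \<Rightarrow> 'u) category)
    (q_boson_data.OB I a s m q ::
      (('k, ('i boson_gen word \<Rightarrow>\<^sub>0 'k) set, 'u) left_module, 'u \<Rightarrow> 'u) category)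
    (q_boson_data.R_tensor I a s m q)
    (q_boson_data.invariants_functor I a s m q)"
proof -
  interpret q_boson I a s m q
    using assms by (simp add: q_boson_def q_boson_axioms_def q_boson_data_def)
  show ?thesis by (rule quasi_inverse)
qed

end
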